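(* Let $n\ge1$. The space $$\bigoplus_{k=0}^nH^*_{GL_n\times\mathbb C^\times}(T^*\mathrm{Gr}_k(\mathbb C^n))\otimes_{\mathbb C[y]}\mathcal L_{\lambda,y}\otimes_{\mathbb C[y]}\mathbb C[y^{\pm1}]$$ is an $E_y(\mathfrak{gl}_2)$-submodule of the $E_y(\mathfrak{gl}_2)$-module $\bigoplus_{k=0}^nH^*_T(T^*\mathrm{Gr}_k(\mathbb C^n))\otimes\mathcal L_{\lambda,(\boldsymbol z,y)}$, whose module structure is induced by the isomorphism $\mathrm{Stab}_{\mathrm{id}}$ from the tensor product of evaluation modules $V(z_1)\otimes\cdots\otimes V(z_n)$.
   Context: **Notation.** $[n]=\{1,\dots,n\}$; $\mathcal I_k$ is the set of $k$-element subsets of $[n]$; $\bar I=[n]\setminus I$; $\boldsymbol z=(z_1,\dots,z_n)$, $\boldsymbol t=(t_1,\dots,t_k)$; $\lambda,y$ are further variables. $\mathcal L_{\lambda,y}$: rational functions $f/g$, $f\in\mathbb C[\lambda,y]$, $g$ a finite product of factors $\lambda+ly$, $l\in\mathbb Z$; $\mathcal L_{\lambda,(\boldsymbol z,y)}=\mathcal L_{\lambda,y}\otimes_{\mathbb C[y]}\mathbb C(\boldsymbol z,y)$. $\mathcal L_{\lambda,yh,y}$: rational functions $f/g$ with $f$ a polynomial in $\lambda,yh,y$ ($h$ a variable) and $g$ a finite product of factors $\lambda+pyh+ly$, $p,l\in\mathbb Z$. For a $\mathbb C[\boldsymbol z,y]$-module $M$, $M\otimes\mathcal L_{\lambda,(\boldsymbol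 z,y)}$ is the tensor product over $\mathbb C[\boldsymbol z,y]$. **Cohomology.** $T=(\mathbb C^\times)^n\times\mathbb C^\times\subset GL_n\times\mathbb C^\times$; the diagonal torus acts via $\mathbb C^n$, the extra $\mathbb C^\times$ scales the fibers of $T^*\mathrm{Gr}_k(\mathbb C^n)$. With $\Gamma=\{\gamma_{1,1},\dots,\gamma_{1,k},\gamma_{2,1},\dots,\gamma_{2,n-k}\}$, $H^*_T(T^*\mathrm{Gr}_k(\mathbb C^n))=\mathbb C[\Gamma,\boldsymbol z,y]^{S_k\times S_{n-k}}/\mathcal J$, $H^*_{GL_n\times\mathbb C^\times}(T^*\mathrm{Gr}_k(\mathbb C^n))=\mathbb C[\Gamma,\boldsymbol z,y]^{S_k\times S_{n-k}\times S_n}/\mathcal J$, where $S_k\times S_{n-k}$ permutes the $\gamma_{1,*}$ and the $\gamma_{2,*}$, $S_n$ permutes the $z_i$, and $\mathcal J$ is generated by the coefficients in $u$ of $\prod_i(u-\gamma_{1,i})\prod_i(u-\gamma_{2,i})-\prod_i(u-z_i)$. The second algebra embeds in the first, so the first space in the claim is a subspace of the second. Restriction to the fixed point $x_I$ ($I\in\mathcal I_k$) is the substitution $\{\gamma_{1,*}\}\mapsto\{z_a\}_{a\in I}$, $\{\gamma_{2,*}\}\mapsto\{z_a\}_{a\in\bar I}$; after tensoring with $\mathcal L_{\lambda,(\boldsymbol z,y)}$ the map to the direct sum over all fixed points is an isomorphism. **Weight functions and $\mathrm{Stab}_{\mathrm{id}}$.** For $i\in I$ put $w(i,I)=\#\{j>i:j\in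 I\}-\#\{j>i:j\in\bar I\}$ ($j\in[n]$). For $I=\{i_1<\dots<i_k\}$ let $l_I(r,a)=t_r-z_a+y$ if $a<i_r$; $=\lambda+t_r-z_a-w(i_r,I)y$ if $a=i_r$; $=t_r-z_a$ if $a>i_r$. Let $W_I(\lambda,\boldsymbol t,\boldsymbol z,y)=y^k\sum_{\pi\in S_k}\Big(\prod_{r=1}^k\prod_{a=1}^n l_I(r,a)\prod_{1\le a<b\le k}\frac{t_a-t_b+y}{t_a-t_b}\Big)\Big|_{t_i\to t_{\pi(i)}}$, $e_k=\prod_{a,b=1}^k(t_a-t_b+y)$, $C^{(r)}_{\mathrm{id},I}=\prod_{i\in I}(\lambda-(w(i,I)+r)y)$, $\tilde W^+_I=W_I/(C^{(0)}_{\mathrm{id},I}C^{(1)}_{\mathrm{id},I}e_k)$. $\kappa_{\mathrm{id},I}$ is the class with $\kappa_{\mathrm{id},I}|_{x_J}=\tilde W^+_I(\lambda,\boldsymbol z_J,\boldsymbol z,y)$ for all $J\in\mathcal I_k$ ($t_1,\dots,t_k$ replaced by $\{z_j\}_{j\in J}$). $\mathbb C^2$ has basis $v_1,v_2$; $v_I=v_{i_1}\otimes\dots\otimes v_{i_n}$ with $i_j=1$ if $j\in I$, $i_j=2$ otherwise; $(\mathbb C^2)^{\otimes n}_k=\mathrm{span}\{v_I:|I|=k\}$. $\mathrm{Stab}_{\mathrm{id}}$ is the $\mathcal L_{\lambda,(\boldsymbol z,y)}$-linear isomorphism $v_I\mapsto\kappa_{\mathrm{id},I}$ from $(\mathbb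 C^2)^{\otimes n}\otimes\mathcal L_{\lambda,(\boldsymbol z,y)}$ to $\oplus_kH^*_T(T^*\mathrm{Gr}_k(\mathbb C^n))\otimes\mathcal L_{\lambda,(\boldsymbol z,y)}$. **R-matrix.** In the basis $v_1\otimes v_1,v_1\otimes v_2,v_2\otimes v_1,v_2\otimes v_2$ (columns are images of basis vectors) $$R(\lambda,z,y)=\begin{pmatrix}1&0&0&0\\0&\frac{(\lambda+y)z}{\lambda(z-y)}&-\frac{(\lambda+z)y}{\lambda(z-y)}&0\\0&-\frac{(\lambda-z)y}{\lambda(z-y)}&\frac{(\lambda-y)z}{\lambda(z-y)}&0\\0&0&0&1\end{pmatrix}.$$ $R^{(i,j)}$ acts in the $i$-th and $j$-th tensor factors; $h^{(j)}$ acts on the $j$-th factor by $v_1\mapsto v_1$, $v_2\mapsto-v_2$; an argument $\lambda-y\sum h^{(j)}$ means that on a vector on which $\sum h^{(j)}$ acts as $\mu$ one substitutes $\lambda-y\mu$. **The rational dynamical quantum group $E_y(\mathfrak{gl}_2)$** is the unital algebra with generators $f(\lambda,yh,y)\in\mathcal L_{\lambda,yh,y}$ and $L_{ij,s}(\lambda,y)$, $i,j\in\{1,2\}$, $s\ge0$. Put $L_{ij}(\lambda,w,y)=\sum_{s\ge0}L_{ij,s}(\lambda,y)w^{-s}$ and $L=(L_{ij})$. Relations: the functions $f$ multiply as functions; $f(\lambda,yh,y)$ commutes with $L_{11}$ and $L_{22}$; $f(\lambda,yh,y)L_{12}=L_{12}f(\lambda,yh-2y,y)$; $f(\lambda,yh,y)L_{21}=L_{21}f(\lambda,yh+2y,y)$;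 and, with $w_{12}=w_1-w_2$, $$R^{(12)}(\lambda-yh,w_{12},y)L^{(1)}(\lambda,w_1,y)L^{(2)}(\lambda-yh^{(1)},w_2,y)=L^{(2)}(\lambda,w_2,y)L^{(1)}(\lambda-yh^{(2)},w_1,y)R^{(12)}(\lambda,w_{12},y).$$ **The $E_y(\mathfrak{gl}_2)$-module $V(z_1)\otimes\cdots\otimes V(z_n)$.** This is $(\mathbb C^2)^{\otimes n}\otimes\mathcal L_{\lambda,(\boldsymbol z,y)}$, where $h$ acts as $2k-n$ on $(\mathbb C^2)^{\otimes n}_k$; this gives the action of the generators $f(\lambda,yh,y)$. With an auxiliary factor $\mathbb C^2$ numbered $0$, $L(\lambda,w,y)=R^{(0,1)}(\lambda-y\sum_{j=2}^nh^{(j)},w-z_1,y)R^{(0,2)}(\lambda-y\sum_{j=3}^nh^{(j)},w-z_2,y)\cdots R^{(0,n)}(\lambda,w-z_n,y)$, $L(v_j\otimes u)=\sum_iv_i\otimes L_{ij}(\lambda,w,y)u$, and the expansion $L_{ij}(\lambda,w,y)=\sum_{s\ge0}L_{ij,s}(\lambda,y)w^{-s}$ at $w=\infty$ gives operators $L_{ij,s}(\lambda,y)$. The operators $f(\lambda,yh,y)$ and $L_{ij,s}(\lambda,y)$ define the $E_y(\mathfrak{gl}_2)$-module structure.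
   Formalization: The module structure induced by Stab_id is taken in the dynamical sense: L_ij(λ) acts as Stab(λ) L_ij(λ) Stab(λ−ε_j y)^{-1} with ε_1=1, ε_2=−1; with plain conjugation by Stab(λ) the claim fails for n=2, k=1. *)

theory Defs
  imports
    "HOL-Algebra.Free_Abelian_Groups"
    "HOL-Algebra.QuotRing"
    "HOL-Algebra.Module"
    "HOL-Library.Countable"
    "HOL-Library.Poly_Mapping"
    "HOL-Combinatorics.Permutations"
    "HOL-Computational_Algebra.Polynomial_Factorial"
    "HOL-Computational_Algebra.Formal_Laurent_Series"
begin

section \<open>Polynomials and rational functions\<close>

text \<open>\<open>G1 i\<close>, \<open>G2 i\<close> are the variables $\gamma_{1,i}$, $\gamma_{2,i}$, and \<open>YH\<close> is the product
  variable $yh$. All rings below sit inside one polynomial ring or its fraction field.\<close>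

datatype var = Lam | Y | YH | Z nat | G1 nat | G2 nat

instance var :: countable
  by countable_datatype

text \<open>The order carries no meaning; it is only needed for the library to know that polynomials in
  these variables form an integral domain.\<close>

instantiation var :: linorder
begin

definition less_eq_var :: "var \<Rightarrow> var \<Rightarrow> bool" where
  "less_eq_var v v' \<longleftrightarrow> to_nat v \<le> to_nat v'"

definition less_var :: "var \<Rightarrow> var \<Rightarrow> bool" where
  "less_var v v' \<longleftrightarrow> to_nat v < to_nat v'"

instance
  by standard (auto simp: less_eq_var_def less_var_def)

end

type_synonym cpoly = "(var \<Rightarrow>\<^sub>0 nat) \<Rightarrow>\<^sub>0 complex"
type_synonym ratf = "cpoly fract"

definition Var :: "var \<Rightarrow> cpoly" where
  "Var v = Poly_Mapping.single (Poly_Mapping.single v 1) 1"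

definition Cst :: "complex \<Rightarrow> cpoly" where
  "Cst c = Poly_Mapping.single 0 c"

definition vars :: "cpoly \<Rightarrow> var set" where
  "vars p = (\<Union>m\<in>Poly_Mapping.keys p. Poly_Mapping.keys m)"

definition polys :: "var set \<Rightarrow> cpoly set" where
  "polys V = {p. vars p \<subseteq> V}"

definition psubst :: "(var \<Rightarrow> cpoly) \<Rightarrow> cpoly \<Rightarrow> cpoly" where
  "psubst \<sigma> p = (\<Sum>m\<in>Poly_Mapping.keys p. Cst (Poly_Mapping.lookup p m) *
     (\<Prod>v\<in>Poly_Mapping.keys m. \<sigma> v ^ Poly_Mapping.lookup m v))"

abbreviation rvar :: "var \<Rightarrow> ratf" where
  "rvar v \<equiv> to_fract (Var v)"

definition class_ring :: "'a::comm_ring_1 set \<Rightarrow> 'a ring" where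
  "class_ring S = \<lparr>carrier = S, monoid.mult = (*), one = 1, zero = 0, add = (+)\<rparr>"

definition Vzy :: "nat \<Rightarrow> var set" where
  "Vzy n = insert Y (Z ` {1..n})"

text \<open>$\mathcal L_{\lambda,y}$\<close>

definition L_lam_y :: "ratf set" where
  "L_lam_y = {Fract f (\<Prod>l\<leftarrow>ls. Var Lam + of_int l * Var Y) | f ls. f \<in> polys {Lam, Y}}"

text \<open>$\mathcal L_{\lambda,(\boldsymbol z,y)}=\mathcal L_{\lambda,y}\otimes_{\mathbb C[y]}
  \mathbb C(\boldsymbol z,y)$ is a localization of $\mathbb C[\lambda,\boldsymbol z,y]$, hence a
  subring of $\mathbb C(\lambda,\boldsymbol z,y)$.\<close>

definition L_lam_zy :: "nat \<Rightarrow> ratf set" where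
  "L_lam_zy n = {Fract f (g * (\<Prod>l\<leftarrow>ls. Var Lam + of_int l * Var Y)) | f g ls.
     f \<in> polys (insert Lam (Vzy n)) \<and> g \<in> polys (Vzy n) \<and> g \<noteq> 0}"

text \<open>$\mathcal L_{\lambda,yh,y}$\<close>

definition yh_denoms :: "cpoly set" where
  "yh_denoms = {(\<Prod>(p, l)\<leftarrow>pls. Var Lam + of_int p * Var YH + of_int l * Var Y) | pls :: (int \<times> int) list. True}"

definition L_lam_yh_y :: "ratf set" where
  "L_lam_yh_y = {Fract f g | f g. f \<in> polys {Lam, YH, Y} \<and> g \<in> yh_denoms}"

text \<open>$f(\lambda,q,y)$ for $f(\lambda,yh,y)\in\mathcal L_{\lambda,yh,y}$; for
  \<open>q = c * Var YH + m * Var Y\<close> with integers \<open>c\<close>, \<open>m\<close> no denominator vanishes.\<close>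

definition yh_subst :: "cpoly \<Rightarrow> ratf \<Rightarrow> ratf" where
  "yh_subst q F = (THE v. \<exists>f g. f \<in> polys {Lam, YH, Y} \<and> g \<in> yh_denoms \<and> F = Fract f g \<and>
     v = Fract (psubst (Var(YH := q)) f) (psubst (Var(YH := q)) g))"

definition Laurent_y :: "ratf set" where
  "Laurent_y = {Fract q (Var Y ^ m) | q m. q \<in> polys {Y}}"


section \<open>Extension of scalars and direct sums\<close>

text \<open>For an \<open>R\<close>-module \<open>M\<close> and an \<open>R\<close>-algebra \<open>S\<close>, the \<open>S\<close>-module $M\otimes_R S$ as the quotient of
  the free abelian group on the pairs. The ring operations of the record, which \<open>module\<close>
  inherits from \<open>ring\<close>, are irrelevant.\<close>

definition tensor_free :: "('r, 'm) module \<Rightarrow> ('r, 's) module \<Rightarrow> ('m \<times> 's \<Rightarrow>\<^sub>0 int) monoid" where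
  "tensor_free M S = free_Abelian_group (carrier M \<times> carrier S)"

definition tensor_rels ::
  "'r ring \<Rightarrow> ('r, 'm) module \<Rightarrow> ('r, 's) module \<Rightarrow> ('m \<times> 's \<Rightarrow>\<^sub>0 int) set" where
  "tensor_rels R M S =
     {frag_of (a \<oplus>\<^bsub>M\<^esub> b, x) - frag_of (a, x) - frag_of (b, x) | a b x.
        a \<in> carrier M \<and> b \<in> carrier M \<and> x \<in> carrier S} \<union>
     {frag_of (a, x \<oplus>\<^bsub>S\<^esub> x') - frag_of (a, x) - frag_of (a, x') | a x x'.
        a \<in> carrier M \<and> x \<in> carrier S \<and> x' \<in> carrier S} \<union>
     {frag_of (r \<odot>\<^bsub>M\<^esub> a, x) - frag_of (a, r \<odot>\<^bsub>S\<^esub> x) | r a x.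
        r \<in> carrier R \<and> a \<in> carrier M \<and> x \<in> carrier S}"

definition tensor_sub ::
  "'r ring \<Rightarrow> ('r, 'm) module \<Rightarrow> ('r, 's) module \<Rightarrow> ('m \<times> 's \<Rightarrow>\<^sub>0 int) set" where
  "tensor_sub R M S = generate (tensor_free M S) (tensor_rels R M S)"

definition tensor ::
  "'r ring \<Rightarrow> ('r, 'm) module \<Rightarrow> ('r, 's) module \<Rightarrow> ('s, ('m \<times> 's \<Rightarrow>\<^sub>0 int) set) module" where
  "tensor R M S = (let Q = tensor_free M S Mod tensor_sub R M S in
     \<lparr>carrier = carrier Q, monoid.mult = undefined, one = undefined,
      zero = \<one>\<^bsub>Q\<^esub>, add = monoid.mult Q,
      module.smult = (\<lambda>c X. \<Union>u\<in>X. tensor_sub R M S #>\<^bsub>tensor_free M S\<^esub>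
                frag_extend (\<lambda>(a, x). frag_of (a, c \<otimes>\<^bsub>S\<^esub> x)) u)\<rparr>)"

definition pure_tensor ::
  "'r ring \<Rightarrow> ('r, 'm) module \<Rightarrow> ('r, 's) module \<Rightarrow> 'm \<Rightarrow> 's \<Rightarrow> ('m \<times> 's \<Rightarrow>\<^sub>0 int) set" where
  "pure_tensor R M S a x = tensor_sub R M S #>\<^bsub>tensor_free M S\<^esub> frag_of (a, x)"

text \<open>Direct sum over a finite index set.\<close>

definition direct_sum :: "'i set \<Rightarrow> ('i \<Rightarrow> ('s, 'm) module) \<Rightarrow> ('s, 'i \<Rightarrow> 'm) module" where
  "direct_sum K M =
     \<lparr>carrier = (\<Pi>\<^sub>E k\<in>K. carrier (M k)), monoid.mult = undefined, one = undefined,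
      zero = (\<lambda>k\<in>K. \<zero>\<^bsub>M k\<^esub>), add = (\<lambda>X X'. \<lambda>k\<in>K. X k \<oplus>\<^bsub>M k\<^esub> X' k),
      module.smult = (\<lambda>c X. \<lambda>k\<in>K. c \<odot>\<^bsub>M k\<^esub> X k)\<rparr>"


section \<open>Equivariant cohomology of the cotangent bundles\<close>

text \<open>The \<open>r\<close>-th smallest element of a finite set, \<open>r \<ge> 1\<close>.\<close>

definition nth_elt :: "nat set \<Rightarrow> nat \<Rightarrow> nat" where
  "nth_elt J r = sorted_list_of_set J ! (r - 1)"

definition ksubsets :: "nat \<Rightarrow> nat \<Rightarrow> nat set set" where
  "ksubsets n k = {I. I \<subseteq> {1..n} \<and> card I = k}"

definition Gam :: "nat \<Rightarrow> nat \<Rightarrow> var set" where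
  "Gam n k = G1 ` {1..k} \<union> G2 ` {1..n - k}"

fun permute_vars :: "(nat \<Rightarrow> nat) \<Rightarrow> (nat \<Rightarrow> nat) \<Rightarrow> (nat \<Rightarrow> nat) \<Rightarrow> var \<Rightarrow> cpoly" where
  "permute_vars \<pi> \<rho> \<tau> (G1 i) = Var (G1 (\<pi> i))"
| "permute_vars \<pi> \<rho> \<tau> (G2 i) = Var (G2 (\<rho> i))"
| "permute_vars \<pi> \<rho> \<tau> (Z i) = Var (Z (\<tau> i))"
| "permute_vars \<pi> \<rho> \<tau> v = Var v"

text \<open>$\mathbb C[\Gamma,\boldsymbol z,y]^{S_k\times S_{n-k}}$ and
  $\mathbb C[\Gamma,\boldsymbol z,y]^{S_k\times S_{n-k}\times S_n}$\<close>

definition inv_T :: "nat \<Rightarrow> nat \<Rightarrow> cpoly ring" where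
  "inv_T n k = class_ring {p \<in> polys (Gam n k \<union> Vzy n).
     \<forall>\<pi> \<rho>. \<pi> permutes {1..k} \<and> \<rho> permutes {1..n - k} \<longrightarrow> psubst (permute_vars \<pi> \<rho> id) p = p}"

definition inv_GL :: "nat \<Rightarrow> nat \<Rightarrow> cpoly ring" where
  "inv_GL n k = class_ring {p \<in> polys (Gam n k \<union> Vzy n).
     \<forall>\<pi> \<rho> \<tau>. \<pi> permutes {1..k} \<and> \<rho> permutes {1..n - k} \<and> \<tau> permutes {1..n} \<longrightarrow>
       psubst (permute_vars \<pi> \<rho> \<tau>) p = p}"

definition rel_poly :: "nat \<Rightarrow> nat \<Rightarrow> cpoly poly" where
  "rel_poly n k =
     (\<Prod>i\<in>{1..k}. [:- Var (G1 i), 1:]) * (\<Prod>i\<in>{1..n - k}. [:- Var (G2 i), 1:])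
     - (\<Prod>i\<in>{1..n}. [:- Var (Z i), 1:])"

definition J_T :: "nat \<Rightarrow> nat \<Rightarrow> cpoly set" where
  "J_T n k = genideal (inv_T n k) (range (poly.coeff (rel_poly n k)))"

definition J_GL :: "nat \<Rightarrow> nat \<Rightarrow> cpoly set" where
  "J_GL n k = genideal (inv_GL n k) (range (poly.coeff (rel_poly n k)))"

definition H_T :: "nat \<Rightarrow> nat \<Rightarrow> cpoly set ring" where
  "H_T n k = inv_T n k Quot J_T n k"

definition H_GL :: "nat \<Rightarrow> nat \<Rightarrow> cpoly set ring" where
  "H_GL n k = inv_GL n k Quot J_GL n k"

text \<open>The embedding of \<open>H_GL\<close> in \<open>H_T\<close>: $f+\mathcal J_{GL}\mapsto f+\mathcal J_T$.\<close>

definition GL_to_T :: "nat \<Rightarrow> nat \<Rightarrow> cpoly set \<Rightarrow> cpoly set" where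
  "GL_to_T n k A = A <+>\<^bsub>inv_T n k\<^esub> J_T n k"

definition C_zy :: "nat \<Rightarrow> cpoly ring" where
  "C_zy n = class_ring (polys (Vzy n))"

definition H_T_mod :: "nat \<Rightarrow> nat \<Rightarrow> (cpoly, cpoly set) module" where
  "H_T_mod n k = ring.extend (H_T n k)
     (module.fields (\<lambda>p A. (J_T n k +>\<^bsub>inv_T n k\<^esub> p) \<otimes>\<^bsub>H_T n k\<^esub> A))"

definition L_mod :: "nat \<Rightarrow> (cpoly, ratf) module" where
  "L_mod n = ring.extend (class_ring (L_lam_zy n)) (module.fields (\<lambda>p x. to_fract p * x))"

type_synonym coh = "(cpoly set \<times> ratf \<Rightarrow>\<^sub>0 int) set"

text \<open>$H^*_T(T^*\mathrm{Gr}_k(\mathbb C^n))\otimes\mathcal L_{\lambda,(\boldsymbol z,y)}$ and the sum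
  over $k$\<close>

definition H_T_L :: "nat \<Rightarrow> nat \<Rightarrow> (ratf, coh) module" where
  "H_T_L n k = tensor (C_zy n) (H_T_mod n k) (L_mod n)"

definition H_T_sum :: "nat \<Rightarrow> (ratf, nat \<Rightarrow> coh) module" where
  "H_T_sum n = direct_sum {0..n} (H_T_L n)"

text \<open>$\bigoplus_k H^*_{GL_n\times\mathbb C^\times}(T^*\mathrm{Gr}_k(\mathbb C^n))
  \otimes_{\mathbb C[y]}\mathcal L_{\lambda,y}\otimes_{\mathbb C[y]}\mathbb C[y^{\pm1}]$ as a subspace
  of \<open>H_T_sum n\<close>, i.e. the image of $A\otimes\ell\otimes q\mapsto A\otimes \ell q$.\<close>

definition H_GL_sum :: "nat \<Rightarrow> (nat \<Rightarrow> coh) set" where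
  "H_GL_sum n = (\<Pi>\<^sub>E k\<in>{0..n}. generate (add_monoid (H_T_L n k))
     {pure_tensor (C_zy n) (H_T_mod n k) (L_mod n) (GL_to_T n k A) (l * q) | A l q.
        A \<in> carrier (H_GL n k) \<and> l \<in> L_lam_y \<and> q \<in> Laurent_y})"

text \<open>Restriction to the fixed point $x_J$, on polynomials, on \<open>H_T\<close>, and extended
  $\mathcal L_{\lambda,(\boldsymbol z,y)}$-linearly. On classes it is the common value on all
  representatives.\<close>

fun at_x :: "nat \<Rightarrow> nat set \<Rightarrow> var \<Rightarrow> cpoly" where
  "at_x n J (G1 i) = Var (Z (nth_elt J i))"
| "at_x n J (G2 i) = Var (Z (nth_elt ({1..n} - J) i))"
| "at_x n J v = Var v"

definition res_H :: "nat \<Rightarrow> nat set \<Rightarrow> cpoly set \<Rightarrow> cpoly" where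
  "res_H n J A = the_elem (psubst (at_x n J) ` A)"

definition res :: "nat \<Rightarrow> nat set \<Rightarrow> coh \<Rightarrow> ratf" where
  "res n J X = the_elem ((\<lambda>u. \<Sum>(A, x)\<in>Poly_Mapping.keys u.
     of_int (Poly_Mapping.lookup u (A, x)) * to_fract (res_H n J A) * x) ` X)"


section \<open>Weight functions and the stable envelope map\<close>

definition wt :: "nat \<Rightarrow> nat \<Rightarrow> nat set \<Rightarrow> int" where
  "wt n i I = int (card {j \<in> I. i < j}) - int (card {j \<in> {1..n} - I. i < j})"

text \<open>The functions $W_I$, $e_k$, $C^{(r)}_{\mathrm{id},I}$ are given by their values at elements of a
  field; \<open>t\<close> and \<open>z\<close> are indexed from 1.\<close>

context
  fixes n :: nat and I :: "nat set" and lam :: "'a::field"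
begin

definition l_fac :: "(nat \<Rightarrow> 'a) \<Rightarrow> (nat \<Rightarrow> 'a) \<Rightarrow> 'a \<Rightarrow> nat \<Rightarrow> nat \<Rightarrow> 'a" where
  "l_fac t z y r a =
     (if a < nth_elt I r then t r - z a + y
      else if a = nth_elt I r then lam + t r - z a - of_int (wt n (nth_elt I r) I) * y
      else t r - z a)"

definition W_term :: "(nat \<Rightarrow> 'a) \<Rightarrow> (nat \<Rightarrow> 'a) \<Rightarrow> 'a \<Rightarrow> 'a" where
  "W_term t z y =
     (\<Prod>r\<in>{1..card I}. \<Prod>a\<in>{1..n}. l_fac t z y r a) *
     (\<Prod>a\<in>{1..card I}. \<Prod>b\<in>{a<..card I}. (t a - t b + y) / (t a - t b))"

definition W :: "(nat \<Rightarrow> 'a) \<Rightarrow> (nat \<Rightarrow> 'a) \<Rightarrow> 'a \<Rightarrow> 'a" where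
  "W t z y = y ^ card I * (\<Sum>\<pi> | \<pi> permutes {1..card I}. W_term (t \<circ> \<pi>) z y)"

definition e_fac :: "(nat \<Rightarrow> 'a) \<Rightarrow> 'a \<Rightarrow> 'a" where
  "e_fac t y = (\<Prod>a\<in>{1..card I}. \<Prod>b\<in>{1..card I}. t a - t b + y)"

definition C_fac :: "int \<Rightarrow> 'a \<Rightarrow> 'a" where
  "C_fac r y = (\<Prod>i\<in>I. lam - of_int (wt n i I + r) * y)"

definition W_plus :: "(nat \<Rightarrow> 'a) \<Rightarrow> (nat \<Rightarrow> 'a) \<Rightarrow> 'a \<Rightarrow> 'a" where
  "W_plus t z y = W t z y / (C_fac 0 y * C_fac 1 y * e_fac t y)"

end

text \<open>$\kappa_{\mathrm{id},I}$ and $\mathrm{Stab}_{\mathrm{id}}$ with \<open>lam\<close> in place of $\lambda$. An element of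
  $(\mathbb C^2)^{\otimes n}\otimes\mathcal L_{\lambda,(\boldsymbol z,y)}$ is the family of its coordinates in
  the basis $v_I$.\<close>

definition kappa :: "nat \<Rightarrow> ratf \<Rightarrow> nat set \<Rightarrow> coh" where
  "kappa n lam I = (THE X. X \<in> carrier (H_T_L n (card I)) \<and>
     (\<forall>J\<in>ksubsets n (card I).
        res n J X = W_plus n I lam (\<lambda>r. rvar (Z (nth_elt J r))) (\<lambda>a. rvar (Z a)) (rvar Y)))"

type_synonym vec = "nat set \<Rightarrow> ratf"

definition V_carrier :: "nat \<Rightarrow> vec set" where
  "V_carrier n = {u. (\<forall>I. u I \<in> L_lam_zy n) \<and> (\<forall>I. \<not> I \<subseteq> {1..n} \<longrightarrow> u I = 0)}"

definition Stab :: "nat \<Rightarrow> ratf \<Rightarrow> vec \<Rightarrow> nat \<Rightarrow> coh" where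
  "Stab n lam u = (\<lambda>k\<in>{0..n}.
     finsum (H_T_L n k) (\<lambda>I. u I \<odot>\<^bsub>H_T_L n k\<^esub> kappa n lam I) (ksubsets n k))"

definition Stab_inv :: "nat \<Rightarrow> ratf \<Rightarrow> (nat \<Rightarrow> coh) \<Rightarrow> vec" where
  "Stab_inv n lam = inv_into (V_carrier n) (Stab n lam)"


section \<open>The R-matrix and the L-operator\<close>

text \<open>The index of a basis vector of $\mathbb C^2$, and the eigenvalue of $h$ on it.\<close>

datatype ind = I1 | I2

fun eps :: "ind \<Rightarrow> int" where
  "eps I1 = 1"
| "eps I2 = -1"

text \<open>\<open>Rmat lam z y (a, b) (c, d)\<close> is the coefficient of $v_a\otimes v_b$ in the image of
  $v_c\otimes v_d$.\<close>

fun Rmat :: "'a::field \<Rightarrow> 'a \<Rightarrow> 'a \<Rightarrow> ind \<times> ind \<Rightarrow> ind \<times> ind \<Rightarrow> 'a" where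
  "Rmat lam z y (I1, I1) (I1, I1) = 1"
| "Rmat lam z y (I1, I2) (I1, I2) = (lam + y) * z / (lam * (z - y))"
| "Rmat lam z y (I1, I2) (I2, I1) = - ((lam + z) * y / (lam * (z - y)))"
| "Rmat lam z y (I2, I1) (I1, I2) = - ((lam - z) * y / (lam * (z - y)))"
| "Rmat lam z y (I2, I1) (I2, I1) = (lam - y) * z / (lam * (z - y))"
| "Rmat lam z y (I2, I2) (I2, I2) = 1"
| "Rmat lam z y _ _ = 0"

definition factor :: "nat \<Rightarrow> nat set \<Rightarrow> ind" where
  "factor j I = (if j \<in> I then I1 else I2)"

definition set_factor :: "nat \<Rightarrow> ind \<Rightarrow> nat set \<Rightarrow> nat set" where
  "set_factor j c I = (if c = I1 then insert j I else I - {j})"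

text \<open>Vectors of $\mathbb C^2\otimes(\mathbb C^2)^{\otimes n}$ (auxiliary factor first) have coordinates in
  the field of Laurent series in $w^{-1}$, so that \<open>fls_X_inv\<close> is $w$. \<open>R_op n lam j\<close> is
  $R^{(0,j)}(\lambda-y\sum_{m=j+1}^n h^{(m)},w-z_j,y)$.\<close>

definition R_op ::
  "nat \<Rightarrow> ratf \<Rightarrow> nat \<Rightarrow> (ind \<Rightarrow> nat set \<Rightarrow> ratf fls) \<Rightarrow> ind \<Rightarrow> nat set \<Rightarrow> ratf fls" where
  "R_op n lam j \<psi> a I = (\<Sum>b\<in>{I1, I2}. \<Sum>c\<in>{I1, I2}.
     Rmat (fls_const (lam - rvar Y * of_int (\<Sum>m\<in>{j<..n}. eps (factor m I))))
          (fls_X_inv - fls_const (rvar (Z j))) (fls_const (rvar Y)) (a, factor j I) (b, c)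
     * \<psi> b (set_factor j c I))"

definition L_op ::
  "nat \<Rightarrow> ratf \<Rightarrow> (ind \<Rightarrow> nat set \<Rightarrow> ratf fls) \<Rightarrow> ind \<Rightarrow> nat set \<Rightarrow> ratf fls" where
  "L_op n lam = foldr (R_op n lam) [1..<Suc n]"

text \<open>$L_{ij,s}$ on $V(z_1)\otimes\cdots\otimes V(z_n)$, with \<open>lam\<close> in place of $\lambda$.\<close>

definition L_coeff :: "nat \<Rightarrow> ratf \<Rightarrow> ind \<Rightarrow> ind \<Rightarrow> nat \<Rightarrow> vec \<Rightarrow> vec" where
  "L_coeff n lam i j s u =
     (\<lambda>I. fls_nth (L_op n lam (\<lambda>a K. if a = j then fls_const (u K) else 0) i I) (int s))"

definition f_act_V :: "nat \<Rightarrow> ratf \<Rightarrow> vec \<Rightarrow> vec" where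
  "f_act_V n f u = (\<lambda>I. yh_subst (of_int (2 * int (card I) - int n) * Var Y) f * u I)"


section \<open>The dynamical quantum group\<close>

text \<open>Noncommutative polynomial expressions in the generators. The dynamical relation involves
  $L_{ij}$ at shifted arguments, so the coefficients of $L_{ij}(\lambda+ly,w,y)$, $l\in\mathbb Z$, are all
  admitted: \<open>Lgen i j s l\<close> stands for $L_{ij,s}(\lambda+ly,y)$.\<close>

datatype Ey_term =
    Scal complex
  | Fn ratf
  | Lgen ind ind nat int
  | Plus Ey_term Ey_term
  | Times Ey_term Ey_term

inductive_set Ey_terms :: "Ey_term set" where
  "Scal c \<in> Ey_terms"
| "f \<in> L_lam_yh_y \<Longrightarrow> Fn f \<in> Ey_terms"
| "Lgen i j s l \<in> Ey_terms"
| "e \<in> Ey_terms \<Longrightarrow> e' \<in> Ey_terms \<Longrightarrow> Plus e e' \<in> Ey_terms"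
| "e \<in> Ey_terms \<Longrightarrow> e' \<in> Ey_terms \<Longrightarrow> Times e e' \<in> Ey_terms"

definition Neg :: "Ey_term \<Rightarrow> Ey_term" where
  "Neg e = Times (Scal (-1)) e"

definition Sum4 :: "(ind \<Rightarrow> ind \<Rightarrow> Ey_term) \<Rightarrow> Ey_term" where
  "Sum4 F = Plus (Plus (F I1 I1) (F I1 I2)) (Plus (F I2 I1) (F I2 I2))"

text \<open>Both sides of
  \[R^{(12)}(\lambda-yh,w_{12},y)L^{(1)}(\lambda,w_1,y)L^{(2)}(\lambda-yh^{(1)},w_2,y)
   =L^{(2)}(\lambda,w_2,y)L^{(1)}(\lambda-yh^{(2)},w_1,y)R^{(12)}(\lambda,w_{12},y)\]
  are multiplied by $w_{12}-y$ to make $R^{(12)}$ polynomial in $w_{12}$, and the coefficients of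
  $w_1^{-r}w_2^{-s}$, $r,s\ge-1$, are compared, for all shifts $\lambda\mapsto\lambda+ly$. The entries of
  $(z-y)R(\lambda,z,y)$ have the form \<open>R_coeff0 + R_coeff1 * z\<close>, hence are determined by $z=0,1$.\<close>

definition R_coeff0 :: "ratf \<Rightarrow> ind \<times> ind \<Rightarrow> ind \<times> ind \<Rightarrow> ratf" where
  "R_coeff0 lam ab cd = (0 - rvar Y) * Rmat lam 0 (rvar Y) ab cd"

definition R_coeff1 :: "ratf \<Rightarrow> ind \<times> ind \<Rightarrow> ind \<times> ind \<Rightarrow> ratf" where
  "R_coeff1 lam ab cd = (1 - rvar Y) * Rmat lam 1 (rvar Y) ab cd - R_coeff0 lam ab cd"

definition Lterm :: "ind \<Rightarrow> ind \<Rightarrow> int \<Rightarrow> int \<Rightarrow> Ey_term" where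
  "Lterm i j s l = (if s < 0 then Scal 0 else Lgen i j (nat s) l)"

definition RLL_lhs :: "int \<Rightarrow> int \<Rightarrow> int \<Rightarrow> ind \<times> ind \<Rightarrow> ind \<times> ind \<Rightarrow> Ey_term" where
  "RLL_lhs l r s out = (\<lambda>(a, b). Sum4 (\<lambda>c d.
     let lam = rvar Lam + of_int l * rvar Y - rvar YH;
         X = (\<lambda>r s. Times (Lterm c a r l) (Lterm d b s (l - eps a)))
     in Plus (Times (Fn (R_coeff1 lam out (c, d))) (Plus (X (r + 1) s) (Neg (X r (s + 1)))))
             (Times (Fn (R_coeff0 lam out (c, d))) (X r s))))"

definition RLL_rhs :: "int \<Rightarrow> int \<Rightarrow> int \<Rightarrow> ind \<times> ind \<Rightarrow> ind \<times> ind \<Rightarrow> Ey_term" where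
  "RLL_rhs l r s = (\<lambda>(a, b) inn. Sum4 (\<lambda>c d.
     let lam = rvar Lam + of_int l * rvar Y;
         X = (\<lambda>r s. Times (Lterm b d s l) (Lterm a c r (l - eps d)))
     in Plus (Times (Plus (X (r + 1) s) (Neg (X r (s + 1)))) (Fn (R_coeff1 lam (c, d) inn)))
             (Times (X r s) (Fn (R_coeff0 lam (c, d) inn)))))"

inductive Ey_eq :: "Ey_term \<Rightarrow> Ey_term \<Rightarrow> bool" (infix \<open>\<sim>\<^sub>y\<close> 50) where
  refl: "a \<sim>\<^sub>y a"
| sym: "a \<sim>\<^sub>y b \<Longrightarrow> b \<sim>\<^sub>y a"
| trans: "a \<sim>\<^sub>y b \<Longrightarrow> b \<sim>\<^sub>y c \<Longrightarrow> a \<sim>\<^sub>y c"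
| plus_cong: "a \<sim>\<^sub>y a' \<Longrightarrow> b \<sim>\<^sub>y b' \<Longrightarrow> Plus a b \<sim>\<^sub>y Plus a' b'"
| times_cong: "a \<sim>\<^sub>y a' \<Longrightarrow> b \<sim>\<^sub>y b' \<Longrightarrow> Times a b \<sim>\<^sub>y Times a' b'"
| plus_assoc: "Plus (Plus a b) c \<sim>\<^sub>y Plus a (Plus b c)"
| plus_comm: "Plus a b \<sim>\<^sub>y Plus b a"
| plus_zero: "Plus (Scal 0) a \<sim>\<^sub>y a"
| plus_neg: "Plus (Neg a) a \<sim>\<^sub>y Scal 0"
| times_assoc: "Times (Times a b) c \<sim>\<^sub>y Times a (Times b c)"
| times_one: "Times (Scal 1) a \<sim>\<^sub>y a"
| distrib_left: "Times a (Plus b c) \<sim>\<^sub>y Plus (Times a b) (Times a c)"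
| distrib_right: "Times (Plus a b) c \<sim>\<^sub>y Plus (Times a c) (Times b c)"
| scal_plus: "Plus (Scal x) (Scal x') \<sim>\<^sub>y Scal (x + x')"
| scal_times: "Times (Scal x) (Scal x') \<sim>\<^sub>y Scal (x * x')"
| scal_central: "Times (Scal x) a \<sim>\<^sub>y Times a (Scal x)"
| fn_scal: "Fn (to_fract (Cst x)) \<sim>\<^sub>y Scal x"
| fn_plus: "f \<in> L_lam_yh_y \<Longrightarrow> g \<in> L_lam_yh_y \<Longrightarrow> Plus (Fn f) (Fn g) \<sim>\<^sub>y Fn (f + g)"
| fn_times: "f \<in> L_lam_yh_y \<Longrightarrow> g \<in> L_lam_yh_y \<Longrightarrow> Times (Fn f) (Fn g) \<sim>\<^sub>y Fn (f * g)"
| fn_L11: "f \<in> L_lam_yh_y \<Longrightarrow> Times (Fn f) (Lgen I1 I1 s l) \<sim>\<^sub>y Times (Lgen I1 I1 s l) (Fn f)"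
| fn_L22: "f \<in> L_lam_yh_y \<Longrightarrow> Times (Fn f) (Lgen I2 I2 s l) \<sim>\<^sub>y Times (Lgen I2 I2 s l) (Fn f)"
| fn_L12: "f \<in> L_lam_yh_y \<Longrightarrow> Times (Fn f) (Lgen I1 I2 s l) \<sim>\<^sub>y
     Times (Lgen I1 I2 s l) (Fn (yh_subst (Var YH - 2 * Var Y) f))"
| fn_L21: "f \<in> L_lam_yh_y \<Longrightarrow> Times (Fn f) (Lgen I2 I1 s l) \<sim>\<^sub>y
     Times (Lgen I2 I1 s l) (Fn (yh_subst (Var YH + 2 * Var Y) f))"
| RLL: "r \<ge> -1 \<Longrightarrow> s \<ge> -1 \<Longrightarrow> RLL_lhs l r s out inn \<sim>\<^sub>y RLL_rhs l r s out inn"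

definition Ey_gl2 :: "Ey_term set set" where
  "Ey_gl2 = Ey_terms // {(e, e'). e \<in> Ey_terms \<and> e' \<in> Ey_terms \<and> e \<sim>\<^sub>y e'}"

text \<open>A module structure on \<open>M\<close> is given by the action \<open>act\<close> of representatives.\<close>

definition Ey_gl2_submodule ::
  "('s, 'v) module \<Rightarrow> (Ey_term \<Rightarrow> 'v \<Rightarrow> 'v) \<Rightarrow> 'v set \<Rightarrow> bool" where
  "Ey_gl2_submodule M act N \<longleftrightarrow>
     N \<subseteq> carrier M \<and> \<zero>\<^bsub>M\<^esub> \<in> N \<and> (\<forall>X\<in>N. \<forall>X'\<in>N. X \<oplus>\<^bsub>M\<^esub> X' \<in> N) \<and>
     (\<forall>E\<in>Ey_gl2. \<forall>e\<in>E. \<forall>X\<in>N. act e X \<in> N)"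

text \<open>The structure on \<open>H_T_sum n\<close> induced by $\mathrm{Stab}_{\mathrm{id}}$. As $\lambda$ is a dynamical
  variable, an isomorphism $\Phi(\lambda)$ of modules intertwines the $L$-operators in the form
  $\Phi(\lambda)\,L_V(\lambda,w,y)=L_H(\lambda,w,y)\,\Phi(\lambda-yh^{(0)})$, with $h^{(0)}$ acting on the
  auxiliary factor; this is what makes the dynamical relation for $L_H$, in which $\lambda$ is replaced
  by $\lambda-yh^{(j)}$, follow from that for $L_V$. In components,
  $L_{H,ij}(\lambda)=\mathrm{Stab}(\lambda)\,L_{V,ij}(\lambda)\,\mathrm{Stab}(\lambda-\epsilon_jy)^{-1}$, where
  $\epsilon_1=1$, $\epsilon_2=-1$. Without the shift the relation fails.\<close>

fun coh_act :: "nat \<Rightarrow> Ey_term \<Rightarrow> (nat \<Rightarrow> coh) \<Rightarrow> nat \<Rightarrow> coh" where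
  "coh_act n (Scal c) X = to_fract (Cst c) \<odot>\<^bsub>H_T_sum n\<^esub> X"
| "coh_act n (Fn f) X = Stab n (rvar Lam) (f_act_V n f (Stab_inv n (rvar Lam) X))"
| "coh_act n (Lgen i j s l) X = (let lam = rvar Lam + of_int l * rvar Y in
     Stab n lam (L_coeff n lam i j s (Stab_inv n (lam - of_int (eps j) * rvar Y) X)))"
| "coh_act n (Plus e e') X = coh_act n e X \<oplus>\<^bsub>H_T_sum n\<^esub> coh_act n e' X"
| "coh_act n (Times e e') X = coh_act n e (coh_act n e' X)"

end

theory Submission
  imports Defs
begin


text \<open>Restriction to the fixed points identifies $\bigoplus_kH^*_T\otimes\mathcal L_{\lambda,(\boldsymbol z,y)}$
  with families $(g_J)_{J\subseteq[n]}$, and the subspace of the theorem consists of the families with values in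
  $\mathcal L_{\lambda,y}[\boldsymbol z,y^{-1}]$ that are equivariant, $g_{\tau(J)}=\tau(g_J)$ for
  $\tau\in S_n$. In this picture $L_{ij}(\lambda,w)$ acts by
  $M(\lambda)L_{ij}(\lambda,w)M(\lambda-\epsilon_jy)^{-1}$, where the matrix $M$ of values of the weight
  functions is triangular. A transposition $s_a$ of the parameters multiplies $M$ by a dynamical
  $\check R$-matrix, and this $\check R$ also intertwines the two L-operators by the dynamical
  Yang-Baxter equation; hence equivariance is preserved. The result may have poles only at $z_a=z_b$ and at
  $z_i=z_a-y$. Solving the triangular system shows that it has none at $z_i=z_a-y$ for $i<a$, hence by
  equivariance none for $i>a$; at $z_a=z_b$, $a<b$, the vanishing of the pivots is compensated by the
  congruences $g_J\equiv g_{(a\,b)J}$ modulo $z_a-z_b$, which follow from equivariance.\<close>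

section \<open>Substitution in polynomials\<close>

text \<open>The pivots of M contain \<open>z_i - z_a\<close> for i < a and
  \<open>z_i - z_a + y\<close> for a < i. Hence back substitution stays integral only along one half
  of the hyperplanes z_i = z_a - y, and symmetry has to supply the other half. The shift of
  \<lambda> in the inverse of M is what lets this symmetry survive: carrying the R-check-matrix past
  the auxiliary line adds the auxiliary weight to its dynamical argument, so the two sides of L meet
  M at arguments that differ by \<epsilon>_j y. Poles are tested by substitution. Every critical
  denominator has the form v - q, and it can be cancelled as soon as the function is defined at v :=
  q; the factor theorem takes the place of unique factorization. An equivariant integral family is a
  class for the following reason: it is determined by its member at [k], this member is symmetric
  under S_k x S_{n-k}, and reading its z as \<gamma> gives a representative. That restriction is
  injective at all comes from Lagrange interpolation at the nodes z_1, ..., z_n in each of the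
  variables \<gamma>.\<close>

lemma Cst_add: "Cst (a + b) = Cst a + Cst b"
  by (simp add: Cst_def single_add)

lemma Cst_mult: "Cst (a * b) = Cst a * Cst b"
  by (simp add: Cst_def mult_single)

lemma Cst_0 [simp]: "Cst 0 = 0"
  by (simp add: Cst_def)

lemma Cst_1 [simp]: "Cst 1 = 1"
  by (simp add: Cst_def)

lemma poly_mapping_expand:
  fixes p :: "'a \<Rightarrow>\<^sub>0 'b::comm_monoid_add"
  shows "p = (\<Sum>m\<in>Poly_Mapping.keys p. Poly_Mapping.single m (Poly_Mapping.lookup p m))"
  by (rule poly_mapping_eqI)
    (auto simp: lookup_sum lookup_single when_def sum.delta in_keys_iff)

definition mon_eval :: "(var \<Rightarrow> cpoly) \<Rightarrow> (var \<Rightarrow>\<^sub>0 nat) \<Rightarrow> cpoly" where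
  "mon_eval \<sigma> m = (\<Prod>v\<in>Poly_Mapping.keys m. \<sigma> v ^ Poly_Mapping.lookup m v)"

lemma mon_eval_superset:
  assumes "finite A" "Poly_Mapping.keys m \<subseteq> A"
  shows "mon_eval \<sigma> m = (\<Prod>v\<in>A. \<sigma> v ^ Poly_Mapping.lookup m v)"
  unfolding mon_eval_def
  by (rule prod.mono_neutral_left) (use assms in \<open>auto simp: in_keys_iff\<close>)

lemma mon_eval_add: "mon_eval \<sigma> (m + m') = mon_eval \<sigma> m * mon_eval \<sigma> m'"
proof -
  let ?A = "Poly_Mapping.keys m \<union> Poly_Mapping.keys m'"
  have "mon_eval \<sigma> (m + m') = (\<Prod>v\<in>?A. \<sigma> v ^ Poly_Mapping.lookup (m + m') v)"
    by (rule mon_eval_superset) (auto dest: subsetD[OF Poly_Mapping.keys_add])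
  moreover have "mon_eval \<sigma> m = (\<Prod>v\<in>?A. \<sigma> v ^ Poly_Mapping.lookup m v)"
    "mon_eval \<sigma> m' = (\<Prod>v\<in>?A. \<sigma> v ^ Poly_Mapping.lookup m' v)"
    by (rule mon_eval_superset; auto)+
  ultimately show ?thesis
    by (simp add: lookup_add power_add prod.distrib)
qed

lemma mon_eval_0 [simp]: "mon_eval \<sigma> 0 = 1"
  by (simp add: mon_eval_def)

lemma psubst_superset:
  assumes "finite A" "Poly_Mapping.keys p \<subseteq> A"
  shows "psubst \<sigma> p = (\<Sum>m\<in>A. Cst (Poly_Mapping.lookup p m) * mon_eval \<sigma> m)"
  unfolding psubst_def mon_eval_def
  by (rule sum.mono_neutral_left) (use assms in \<open>auto simp: in_keys_iff\<close>)

lemma psubst_add [simp]: "psubst \<sigma> (p + q) = psubst \<sigma> p + psubst \<sigma> q"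
proof -
  let ?A = "Poly_Mapping.keys p \<union> Poly_Mapping.keys q"
  have "psubst \<sigma> (p + q) = (\<Sum>m\<in>?A. Cst (Poly_Mapping.lookup (p + q) m) * mon_eval \<sigma> m)"
    by (rule psubst_superset) (auto dest: subsetD[OF Poly_Mapping.keys_add])
  moreover have "psubst \<sigma> p = (\<Sum>m\<in>?A. Cst (Poly_Mapping.lookup p m) * mon_eval \<sigma> m)"
    "psubst \<sigma> q = (\<Sum>m\<in>?A. Cst (Poly_Mapping.lookup q m) * mon_eval \<sigma> m)"
    by (rule psubst_superset; auto)+
  ultimately show ?thesis
    by (simp add: lookup_add Cst_add ring_distribs sum.distrib)
qed

lemma psubst_single: "psubst \<sigma> (Poly_Mapping.single m c) = Cst c * mon_eval \<sigma> m"
  by (subst psubst_superset[of "{m}"]) auto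

lemma cpoly_single_induct [case_names single add]:
  fixes p :: cpoly
  assumes "\<And>m c. P (Poly_Mapping.single m c)" "\<And>p q. P p \<Longrightarrow> P q \<Longrightarrow> P (p + q)"
  shows "P p"
proof -
  have "finite A \<Longrightarrow> P (\<Sum>m\<in>A. Poly_Mapping.single m (Poly_Mapping.lookup p m))" for A
    by (induction rule: finite_induct) (use assms assms(1)[of _ 0] in auto)
  from this[of "Poly_Mapping.keys p"] show ?thesis
    using poly_mapping_expand[of p] by simp
qed

lemma psubst_0 [simp]: "psubst \<sigma> 0 = 0"
  by (simp add: psubst_def)

lemma psubst_mult [simp]: "psubst \<sigma> (p * q) = psubst \<sigma> p * psubst \<sigma> q"
proof (induction p rule: cpoly_single_induct)
  case (single m c)
  show ?case
    by (induction q rule: cpoly_single_induct)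
      (simp_all add: psubst_single mult_single mon_eval_add Cst_mult ring_distribs mult_ac)
qed (simp add: ring_distribs)

lemma psubst_Cst [simp]: "psubst \<sigma> (Cst c) = Cst c"
  by (simp add: Cst_def[of c] psubst_single)

lemma psubst_1 [simp]: "psubst \<sigma> 1 = 1"
  using psubst_Cst[of \<sigma> 1] by simp

lemma psubst_Var [simp]: "psubst \<sigma> (Var v) = \<sigma> v"
  by (simp add: Var_def psubst_single mon_eval_def)

lemma psubst_uminus [simp]: "psubst \<sigma> (- p) = - psubst \<sigma> p"
  using psubst_add[of \<sigma> p "- p"] by (simp add: eq_neg_iff_add_eq_0 add.commute)

lemma psubst_diff [simp]: "psubst \<sigma> (p - q) = psubst \<sigma> p - psubst \<sigma> q"
  using psubst_add[of \<sigma> p "- q"] by simp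

lemma psubst_sum [simp]: "psubst \<sigma> (sum f A) = (\<Sum>x\<in>A. psubst \<sigma> (f x))"
  by (induction A rule: infinite_finite_induct) auto

lemma psubst_prod [simp]: "psubst \<sigma> (prod f A) = (\<Prod>x\<in>A. psubst \<sigma> (f x))"
  by (induction A rule: infinite_finite_induct) auto

lemma psubst_prod_list [simp]: "psubst \<sigma> (prod_list ps) = (\<Prod>p\<leftarrow>ps. psubst \<sigma> p)"
  by (induction ps) auto

lemma psubst_power [simp]: "psubst \<sigma> (p ^ k) = psubst \<sigma> p ^ k"
  by (induction k) auto

lemma psubst_of_nat [simp]: "psubst \<sigma> (of_nat k) = of_nat k"
  by (induction k) auto

lemma psubst_of_int [simp]: "psubst \<sigma> (of_int k) = of_int k"
  by (cases k rule: int_cases2) auto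

lemma psubst_numeral [simp]: "psubst \<sigma> (numeral k) = numeral k"
  using psubst_of_nat[of \<sigma> "numeral k"] by simp

lemma Var_power: "Var v ^ k = Poly_Mapping.single (Poly_Mapping.single v k) 1"
  by (induction k) (auto simp: Var_def mult_single single_add[symmetric])

lemma mon_eval_Var: "mon_eval Var m = Poly_Mapping.single m 1"
proof -
  have "finite A \<Longrightarrow> (\<Prod>v\<in>A. Poly_Mapping.single (f v) (1::complex)) =
      Poly_Mapping.single (sum f A :: var \<Rightarrow>\<^sub>0 nat) 1" for A and f :: "var \<Rightarrow> var \<Rightarrow>\<^sub>0 nat"
    by (induction rule: finite_induct) (auto simp: mult_single)
  then show ?thesis
    by (simp add: mon_eval_def Var_power poly_mapping_expand[of m, symmetric])
qed

lemma single_eq_mon: "Poly_Mapping.single m c = Cst c * (\<Prod>v\<in>Poly_Mapping.keys m. Var v ^ Poly_Mapping.lookup m v)"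
  using mon_eval_Var[of m] by (simp add: mon_eval_def Cst_def mult_single)

lemma cpoly_expand: "p = (\<Sum>m\<in>Poly_Mapping.keys p. Cst (Poly_Mapping.lookup p m) *
    (\<Prod>v\<in>Poly_Mapping.keys m. Var v ^ Poly_Mapping.lookup m v))"
  by (subst (1) poly_mapping_expand) (simp only: single_eq_mon)

text \<open>The expansion into monomials shows that \<open>polys V\<close> is generated by V over
  the constants. Identities between substitutions then have to be checked on variables only.\<close>

lemma polys_induct [consumes 1, case_names Cst Var add mult]:
  assumes "p \<in> polys V"
    and C: "\<And>c. P (Cst c)" and V: "\<And>v. v \<in> V \<Longrightarrow> P (Var v)"
    and A: "\<And>p q. P p \<Longrightarrow> P q \<Longrightarrow> P (p + q)" and M: "\<And>p q. P p \<Longrightarrow> P q \<Longrightarrow> P (p * q)"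
  shows "P p"
proof -
  have P0: "P 0" "P 1" using C[of 0] C[of 1] by auto
  have pw: "P x \<Longrightarrow> P (x ^ k)" for x k
    by (induction k) (auto intro: M P0)
  have pr: "finite A \<Longrightarrow> (\<And>x. x \<in> A \<Longrightarrow> P (f x)) \<Longrightarrow> P (prod f A)" for A and f :: "var \<Rightarrow> cpoly"
    by (induction rule: finite_induct) (auto intro: M P0)
  have sm: "finite A \<Longrightarrow> (\<And>x. x \<in> A \<Longrightarrow> P (f x)) \<Longrightarrow> P (sum f A)" for A and f :: "(var \<Rightarrow>\<^sub>0 nat) \<Rightarrow> cpoly"
    by (induction rule: finite_induct) (auto intro: A P0)
  have "v \<in> V" if "m \<in> Poly_Mapping.keys p" "v \<in> Poly_Mapping.keys m" for m v
    using assms(1) that by (auto simp: polys_def vars_def)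
  then show ?thesis
    by (subst cpoly_expand) (intro sm M C pr pw V finite_keys; blast)
qed

lemma cpoly_induct [case_names Cst Var add mult]:
  assumes "\<And>c. P (Cst c)" "\<And>v. P (Var v)"
    and "\<And>p q. P p \<Longrightarrow> P q \<Longrightarrow> P (p + q)" "\<And>p q. P p \<Longrightarrow> P q \<Longrightarrow> P (p * q)"
  shows "P p"
  by (rule polys_induct[of p UNIV]) (use assms in \<open>auto simp: polys_def\<close>)

lemma psubst_psubst: "psubst \<sigma> (psubst \<tau> p) = psubst (\<lambda>v. psubst \<sigma> (\<tau> v)) p"
  by (induction p rule: cpoly_induct) auto

lemma psubst_id [simp]: "psubst Var p = p"
  by (induction p rule: cpoly_induct) auto

lemma psubst_cong:
  "p \<in> polys V \<Longrightarrow> (\<And>v. v \<in> V \<Longrightarrow> \<sigma> v = \<tau> v) \<Longrightarrow> psubst \<sigma> p = psubst \<tau> p"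
  by (induction p rule: polys_induct) auto

lemma psubst_eq_self: "p \<in> polys V \<Longrightarrow> (\<And>v. v \<in> V \<Longrightarrow> \<sigma> v = Var v) \<Longrightarrow> psubst \<sigma> p = p"
  using psubst_cong[of p V \<sigma> Var] by simp

lemma polys_add [intro]: "p \<in> polys V \<Longrightarrow> q \<in> polys V \<Longrightarrow> p + q \<in> polys V"
  by (auto simp: polys_def vars_def dest!: subsetD[OF Poly_Mapping.keys_add])

lemma polys_mult [intro]:
  assumes "p \<in> polys V" "q \<in> polys V" shows "p * q \<in> polys V"
proof -
  have "v \<in> V" if m: "m \<in> Poly_Mapping.keys (p * q)" and v: "v \<in> Poly_Mapping.keys m" for m v
  proof -
    obtain a b where ab: "m = a + b" "a \<in> Poly_Mapping.keys p" "b \<in> Poly_Mapping.keys q"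
      using m keys_mult[of p q] by blast
    with v have "v \<in> Poly_Mapping.keys a \<or> v \<in> Poly_Mapping.keys b"
      using Poly_Mapping.keys_add[of a b] by auto
    with ab assms show ?thesis by (auto simp: polys_def vars_def)
  qed
  then show ?thesis by (auto simp: polys_def vars_def)
qed

lemma polys_Cst [intro, simp]: "Cst c \<in> polys V"
  by (auto simp: polys_def vars_def Cst_def split: if_splits)

lemma polys_Var [intro]: "v \<in> V \<Longrightarrow> Var v \<in> polys V"
  by (auto simp: polys_def vars_def Var_def split: if_splits)

lemma polys_0 [intro, simp]: "0 \<in> polys V" and polys_1 [intro, simp]: "1 \<in> polys V"
  using polys_Cst[of 0 V] polys_Cst[of 1 V] by auto

lemma polys_uminus [intro]: "p \<in> polys V \<Longrightarrow> - p \<in> polys V"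
  by (simp add: polys_def vars_def)

lemma polys_diff [intro]: "p \<in> polys V \<Longrightarrow> q \<in> polys V \<Longrightarrow> p - q \<in> polys V"
  using polys_add[OF _ polys_uminus] by (metis diff_conv_add_uminus)

lemma polys_sum [intro]: "(\<And>x. x \<in> A \<Longrightarrow> f x \<in> polys V) \<Longrightarrow> sum f A \<in> polys V"
  by (induction A rule: infinite_finite_induct) auto

lemma polys_prod [intro]: "(\<And>x. x \<in> A \<Longrightarrow> f x \<in> polys V) \<Longrightarrow> prod f A \<in> polys V"
  by (induction A rule: infinite_finite_induct) auto

lemma polys_prod_list [intro]: "(\<And>x. x \<in> set xs \<Longrightarrow> x \<in> polys V) \<Longrightarrow> prod_list xs \<in> polys V"
  by (induction xs) auto

lemma polys_power [intro]: "p \<in> polys V \<Longrightarrow> p ^ k \<in> polys V"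
  by (induction k) auto

lemma polys_of_nat [intro, simp]: "of_nat k \<in> polys V"
  by (induction k) auto

lemma polys_of_int [intro, simp]: "of_int k \<in> polys V"
  by (cases k rule: int_cases2) auto

lemma polys_mono: "V \<subseteq> V' \<Longrightarrow> polys V \<subseteq> polys V'"
  by (auto simp: polys_def)

lemma polys_psubst:
  "p \<in> polys V \<Longrightarrow> (\<And>v. v \<in> V \<Longrightarrow> \<sigma> v \<in> polys V') \<Longrightarrow> psubst \<sigma> p \<in> polys V'"
  by (induction p rule: polys_induct) auto

lemma of_int_eq_Cst: "(of_int k :: cpoly) = Cst (of_int k)"
  by (simp add: Cst_def)

lemma Cst_eq_0_iff [simp]: "Cst c = 0 \<longleftrightarrow> c = 0"
  by (metis Cst_0 Cst_def lookup_single_eq)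

text \<open>Factor theorem in several variables: modulo v - q the substitution v := q is the
  identity. Only the product is not immediate; there the difference telescopes. All divisibility
  below comes from this.\<close>

lemma dvd_diff_psubst: "Var v - q dvd p - psubst (Var(v := q)) p"
proof (induction p rule: cpoly_induct)
  case (mult p p')
  have "p * p' - psubst (Var(v := q)) (p * p')
      = (p - psubst (Var(v := q)) p) * p' + psubst (Var(v := q)) p * (p' - psubst (Var(v := q)) p')"
    by (simp add: algebra_simps)
  with mult show ?case by (metis dvd_add dvd_mult dvd_mult2)
next
  case (add p p')
  have "p + p' - psubst (Var(v := q)) (p + p')
      = (p - psubst (Var(v := q)) p) + (p' - psubst (Var(v := q)) p')"
    by simp
  with add show ?case by (metis dvd_add)
qed auto

lemma dvd_if_psubst_0: "psubst (Var(v := q)) p = 0 \<Longrightarrow> Var v - q dvd p"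
  using dvd_diff_psubst[of v q p] by simp

text \<open>Setting the variables outside V to 0 is a ring endomorphism that fixes l and l * p;
  cancelling l shows that it fixes p.\<close>

lemma polys_dvd_cofactor:
  assumes "l * p \<in> polys V" "l \<in> polys V" "l \<noteq> 0"
  shows "p \<in> polys V"
proof -
  let ?\<theta> = "\<lambda>v. if v \<in> V then Var v else 0"
  have "l * psubst ?\<theta> p = psubst ?\<theta> (l * p)"
    by (simp add: psubst_eq_self[OF assms(2)])
  also have "\<dots> = l * p"
    by (rule psubst_eq_self[OF assms(1)]) simp
  finally have "psubst ?\<theta> p = p" using assms(3) by simp
  moreover have "psubst ?\<theta> p \<in> polys V"
    by (rule polys_psubst[of _ UNIV]) (auto simp: polys_def[of UNIV] polys_Var)
  ultimately show ?thesis by simp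
qed

section \<open>Regular rational functions\<close>

lemma psubst_nonzero_imp: "psubst \<sigma> b \<noteq> 0 \<Longrightarrow> b \<noteq> 0"
  by auto

text \<open>Membership in the local ring at the kernel of \<open>psubst \<sigma>\<close>, a prime
  ideal. If \<sigma> replaces one variable v by a polynomial q free of v, this is the absence of a
  pole along v = q. The map \<open>rsub\<close> is the induced homomorphism into the fraction
  field.\<close>

definition regular :: "(var \<Rightarrow> cpoly) \<Rightarrow> ratf \<Rightarrow> bool" where
  "regular \<sigma> x \<longleftrightarrow> (\<exists>a b. x = Fract a b \<and> psubst \<sigma> b \<noteq> 0)"

definition rsub :: "(var \<Rightarrow> cpoly) \<Rightarrow> ratf \<Rightarrow> ratf" where
  "rsub \<sigma> x = (THE v. \<exists>a b. x = Fract a b \<and> psubst \<sigma> b \<noteq> 0 \<and> v = Fract (psubst \<sigma> a) (psubst \<sigma> b))"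

lemma rsub_Fract:
  assumes "psubst \<sigma> b \<noteq> 0"
  shows "rsub \<sigma> (Fract a b) = Fract (psubst \<sigma> a) (psubst \<sigma> b)"
  unfolding rsub_def
proof (rule the_equality)
  fix v assume "\<exists>c d. Fract a b = Fract c d \<and> psubst \<sigma> d \<noteq> 0 \<and> v = Fract (psubst \<sigma> c) (psubst \<sigma> d)"
  then obtain c d where *: "Fract a b = Fract c d" "psubst \<sigma> d \<noteq> 0" "v = Fract (psubst \<sigma> c) (psubst \<sigma> d)"
    by blast
  have "b \<noteq> 0" "d \<noteq> 0" using assms *(2) by auto
  with *(1) have "a * d = c * b" by (simp add: eq_fract)
  from arg_cong[OF this, of "psubst \<sigma>"] show "v = Fract (psubst \<sigma> a) (psubst \<sigma> b)"
    using assms * by (simp add: eq_fract)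
qed (use assms in blast)

lemma regular_Fract: "psubst \<sigma> b \<noteq> 0 \<Longrightarrow> regular \<sigma> (Fract a b)"
  by (auto simp: regular_def)

lemma regular_cases:
  assumes "regular \<sigma> x"
  obtains a b where "x = Fract a b" "b \<noteq> 0" "psubst \<sigma> b \<noteq> 0" "rsub \<sigma> x = Fract (psubst \<sigma> a) (psubst \<sigma> b)"
  using assms rsub_Fract unfolding regular_def by (metis psubst_nonzero_imp)

lemma regular_to_fract [simp]: "regular \<sigma> (to_fract p)"
  using regular_Fract[of \<sigma> 1 p] by (simp add: to_fract_def)

lemma rsub_to_fract [simp]: "rsub \<sigma> (to_fract p) = to_fract (psubst \<sigma> p)"
  using rsub_Fract[of \<sigma> 1 p] by (simp add: to_fract_def)

lemma regular_rsub_add: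
  assumes "regular \<sigma> x" "regular \<sigma> y"
  shows "regular \<sigma> (x + y) \<and> rsub \<sigma> (x + y) = rsub \<sigma> x + rsub \<sigma> y"
proof -
  obtain a b where x: "x = Fract a b" "b \<noteq> 0" "psubst \<sigma> b \<noteq> 0" "rsub \<sigma> x = Fract (psubst \<sigma> a) (psubst \<sigma> b)"
    using assms(1) by (rule regular_cases)
  obtain c d where y: "y = Fract c d" "d \<noteq> 0" "psubst \<sigma> d \<noteq> 0" "rsub \<sigma> y = Fract (psubst \<sigma> c) (psubst \<sigma> d)"
    using assms(2) by (rule regular_cases)
  show ?thesis
    unfolding x(4) y(4) unfolding x(1) y(1)
    using x(2,3) y(2,3) by (simp add: add_fract regular_Fract rsub_Fract)
qed

lemma regular_rsub_mult:
  assumes "regular \<sigma> x" "regular \<sigma> y"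
  shows "regular \<sigma> (x * y) \<and> rsub \<sigma> (x * y) = rsub \<sigma> x * rsub \<sigma> y"
proof -
  obtain a b where x: "x = Fract a b" "b \<noteq> 0" "psubst \<sigma> b \<noteq> 0" "rsub \<sigma> x = Fract (psubst \<sigma> a) (psubst \<sigma> b)"
    using assms(1) by (rule regular_cases)
  obtain c d where y: "y = Fract c d" "d \<noteq> 0" "psubst \<sigma> d \<noteq> 0" "rsub \<sigma> y = Fract (psubst \<sigma> c) (psubst \<sigma> d)"
    using assms(2) by (rule regular_cases)
  show ?thesis
    unfolding x(4) y(4) unfolding x(1) y(1)
    using x(2,3) y(2,3) by (simp add: mult_fract regular_Fract rsub_Fract)
qed

lemmas regular_add [intro, simp] = regular_rsub_add[THEN conjunct1]
  and rsub_add [simp] = regular_rsub_add[THEN conjunct2]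
  and regular_mult [intro, simp] = regular_rsub_mult[THEN conjunct1]
  and rsub_mult [simp] = regular_rsub_mult[THEN conjunct2]

lemma regular_0 [simp]: "regular \<sigma> 0" and regular_1 [simp]: "regular \<sigma> 1"
  and rsub_0 [simp]: "rsub \<sigma> 0 = 0" and rsub_1 [simp]: "rsub \<sigma> 1 = 1"
  using regular_to_fract[of \<sigma> 0] regular_to_fract[of \<sigma> 1] rsub_to_fract[of \<sigma> 0] rsub_to_fract[of \<sigma> 1]
  by simp_all

lemma regular_rsub_uminus: "regular \<sigma> x \<Longrightarrow> regular \<sigma> (- x) \<and> rsub \<sigma> (- x) = - rsub \<sigma> x"
  using regular_rsub_mult[of \<sigma> "to_fract (-1)" x] regular_to_fract[of \<sigma> "-1"] rsub_to_fract[of \<sigma> "-1"]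
  by simp

lemmas regular_uminus [intro, simp] = regular_rsub_uminus[THEN conjunct1]
  and rsub_uminus [simp] = regular_rsub_uminus[THEN conjunct2]

lemma regular_diff [intro, simp]: "regular \<sigma> x \<Longrightarrow> regular \<sigma> y \<Longrightarrow> regular \<sigma> (x - y)"
  using regular_add[of \<sigma> x "- y"] by simp

lemma rsub_diff [simp]: "regular \<sigma> x \<Longrightarrow> regular \<sigma> y \<Longrightarrow> rsub \<sigma> (x - y) = rsub \<sigma> x - rsub \<sigma> y"
  using rsub_add[of \<sigma> x "- y"] by simp

lemma regular_rsub_sum:
  "(\<And>x. x \<in> A \<Longrightarrow> regular \<sigma> (f x)) \<Longrightarrow> regular \<sigma> (sum f A) \<and> rsub \<sigma> (sum f A) = (\<Sum>x\<in>A. rsub \<sigma> (f x))"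
  by (induction A rule: infinite_finite_induct) auto

lemma regular_rsub_prod:
  "(\<And>x. x \<in> A \<Longrightarrow> regular \<sigma> (f x)) \<Longrightarrow> regular \<sigma> (prod f A) \<and> rsub \<sigma> (prod f A) = (\<Prod>x\<in>A. rsub \<sigma> (f x))"
  by (induction A rule: infinite_finite_induct) auto

lemmas regular_sum [intro] = regular_rsub_sum[THEN conjunct1]
  and rsub_sum = regular_rsub_sum[THEN conjunct2]
  and regular_prod [intro] = regular_rsub_prod[THEN conjunct1]
  and rsub_prod = regular_rsub_prod[THEN conjunct2]

lemma regular_rsub_power:
  "regular \<sigma> x \<Longrightarrow> regular \<sigma> (x ^ k) \<and> rsub \<sigma> (x ^ k) = rsub \<sigma> x ^ k"
  by (induction k) auto

lemma of_int_fract: "(of_int k :: ratf) = to_fract (of_int k)"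
proof -
  have n: "(of_nat m :: ratf) = to_fract (of_nat m)" for m by (induction m) auto
  show ?thesis by (cases k rule: int_cases2) (auto simp: n)
qed

lemma regular_of_int [simp]: "regular \<sigma> (of_int k)" and rsub_of_int [simp]: "rsub \<sigma> (of_int k) = of_int k"
  by (simp_all add: of_int_fract)

lemma regular_rsub_inverse:
  assumes "regular \<sigma> x" "rsub \<sigma> x \<noteq> 0"
  shows "regular \<sigma> (inverse x) \<and> rsub \<sigma> (inverse x) = inverse (rsub \<sigma> x)"
proof -
  obtain a b where x: "x = Fract a b" "b \<noteq> 0" "psubst \<sigma> b \<noteq> 0" "rsub \<sigma> x = Fract (psubst \<sigma> a) (psubst \<sigma> b)"
    using assms(1) by (rule regular_cases)
  then have "psubst \<sigma> a \<noteq> 0" using assms(2) by (auto simp: fract_collapse)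
  then show ?thesis unfolding x(4) unfolding x(1)
    by (simp add: regular_Fract rsub_Fract)
qed

lemmas regular_inverse [intro] = regular_rsub_inverse[THEN conjunct1]
  and rsub_inverse = regular_rsub_inverse[THEN conjunct2]

lemma regular_divide [intro]:
  "regular \<sigma> x \<Longrightarrow> regular \<sigma> y \<Longrightarrow> rsub \<sigma> y \<noteq> 0 \<Longrightarrow> regular \<sigma> (x / y)"
  by (simp add: divide_inverse regular_inverse)

lemma rsub_divide:
  "regular \<sigma> x \<Longrightarrow> regular \<sigma> y \<Longrightarrow> rsub \<sigma> y \<noteq> 0 \<Longrightarrow> rsub \<sigma> (x / y) = rsub \<sigma> x / rsub \<sigma> y"
  by (simp add: divide_inverse regular_inverse rsub_inverse)


section \<open>Localizations\<close>

locale comm_subring =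
  fixes S :: "'a::comm_ring_1 set"
  assumes one_mem [simp, intro]: "1 \<in> S"
    and diff_mem [intro]: "x \<in> S \<Longrightarrow> y \<in> S \<Longrightarrow> x - y \<in> S"
    and mult_mem [intro]: "x \<in> S \<Longrightarrow> y \<in> S \<Longrightarrow> x * y \<in> S"
begin

lemma zero_mem [simp, intro]: "0 \<in> S"
  using diff_mem[OF one_mem one_mem] by simp

lemma uminus_mem [intro]: "x \<in> S \<Longrightarrow> - x \<in> S"
  using diff_mem[OF zero_mem] by fastforce

lemma add_mem [intro]: "x \<in> S \<Longrightarrow> y \<in> S \<Longrightarrow> x + y \<in> S"
  using diff_mem[OF _ uminus_mem] by fastforce

lemma sum_mem [intro]: "(\<And>x. x \<in> A \<Longrightarrow> f x \<in> S) \<Longrightarrow> sum f A \<in> S"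
  by (induction A rule: infinite_finite_induct) auto

lemma prod_mem [intro]: "(\<And>x. x \<in> A \<Longrightarrow> f x \<in> S) \<Longrightarrow> prod f A \<in> S"
  by (induction A rule: infinite_finite_induct) auto

lemma power_mem [intro]: "x \<in> S \<Longrightarrow> x ^ k \<in> S"
  by (induction k) auto

lemma of_nat_mem [simp, intro]: "of_nat k \<in> S"
  by (induction k) auto

lemma of_int_mem [simp, intro]: "of_int k \<in> S"
  by (cases k rule: int_cases2) auto

end

text \<open>Closure under inverses is deliberately absent: a lemma on matrix entries assumes
  \<open>inverse x \<in> S\<close> just for the denominators that occur. One statement then serves
  the localizations and the local rings \<open>{x. regular \<sigma> x}\<close> alike.\<close>

locale field_subring = comm_subring S for S :: "'a::field set"
begin

lemma inverse_prod_mem: "(\<And>x. x \<in> A \<Longrightarrow> inverse (f x) \<in> S) \<Longrightarrow> inverse (prod f A) \<in> S"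
  by (auto simp: prod_inversef[symmetric])

lemma inverse_mult_mem: "inverse x \<in> S \<Longrightarrow> inverse y \<in> S \<Longrightarrow> inverse (x * y) \<in> S"
  by auto

lemma divide_mem: "x \<in> S \<Longrightarrow> inverse y \<in> S \<Longrightarrow> x / y \<in> S"
  by (auto simp: divide_inverse)

end

lemma field_subring_regular: "field_subring {x. regular \<sigma> x}"
  by standard auto

text \<open>Localization at the monoid generated by D. The list records multiplicities and lets the
  factors of a denominator be cancelled one at a time.\<close>

definition loc :: "var set \<Rightarrow> cpoly set \<Rightarrow> ratf set" where
  "loc V D = {Fract f (prod_list ls) | f ls. f \<in> polys V \<and> set ls \<subseteq> D}"

lemma prod_list_nonzero: "0 \<notin> D \<Longrightarrow> set ls \<subseteq> D \<Longrightarrow> prod_list ls \<noteq> (0::cpoly)"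
  by (auto simp: prod_list_zero_iff)

lemma locI: "f \<in> polys V \<Longrightarrow> set ls \<subseteq> D \<Longrightarrow> Fract f (prod_list ls) \<in> loc V D"
  by (auto simp: loc_def)

lemma loc_subring:
  assumes "D \<subseteq> polys V" "0 \<notin> D"
  shows "field_subring (loc V D)"
proof
  show "1 \<in> loc V D"
    using locI[of 1 V "[]" D] by (simp add: One_fract_def)
next
  fix x y assume "x \<in> loc V D" "y \<in> loc V D"
  then obtain f g ls ms where *: "x = Fract f (prod_list ls)" "y = Fract g (prod_list ms)"
    "f \<in> polys V" "g \<in> polys V" "set ls \<subseteq> D" "set ms \<subseteq> D"
    by (auto simp: loc_def)
  note nz = prod_list_nonzero[OF assms(2) *(5)] prod_list_nonzero[OF assms(2) *(6)]
  have "x * y = Fract (f * g) (prod_list (ls @ ms))"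
    using * by simp
  moreover have "Fract (f * g) (prod_list (ls @ ms)) \<in> loc V D"
    using * by (intro locI) auto
  ultimately show "x * y \<in> loc V D" by (simp only:)
  have pl: "prod_list ms \<in> polys V" "prod_list ls \<in> polys V"
    using * assms(1) by (auto intro!: polys_prod_list)
  have "x - y = Fract (f * prod_list ms - g * prod_list ls) (prod_list (ls @ ms))"
    using * nz by (simp add: diff_fract)
  moreover have "Fract (f * prod_list ms - g * prod_list ls) (prod_list (ls @ ms)) \<in> loc V D"
    using * pl by (intro locI) auto
  ultimately show "x - y \<in> loc V D" by (simp only:)
qed

lemma to_fract_in_loc: "p \<in> polys V \<Longrightarrow> to_fract p \<in> loc V D"
  using locI[of p V "[]" D] by (simp add: to_fract_def)

lemma inverse_in_loc: "d \<in> D \<Longrightarrow> inverse (to_fract d) \<in> loc V D"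
  using locI[of 1 V "[d]" D] by (simp add: to_fract_def)

lemma loc_mono: "V \<subseteq> V' \<Longrightarrow> D \<subseteq> D' \<Longrightarrow> loc V D \<subseteq> loc V' D'"
  unfolding loc_def using polys_mono by blast

lemma rsub_loc:
  assumes "x \<in> loc V D" "\<And>v. v \<in> V \<Longrightarrow> \<sigma> v \<in> polys V'" "\<And>d. d \<in> D \<Longrightarrow> psubst \<sigma> d \<in> D'" "0 \<notin> D'"
  shows "regular \<sigma> x" "rsub \<sigma> x \<in> loc V' D'"
proof -
  obtain f ls where *: "x = Fract f (prod_list ls)" "f \<in> polys V" "set ls \<subseteq> D"
    using assms(1) by (auto simp: loc_def)
  have D: "set (map (psubst \<sigma>) ls) \<subseteq> D'" using *(3) assms(3) by auto
  have nz: "psubst \<sigma> (prod_list ls) \<noteq> 0"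
    using prod_list_nonzero[OF assms(4) D] by simp
  then show "regular \<sigma> x" using * by (simp add: regular_Fract)
  have "rsub \<sigma> x = Fract (psubst \<sigma> f) (prod_list (map (psubst \<sigma>) ls))"
    using nz * by (simp add: rsub_Fract)
  with locI[OF polys_psubst[OF *(2) assms(2)] D] show "rsub \<sigma> x \<in> loc V' D'"
    by simp
qed

text \<open>Comparing the given fraction with one whose denominator survives v := q, and
  substituting v := q in the cross-multiplied identity, shows that the numerator vanishes there. By
  the factor theorem it is divisible by e = v - q, so this factor of the denominator
  cancels.\<close>

lemma loc_cancel:
  assumes x: "x \<in> loc V (D \<union> E)" and D: "D \<subseteq> polys V" "E \<subseteq> polys V" "0 \<notin> D" "0 \<notin> E"
    and E: "\<And>e. e \<in> E \<Longrightarrow> \<exists>v q. e = Var v - q \<and> psubst (Var(v := q)) e = 0 \<and> regular (Var(v := q)) x"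
  shows "x \<in> loc V D"
proof -
  \<comment> \<open>Here \<open>ls\<close> holds the factors of the denominator still to be
    examined, \<open>ds\<close> those already known to lie in D.\<close>
  have main: "x \<in> loc V D"
    if "x = Fract f (prod_list ds * prod_list ls)" "f \<in> polys V" "set ds \<subseteq> D" "set ls \<subseteq> D \<union> E"
    for f ds ls
    using that
  proof (induction ls arbitrary: f ds)
    case Nil
    then show ?case by (simp add: locI)
  next
    case (Cons e ls)
    show ?case
    proof (cases "e \<in> D")
      case True
      show ?thesis
        by (rule Cons.IH[of f "e # ds"]) (use Cons.prems True in \<open>auto simp: mult_ac\<close>)
    next
      case False
      with Cons.prems have e: "e \<in> E" by auto
      then obtain v q where vq: "e = Var v - q" "psubst (Var(v := q)) e = 0" "regular (Var(v := q)) x"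
        using E by blast
      let ?\<sigma> = "Var(v := q)"
      obtain c d where cd: "x = Fract c d" "psubst ?\<sigma> d \<noteq> 0" "d \<noteq> 0"
        using vq(3) by (rule regular_cases) blast
      have nz: "prod_list ds \<noteq> 0" "prod_list ls \<noteq> 0" "e \<noteq> 0"
        using prod_list_nonzero[of D ds] prod_list_nonzero[of "D \<union> E" ls] Cons.prems D e by auto
      have "f * d = c * (prod_list ds * (e * prod_list ls))"
        using Cons.prems(1) cd nz by (simp add: eq_fract)
      from arg_cong[OF this, of "psubst ?\<sigma>"] have "psubst ?\<sigma> f * psubst ?\<sigma> d = 0"
        by (simp only: psubst_mult vq(2) mult_zero_left mult_zero_right)
      with cd(2) have "psubst ?\<sigma> f = 0"
        by (metis mult_eq_0_iff)
      then have "e dvd f" unfolding vq(1) by (rule dvd_if_psubst_0)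
      then obtain f' where f': "f = e * f'" by (elim dvdE)
      have "f' \<in> polys V"
        using polys_dvd_cofactor[of e f' V] Cons.prems(2) f' e D nz by auto
      moreover have "x = Fract f' (prod_list ds * prod_list ls)"
        using Cons.prems(1) f' nz by (simp add: eq_fract mult_ac)
      ultimately show ?thesis using Cons.IH[of f' ds] Cons.prems by auto
    qed
  qed
  obtain f ls where "x = Fract f (prod_list ls)" "f \<in> polys V" "set ls \<subseteq> D \<union> E"
    using x by (auto simp: loc_def)
  then show ?thesis using main[of f "[]" ls] by simp
qed

section \<open>The denominators that occur and the rings they define\<close>

definition lam_forms :: "cpoly set" where
  "lam_forms = {Var Lam + of_int l * Var Y | l. True}"

definition zdiffs :: "nat \<Rightarrow> cpoly set" where
  "zdiffs n = {Var (Z a) - Var (Z b) | a b. a \<in> {1..n} \<and> b \<in> {1..n} \<and> a \<noteq> b}"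

text \<open>The form z_a - z_b + y is bracketed as v - q, the shape to which the factor theorem
  applies with v = z_a.\<close>

definition zydiffs :: "nat \<Rightarrow> cpoly set" where
  "zydiffs n = {Var (Z a) - (Var (Z b) - Var Y) | a b. a \<in> {1..n} \<and> b \<in> {1..n} \<and> a \<noteq> b}"

abbreviation Vlzy :: "nat \<Rightarrow> var set" where
  "Vlzy n \<equiv> insert Lam (Vzy n)"

text \<open>Polynomials in $\boldsymbol z$ over $\mathcal L_{\lambda,y}[y^{-1}]$, and the ring in which the
  stable envelopes and their inverses have their matrix entries.\<close>

definition Pol :: "nat \<Rightarrow> ratf set" where
  "Pol n = loc (Vlzy n) (insert (Var Y) lam_forms)"

definition Sfull :: "nat \<Rightarrow> ratf set" where
  "Sfull n = loc (Vlzy n) (insert (Var Y) lam_forms \<union> (zdiffs n \<union> zydiffs n))"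

lemma Var_nonzero [simp]: "Var v \<noteq> 0"
  using psubst_Var[of "\<lambda>_. 1" v] by (metis psubst_0 one_neq_zero)

lemma Var_eq_iff [simp]: "Var v = Var v' \<longleftrightarrow> v = v'"
proof
  assume *: "Var v = Var v'"
  show "v = v'"
  proof (rule ccontr)
    assume "v \<noteq> v'"
    with arg_cong[OF *, of "psubst (Var(v := 0))"] show False by simp
  qed
qed simp

lemma lam_form_nonzero: "Var Lam + of_int l * Var Y \<noteq> 0"
  by (rule psubst_nonzero_imp[of "Var(Y := 0)"]) simp

lemma zydiff_nonzero: "Var (Z a) - (Var (Z b) - Var Y) \<noteq> 0" "0 \<noteq> Var (Z a) - (Var (Z b) - Var Y)"
proof -
  show "Var (Z a) - (Var (Z b) - Var Y) \<noteq> 0"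
    by (rule psubst_nonzero_imp[of "\<lambda>v. if v = Y then 1 else 0"]) simp
  then show "0 \<noteq> Var (Z a) - (Var (Z b) - Var Y)" by metis
qed

lemma forms_nonzero: "0 \<notin> insert (Var Y) lam_forms" "0 \<notin> zdiffs n \<union> zydiffs n"
  using zydiff_nonzero(2) lam_form_nonzero[symmetric] Var_nonzero[symmetric]
  by (fastforce simp: lam_forms_def zdiffs_def zydiffs_def)+

lemma forms_polys: "insert (Var Y) lam_forms \<subseteq> polys (Vlzy n)" "zdiffs n \<union> zydiffs n \<subseteq> polys (Vlzy n)"
  by (auto simp: lam_forms_def zdiffs_def zydiffs_def Vzy_def intro!: polys_add polys_mult polys_diff polys_Var)

lemma Pol_subring: "field_subring (Pol n)"
  unfolding Pol_def using forms_nonzero forms_polys by (intro loc_subring) auto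

lemma Sfull_subring: "field_subring (Sfull n)"
  unfolding Sfull_def using forms_nonzero forms_polys by (intro loc_subring) auto

lemma Pol_le_Sfull: "Pol n \<subseteq> Sfull n"
  unfolding Pol_def Sfull_def by (rule loc_mono) auto

lemma Pol_if_regular:
  assumes "x \<in> Sfull n"
    and "\<And>a b. a \<in> {1..n} \<Longrightarrow> b \<in> {1..n} \<Longrightarrow> a \<noteq> b \<Longrightarrow> regular (Var(Z a := Var (Z b))) x"
    and "\<And>a b. a \<in> {1..n} \<Longrightarrow> b \<in> {1..n} \<Longrightarrow> a \<noteq> b \<Longrightarrow> regular (Var(Z a := Var (Z b) - Var Y)) x"
  shows "x \<in> Pol n"
  unfolding Pol_def
proof (rule loc_cancel)
  show "x \<in> loc (Vlzy n) (insert (Var Y) lam_forms \<union> (zdiffs n \<union> zydiffs n))"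
    using assms(1) by (simp add: Sfull_def)
  fix e assume "e \<in> zdiffs n \<union> zydiffs n"
  then consider a b where "a \<in> {1..n}" "b \<in> {1..n}" "a \<noteq> b" "e = Var (Z a) - Var (Z b)"
    | a b where "a \<in> {1..n}" "b \<in> {1..n}" "a \<noteq> b" "e = Var (Z a) - (Var (Z b) - Var Y)"
    by (auto simp: zdiffs_def zydiffs_def)
  then show "\<exists>v q. e = Var v - q \<and> psubst (Var(v := q)) e = 0 \<and> regular (Var(v := q)) x"
  proof cases
    case 1
    with assms(2)[of a b] show ?thesis
      by (intro exI[of _ "Z a"] exI[of _ "Var (Z b)"]) auto
  next
    case 2
    with assms(3)[of a b] show ?thesis
      by (intro exI[of _ "Z a"] exI[of _ "Var (Z b) - Var Y"]) auto
  qed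
qed (use forms_polys forms_nonzero in blast)+

lemma L_lam_y_loc: "L_lam_y = loc {Lam, Y} lam_forms"
proof -
  have "\<exists>ks. prod_list ls = (\<Prod>l\<leftarrow>ks. Var Lam + of_int l * Var Y)" if "set ls \<subseteq> lam_forms" for ls
    using that
  proof (induction ls)
    case (Cons a ls)
    then obtain ks l where "prod_list ls = (\<Prod>l\<leftarrow>ks. Var Lam + of_int l * Var Y)"
      "a = Var Lam + of_int l * Var Y" by (auto simp: lam_forms_def)
    then show ?case by (intro exI[of _ "l # ks"]) simp
  qed (auto intro: exI[of _ "[]"])
  note 1 = this
  have 2: "set (map (\<lambda>l. Var Lam + of_int l * Var Y) ks) \<subseteq> lam_forms" for ks
    by (auto simp: lam_forms_def)
  show ?thesis
  proof (intro equalityI subsetI)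
    fix x assume "x \<in> L_lam_y"
    then obtain f ks where "x = Fract f (\<Prod>l\<leftarrow>ks. Var Lam + of_int l * Var Y)" "f \<in> polys {Lam, Y}"
      unfolding L_lam_y_def by blast
    with locI[OF this(2) 2[of ks]] show "x \<in> loc {Lam, Y} lam_forms" by simp
  next
    fix x assume "x \<in> loc {Lam, Y} lam_forms"
    then obtain f ls where *: "x = Fract f (prod_list ls)" "f \<in> polys {Lam, Y}" "set ls \<subseteq> lam_forms"
      unfolding loc_def by blast
    from 1[OF *(3)] *(1,2) show "x \<in> L_lam_y"
      unfolding L_lam_y_def by force
  qed
qed

lemma L_lam_zy_loc: "L_lam_zy n = loc (Vlzy n) (lam_forms \<union> (polys (Vzy n) - {0}))" (is "_ = ?R")
proof (intro equalityI subsetI)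
  fix x assume "x \<in> L_lam_zy n"
  then obtain f g ls where *: "x = Fract f (g * (\<Prod>l\<leftarrow>ls. Var Lam + of_int l * Var Y))"
    "f \<in> polys (Vlzy n)" "g \<in> polys (Vzy n)" "g \<noteq> 0" by (auto simp: L_lam_zy_def)
  have "set (g # map (\<lambda>l. Var Lam + of_int l * Var Y) ls) \<subseteq> lam_forms \<union> (polys (Vzy n) - {0})"
    using * by (auto simp: lam_forms_def)
  from locI[OF *(2) this] show "x \<in> ?R" using * by simp
next
  fix x assume "x \<in> ?R"
  then obtain f ls where *: "x = Fract f (prod_list ls)" "f \<in> polys (Vlzy n)"
    "set ls \<subseteq> lam_forms \<union> (polys (Vzy n) - {0})" by (auto simp: loc_def)
  have "\<exists>g ks. prod_list ls = g * (\<Prod>l\<leftarrow>ks. Var Lam + of_int l * Var Y) \<and> g \<in> polys (Vzy n) \<and> g \<noteq> 0"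
    using *(3)
  proof (induction ls)
    case Nil
    show ?case by (intro exI[of _ 1] exI[of _ "[]"]) auto
  next
    case (Cons a ls)
    then obtain g ks where IH: "prod_list ls = g * (\<Prod>l\<leftarrow>ks. Var Lam + of_int l * Var Y)"
      "g \<in> polys (Vzy n)" "g \<noteq> 0" by auto
    consider l where "a = Var Lam + of_int l * Var Y" | "a \<in> polys (Vzy n)" "a \<noteq> 0"
      using Cons.prems by (auto simp: lam_forms_def)
    then show ?case
    proof cases
      case 1
      with IH show ?thesis by (intro exI[of _ g] exI[of _ "l # ks"]) (simp add: mult_ac)
    next
      case 2
      with IH show ?thesis by (intro exI[of _ "a * g"] exI[of _ ks]) (auto simp: mult_ac)
    qed
  qed
  with *(1,2) show "x \<in> L_lam_zy n" unfolding L_lam_zy_def by force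
qed

lemma L_lam_zy_forms: "lam_forms \<union> (polys (Vzy n) - {0}) \<subseteq> polys (Vlzy n)" "0 \<notin> lam_forms \<union> (polys (Vzy n) - {0})"
  using forms_polys[of n] forms_nonzero polys_mono[of "Vzy n" "Vlzy n"] by auto

lemma L_lam_zy_subring: "field_subring (L_lam_zy n)"
  unfolding L_lam_zy_loc using L_lam_zy_forms by (rule loc_subring)

lemma L_lam_y_subring: "field_subring L_lam_y"
  unfolding L_lam_y_loc using forms_nonzero
  by (intro loc_subring) (auto simp: lam_forms_def intro!: polys_Var polys_add polys_mult)

lemma Sfull_le_L: "Sfull n \<subseteq> L_lam_zy n"
proof -
  have "zdiffs n \<union> zydiffs n \<subseteq> polys (Vzy n)"
    by (auto simp: zdiffs_def zydiffs_def Vzy_def intro!: polys_add polys_diff polys_Var)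
  then show ?thesis
    unfolding Sfull_def L_lam_zy_loc using forms_nonzero(2)[of n]
    by (intro loc_mono) (auto simp: Vzy_def intro!: polys_Var)
qed

lemma Pol_le_L: "Pol n \<subseteq> L_lam_zy n"
  using Pol_le_Sfull Sfull_le_L by blast

lemma L_lam_y_le_Pol: "L_lam_y \<subseteq> Pol n"
  unfolding L_lam_y_loc Pol_def by (rule loc_mono) (auto simp: Vzy_def)

lemma Laurent_y_le_Pol: "Laurent_y \<subseteq> Pol n"
proof
  fix x assume "x \<in> Laurent_y"
  then obtain q m where *: "x = Fract q (Var Y ^ m)" "q \<in> polys {Y}" by (auto simp: Laurent_y_def)
  have "q \<in> polys (Vlzy n)" using *(2) polys_mono[of "{Y}" "Vlzy n"] by (auto simp: Vzy_def)
  moreover have "set (replicate m (Var Y)) \<subseteq> insert (Var Y) lam_forms" by auto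
  ultimately have "Fract q (prod_list (replicate m (Var Y))) \<in> Pol n"
    unfolding Pol_def by (rule locI)
  then show "x \<in> Pol n" using *(1) by simp
qed

section \<open>Permutations of the equivariant parameters\<close>

abbreviation zsub :: "(nat \<Rightarrow> nat) \<Rightarrow> cpoly \<Rightarrow> cpoly" where
  "zsub \<tau> \<equiv> psubst (permute_vars id id \<tau>)"

abbreviation rs :: "(nat \<Rightarrow> nat) \<Rightarrow> ratf \<Rightarrow> ratf" where
  "rs \<tau> \<equiv> rsub (permute_vars id id \<tau>)"

lemma psubst_permute_vars_comp:
  "psubst (permute_vars \<pi> \<rho> \<tau>) (psubst (permute_vars \<pi>' \<rho>' \<tau>') p) =
    psubst (permute_vars (\<pi> \<circ> \<pi>') (\<rho> \<circ> \<rho>') (\<tau> \<circ> \<tau>')) p"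
proof -
  have "psubst (permute_vars \<pi> \<rho> \<tau>) (permute_vars \<pi>' \<rho>' \<tau>' v) = permute_vars (\<pi> \<circ> \<pi>') (\<rho> \<circ> \<rho>') (\<tau> \<circ> \<tau>') v" for v
    by (cases v) auto
  then show ?thesis by (simp add: psubst_psubst)
qed

lemma permute_vars_id [simp]: "permute_vars id id id = Var"
proof
  fix v show "permute_vars id id id v = Var v" by (cases v) auto
qed

lemma zsub_nonzero:
  assumes "bij \<tau>" "p \<noteq> 0" shows "zsub \<tau> p \<noteq> 0"
proof
  assume "zsub \<tau> p = 0"
  then have "zsub (inv_into UNIV \<tau>) (zsub \<tau> p) = 0" by simp
  then show False using assms by (simp add: psubst_permute_vars_comp bij_is_inj)
qed

text \<open>A permutation of the parameters is an invertible substitution and kills no denominator,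
  so \<open>rs \<tau>\<close> is defined everywhere and is a field automorphism.\<close>

lemma rs_regular [simp]:
  assumes "bij \<tau>" shows "regular (permute_vars id id \<tau>) x"
proof -
  obtain a b where "x = Fract a b" "b \<noteq> 0" by (cases x) auto
  then show ?thesis using zsub_nonzero[OF assms] by (auto intro: regular_Fract)
qed

lemma rs_eq_0_iff [simp]:
  assumes "bij \<tau>" shows "rs \<tau> x = 0 \<longleftrightarrow> x = 0"
proof -
  obtain a b where x: "x = Fract a b" "b \<noteq> 0" by (cases x) auto
  then have "zsub \<tau> b \<noteq> 0" using zsub_nonzero[OF assms] by auto
  then show ?thesis using x zsub_nonzero[OF assms, of a] by (auto simp: rsub_Fract Zero_fract_def eq_fract)
qed

lemma rs_inverse [simp]:
  assumes "bij \<tau>" shows "rs \<tau> (inverse x) = inverse (rs \<tau> x)"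
proof (cases "x = 0")
  case False
  then show ?thesis using rsub_inverse[OF rs_regular[OF assms]] assms by simp
qed simp

lemma rs_rs: 
  assumes "bij \<tau>" "bij \<rho>" shows "rs \<rho> (rs \<tau> x) = rs (\<rho> \<circ> \<tau>) x"
proof -
  obtain a b where x: "x = Fract a b" "b \<noteq> 0" by (cases x) auto
  then have "zsub \<tau> b \<noteq> 0" "zsub \<rho> (zsub \<tau> b) \<noteq> 0" "zsub (\<rho> \<circ> \<tau>) b \<noteq> 0"
    using zsub_nonzero assms bij_comp by blast+
  then show ?thesis using x by (simp add: rsub_Fract psubst_permute_vars_comp)
qed

lemma rs_id [simp]: "rs id x = x"
proof -
  obtain a b where x: "x = Fract a b" "b \<noteq> 0" by (cases x) auto
  then show ?thesis by (simp add: rsub_Fract)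
qed

text \<open>The transposition carries the hyperplane z_i = z_a - y to z_a = z_i - y. This is how the
  half i < a of the hyperplanes controls the half i > a.\<close>

lemma regular_transpose:
  assumes "regular (Var(Z i := Var (Z a) - Var Y)) x" "i \<noteq> a"
  shows "regular (Var(Z a := Var (Z i) - Var Y)) (rs (transpose i a) x)"
proof -
  let ?\<tau> = "transpose i a"
  let ?s = "Var(Z i := Var (Z a) - Var Y)" and ?s' = "Var(Z a := Var (Z i) - Var Y)"
  obtain p q where x: "x = Fract p q" "psubst ?s q \<noteq> 0" "q \<noteq> 0" using assms(1) by (rule regular_cases) blast
  have eq: "psubst ?s' (permute_vars id id ?\<tau> v) = zsub ?\<tau> (?s v)" for v
    using assms(2) by (cases v) (auto simp: transpose_def)
  have "psubst ?s' (zsub ?\<tau> q) = zsub ?\<tau> (psubst ?s q)"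
    unfolding psubst_psubst eq ..
  also have "\<dots> \<noteq> 0" using x(2) zsub_nonzero[of ?\<tau>] by simp
  finally show ?thesis
    using x zsub_nonzero[of ?\<tau> q] by (simp add: rsub_Fract regular_Fract)
qed


section \<open>Extension of scalars\<close>

text \<open>The last two assumptions are what makes multiplication in the right factor carry
  relations to relations; the others keep the generators of the relations inside the free
  group.\<close>

locale tensor_setup =
  fixes R :: "'r ring" and M :: "('r, 'm) module" and S :: "('r, 's) module"
  assumes M_add: "a \<in> carrier M \<Longrightarrow> b \<in> carrier M \<Longrightarrow> a \<oplus>\<^bsub>M\<^esub> b \<in> carrier M"
    and M_smult: "r \<in> carrier R \<Longrightarrow> a \<in> carrier M \<Longrightarrow> r \<odot>\<^bsub>M\<^esub> a \<in> carrier M"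
    and S_add: "x \<in> carrier S \<Longrightarrow> x' \<in> carrier S \<Longrightarrow> x \<oplus>\<^bsub>S\<^esub> x' \<in> carrier S"
    and S_smult: "r \<in> carrier R \<Longrightarrow> x \<in> carrier S \<Longrightarrow> r \<odot>\<^bsub>S\<^esub> x \<in> carrier S"
    and S_mult: "c \<in> carrier S \<Longrightarrow> x \<in> carrier S \<Longrightarrow> c \<otimes>\<^bsub>S\<^esub> x \<in> carrier S"
    and S_distrib: "c \<in> carrier S \<Longrightarrow> x \<in> carrier S \<Longrightarrow> x' \<in> carrier S \<Longrightarrow>
      c \<otimes>\<^bsub>S\<^esub> (x \<oplus>\<^bsub>S\<^esub> x') = c \<otimes>\<^bsub>S\<^esub> x \<oplus>\<^bsub>S\<^esub> c \<otimes>\<^bsub>S\<^esub> x'"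
    and S_assoc: "c \<in> carrier S \<Longrightarrow> r \<in> carrier R \<Longrightarrow> x \<in> carrier S \<Longrightarrow>
      c \<otimes>\<^bsub>S\<^esub> (r \<odot>\<^bsub>S\<^esub> x) = r \<odot>\<^bsub>S\<^esub> (c \<otimes>\<^bsub>S\<^esub> x)"
begin

abbreviation "rels \<equiv> tensor_rels R M S"
abbreviation "sub \<equiv> tensor_sub R M S"
abbreviation "T \<equiv> tensor R M S"

definition frags :: "('m \<times> 's \<Rightarrow>\<^sub>0 int) set" where
  "frags = {u. Poly_Mapping.keys u \<subseteq> carrier M \<times> carrier S}"

lemma frags_carrier: "carrier (tensor_free M S) = frags"
  by (auto simp: tensor_free_def frags_def)

lemma frags_add [intro]: "u \<in> frags \<Longrightarrow> v \<in> frags \<Longrightarrow> u + v \<in> frags"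
  by (auto simp: frags_def dest!: subsetD[OF Poly_Mapping.keys_add])

lemma frags_0 [intro, simp]: "0 \<in> frags"
  by (simp add: frags_def)

lemma frags_uminus [intro]: "u \<in> frags \<Longrightarrow> - u \<in> frags"
  by (simp add: frags_def)

lemma frags_diff [intro]: "u \<in> frags \<Longrightarrow> v \<in> frags \<Longrightarrow> u - v \<in> frags"
  using frags_add[OF _ frags_uminus] by fastforce

lemma frags_of [intro]: "a \<in> carrier M \<Longrightarrow> x \<in> carrier S \<Longrightarrow> frag_of (a, x) \<in> frags"
  by (simp add: frags_def)

lemma frags_induct [consumes 1, case_names zero diff of]:
  assumes "u \<in> frags" "P 0" "\<And>u v. u \<in> frags \<Longrightarrow> v \<in> frags \<Longrightarrow> P u \<Longrightarrow> P v \<Longrightarrow> P (u - v)"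
    "\<And>a x. a \<in> carrier M \<Longrightarrow> x \<in> carrier S \<Longrightarrow> P (frag_of (a, x))"
  shows "P u"
  by (rule free_Abelian_group_induct[of u "carrier M \<times> carrier S" P])
    (use assms in \<open>auto simp: frags_def\<close>)

lemma rels_frags: "rels \<subseteq> frags"
  unfolding tensor_rels_def by (auto intro!: frags_diff frags_of M_add M_smult S_add S_smult)

lemma sub_subgroup: "subgroup sub (tensor_free M S)"
  unfolding tensor_sub_def
proof (rule group.generate_is_subgroup)
  show "group (tensor_free M S)" by (simp add: tensor_free_def)
  show "rels \<subseteq> carrier (tensor_free M S)" using rels_frags by (simp add: frags_carrier)
qed

lemma sub_frags: "sub \<subseteq> frags"
  using subgroup.subset[OF sub_subgroup] by (simp add: frags_carrier)

lemma sub_0 [simp, intro]: "0 \<in> sub"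
  using subgroup.one_closed[OF sub_subgroup] by (simp add: tensor_free_def)

lemma sub_add [intro]: "u \<in> sub \<Longrightarrow> v \<in> sub \<Longrightarrow> u + v \<in> sub"
  using subgroup.m_closed[OF sub_subgroup] by (simp add: tensor_free_def)

lemma sub_uminus [intro]: "u \<in> sub \<Longrightarrow> - u \<in> sub"
  using subgroup.m_inv_closed[OF sub_subgroup, of u] sub_frags
  by (auto simp: tensor_free_def frags_def)

lemma sub_diff [intro]: "u \<in> sub \<Longrightarrow> v \<in> sub \<Longrightarrow> u - v \<in> sub"
  using sub_add[OF _ sub_uminus] by fastforce

lemma rels_sub: "u \<in> rels \<Longrightarrow> u \<in> sub"
  unfolding tensor_sub_def by (rule generate.incl)

lemma sub_induct [consumes 1, case_names zero rels diff]:
  assumes "u \<in> sub" "P 0" "\<And>u. u \<in> rels \<Longrightarrow> P u" "\<And>u v. P u \<Longrightarrow> P v \<Longrightarrow> P (u - v)"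
  shows "P u"
  using assms(1) unfolding tensor_sub_def
proof (induction rule: generate.induct)
  case one
  then show ?case using assms(2) by (simp add: tensor_free_def)
next
  case (incl h)
  then show ?case by (rule assms(3))
next
  case (inv h)
  then have "inv\<^bsub>tensor_free M S\<^esub> h = 0 - h"
    using rels_frags by (auto simp: tensor_free_def frags_def)
  then show ?case using assms(2) assms(3)[OF inv] assms(4) by metis
next
  case (eng g h)
  have "g \<otimes>\<^bsub>tensor_free M S\<^esub> h = g - (0 - h)"
    by (simp add: tensor_free_def)
  then show ?case using eng assms(2,4) by metis
qed

definition cls :: "('m \<times> 's \<Rightarrow>\<^sub>0 int) \<Rightarrow> ('m \<times> 's \<Rightarrow>\<^sub>0 int) set" where
  "cls u = {v. v - u \<in> sub}"

lemma cls_coset: "sub #>\<^bsub>tensor_free M S\<^esub> u = cls u"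
  unfolding r_coset_def cls_def tensor_free_def by (auto; metis add_diff_cancel_right' diff_add_cancel)

lemma cls_self: "u \<in> cls u"
  by (simp add: cls_def)

lemma cls_eq_iff: "cls u = cls v \<longleftrightarrow> u - v \<in> sub"
proof
  show "u - v \<in> sub" if "cls u = cls v"
  proof -
    have "u \<in> cls v" using cls_self[of u] that by simp
    then show ?thesis by (simp add: cls_def)
  qed
  show "cls u = cls v" if uv: "u - v \<in> sub"
  proof (rule Set.set_eqI)
    fix x
    have "x - u \<in> sub \<longleftrightarrow> x - v \<in> sub"
      using sub_add[OF _ uv, of "x - u"] sub_diff[OF _ uv, of "x - v"] by auto
    then show "x \<in> cls u \<longleftrightarrow> x \<in> cls v" by (simp add: cls_def)
  qed
qed

lemma carrier_T: "carrier T = cls ` frags"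
  by (auto simp: tensor_def Let_def FactGroup_def RCOSETS_def frags_carrier cls_coset)

lemma zero_T: "\<zero>\<^bsub>T\<^esub> = cls 0"
  by (auto simp: tensor_def Let_def FactGroup_def cls_def)

lemma add_T: "cls u \<oplus>\<^bsub>T\<^esub> cls v = cls (u + v)"
proof -
  have "cls u <#>\<^bsub>tensor_free M S\<^esub> cls v = cls (u + v)"
  proof (intro equalityI subsetI)
    fix x assume "x \<in> cls u <#>\<^bsub>tensor_free M S\<^esub> cls v"
    then obtain a b where "x = a + b" "a - u \<in> sub" "b - v \<in> sub"
      by (auto simp: set_mult_def tensor_free_def cls_def)
    then show "x \<in> cls (u + v)" using sub_add[of "a - u" "b - v"] by (simp add: cls_def algebra_simps)
  next
    fix x assume "x \<in> cls (u + v)"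
    then have "x - v \<in> cls u" by (simp add: cls_def algebra_simps)
    then show "x \<in> cls u <#>\<^bsub>tensor_free M S\<^esub> cls v"
      using cls_self[of v] by (force simp: set_mult_def tensor_free_def)
  qed
  then show ?thesis by (simp add: tensor_def Let_def FactGroup_def)
qed

definition scale :: "'s \<Rightarrow> ('m \<times> 's \<Rightarrow>\<^sub>0 int) \<Rightarrow> ('m \<times> 's \<Rightarrow>\<^sub>0 int)" where
  "scale c = frag_extend (\<lambda>(a, x). frag_of (a, c \<otimes>\<^bsub>S\<^esub> x))"

lemma scale_simps [simp]: "scale c 0 = 0" "scale c (u + v) = scale c u + scale c v"
  "scale c (u - v) = scale c u - scale c v" "scale c (frag_of (a, x)) = frag_of (a, c \<otimes>\<^bsub>S\<^esub> x)"
  by (simp_all add: scale_def frag_extend_add frag_extend_diff)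

lemma scale_sub:
  assumes c: "c \<in> carrier S" and u: "u \<in> sub"
  shows "scale c u \<in> sub"
  using u
proof (induction rule: sub_induct)
  case (rels u)
  then have "scale c u \<in> rels"
    unfolding tensor_rels_def using c
    by (auto simp: S_distrib S_assoc; use S_mult in blast)
  then show ?case by (rule rels_sub)
qed auto

lemma scale_frags:
  assumes "c \<in> carrier S" "u \<in> frags" shows "scale c u \<in> frags"
  using assms(2) by (induction rule: frags_induct) (use assms(1) in \<open>auto intro: S_mult\<close>)

text \<open>The union over representatives in the definition of \<open>tensor\<close> is a union of
  equal cosets, because scaling preserves the relations.\<close>

lemma smult_T:
  assumes "c \<in> carrier S" shows "c \<odot>\<^bsub>T\<^esub> cls u = cls (scale c u)"
proof -
  have "c \<odot>\<^bsub>T\<^esub> cls u = (\<Union>v\<in>cls u. cls (scale c v))"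
    by (simp add: tensor_def Let_def cls_coset scale_def)
  moreover have "cls (scale c v) = cls (scale c u)" if "v \<in> cls u" for v
    using that scale_sub[OF assms] unfolding cls_eq_iff by (fastforce simp: cls_def)
  then have "(\<Union>v\<in>cls u. cls (scale c v)) = (\<Union>v\<in>cls u. cls (scale c u))"
    by (intro SUP_cong) auto
  moreover have "\<dots> = cls (scale c u)" using cls_self[of u] by (intro UN_constant[THEN HOL.trans]) auto
  ultimately show ?thesis by (simp only:)
qed

lemma pure_T: "pure_tensor R M S a x = cls (frag_of (a, x))"
  by (simp add: pure_tensor_def cls_coset)

lemma abelian_group_T: "abelian_group T"
proof (rule abelian_groupI)
  fix X assume "X \<in> carrier T"
  then obtain u where u: "u \<in> frags" "X = cls u" by (auto simp: carrier_T)
  show "\<exists>Y\<in>carrier T. Y \<oplus>\<^bsub>T\<^esub> X = \<zero>\<^bsub>T\<^esub>"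
    using u by (intro bexI[of _ "cls (- u)"]) (auto simp: carrier_T add_T zero_T)
qed (auto simp: carrier_T add_T zero_T add_ac)

lemma inv_T_cls: "u \<in> frags \<Longrightarrow> inv\<^bsub>add_monoid T\<^esub> cls u = cls (- u)"
  using abelian_group.minus_equality[OF abelian_group_T, of "cls (-u)" "cls u"]
  by (auto simp: carrier_T add_T zero_T a_inv_def)

lemma pure_add_left: "a \<in> carrier M \<Longrightarrow> b \<in> carrier M \<Longrightarrow> x \<in> carrier S \<Longrightarrow>
    cls (frag_of (a \<oplus>\<^bsub>M\<^esub> b, x)) = cls (frag_of (a, x) + frag_of (b, x))"
  unfolding cls_eq_iff diff_diff_eq[symmetric] by (rule rels_sub) (auto simp: tensor_rels_def)

lemma pure_add_right: "a \<in> carrier M \<Longrightarrow> x \<in> carrier S \<Longrightarrow> x' \<in> carrier S \<Longrightarrow>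
    cls (frag_of (a, x \<oplus>\<^bsub>S\<^esub> x')) = cls (frag_of (a, x) + frag_of (a, x'))"
  unfolding cls_eq_iff diff_diff_eq[symmetric] by (rule rels_sub) (auto simp: tensor_rels_def)

lemma pure_smult: "r \<in> carrier R \<Longrightarrow> a \<in> carrier M \<Longrightarrow> x \<in> carrier S \<Longrightarrow>
    cls (frag_of (r \<odot>\<^bsub>M\<^esub> a, x)) = cls (frag_of (a, r \<odot>\<^bsub>S\<^esub> x))"
  unfolding cls_eq_iff by (rule rels_sub) (auto simp: tensor_rels_def)

lemma cls_cong_add: "cls u = cls u' \<Longrightarrow> cls v = cls v' \<Longrightarrow> cls (u + v) = cls (u' + v')"
  using add_T by metis

lemma cls_cong_diff: "cls u = cls u' \<Longrightarrow> cls v = cls v' \<Longrightarrow> cls (u - v) = cls (u' - v')"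
  unfolding cls_eq_iff using sub_diff[of "u - u'" "v - v'"] by (simp add: algebra_simps)

end


section \<open>Invariant polynomials and restriction to fixed points\<close>

lemma class_ring_simps [simp]:
  "carrier (class_ring S) = S" "x \<otimes>\<^bsub>class_ring S\<^esub> y = x * y" "\<one>\<^bsub>class_ring S\<^esub> = 1"
  "x \<oplus>\<^bsub>class_ring S\<^esub> y = x + y" "\<zero>\<^bsub>class_ring S\<^esub> = 0"
  by (simp_all add: class_ring_def)

lemma class_ring_cring: "comm_subring S \<Longrightarrow> cring (class_ring S)"
proof -
  assume "comm_subring S"
  then interpret comm_subring S .
  show ?thesis
    by (rule cringI, rule abelian_groupI)
      (auto intro!: comm_monoidI bexI[of _ "- _"] simp: algebra_simps)
qed

lemma class_ring_ideal:
  assumes "comm_subring S" "I \<subseteq> S" "0 \<in> I" "\<And>a b. a \<in> I \<Longrightarrow> b \<in> I \<Longrightarrow> a - b \<in> I"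
    "\<And>a s. a \<in> I \<Longrightarrow> s \<in> S \<Longrightarrow> s * a \<in> I"
  shows "ideal I (class_ring S)"
proof -
  interpret comm_subring S by fact
  interpret C: cring "class_ring S" using assms(1) by (rule class_ring_cring)
  have um: "- a \<in> I" if "a \<in> I" for a using assms(4)[OF assms(3) that] by simp
  have add: "a + b \<in> I" if "a \<in> I" "b \<in> I" for a b using assms(4)[OF that(1) um[OF that(2)]] by simp
  have inv: "inv\<^bsub>add_monoid (class_ring S)\<^esub> a = - a" if "a \<in> I" for a
    using C.minus_equality[of "- a" a] that assms(2) uminus_mem by (auto simp: a_inv_def)
  show ?thesis
  proof (rule idealI)
    show "ring (class_ring S)" by (rule C.ring_axioms)
    show "subgroup I (add_monoid (class_ring S))"
      by (rule group.subgroupI[OF C.a_group]) (use assms(2,3) add um inv in auto)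
  qed (use assms(5) in \<open>auto simp: mult.commute\<close>)
qed

lemma class_ring_idealD:
  assumes "ideal I (class_ring S)"
  shows "I \<subseteq> S" "0 \<in> I" "\<And>a b. a \<in> I \<Longrightarrow> b \<in> I \<Longrightarrow> a + b \<in> I" 
    "\<And>a s. a \<in> I \<Longrightarrow> s \<in> S \<Longrightarrow> s * a \<in> I"
proof -
  interpret ideal I "class_ring S" by fact
  show "I \<subseteq> S" using a_subset by simp
  show "0 \<in> I" using additive_subgroup.zero_closed[OF is_additive_subgroup] by simp
  show "a + b \<in> I" if "a \<in> I" "b \<in> I" for a b using additive_subgroup.a_closed[OF is_additive_subgroup that] by simp
  show "s * a \<in> I" if "a \<in> I" "s \<in> S" for a s using I_l_closed[of a s] that by simp
qed

section \<open>Increasing enumeration of finite sets\<close>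

lemma bij_betw_nth_elt:
  assumes "finite J" shows "bij_betw (nth_elt J) {1..card J} J"
proof -
  let ?xs = "sorted_list_of_set J"
  have "bij_betw (nth ?xs) {..<length ?xs} (set ?xs)"
    by (rule bij_betw_nth) auto
  moreover have "bij_betw (\<lambda>r. r - 1) {1..card J} {..<card J}"
    by (rule bij_betw_byWitness[of _ Suc]) auto
  ultimately have "bij_betw (nth ?xs \<circ> (\<lambda>r. r - 1)) {1..card J} J"
    using assms by (intro bij_betw_trans) auto
  then show ?thesis by (simp add: nth_elt_def[abs_def] o_def)
qed

lemma nth_elt_in: "finite J \<Longrightarrow> r \<in> {1..card J} \<Longrightarrow> nth_elt J r \<in> J"
  using bij_betw_nth_elt[of J] by (auto simp: bij_betw_def)

lemma finite_ksubsets [simp]: "finite (ksubsets n k)"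
  by (rule finite_subset[of _ "Pow {1..n}"]) (auto simp: ksubsets_def)

lemma ksubsetsD: "J \<in> ksubsets n k \<Longrightarrow> J \<subseteq> {1..n} \<and> card J = k \<and> finite J"
  unfolding ksubsets_def using finite_subset[of J "{1..n}"] by blast

lemma card_compl_ksubsets: "J \<in> ksubsets n k \<Longrightarrow> card ({1..n} - J) = n - k"
  using ksubsetsD[of J n k] by (simp add: card_Diff_subset)

abbreviation Vall :: "nat \<Rightarrow> nat \<Rightarrow> var set" where
  "Vall n k \<equiv> Gam n k \<union> Vzy n"

definition TT :: "nat \<Rightarrow> nat \<Rightarrow> cpoly set" where
  "TT n k = {p \<in> polys (Vall n k).
     \<forall>\<pi> \<rho>. \<pi> permutes {1..k} \<and> \<rho> permutes {1..n - k} \<longrightarrow> psubst (permute_vars \<pi> \<rho> id) p = p}"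

definition GG :: "nat \<Rightarrow> nat \<Rightarrow> cpoly set" where
  "GG n k = {p \<in> polys (Vall n k).
     \<forall>\<pi> \<rho> \<tau>. \<pi> permutes {1..k} \<and> \<rho> permutes {1..n - k} \<and> \<tau> permutes {1..n} \<longrightarrow>
       psubst (permute_vars \<pi> \<rho> \<tau>) p = p}"

lemma inv_T_TT: "inv_T n k = class_ring (TT n k)" and inv_GL_GG: "inv_GL n k = class_ring (GG n k)"
  by (simp_all add: inv_T_def inv_GL_def TT_def GG_def)

lemma TT_subring: "comm_subring (TT n k)" and GG_subring: "comm_subring (GG n k)"
  by standard (auto simp: TT_def GG_def)

lemma GG_le_TT: "GG n k \<subseteq> TT n k"
  by (auto simp: TT_def GG_def intro: permutes_id)

lemma C_zy_TT: "polys (Vzy n) \<subseteq> TT n k"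
proof
  fix p assume p: "p \<in> polys (Vzy n)"
  have "psubst (permute_vars \<pi> \<rho> id) p = p" for \<pi> \<rho>
    by (rule psubst_eq_self[OF p]) (auto simp: Vzy_def)
  then show "p \<in> TT n k" using p polys_mono[of "Vzy n" "Vall n k"] by (auto simp: TT_def)
qed

subsection \<open>The relations\<close>

lemma map_poly_psubst_mult:
  "map_poly (psubst \<sigma>) (p * q) = map_poly (psubst \<sigma>) p * map_poly (psubst \<sigma>) q"
  by (rule poly_eqI) (simp add: coeff_map_poly coeff_mult)

lemma map_poly_psubst_prod:
  "map_poly (psubst \<sigma>) (prod f A) = (\<Prod>x\<in>A. map_poly (psubst \<sigma>) (f x))"
  by (induction A rule: infinite_finite_induct) (simp_all add: map_poly_psubst_mult)

lemma map_poly_psubst_diff: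
  "map_poly (psubst \<sigma>) (p - q) = map_poly (psubst \<sigma>) p - map_poly (psubst \<sigma>) q"
  by (rule poly_eqI) (simp add: coeff_map_poly)

lemma map_poly_psubst_linear: "map_poly (psubst \<sigma>) [:- p, 1:] = [:- psubst \<sigma> p, 1:]"
  by (simp add: map_poly_pCons)

text \<open>Substitution commutes with taking coefficients in u. Invariance of the generators of the
  ideal and their vanishing at fixed points can thus be read off from the factored
  polynomial.\<close>

lemma psubst_coeff_rel_poly:
  "psubst \<sigma> (poly.coeff (rel_poly n k) i) = poly.coeff
    ((\<Prod>i\<in>{1..k}. [:- \<sigma> (G1 i), 1:]) * (\<Prod>i\<in>{1..n - k}. [:- \<sigma> (G2 i), 1:])
     - (\<Prod>i\<in>{1..n}. [:- \<sigma> (Z i), 1:])) i"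
proof -
  have "psubst \<sigma> (poly.coeff (rel_poly n k) i) = poly.coeff (map_poly (psubst \<sigma>) (rel_poly n k)) i"
    by (simp add: coeff_map_poly)
  also have "map_poly (psubst \<sigma>) (rel_poly n k) = (\<Prod>i\<in>{1..k}. [:- \<sigma> (G1 i), 1:]) * (\<Prod>i\<in>{1..n - k}. [:- \<sigma> (G2 i), 1:])
     - (\<Prod>i\<in>{1..n}. [:- \<sigma> (Z i), 1:])"
    unfolding rel_poly_def
    by (simp only: map_poly_psubst_mult map_poly_psubst_prod map_poly_psubst_diff map_poly_psubst_linear psubst_Var)
  finally show ?thesis .
qed

lemma prod_permutes: "\<pi> permutes A \<Longrightarrow> (\<Prod>i\<in>A. f (\<pi> i)) = prod f A"
  using prod.permute[of \<pi> A f] by (simp add: o_def)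

lemma coeff_rel_poly_polys: "poly.coeff (rel_poly n k) i \<in> polys (Vall n k)"
proof -
  let ?P = "\<lambda>q::cpoly poly. \<forall>i. poly.coeff q i \<in> polys (Vall n k)"
  have m: "?P (p * q)" if "?P p" "?P q" for p q
    using that by (auto simp: coeff_mult intro!: polys_sum polys_mult)
  have pr: "?P (prod f A)" if "finite A" "\<And>x. x \<in> A \<Longrightarrow> ?P (f x)" for A and f :: "nat \<Rightarrow> cpoly poly"
    using that
  proof (induction rule: finite_induct)
    case (insert x A)
    then have "?P (f x)" "?P (prod f A)" by blast+
    from m[OF this] insert.hyps show ?case by simp
  qed auto
  have l: "?P [:- Var v, 1:]" if "v \<in> Vall n k" for v
    using that by (auto simp: coeff_pCons intro!: polys_uminus polys_Var split: nat.split)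
  have "?P (\<Prod>i\<in>{1..k}. [:- Var (G1 i), 1:])" "?P (\<Prod>i\<in>{1..n - k}. [:- Var (G2 i), 1:])"
    "?P (\<Prod>i\<in>{1..n}. [:- Var (Z i), 1:])"
    by (rule pr; rule finite_atLeastAtMost l; simp add: Gam_def Vzy_def)+
  from m[OF this(1,2)] this(3) show ?thesis
    unfolding rel_poly_def coeff_diff by (blast intro: polys_diff)
qed

lemma coeff_rel_poly_GG: "poly.coeff (rel_poly n k) i \<in> GG n k"
  unfolding GG_def using coeff_rel_poly_polys
proof (intro CollectI conjI allI impI)
  fix \<pi> \<rho> \<tau> assume *: "\<pi> permutes {1..k} \<and> \<rho> permutes {1..n - k} \<and> \<tau> permutes {1..n}"
  then show "psubst (permute_vars \<pi> \<rho> \<tau>) (poly.coeff (rel_poly n k) i) = poly.coeff (rel_poly n k) i"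
    apply (subst psubst_coeff_rel_poly)
    unfolding rel_poly_def permute_vars.simps
    using prod_permutes[of \<pi> "{1..k}" "\<lambda>i. [:- Var (G1 i), 1:]"]
      prod_permutes[of \<rho> "{1..n-k}" "\<lambda>i. [:- Var (G2 i), 1:]"]
      prod_permutes[of \<tau> "{1..n}" "\<lambda>i. [:- Var (Z i), 1:]"] by simp
qed

lemma coeff_rel_poly_TT: "poly.coeff (rel_poly n k) i \<in> TT n k"
  using coeff_rel_poly_GG GG_le_TT by blast

lemma at_x_coeff_rel_poly:
  assumes J: "J \<in> ksubsets n k"
  shows "psubst (at_x n J) (poly.coeff (rel_poly n k) i) = 0"
proof -
  note J' = ksubsetsD[OF J]
  let ?f = "\<lambda>j. [:- Var (Z j), 1::cpoly:]"
  have 1: "(\<Prod>i\<in>{1..k}. ?f (nth_elt J i)) = prod ?f J"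
    using bij_betw_nth_elt[of J] J' by (intro prod.reindex_bij_betw) auto
  have 2: "(\<Prod>i\<in>{1..n - k}. ?f (nth_elt ({1..n} - J) i)) = prod ?f ({1..n} - J)"
    using bij_betw_nth_elt[of "{1..n} - J"] card_compl_ksubsets[OF J]
    by (intro prod.reindex_bij_betw) auto
  have "prod ?f J * prod ?f ({1..n} - J) = prod ?f {1..n}"
    using prod.subset_diff[of J "{1..n}" ?f] J' by (simp add: mult.commute)
  with 1 2 show ?thesis unfolding psubst_coeff_rel_poly at_x.simps by simp
qed

lemma J_T_ideal: "ideal (J_T n k) (class_ring (TT n k))"
  unfolding J_T_def inv_T_TT using cring.axioms(1)[OF class_ring_cring[OF TT_subring]]
  by (rule ring.genideal_ideal) (use coeff_rel_poly_TT in auto)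

lemma J_GL_ideal: "ideal (J_GL n k) (class_ring (GG n k))"
  unfolding J_GL_def inv_GL_GG using cring.axioms(1)[OF class_ring_cring[OF GG_subring]]
  by (rule ring.genideal_ideal) (use coeff_rel_poly_GG in auto)

lemmas J_T_D = class_ring_idealD[OF J_T_ideal] and J_GL_D = class_ring_idealD[OF J_GL_ideal]

lemma J_T_coeff: "poly.coeff (rel_poly n k) i \<in> J_T n k"
  using ring.genideal_self[OF cring.axioms(1)[OF class_ring_cring[OF TT_subring]], of "range (poly.coeff (rel_poly n k))" n k]
    coeff_rel_poly_TT by (auto simp: J_T_def inv_T_TT)

lemma J_T_minus: "a \<in> J_T n k \<Longrightarrow> - a \<in> J_T n k"
  using J_T_D(4)[of a n k "- 1"] comm_subring.uminus_mem[OF TT_subring comm_subring.one_mem[OF TT_subring]]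
  by simp

lemma J_T_diff: "a \<in> J_T n k \<Longrightarrow> b \<in> J_T n k \<Longrightarrow> a - b \<in> J_T n k"
  using J_T_D(3)[OF _ J_T_minus] by fastforce

lemma J_T_sum: "(\<And>x. x \<in> A \<Longrightarrow> f x \<in> J_T n k) \<Longrightarrow> sum f A \<in> J_T n k"
  by (induction A rule: infinite_finite_induct) (auto intro: J_T_D)

text \<open>The intersection of \<open>J_T\<close> with \<open>GG\<close> is an ideal of
  \<open>GG\<close> and contains the generators, so it contains the ideal which they
  generate.\<close>

lemma J_GL_le_J_T: "J_GL n k \<subseteq> J_T n k"
proof -
  have "J_GL n k \<subseteq> J_T n k \<inter> GG n k"
    unfolding J_GL_def inv_GL_GG
  proof (rule ring.genideal_minimal)
    show "ideal (J_T n k \<inter> GG n k) (class_ring (GG n k))"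
      using GG_le_TT[of n k] GG_subring[of n k]
      by (intro class_ring_ideal) (auto intro: J_T_D J_T_diff simp: comm_subring.zero_mem comm_subring.mult_mem comm_subring.diff_mem)
    show "range (poly.coeff (rel_poly n k)) \<subseteq> J_T n k \<inter> GG n k"
      using J_T_coeff coeff_rel_poly_GG by auto
  qed (use cring.axioms(1)[OF class_ring_cring[OF GG_subring]] in auto)
  then show ?thesis by blast
qed

lemma at_x_J_T:
  assumes "J \<in> ksubsets n k" "p \<in> J_T n k"
  shows "psubst (at_x n J) p = 0"
proof -
  have "J_T n k \<subseteq> {p \<in> TT n k. psubst (at_x n J) p = 0}"
    unfolding J_T_def inv_T_TT
  proof (rule ring.genideal_minimal)
    show "ideal {p \<in> TT n k. psubst (at_x n J) p = 0} (class_ring (TT n k))"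
      using TT_subring by (intro class_ring_ideal) (auto simp: comm_subring.zero_mem comm_subring.mult_mem comm_subring.diff_mem)
    show "range (poly.coeff (rel_poly n k)) \<subseteq> {p \<in> TT n k. psubst (at_x n J) p = 0}"
      using coeff_rel_poly_TT at_x_coeff_rel_poly[OF assms(1)] by auto
  qed (rule cring.axioms(1)[OF class_ring_cring[OF TT_subring]])
  then show ?thesis using assms(2) by blast
qed

subsection \<open>Classes\<close>

definition hc :: "nat \<Rightarrow> nat \<Rightarrow> cpoly \<Rightarrow> cpoly set" where
  "hc n k p = {q. q - p \<in> J_T n k}"

lemma hc_coset: "J_T n k +>\<^bsub>inv_T n k\<^esub> p = hc n k p"
  unfolding a_r_coset_def' hc_def inv_T_TT
  by (auto; metis add_diff_cancel_right' diff_add_cancel)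

lemma hc_self: "p \<in> hc n k p"
  using J_T_D(2) by (simp add: hc_def)

lemma hc_eq_iff: "hc n k p = hc n k q \<longleftrightarrow> p - q \<in> J_T n k"
proof
  assume "hc n k p = hc n k q"
  then have "p \<in> hc n k q" using hc_self by metis
  then show "p - q \<in> J_T n k" by (simp add: hc_def)
next
  assume pq: "p - q \<in> J_T n k"
  show "hc n k p = hc n k q"
  proof (rule Set.set_eqI)
    fix x
    show "x \<in> hc n k p \<longleftrightarrow> x \<in> hc n k q"
      using J_T_D(3)[OF _ pq, of "x - p"] J_T_diff[OF _ pq, of "x - q"] by (auto simp: hc_def)
  qed
qed

lemma carrier_H_T: "carrier (H_T n k) = hc n k ` TT n k"
  by (auto simp: H_T_def FactRing_def A_RCOSETS_def' hc_coset inv_T_TT[symmetric])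
    (auto simp: inv_T_TT hc_coset)

lemma H_T_add: "p \<in> TT n k \<Longrightarrow> q \<in> TT n k \<Longrightarrow> hc n k p \<oplus>\<^bsub>H_T n k\<^esub> hc n k q = hc n k (p + q)"
  using ideal.a_rcos_sum[OF J_T_ideal, of p n k q]
  by (simp add: H_T_def FactRing_def hc_coset[symmetric] inv_T_TT)

lemma H_T_mult: "p \<in> TT n k \<Longrightarrow> q \<in> TT n k \<Longrightarrow> hc n k p \<otimes>\<^bsub>H_T n k\<^esub> hc n k q = hc n k (p * q)"
  using ideal.rcoset_mult_add[OF J_T_ideal, of p n k q]
  by (simp add: H_T_def FactRing_def hc_coset[symmetric] inv_T_TT)

text \<open>Representatives differ by elements of \<open>J_T\<close>, which vanish at every fixed
  point; hence \<open>the_elem\<close> in \<open>res_H\<close> meets a singleton.\<close>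

lemma res_H_hc:
  assumes "J \<in> ksubsets n k" shows "res_H n J (hc n k p) = psubst (at_x n J) p"
proof -
  have "psubst (at_x n J) ` hc n k p = {psubst (at_x n J) p}"
    using hc_self[of p n k] at_x_J_T[OF assms] by (fastforce simp: hc_def)
  then show ?thesis by (simp add: res_H_def)
qed

lemma carrier_H_GL: "carrier (H_GL n k) = (\<lambda>p. J_GL n k +>\<^bsub>inv_GL n k\<^esub> p) ` GG n k"
  by (auto simp: H_GL_def FactRing_def A_RCOSETS_def' inv_GL_GG)

lemma GL_to_T_coset:
  assumes "p \<in> GG n k" shows "GL_to_T n k (J_GL n k +>\<^bsub>inv_GL n k\<^esub> p) = hc n k p"
proof -
  have "GL_to_T n k (J_GL n k +>\<^bsub>inv_GL n k\<^esub> p) = {a + p + b | a b. a \<in> J_GL n k \<and> b \<in> J_T n k}"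
    by (auto simp: GL_to_T_def set_add_def' a_r_coset_def' inv_T_TT inv_GL_GG)
  also have "\<dots> = hc n k p"
  proof (rule equalityI; rule subsetI)
    fix x assume "x \<in> {a + p + b | a b. a \<in> J_GL n k \<and> b \<in> J_T n k}"
    then obtain a b where "x = a + p + b" "a \<in> J_T n k" "b \<in> J_T n k" using J_GL_le_J_T by blast
    then show "x \<in> hc n k p" using J_T_D(3)[of a n k b] by (simp add: hc_def algebra_simps)
  next
    fix x assume "x \<in> hc n k p"
    then have "x = 0 + p + (x - p)" "x - p \<in> J_T n k" by (auto simp: hc_def)
    then show "x \<in> {a + p + b | a b. a \<in> J_GL n k \<and> b \<in> J_T n k}" using J_GL_D(2) by blast
  qed
  finally show ?thesis .
qed


section \<open>Localization at the fixed points\<close>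

text \<open>The Reynolds operator of S_k x S_{n-k}; characteristic 0 enters through the division by
  the order of the group.\<close>

definition avg :: "nat \<Rightarrow> nat \<Rightarrow> cpoly \<Rightarrow> cpoly" where
  "avg n k p = Cst (1 / of_nat (fact k * fact (n - k))) *
     (\<Sum>\<pi> | \<pi> permutes {1..k}. \<Sum>\<rho> | \<rho> permutes {1..n - k}. psubst (permute_vars \<pi> \<rho> id) p)"

lemma permute_vars_polys:
  assumes "\<pi> permutes {1..k}" "\<rho> permutes {1..n - k}" "p \<in> polys (Vall n k)"
  shows "psubst (permute_vars \<pi> \<rho> id) p \<in> polys (Vall n k)"
proof (rule polys_psubst[OF assms(3)])
  fix v assume "v \<in> Vall n k"
  then show "permute_vars \<pi> \<rho> id v \<in> polys (Vall n k)"
    using permutes_in_image[OF assms(1)] permutes_in_image[OF assms(2)]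
    by (cases v) (auto simp: Gam_def Vzy_def intro!: polys_Var)
qed

lemma avg_TT:
  assumes "p \<in> polys (Vall n k)" shows "avg n k p \<in> TT n k"
  unfolding TT_def
proof (intro CollectI conjI allI impI)
  show "avg n k p \<in> polys (Vall n k)"
    unfolding avg_def using assms by (intro polys_mult polys_sum permute_vars_polys) auto
  fix \<pi> \<rho> assume *: "\<pi> permutes {1..k} \<and> \<rho> permutes {1..n - k}"
  have "(\<Sum>\<pi>' | \<pi>' permutes {1..k}. \<Sum>\<rho>' | \<rho>' permutes {1..n - k}. psubst (permute_vars (\<pi> \<circ> \<pi>') (\<rho> \<circ> \<rho>') id) p)
    = (\<Sum>\<pi>' | \<pi>' permutes {1..k}. \<Sum>\<rho>' | \<rho>' permutes {1..n - k}. psubst (permute_vars (\<pi> \<circ> \<pi>') \<rho>' id) p)"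
    by (intro sum.cong HOL.refl setum_permutations_compose_left[symmetric]) (use * in auto)
  also have "\<dots> = (\<Sum>\<pi>' | \<pi>' permutes {1..k}. \<Sum>\<rho>' | \<rho>' permutes {1..n - k}. psubst (permute_vars \<pi>' \<rho>' id) p)"
    by (rule setum_permutations_compose_left[symmetric]) (use * in auto)
  finally show "psubst (permute_vars \<pi> \<rho> id) (avg n k p) = avg n k p"
    by (simp add: avg_def psubst_permute_vars_comp)
qed

text \<open>Unlike \<open>TT\<close>, this does not restrict the variables, so that it also covers
  polynomials that contain \<lambda>.\<close>

definition sym_inv :: "nat \<Rightarrow> nat \<Rightarrow> cpoly \<Rightarrow> bool" where
  "sym_inv n k p \<longleftrightarrow> (\<forall>\<pi> \<rho>. \<pi> permutes {1..k} \<and> \<rho> permutes {1..n - k} \<longrightarrow> psubst (permute_vars \<pi> \<rho> id) p = p)"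

lemma TT_sym_inv: "p \<in> TT n k \<Longrightarrow> sym_inv n k p"
  by (simp add: TT_def sym_inv_def)

lemma avg_mult: "sym_inv n k q \<Longrightarrow> avg n k (p * q) = avg n k p * q"
  by (simp add: avg_def sym_inv_def sum_distrib_right mult.assoc)

lemma avg_add: "avg n k (p + q) = avg n k p + avg n k q"
  by (simp add: avg_def sum.distrib ring_distribs)

lemma avg_sum: "avg n k (sum f A) = (\<Sum>x\<in>A. avg n k (f x))"
proof (induction A rule: infinite_finite_induct)
  have 0: "avg n k 0 = 0" by (simp add: avg_def)
qed (auto simp: avg_add, auto simp: avg_def)

lemma avg_eq:
  assumes "sym_inv n k p" shows "avg n k p = p"
proof -
  have N: "of_nat m = Cst (of_nat m)" for m by (simp add: Cst_def)
  have "avg n k p = Cst (1 / of_nat (fact k * fact (n - k))) * (of_nat (fact k * fact (n - k)) * p)"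
    using assms by (simp add: avg_def sym_inv_def card_permutations mult.assoc)
  also have "\<dots> = p"
    unfolding N mult.assoc[symmetric] Cst_mult[symmetric] by simp
  finally show ?thesis .
qed

text \<open>The ideal generated by the relations in the ring of all polynomials; averaging over
  $S_k\times S_{n-k}$ shows that it meets the invariants in \<open>J_T\<close>.\<close>

definition Jall :: "nat \<Rightarrow> nat \<Rightarrow> cpoly set" where
  "Jall n k = {\<Sum>i\<le>degree (rel_poly n k). a i * poly.coeff (rel_poly n k) i | a. True}"

lemma Jall_add: "p \<in> Jall n k \<Longrightarrow> q \<in> Jall n k \<Longrightarrow> p + q \<in> Jall n k"
proof -
  assume "p \<in> Jall n k" "q \<in> Jall n k"
  then obtain a b where "p = (\<Sum>i\<le>degree (rel_poly n k). a i * poly.coeff (rel_poly n k) i)"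
    "q = (\<Sum>i\<le>degree (rel_poly n k). b i * poly.coeff (rel_poly n k) i)" by (auto simp: Jall_def)
  then have "p + q = (\<Sum>i\<le>degree (rel_poly n k). (a i + b i) * poly.coeff (rel_poly n k) i)"
    by (simp add: ring_distribs sum.distrib)
  then show ?thesis by (auto simp: Jall_def intro!: exI[of _ "\<lambda>i. a i + b i"])
qed

lemma Jall_mult: "p \<in> Jall n k \<Longrightarrow> q * p \<in> Jall n k"
proof -
  assume "p \<in> Jall n k"
  then obtain a where "p = (\<Sum>i\<le>degree (rel_poly n k). a i * poly.coeff (rel_poly n k) i)" by (auto simp: Jall_def)
  then have "q * p = (\<Sum>i\<le>degree (rel_poly n k). (q * a i) * poly.coeff (rel_poly n k) i)"
    by (simp add: sum_distrib_left mult.assoc)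
  then show ?thesis by (auto simp: Jall_def intro!: exI[of _ "\<lambda>i. q * a i"])
qed

lemma Jall_0: "0 \<in> Jall n k"
  by (auto simp: Jall_def intro!: exI[of _ "\<lambda>i. 0"])

lemma Jall_poly: "poly (rel_poly n k) u \<in> Jall n k"
  unfolding Jall_def poly_altdef by (auto simp: mult.commute intro!: exI[of _ "\<lambda>i. u ^ i"])

lemma Jall_TT:
  assumes "f \<in> Jall n k" "f \<in> TT n k" shows "f \<in> J_T n k"
proof -
  let ?D = "degree (rel_poly n k)" and ?c = "poly.coeff (rel_poly n k)"
  \<comment> \<open>Killing the variables outside \<open>Vall n k\<close> leaves f and the
    generators unchanged and brings the coefficients into the ring on which averaging lands in
    \<open>TT\<close>.\<close>
  let ?\<theta> = "\<lambda>v. if v \<in> Vall n k then Var v else 0"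
  obtain a where a: "f = (\<Sum>i\<le>?D. a i * ?c i)" using assms(1) by (auto simp: Jall_def)
  have "f \<in> polys (Vall n k)" using assms(2) by (simp add: TT_def)
  then have "f = psubst ?\<theta> f" by (subst psubst_eq_self) auto
  also have "\<dots> = (\<Sum>i\<le>?D. psubst ?\<theta> (a i) * ?c i)"
    unfolding a using psubst_eq_self[OF coeff_rel_poly_polys, of n k ?\<theta>] by simp
  finally have "avg n k f = (\<Sum>i\<le>?D. avg n k (psubst ?\<theta> (a i)) * ?c i)"
    by (simp only: avg_sum avg_mult[OF TT_sym_inv[OF coeff_rel_poly_TT]])
  moreover have "psubst ?\<theta> q \<in> polys (Vall n k)" for q
    by (rule polys_psubst[of _ UNIV]) (auto simp: polys_def[of UNIV] polys_Var)
  then have "avg n k (psubst ?\<theta> (a i)) * ?c i \<in> J_T n k" for i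
    using J_T_D(4)[OF J_T_coeff avg_TT] by blast
  then have "(\<Sum>i\<le>?D. avg n k (psubst ?\<theta> (a i)) * ?c i) \<in> J_T n k" by (rule J_T_sum)
  ultimately show ?thesis
    using avg_eq[OF TT_sym_inv[OF assms(2)]] by simp
qed

section \<open>Lagrange interpolation at the nodes z_1, ..., z_n\<close>

definition zlag :: "nat \<Rightarrow> nat \<Rightarrow> cpoly \<Rightarrow> cpoly" where
  "zlag n a u = (\<Prod>b\<in>{1..n} - {a}. u - Var (Z b))"

text \<open>The product of the Lagrange denominators of all nodes except z_a:
  \<open>zcof n a * zlag n a u\<close> divided by \<open>zdisc n\<close> is the basis polynomial at
  z_a. Up to sign, \<open>zdisc\<close> is the discriminant of the product of the u - z_b.\<close>

definition zcof :: "nat \<Rightarrow> nat \<Rightarrow> cpoly" where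
  "zcof n a = (\<Prod>b\<in>{1..n} - {a}. zlag n b (Var (Z b)))"

definition zdisc :: "nat \<Rightarrow> cpoly" where
  "zdisc n = (\<Prod>b\<in>{1..n}. zlag n b (Var (Z b)))"

lemma zlag_polys: "u \<in> polys (Vzy n) \<Longrightarrow> zlag n a u \<in> polys (Vzy n)"
  unfolding zlag_def by (intro polys_prod polys_diff polys_Var) (auto simp: Vzy_def)

lemma zdisc_polys: "zdisc n \<in> polys (Vzy n)"
  unfolding zdisc_def by (intro polys_prod zlag_polys polys_Var) (auto simp: Vzy_def)

lemma zlag_nonzero: "zlag n a (Var (Z a)) \<noteq> 0"
  by (auto simp: zlag_def)

lemma zdisc_nonzero: "zdisc n \<noteq> 0"
  by (auto simp: zdisc_def zlag_nonzero)

text \<open>Lagrange interpolation of the constant 1 at the nodes \<open>Z a\<close>, with denominators cleared.\<close>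

lemma lagrange:
  assumes "n \<ge> 1" shows "(\<Sum>a\<in>{1..n}. zcof n a * zlag n a u) = zdisc n"
proof -
  let ?P = "\<Sum>a\<in>{1..n}. smult (zcof n a) (\<Prod>b\<in>{1..n} - {a}. [:- Var (Z b), 1:])"
  have ev: "poly ?P u = (\<Sum>a\<in>{1..n}. zcof n a * zlag n a u)" for u
    by (simp add: poly_sum poly_prod zlag_def)
  have "?P = [:zdisc n:]"
  proof (rule poly_eqI_degree)
    let ?A = "(\<lambda>a. Var (Z a)) ` {1..n}"
    have card: "card ?A = n" by (subst card_image) (auto simp: inj_on_def)
    have "degree ?P \<le> n - 1"
    proof (rule degree_sum_le)
      fix a assume a: "a \<in> {1..n}"
      have "degree (\<Prod>b\<in>{1..n} - {a}. [:- Var (Z b), 1:]) \<le> n - 1"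
        using degree_prod_sum_le[of "{1..n} - {a}" "\<lambda>b. [:- Var (Z b), 1:]"] a by simp
      then show "degree (smult (zcof n a) (\<Prod>b\<in>{1..n} - {a}. [:- Var (Z b), 1:])) \<le> n - 1"
        using degree_smult_le by (rule order_trans[rotated])
    qed simp
    then show "card ?A > degree ?P" "card ?A > degree [:zdisc n:]" using card assms by auto
    fix x assume "x \<in> ?A"
    then obtain c where c: "c \<in> {1..n}" "x = Var (Z c)" by auto
    have "zcof n a * zlag n a x = (if a = c then zdisc n else 0)" if "a \<in> {1..n}" for a
    proof (cases "a = c")
      case True
      then show ?thesis
        using c prod.remove[of "{1..n}" c "\<lambda>b. zlag n b (Var (Z b))"] by (simp add: zdisc_def zcof_def mult.commute)
    next
      case False
      then have "zlag n a x = 0" using c by (auto simp: zlag_def)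
      then show ?thesis using False by simp
    qed
    then have "(\<Sum>a\<in>{1..n}. zcof n a * zlag n a x) = (\<Sum>a\<in>{1..n}. if a = c then zdisc n else 0)"
      by (intro sum.cong) auto
    then show "poly ?P x = poly [:zdisc n:] x" unfolding ev using c by (simp add: sum.delta)
  qed
  with ev[of u] show ?thesis by simp
qed

lemma poly_rel_poly:
  "poly (rel_poly n k) u = (\<Prod>v\<in>Gam n k. u - Var v) - (\<Prod>b\<in>{1..n}. u - Var (Z b))"
proof -
  have "(\<Prod>v\<in>Gam n k. u - Var v) = (\<Prod>i\<in>{1..k}. u - Var (G1 i)) * (\<Prod>i\<in>{1..n - k}. u - Var (G2 i))"
    unfolding Gam_def by (subst prod.union_disjoint) (auto simp: prod.reindex inj_on_def)
  then show ?thesis by (simp add: rel_poly_def poly_prod)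
qed

lemma finite_Gam [simp]: "finite (Gam n k)"
  by (simp add: Gam_def)

lemma card_Gam: "k \<le> n \<Longrightarrow> card (Gam n k) = n"
  unfolding Gam_def by (subst card_Un_disjoint) (auto simp: card_image inj_on_def)

text \<open>Compares an arbitrary enumeration with the increasing one \<open>nth_elt\<close>; the
  permutation found is later absorbed by the invariance of a polynomial.\<close>

lemma ex_permutes:
  fixes m :: nat
  assumes h: "bij_betw h {1..m} B" and e: "bij_betw e {1..m} B"
  shows "\<exists>\<pi>. \<pi> permutes {1..m} \<and> (\<forall>r\<in>{1..m}. e (\<pi> r) = h r)"
proof -
  let ?p = "\<lambda>r. if r \<in> {1..m} then inv_into {1..m} e (h r) else r"
  have "bij_betw (inv_into {1..m} e \<circ> h) {1..m} {1..m}"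
    using h bij_betw_inv_into[OF e] by (rule bij_betw_trans)
  then have "bij_betw ?p {1..m} {1..m}" by (rule bij_betw_cong[THEN iffD1, rotated]) auto
  then have "?p permutes {1..m}" by (rule bij_imp_permutes) auto
  moreover have "e (?p r) = h r" if "r \<in> {1..m}" for r
    using that h e by (auto simp: bij_betw_def intro!: f_inv_into_f)
  ultimately show ?thesis by blast
qed

text \<open>Such a substitution is restriction to the fixed point J given by the images of the first
  group of \<gamma>, up to reordering within each of the two groups. The invariance of f absorbs the
  reordering.\<close>

lemma TT_subst_bij:
  assumes f: "f \<in> TT n k" and kn: "k \<le> n"
    and g: "bij_betw g (Gam n k) {1..n}"
    and van: "\<And>J. J \<in> ksubsets n k \<Longrightarrow> psubst (at_x n J) f = 0"
  shows "psubst (\<lambda>v. if v \<in> Gam n k then Var (Z (g v)) else Var v) f = 0"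
proof -
  define J where "J = g ` G1 ` {1..k}"
  have ginj: "inj_on g (Gam n k)" and gimg: "g ` Gam n k = {1..n}" using g by (auto simp: bij_betw_def)
  have b1: "bij_betw (\<lambda>r. g (G1 r)) {1..k} J"
  proof (intro bij_betw_imageI inj_onI)
    fix r s assume "r \<in> {1..k}" "s \<in> {1..k}" "g (G1 r) = g (G1 s)"
    with inj_onD[OF ginj, of "G1 r" "G1 s"] show "r = s" by (simp add: Gam_def)
  qed (simp add: J_def image_image)
  have cJ: "card J = k" using bij_betw_same_card[OF b1] by simp
  have JJ: "{1..n} - J = g ` G2 ` {1..n - k}"
  proof -
    have "{1..n} = J \<union> g ` G2 ` {1..n - k}" unfolding gimg[symmetric] J_def Gam_def by blast
    moreover have "J \<inter> g ` G2 ` {1..n - k} = {}"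
      using inj_on_image_Int[OF ginj, of "G1 ` {1..k}" "G2 ` {1..n - k}"] by (auto simp: J_def Gam_def)
    ultimately show ?thesis by blast
  qed
  have b2: "bij_betw (\<lambda>r. g (G2 r)) {1..n - k} ({1..n} - J)"
  proof (intro bij_betw_imageI inj_onI)
    fix r s assume "r \<in> {1..n - k}" "s \<in> {1..n - k}" "g (G2 r) = g (G2 s)"
    with inj_onD[OF ginj, of "G2 r" "G2 s"] show "r = s" by (simp add: Gam_def)
  qed (simp only: JJ image_image)
  have Jsub: "J \<in> ksubsets n k"
    unfolding ksubsets_def using cJ gimg by (auto simp: J_def Gam_def)
  have n1: "bij_betw (nth_elt J) {1..k} J"
    using bij_betw_nth_elt[of J] ksubsetsD[OF Jsub] by simp
  have n2: "bij_betw (nth_elt ({1..n} - J)) {1..n - k} ({1..n} - J)"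
    using bij_betw_nth_elt[of "{1..n} - J"] card_compl_ksubsets[OF Jsub] by simp
  obtain \<pi> where \<pi>: "\<pi> permutes {1..k}" "\<forall>r\<in>{1..k}. nth_elt J (\<pi> r) = g (G1 r)"
    using ex_permutes[OF b1 n1] by blast
  obtain \<rho> where \<rho>: "\<rho> permutes {1..n - k}" "\<forall>r\<in>{1..n - k}. nth_elt ({1..n} - J) (\<rho> r) = g (G2 r)"
    using ex_permutes[OF b2 n2] by blast
  have "psubst (at_x n J) (psubst (permute_vars \<pi> \<rho> id) f) = 0"
    using f \<pi> \<rho> van[OF Jsub] by (simp add: TT_def)
  moreover have "psubst (at_x n J) (psubst (permute_vars \<pi> \<rho> id) f)
    = psubst (\<lambda>v. if v \<in> Gam n k then Var (Z (g v)) else Var v) f"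
    unfolding psubst_psubst
  proof (rule psubst_cong)
    show "f \<in> polys (Vall n k)" using f by (simp add: TT_def)
    fix v assume "v \<in> Vall n k"
    then show "psubst (at_x n J) (permute_vars \<pi> \<rho> id v) = (if v \<in> Gam n k then Var (Z (g v)) else Var v)"
      using \<pi> \<rho> by (cases v) (auto simp: Gam_def Vzy_def)
  qed
  ultimately show ?thesis by simp
qed

text \<open>Multiplying by the Lagrange expansion of \<open>zdisc n\<close> in each variable of \<open>Gam n k\<close> reduces the claim to
  the substitutions \<open>v \<mapsto> Z (g v)\<close>; the relations kill those with \<open>g\<close> not bijective.\<close>

lemma fixed_points_vanish:
  assumes n: "n \<ge> 1" and kn: "k \<le> n" and f: "f \<in> TT n k"
    and van: "\<And>J. J \<in> ksubsets n k \<Longrightarrow> psubst (at_x n J) f = 0"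
  shows "\<exists>c\<in>polys (Vzy n). c \<noteq> 0 \<and> c * f \<in> J_T n k"
proof -
  \<comment> \<open>The polynomials that fall into the ideal of relations after multiplication by a
    nonzero polynomial in z and y, i.e. the kernel of localization.\<close>
  define Zs where "Zs = {p. \<exists>c\<in>polys (Vzy n). c \<noteq> 0 \<and> c * p \<in> Jall n k}"
  have Zadd: "p + q \<in> Zs" if p: "p \<in> Zs" and q: "q \<in> Zs" for p q
  proof -
    obtain c where c: "c \<in> polys (Vzy n)" "c \<noteq> 0" "c * p \<in> Jall n k"
      using p unfolding Zs_def by blast
    obtain d where d: "d \<in> polys (Vzy n)" "d \<noteq> 0" "d * q \<in> Jall n k"
      using q unfolding Zs_def by blast
    have "(c * d) * (p + q) = d * (c * p) + c * (d * q)" by (simp add: algebra_simps)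
    then have "(c * d) * (p + q) \<in> Jall n k" using Jall_add[OF Jall_mult[OF c(3)] Jall_mult[OF d(3)]] by metis
    then show ?thesis using c d unfolding Zs_def by (intro CollectI bexI[of _ "c * d"]) auto
  qed
  have Zmult: "q * p \<in> Zs" if p: "p \<in> Zs" for p q
  proof -
    obtain c where c: "c \<in> polys (Vzy n)" "c \<noteq> 0" "c * p \<in> Jall n k"
      using p unfolding Zs_def by blast
    have "c * (q * p) = q * (c * p)" by (simp add: algebra_simps)
    then have "c * (q * p) \<in> Jall n k" using Jall_mult[OF c(3), of q] by (simp only:)
    then show ?thesis using c(1,2) unfolding Zs_def by blast
  qed
  have Zcancel: "p \<in> Zs" if p: "d * p \<in> Zs" and d: "d \<in> polys (Vzy n)" "d \<noteq> 0" for d p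
  proof -
    obtain c where c: "c \<in> polys (Vzy n)" "c \<noteq> 0" "c * (d * p) \<in> Jall n k"
      using p unfolding Zs_def by blast
    then show ?thesis using d unfolding Zs_def by (intro CollectI bexI[of _ "c * d"]) (auto simp: mult.assoc)
  qed
  have Z0: "0 \<in> Zs" unfolding Zs_def using Jall_0 by (auto intro!: bexI[of _ 1])
  have ZJ: "p \<in> Zs" if "p \<in> Jall n k" for p
    using that unfolding Zs_def by (intro CollectI bexI[of _ 1]) auto
  have Zsum: "sum h A \<in> Zs" if "\<And>x. x \<in> A \<Longrightarrow> h x \<in> Zs" for h and A :: "(var \<Rightarrow> nat) set"
    using that by (induction A rule: infinite_finite_induct) (auto intro: Zadd Z0)
  define L where "L g = (\<Prod>v\<in>Gam n k. zlag n (g v) (Var v))" for g :: "var \<Rightarrow> nat"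
  define ev where "ev g v = (if v \<in> Gam n k then Var (Z (g v)) else Var v)" for g :: "var \<Rightarrow> nat" and v
  have zs: "(\<Prod>b\<in>{1..n}. Var v - Var (Z b)) \<in> Jall n k" if "v \<in> Gam n k" for v
  proof -
    have "(\<Prod>w\<in>Gam n k. Var v - Var w) = 0" using that by (auto simp: prod_zero_iff)
    then have "(\<Prod>b\<in>{1..n}. Var v - Var (Z b)) = (- 1) * poly (rel_poly n k) (Var v)" by (simp add: poly_rel_poly)
    then show ?thesis using Jall_mult[OF Jall_poly] by metis
  qed
  \<comment> \<open>In the presence of \<open>L g\<close> each \<gamma>-variable v may be replaced
    by z_{g v}: the difference times the Lagrange numerator of v is the full product of the v - z_b,
    which is a relation.\<close>
  have step: "(p - psubst (ev g) p) * L g \<in> Zs" if g: "g \<in> Gam n k \<rightarrow> {1..n}" for g p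
  proof (induction p rule: cpoly_induct)
    case (Cst c)
    show ?case using Z0 by simp
  next
    case (Var v)
    show ?case
    proof (cases "v \<in> Gam n k")
      case True
      with g have gv: "g v \<in> {1..n}" by auto
      have "(Var v - Var (Z (g v))) * zlag n (g v) (Var v) = (\<Prod>b\<in>{1..n}. Var v - Var (Z b))"
        unfolding zlag_def using gv by (subst (2) prod.remove[of _ "g v"]) auto
      moreover have "L g = zlag n (g v) (Var v) * (\<Prod>v\<in>Gam n k - {v}. zlag n (g v) (Var v))"
        unfolding L_def using True by (subst prod.remove[of _ v]) auto
      ultimately have "(Var v - psubst (ev g) (Var v)) * L g =
          (\<Prod>v\<in>Gam n k - {v}. zlag n (g v) (Var v)) * (\<Prod>b\<in>{1..n}. Var v - Var (Z b))"
        using True by (simp add: ev_def mult_ac)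
      then show ?thesis using Zmult[OF ZJ[OF zs[OF True]]] by simp
    next
      case False
      then show ?thesis using Z0 by (simp add: ev_def)
    qed
  next
    case (add p q)
    from Zadd[OF this] show ?case by (simp add: algebra_simps)
  next
    case (mult p q)
    have "(p * q - psubst (ev g) (p * q)) * L g =
       p * ((q - psubst (ev g) q) * L g) + psubst (ev g) q * ((p - psubst (ev g) p) * L g)"
      by (simp add: algebra_simps)
    then show ?case using Zadd[OF Zmult[OF mult(2)] Zmult[OF mult(1)]] by metis
  qed
  have term_mem: "L g * f \<in> Zs" if g: "g \<in> Gam n k \<rightarrow> {1..n}" for g
  proof (cases "g ` Gam n k = {1..n}")
    case True
    then have "inj_on g (Gam n k)" using card_Gam[OF kn] by (intro eq_card_imp_inj_on) auto
    with True have "bij_betw g (Gam n k) {1..n}" by (simp add: bij_betw_def)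
    from TT_subst_bij[OF f kn this van] have "psubst (ev g) f = 0" by (simp add: ev_def[abs_def])
    with step[OF g, of f] show ?thesis by (simp add: mult.commute)
  next
    case False
    \<comment> \<open>If g misses b, the relation at u = z_b is the product of the z_b - v. Under
      the substitution it becomes a nonzero polynomial in z that multiplies \<open>L g\<close> into
      the relations, so \<open>L g\<close> itself is torsion.\<close>
    with g obtain b where b: "b \<in> {1..n}" "b \<notin> g ` Gam n k" by blast
    define p where "p = poly (rel_poly n k) (Var (Z b))"
    have p: "p = (\<Prod>v\<in>Gam n k. Var (Z b) - Var v)"
      unfolding p_def poly_rel_poly using b by (auto simp: prod_zero_iff)
    have evp: "psubst (ev g) p = (\<Prod>v\<in>Gam n k. Var (Z b) - Var (Z (g v)))"
      unfolding p by (auto simp: ev_def Gam_def intro!: prod.cong)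
    have "psubst (ev g) p * L g = L g * p + (- 1) * ((p - psubst (ev g) p) * L g)"
      by (simp add: algebra_simps)
    moreover have "p \<in> Zs" unfolding p_def by (rule ZJ[OF Jall_poly])
    ultimately have "psubst (ev g) p * L g \<in> Zs" using Zadd Zmult step[OF g] by metis
    moreover have "psubst (ev g) p \<in> polys (Vzy n)"
      unfolding evp using g b by (intro polys_prod polys_diff polys_Var) (auto simp: Vzy_def)
    moreover have "psubst (ev g) p \<noteq> 0" unfolding evp using b by auto
    ultimately have "L g \<in> Zs" by (rule Zcancel)
    then show ?thesis using Zmult[of "L g" f] by (simp add: mult.commute)
  qed
  have "zdisc n ^ card (Gam n k) * f = (\<Prod>v\<in>Gam n k. \<Sum>a\<in>{1..n}. zcof n a * zlag n a (Var v)) * f"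
    using lagrange[OF n] by simp
  also have "\<dots> = (\<Sum>g\<in>Gam n k \<rightarrow>\<^sub>E {1..n}. (\<Prod>v\<in>Gam n k. zcof n (g v)) * (L g * f))"
    by (subst prod_sum_PiE) (auto simp: sum_distrib_right prod.distrib L_def mult.assoc)
  finally have "zdisc n ^ card (Gam n k) * f = (\<Sum>g\<in>Gam n k \<rightarrow>\<^sub>E {1..n}. (\<Prod>v\<in>Gam n k. zcof n (g v)) * (L g * f))" .
  moreover have "\<dots> \<in> Zs" by (intro Zsum Zmult term_mem) auto
  ultimately have "f \<in> Zs"
    using Zcancel[of "zdisc n ^ card (Gam n k)" f] zdisc_polys zdisc_nonzero by auto
  then obtain c where c: "c \<in> polys (Vzy n)" "c \<noteq> 0" "c * f \<in> Jall n k" unfolding Zs_def mem_Collect_eq by metis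
  have "c * f \<in> TT n k"
    using c(1) C_zy_TT f comm_subring.mult_mem[OF TT_subring] by blast
  with Jall_TT[OF c(3)] c show ?thesis by blast
qed


section \<open>Restriction is an isomorphism after localization\<close>

lemma H_T_mod_simps:
  "carrier (H_T_mod n k) = hc n k ` TT n k"
  "p \<in> TT n k \<Longrightarrow> q \<in> TT n k \<Longrightarrow> hc n k p \<oplus>\<^bsub>H_T_mod n k\<^esub> hc n k q = hc n k (p + q)"
  "r \<in> TT n k \<Longrightarrow> q \<in> TT n k \<Longrightarrow> r \<odot>\<^bsub>H_T_mod n k\<^esub> hc n k q = hc n k (r * q)"
  by (simp_all add: H_T_mod_def ring.defs module.defs carrier_H_T H_T_add H_T_mult hc_coset)

lemma L_mod_simps [simp]:
  "carrier (L_mod n) = L_lam_zy n" "x \<oplus>\<^bsub>L_mod n\<^esub> y = x + y" "x \<otimes>\<^bsub>L_mod n\<^esub> y = x * y"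
  "p \<odot>\<^bsub>L_mod n\<^esub> x = to_fract p * x"
  by (simp_all add: L_mod_def ring.defs module.defs class_ring_def)

lemma C_zy_simps [simp]: "carrier (C_zy n) = polys (Vzy n)"
  by (simp add: C_zy_def)

lemmas TT_add = comm_subring.add_mem[OF TT_subring]
  and TT_mult = comm_subring.mult_mem[OF TT_subring]
  and TT_diff = comm_subring.diff_mem[OF TT_subring]
  and TT_sum = comm_subring.sum_mem[OF TT_subring]
  and TT_0 = comm_subring.zero_mem[OF TT_subring]

lemmas L_add = comm_subring.add_mem[OF field_subring.axioms[OF L_lam_zy_subring]]
  and L_mult = comm_subring.mult_mem[OF field_subring.axioms[OF L_lam_zy_subring]]
  and L_diff = comm_subring.diff_mem[OF field_subring.axioms[OF L_lam_zy_subring]]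
  and L_0 = comm_subring.zero_mem[OF field_subring.axioms[OF L_lam_zy_subring]]

lemma L_to_fract: "p \<in> polys (Vlzy n) \<Longrightarrow> to_fract p \<in> L_lam_zy n"
  unfolding L_lam_zy_loc by (rule to_fract_in_loc)

lemma L_to_fract': "p \<in> polys (Vzy n) \<Longrightarrow> to_fract p \<in> L_lam_zy n"
  using polys_mono[of "Vzy n" "Vlzy n"] by (intro L_to_fract) auto

lemma L_inverse: "p \<in> polys (Vzy n) \<Longrightarrow> p \<noteq> 0 \<Longrightarrow> inverse (to_fract p) \<in> L_lam_zy n"
  unfolding L_lam_zy_loc by (rule inverse_in_loc) auto

lemma tensor_setup_H: "tensor_setup (C_zy n) (H_T_mod n k) (L_mod n)"
proof
  fix c r x assume *: "c \<in> carrier (L_mod n)" "r \<in> carrier (C_zy n)" "x \<in> carrier (L_mod n)"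
  show "c \<otimes>\<^bsub>L_mod n\<^esub> (r \<odot>\<^bsub>L_mod n\<^esub> x) = r \<odot>\<^bsub>L_mod n\<^esub> (c \<otimes>\<^bsub>L_mod n\<^esub> x)" by simp
next
  fix r a assume "r \<in> carrier (C_zy n)" "a \<in> carrier (H_T_mod n k)"
  then obtain q where q: "q \<in> TT n k" "a = hc n k q" "r \<in> TT n k"
    using C_zy_TT by (auto simp: H_T_mod_simps(1))
  show "r \<odot>\<^bsub>H_T_mod n k\<^esub> a \<in> carrier (H_T_mod n k)"
    unfolding q(2) H_T_mod_simps(3)[OF q(3,1)] H_T_mod_simps(1) using TT_mult[OF q(3,1)] by blast
qed (auto simp: H_T_mod_simps L_to_fract' intro: L_add L_mult TT_add simp: algebra_simps)

interpretation TS: tensor_setup "C_zy n" "H_T_mod n k" "L_mod n" for n k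
  by (rule tensor_setup_H)

text \<open>The value of \<open>res\<close> computed on one representative of a tensor;
  \<open>Phi_sub\<close> gives independence of the representative.\<close>

definition Phi :: "nat \<Rightarrow> nat set \<Rightarrow> (cpoly set \<times> ratf \<Rightarrow>\<^sub>0 int) \<Rightarrow> ratf" where
  "Phi n J u = (\<Sum>(A, x)\<in>Poly_Mapping.keys u. of_int (Poly_Mapping.lookup u (A, x)) * to_fract (res_H n J A) * x)"

lemma Phi_superset:
  assumes "finite B" "Poly_Mapping.keys u \<subseteq> B"
  shows "Phi n J u = (\<Sum>(A, x)\<in>B. of_int (Poly_Mapping.lookup u (A, x)) * to_fract (res_H n J A) * x)"
  unfolding Phi_def by (rule sum.mono_neutral_left) (use assms in \<open>auto simp: in_keys_iff\<close>)

lemma Phi_diff: "Phi n J (u - v) = Phi n J u - Phi n J v"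
proof -
  let ?A = "Poly_Mapping.keys u \<union> Poly_Mapping.keys v"
  have 1: "Phi n J (u - v) = (\<Sum>(A, x)\<in>?A. of_int (Poly_Mapping.lookup (u - v) (A, x)) * to_fract (res_H n J A) * x)"
    by (rule Phi_superset) (auto dest: subsetD[OF keys_diff])
  have 2: "Phi n J u = (\<Sum>(A, x)\<in>?A. of_int (Poly_Mapping.lookup u (A, x)) * to_fract (res_H n J A) * x)"
    "Phi n J v = (\<Sum>(A, x)\<in>?A. of_int (Poly_Mapping.lookup v (A, x)) * to_fract (res_H n J A) * x)"
    by (rule Phi_superset; auto)+
  show ?thesis unfolding 1 2
    by (simp add: lookup_minus sum_subtractf[symmetric] case_prod_unfold left_diff_distrib)
qed

lemma Phi_0 [simp]: "Phi n J 0 = 0"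
  by (simp add: Phi_def)

lemma Phi_add: "Phi n J (u + v) = Phi n J u + Phi n J v"
  using Phi_diff[of n J u "0 - v"] Phi_diff[of n J 0 v] by simp

lemma Phi_sum: "Phi n J (sum f A) = (\<Sum>x\<in>A. Phi n J (f x))"
  by (induction A rule: infinite_finite_induct) (auto simp: Phi_add)

lemma Phi_of: "J \<in> ksubsets n k \<Longrightarrow> Phi n J (frag_of (hc n k p, x)) = to_fract (psubst (at_x n J) p) * x"
  by (simp add: Phi_def keys_frag_of res_H_hc)

lemma at_x_polys_Vzy:
  assumes J: "J \<in> ksubsets n k" and p: "p \<in> polys (Vall n k)"
  shows "psubst (at_x n J) p \<in> polys (Vzy n)"
proof (rule polys_psubst[OF p])
  have 1: "nth_elt J i \<in> {1..n}" if "i \<in> {1..k}" for i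
    using ksubsetsD[OF J] nth_elt_in[of J i] that by blast
  have 2: "nth_elt ({1..n} - J) i \<in> {1..n}" if "i \<in> {1..n - k}" for i
    using nth_elt_in[of "{1..n} - J" i] card_compl_ksubsets[OF J] that by auto
  fix v assume "v \<in> Vall n k"
  then consider i where "v = G1 i" "i \<in> {1..k}" | i where "v = G2 i" "i \<in> {1..n - k}" | "v \<in> Vzy n"
    unfolding Gam_def by blast
  then show "at_x n J v \<in> polys (Vzy n)"
  proof cases
    case 3
    then have "at_x n J v = Var v" by (auto simp: Vzy_def)
    with 3 show ?thesis by (simp add: polys_Var)
  qed (use 1 2 in \<open>simp_all add: polys_Var Vzy_def\<close>)
qed

lemma at_x_TT: "J \<in> ksubsets n k \<Longrightarrow> p \<in> TT n k \<Longrightarrow> psubst (at_x n J) p \<in> polys (Vzy n)"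
  by (rule at_x_polys_Vzy) (auto simp: TT_def)

lemma at_x_C_zy: "p \<in> polys (Vzy n) \<Longrightarrow> psubst (at_x n J) p = p"
  by (rule psubst_eq_self) (auto simp: Vzy_def)

lemma Phi_sub:
  assumes J: "J \<in> ksubsets n k" and u: "u \<in> TS.sub n k"
  shows "Phi n J u = 0"
  using u
proof (induction rule: TS.sub_induct)
  case (rels u)
  then consider a b x where "u = frag_of (a \<oplus>\<^bsub>H_T_mod n k\<^esub> b, x) - frag_of (a, x) - frag_of (b, x)"
      "a \<in> hc n k ` TT n k" "b \<in> hc n k ` TT n k"
    | a x x' where "u = frag_of (a, x + x') - frag_of (a, x) - frag_of (a, x')" "a \<in> hc n k ` TT n k"
    | r a x where "u = frag_of (r \<odot>\<^bsub>H_T_mod n k\<^esub> a, x) - frag_of (a, to_fract r * x)"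
      "r \<in> polys (Vzy n)" "a \<in> hc n k ` TT n k"
    unfolding tensor_rels_def H_T_mod_simps(1) L_mod_simps C_zy_simps by blast
  then show ?case
  proof cases
    case 1
    then obtain p q where "a = hc n k p" "b = hc n k q" "p \<in> TT n k" "q \<in> TT n k" by blast
    with 1(1) show ?thesis by (simp only: Phi_diff Phi_of[OF J] H_T_mod_simps(2) psubst_add) (simp add: algebra_simps)
  next
    case 2
    then obtain p where "a = hc n k p" by blast
    with 2(1) show ?thesis by (simp only: Phi_diff Phi_of[OF J]) (simp add: algebra_simps)
  next
    case 3
    then obtain p where "a = hc n k p" "p \<in> TT n k" "r \<in> TT n k" using C_zy_TT by blast
    with 3(1) show ?thesis
      by (simp only: Phi_diff Phi_of[OF J] H_T_mod_simps(3) psubst_mult at_x_C_zy[OF 3(2)]) (simp add: algebra_simps)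
  qed
qed (auto simp: Phi_diff)

lemma res_cls:
  assumes "J \<in> ksubsets n k" shows "res n J (TS.cls n k u) = Phi n J u"
proof -
  have "Phi n J v = Phi n J u" if "v \<in> TS.cls n k u" for v
    using that Phi_sub[OF assms, of "v - u"] by (simp add: TS.cls_def Phi_diff)
  then have "Phi n J ` TS.cls n k u = {Phi n J u}"
    using TS.cls_self[of u n k] by blast
  then show ?thesis by (simp add: res_def Phi_def[abs_def])
qed

lemma H_T_L_T: "H_T_L n k = tensor (C_zy n) (H_T_mod n k) (L_mod n)"
  by (simp add: H_T_L_def)

lemma H_T_L_cases:
  assumes "X \<in> carrier (H_T_L n k)"
  obtains u where "u \<in> TS.frags n k" "X = TS.cls n k u"
  using assms unfolding H_T_L_T TS.carrier_T by blast

lemma abelian_group_H: "abelian_group (H_T_L n k)"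
  unfolding H_T_L_T by (rule TS.abelian_group_T)

lemma abelian_monoid_H: "abelian_monoid (H_T_L n k)"
  using abelian_group_H abelian_group.axioms(1) by blast

lemma res_add:
  assumes "X \<in> carrier (H_T_L n k)" "X' \<in> carrier (H_T_L n k)" "J \<in> ksubsets n k"
  shows "res n J (X \<oplus>\<^bsub>H_T_L n k\<^esub> X') = res n J X + res n J X'"
  using assms(1,2) by (elim H_T_L_cases) (simp add: H_T_L_T TS.add_T res_cls[OF assms(3)] Phi_add)

lemma res_zero: "J \<in> ksubsets n k \<Longrightarrow> res n J \<zero>\<^bsub>H_T_L n k\<^esub> = 0"
  by (simp add: H_T_L_T TS.zero_T res_cls)

lemma Phi_scale:
  assumes "u \<in> TS.frags n k" "c \<in> L_lam_zy n" "J \<in> ksubsets n k"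
  shows "Phi n J (TS.scale n c u) = c * Phi n J u"
  using assms(1)
  by (induction rule: TS.frags_induct) (auto simp: Phi_diff H_T_mod_simps Phi_of[OF assms(3)] right_diff_distrib)

lemma smult_H:
  assumes "X \<in> carrier (H_T_L n k)" "c \<in> L_lam_zy n"
  shows "c \<odot>\<^bsub>H_T_L n k\<^esub> X \<in> carrier (H_T_L n k)"
    and "J \<in> ksubsets n k \<Longrightarrow> res n J (c \<odot>\<^bsub>H_T_L n k\<^esub> X) = c * res n J X"
proof -
  obtain u where u: "u \<in> TS.frags n k" "X = TS.cls n k u" using assms(1) by (rule H_T_L_cases)
  have c: "c \<in> carrier (L_mod n)" using assms(2) by simp
  show "c \<odot>\<^bsub>H_T_L n k\<^esub> X \<in> carrier (H_T_L n k)"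
    unfolding H_T_L_T u(2) TS.smult_T[OF c] TS.carrier_T using TS.scale_frags[OF c u(1)] by blast
  show "res n J (c \<odot>\<^bsub>H_T_L n k\<^esub> X) = c * res n J X" if "J \<in> ksubsets n k"
    unfolding H_T_L_T u(2) TS.smult_T[OF c] res_cls[OF that] using Phi_scale[OF u(1) assms(2) that] .
qed

lemma res_in_L:
  assumes "X \<in> carrier (H_T_L n k)" "J \<in> ksubsets n k"
  shows "res n J X \<in> L_lam_zy n"
proof -
  obtain u where u: "u \<in> TS.frags n k" "X = TS.cls n k u" using assms(1) by (rule H_T_L_cases)
  have "Phi n J u \<in> L_lam_zy n" using u(1)
  proof (induction rule: TS.frags_induct)
    case (of A x)
    then obtain p where p: "A = hc n k p" "p \<in> TT n k" by (auto simp: H_T_mod_simps(1))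
    show ?case unfolding p(1) Phi_of[OF assms(2)]
      using of(2) by (intro L_mult L_to_fract' at_x_TT[OF assms(2) p(2)]) simp
  qed (simp_all add: Phi_diff L_diff L_0)
  then show ?thesis using u(2) res_cls[OF assms(2)] by simp
qed

lemma res_finsum:
  assumes "finite A" "\<And>I. I \<in> A \<Longrightarrow> F I \<in> carrier (H_T_L n k)"
  shows "finsum (H_T_L n k) F A \<in> carrier (H_T_L n k)"
    and "J \<in> ksubsets n k \<Longrightarrow> res n J (finsum (H_T_L n k) F A) = (\<Sum>I\<in>A. res n J (F I))"
proof -
  interpret M: abelian_monoid "H_T_L n k" by (rule abelian_monoid_H)
  show "finsum (H_T_L n k) F A \<in> carrier (H_T_L n k)" using assms by (intro M.finsum_closed) auto
  show "res n J (finsum (H_T_L n k) F A) = (\<Sum>I\<in>A. res n J (F I))" if J: "J \<in> ksubsets n k"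
    using assms
  proof (induction A rule: finite_induct)
    case (insert x A)
    then have "F \<in> A \<rightarrow> carrier (H_T_L n k)" "F x \<in> carrier (H_T_L n k)" by auto
    then show ?case using insert J by (simp add: res_add M.finsum_closed)
  qed (simp add: res_zero[OF J])
qed

section \<open>Classes supported at a single fixed point\<close>

definition E_pt :: "nat \<Rightarrow> nat \<Rightarrow> nat set \<Rightarrow> cpoly" where
  "E_pt n k I = (\<Prod>i\<in>{1..k}. \<Prod>a\<in>{1..n} - I. Var (G1 i) - Var (Z a))"

definition den_pt :: "nat \<Rightarrow> nat \<Rightarrow> nat set \<Rightarrow> cpoly" where
  "den_pt n k I = psubst (at_x n I) (E_pt n k I)"

lemma E_pt_TT: "E_pt n k I \<in> TT n k"
  unfolding TT_def
proof (intro CollectI conjI allI impI)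
  show "E_pt n k I \<in> polys (Vall n k)"
    unfolding E_pt_def by (intro polys_prod polys_diff polys_Var) (auto simp: Gam_def Vzy_def)
  fix \<pi> \<rho> assume "\<pi> permutes {1..k} \<and> \<rho> permutes {1..n - k}"
  then show "psubst (permute_vars \<pi> \<rho> id) (E_pt n k I) = E_pt n k I"
    using prod_permutes[of \<pi> "{1..k}" "\<lambda>i. \<Prod>a\<in>{1..n} - I. Var (G1 i) - Var (Z a)"]
    by (simp add: E_pt_def)
qed

text \<open>Distinct subsets of equal size are not nested, so some a in J lies outside I; a variable
  \<gamma>_{1,i} restricts to z_a at x_J and kills the factor with this a. After division by
  \<open>den_pt\<close> the polynomial \<open>E_pt\<close> thus represents the idempotent of
  x_I.\<close>

lemma at_x_E_pt:
  assumes "J \<in> ksubsets n k" "I \<in> ksubsets n k" "J \<noteq> I"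
  shows "psubst (at_x n J) (E_pt n k I) = 0"
proof -
  note J = ksubsetsD[OF assms(1)] and I = ksubsetsD[OF assms(2)]
  have "\<not> J \<subseteq> I" using I J assms(3) card_subset_eq[of I J] by auto
  then obtain a where a: "a \<in> J" "a \<notin> I" by blast
  then have "a \<in> nth_elt J ` {1..k}"
    using bij_betw_imp_surj_on[OF bij_betw_nth_elt[of J]] J by simp
  then obtain i where i: "i \<in> {1..k}" "nth_elt J i = a" by blast
  have "(\<Prod>b\<in>{1..n} - I. Var (Z (nth_elt J i)) - Var (Z b)) = (0::cpoly)"
    using a J i by (intro prod_zero bexI[of _ a]) auto
  then have "(\<Prod>i\<in>{1..k}. \<Prod>b\<in>{1..n} - I. Var (Z (nth_elt J i)) - Var (Z b)) = (0::cpoly)"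
    by (rule prod_zero[OF finite_atLeastAtMost bexI, OF _ i(1)])
  then show ?thesis by (simp add: E_pt_def)
qed

lemma den_pt: 
  assumes "I \<in> ksubsets n k" shows "den_pt n k I \<noteq> 0" "den_pt n k I \<in> polys (Vzy n)"
proof -
  show "den_pt n k I \<noteq> 0"
    using nth_elt_in[of I] ksubsetsD[OF assms] by (auto simp: den_pt_def E_pt_def prod_zero_iff)
  show "den_pt n k I \<in> polys (Vzy n)"
    unfolding den_pt_def by (rule at_x_TT[OF assms E_pt_TT])
qed

lemma cls_sum_cong: "(\<And>x. x \<in> A \<Longrightarrow> TS.cls n k (f x) = TS.cls n k (g x)) \<Longrightarrow> TS.cls n k (sum f A) = TS.cls n k (sum g A)"
proof (induction A rule: infinite_finite_induct)
  case (insert x A)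
  have "TS.cls n k (f x + sum f A) = TS.cls n k (g x + sum g A)"
    by (rule TS.cls_cong_add) (use insert in auto)
  then show ?case using insert.hyps by simp
qed simp_all

lemma cls_hc_0: "x \<in> L_lam_zy n \<Longrightarrow> TS.cls n k (frag_of (hc n k 0, x)) = TS.cls n k 0"
  using TS.pure_add_left[of "hc n k 0" n k "hc n k 0" x] TT_0[of n k]
  by (simp add: H_T_mod_simps TS.cls_eq_iff) (metis TS.sub_uminus minus_minus)

lemma cls_hc_sum:
  assumes "finite A" "\<And>i. i \<in> A \<Longrightarrow> f i \<in> TT n k" "x \<in> L_lam_zy n"
  shows "TS.cls n k (frag_of (hc n k (sum f A), x)) = TS.cls n k (\<Sum>i\<in>A. frag_of (hc n k (f i), x))"
  using assms
proof (induction A rule: finite_induct)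
  case (insert i A)
  have s: "sum f A \<in> TT n k" "f i \<in> TT n k" using insert.prems by (auto intro: TT_sum)
  then have "TS.cls n k (frag_of (hc n k (f i + sum f A), x))
    = TS.cls n k (frag_of (hc n k (f i), x) + frag_of (hc n k (sum f A), x))"
    using TS.pure_add_left[of "hc n k (f i)" n k "hc n k (sum f A)" x] insert.prems(2)
    by (simp add: H_T_mod_simps)
  also have "\<dots> = TS.cls n k (frag_of (hc n k (f i), x) + (\<Sum>i\<in>A. frag_of (hc n k (f i), x)))"
    by (rule TS.cls_cong_add) (use insert in auto)
  finally show ?case using insert.hyps by simp
qed (simp add: cls_hc_0)

lemma cls_hc_0_right: "p \<in> TT n k \<Longrightarrow> TS.cls n k (frag_of (hc n k p, 0)) = TS.cls n k 0"
  using TS.pure_add_right[of "hc n k p" n k 0 0] L_0[of n]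
  by (simp add: H_T_mod_simps TS.cls_eq_iff) (metis TS.sub_uminus minus_minus)

lemma cls_hc_diff_right:
  assumes "p \<in> TT n k" "x \<in> L_lam_zy n" "x' \<in> L_lam_zy n"
  shows "TS.cls n k (frag_of (hc n k p, x - x')) = TS.cls n k (frag_of (hc n k p, x) - frag_of (hc n k p, x'))"
  using TS.pure_add_right[of "hc n k p" n k "x - x'" x'] assms L_diff[of x n x']
  by (simp add: H_T_mod_simps TS.cls_eq_iff) (metis (no_types, lifting) TS.sub_uminus add_diff_eq diff_diff_eq2 minus_diff_eq)

definition pt_expand :: "nat \<Rightarrow> nat \<Rightarrow> (nat set \<Rightarrow> ratf) \<Rightarrow> (cpoly set \<times> ratf \<Rightarrow>\<^sub>0 int)" where
  "pt_expand n k g = (\<Sum>I\<in>ksubsets n k. frag_of (hc n k (E_pt n k I), g I / to_fract (den_pt n k I)))"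

lemma pt_expand_frags: "(\<And>I. I \<in> ksubsets n k \<Longrightarrow> g I \<in> L_lam_zy n) \<Longrightarrow> pt_expand n k g \<in> TS.frags n k"
proof -
  assume g: "\<And>I. I \<in> ksubsets n k \<Longrightarrow> g I \<in> L_lam_zy n"
  have "finite A \<Longrightarrow> (\<And>I. I \<in> A \<Longrightarrow> f I \<in> TS.frags n k) \<Longrightarrow> sum f A \<in> TS.frags n k" for A and f :: "nat set \<Rightarrow> _"
    by (induction A rule: finite_induct) (auto intro: TS.frags_add)
  moreover have "frag_of (hc n k (E_pt n k I), g I / to_fract (den_pt n k I)) \<in> TS.frags n k"
    if "I \<in> ksubsets n k" for I
    using E_pt_TT g[OF that] den_pt[OF that]
    by (intro TS.frags_of) (auto simp: H_T_mod_simps divide_inverse intro!: L_mult L_inverse)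
  ultimately show ?thesis unfolding pt_expand_def by auto
qed

lemma Phi_pt_expand:
  assumes "J \<in> ksubsets n k" shows "Phi n J (pt_expand n k g) = g J"
proof -
  have "Phi n J (pt_expand n k g) = (\<Sum>I\<in>ksubsets n k. to_fract (psubst (at_x n J) (E_pt n k I)) * (g I / to_fract (den_pt n k I)))"
    by (simp add: pt_expand_def Phi_sum Phi_of[OF assms])
  also have "\<dots> = (\<Sum>I\<in>ksubsets n k. if I = J then g J else 0)"
    using den_pt(1)[OF assms] at_x_E_pt[OF assms] by (intro sum.cong) (auto simp: den_pt_def)
  finally show ?thesis using assms by (simp add: sum.delta)
qed

text \<open>Every tensor is the combination of the idempotents of the fixed points with its own
  restrictions as coefficients. Both sides are additive, so pure tensors decide; there the
  difference vanishes at all fixed points and is torsion by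
  \<open>fixed_points_vanish\<close>.\<close>

lemma cls_pt_expand:
  assumes n: "n \<ge> 1" and kn: "k \<le> n" and u: "u \<in> TS.frags n k"
  shows "TS.cls n k u = TS.cls n k (pt_expand n k (\<lambda>I. Phi n I u))"
  using u
proof (induction rule: TS.frags_induct)
  case zero
  have "TS.cls n k (pt_expand n k (\<lambda>I. Phi n I 0)) = TS.cls n k (\<Sum>I\<in>ksubsets n k. 0)"
    unfolding pt_expand_def by (rule cls_sum_cong) (simp add: cls_hc_0_right[OF E_pt_TT])
  then show ?case by simp
next
  case (diff u v)
  have PL: "Phi n I w / to_fract (den_pt n k I) \<in> L_lam_zy n" if "w \<in> TS.frags n k" "I \<in> ksubsets n k" for w I
    using res_in_L[of "TS.cls n k w" n k I] that den_pt[OF that(2)]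
    by (auto simp: H_T_L_T TS.carrier_T res_cls divide_inverse intro!: L_mult L_inverse)
  have "TS.cls n k (pt_expand n k (\<lambda>I. Phi n I (u - v))) =
    TS.cls n k (\<Sum>I\<in>ksubsets n k. frag_of (hc n k (E_pt n k I), Phi n I u / to_fract (den_pt n k I))
      - frag_of (hc n k (E_pt n k I), Phi n I v / to_fract (den_pt n k I)))"
    unfolding pt_expand_def Phi_diff diff_divide_distrib
    by (rule cls_sum_cong, rule cls_hc_diff_right) (use E_pt_TT PL diff in auto)
  also have "\<dots> = TS.cls n k (pt_expand n k (\<lambda>I. Phi n I u) - pt_expand n k (\<lambda>I. Phi n I v))"
    by (simp add: pt_expand_def sum_subtractf)
  finally show ?case using TS.cls_cong_diff[OF diff(3,4)] by simp
next
  case (of A x)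
  then obtain p where p: "A = hc n k p" "p \<in> TT n k" and x: "x \<in> L_lam_zy n" by (auto simp: H_T_mod_simps)
  let ?K = "ksubsets n k"
  define D where "D = (\<Prod>I\<in>?K. den_pt n k I)"
  define DI where "DI I = (\<Prod>I\<in>?K - {I}. den_pt n k I)" for I
  \<comment> \<open>The difference of p and its expansion, multiplied by the product D of all
    \<open>den_pt\<close> so that it is a polynomial.\<close>
  define f where "f = D * p - (\<Sum>I\<in>?K. (DI I * psubst (at_x n I) p) * E_pt n k I)"
  have D: "D \<in> polys (Vzy n)" "D \<noteq> 0"
    unfolding D_def using den_pt by (auto intro!: polys_prod)
  have DI: "DI I \<in> polys (Vzy n)" for I
    unfolding DI_def using den_pt by (auto intro!: polys_prod)
  have DDI: "D = den_pt n k I * DI I" if "I \<in> ?K" for I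
    unfolding D_def DI_def using that by (subst prod.remove[of _ I]) auto
  have cI: "DI I * psubst (at_x n I) p \<in> polys (Vzy n)" if "I \<in> ?K" for I
    using DI at_x_TT[OF that p(2)] by blast
  have fT: "f \<in> TT n k"
    unfolding f_def
    by (rule TT_diff, rule TT_mult[OF subsetD[OF C_zy_TT D(1)] p(2)], rule TT_sum,
        rule TT_mult[OF subsetD[OF C_zy_TT cI] E_pt_TT])
  have "psubst (at_x n J) f = 0" if J: "J \<in> ?K" for J
  proof -
    have "(\<Sum>I\<in>?K. (DI I * psubst (at_x n I) p) * psubst (at_x n J) (E_pt n k I))
      = (\<Sum>I\<in>?K. if I = J then D * psubst (at_x n J) p else 0)"
      using at_x_E_pt[OF J] DDI[OF J] by (intro sum.cong) (auto simp: den_pt_def)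
    also have "\<dots> = D * psubst (at_x n J) p" using J by (simp add: sum.delta)
    finally show ?thesis
      unfolding f_def psubst_diff psubst_sum psubst_mult at_x_C_zy[OF D(1)]
      using cI at_x_C_zy[OF cI, of _ J] by simp
  qed
  then obtain c where c: "c \<in> polys (Vzy n)" "c \<noteq> 0" "c * f \<in> J_T n k"
    using fixed_points_vanish[OF n kn fT] by blast
  have eq: "hc n k ((c * D) * p) = hc n k (\<Sum>I\<in>?K. (c * (DI I * psubst (at_x n I) p)) * E_pt n k I)"
    unfolding hc_eq_iff using c(3) by (simp add: f_def right_diff_distrib sum_distrib_left mult.assoc)
  have cD: "c * D \<in> polys (Vzy n)" "c * D \<noteq> 0" using c D by auto
  \<comment> \<open>Dividing the scalar by c D lets this factor move across the tensor sign to p,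
    where c f lies in \<open>J_T\<close>.\<close>
  define x' where "x' = x / to_fract (c * D)"
  have x': "x' \<in> L_lam_zy n" unfolding x'_def divide_inverse using x cD by (intro L_mult L_inverse)
  have xx: "x = to_fract (c * D) * x'" unfolding x'_def using cD(2) by (simp del: to_fract_mult)
  have "TS.cls n k (frag_of (A, x)) = TS.cls n k (frag_of ((c * D) \<odot>\<^bsub>H_T_mod n k\<^esub> hc n k p, x'))"
    using TS.pure_smult[of "c * D" n "hc n k p" k x'] cD x' p xx by (simp add: H_T_mod_simps)
  also have "\<dots> = TS.cls n k (frag_of (hc n k (\<Sum>I\<in>?K. (c * (DI I * psubst (at_x n I) p)) * E_pt n k I), x'))"
    using H_T_mod_simps(3)[OF subsetD[OF C_zy_TT cD(1)] p(2)] eq by simp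
  also have "\<dots> = TS.cls n k (\<Sum>I\<in>?K. frag_of (hc n k ((c * (DI I * psubst (at_x n I) p)) * E_pt n k I), x'))"
    by (rule cls_hc_sum[OF finite_ksubsets TT_mult[OF subsetD[OF C_zy_TT polys_mult[OF c(1) cI]] E_pt_TT] x'])
  also have "\<dots> = TS.cls n k (pt_expand n k (\<lambda>I. Phi n I (frag_of (A, x))))"
    unfolding pt_expand_def
  proof (rule cls_sum_cong)
    fix I assume I: "I \<in> ?K"
    let ?r = "c * (DI I * psubst (at_x n I) p)"
    have r: "?r \<in> polys (Vzy n)" using c(1) cI[OF I] by blast
    have "TS.cls n k (frag_of (hc n k (?r * E_pt n k I), x')) = TS.cls n k (frag_of (hc n k (E_pt n k I), to_fract ?r * x'))"
      using TS.pure_smult[of ?r n "hc n k (E_pt n k I)" k x'] H_T_mod_simps(3)[OF subsetD[OF C_zy_TT r] E_pt_TT]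
        r x' E_pt_TT by (simp add: H_T_mod_simps(1))
    also have "to_fract ?r * x' = Phi n I (frag_of (A, x)) / to_fract (den_pt n k I)"
      using cD(2) den_pt(1)[OF I] by (simp add: x'_def p(1) Phi_of[OF I] DDI[OF I] field_simps)
    finally show "TS.cls n k (frag_of (hc n k (?r * E_pt n k I), x')) =
      TS.cls n k (frag_of (hc n k (E_pt n k I), Phi n I (frag_of (A, x)) / to_fract (den_pt n k I)))" .
  qed
  finally show ?case .
qed

lemma res_inj:
  assumes n: "n \<ge> 1" and kn: "k \<le> n" and X: "X \<in> carrier (H_T_L n k)" "X' \<in> carrier (H_T_L n k)"
    and eq: "\<And>J. J \<in> ksubsets n k \<Longrightarrow> res n J X = res n J X'"
  shows "X = X'"
proof -
  obtain u where u: "u \<in> TS.frags n k" "X = TS.cls n k u" using X(1) by (rule H_T_L_cases)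
  obtain v where v: "v \<in> TS.frags n k" "X' = TS.cls n k v" using X(2) by (rule H_T_L_cases)
  have "Phi n I u = Phi n I v" if "I \<in> ksubsets n k" for I
    using eq[OF that] u v res_cls[OF that] by simp
  then have "pt_expand n k (\<lambda>I. Phi n I u) = pt_expand n k (\<lambda>I. Phi n I v)"
    unfolding pt_expand_def by (intro sum.cong) auto
  then show ?thesis using cls_pt_expand[OF n kn] u v by metis
qed

lemma res_surj:
  assumes "\<And>J. J \<in> ksubsets n k \<Longrightarrow> g J \<in> L_lam_zy n"
  shows "\<exists>X\<in>carrier (H_T_L n k). \<forall>J\<in>ksubsets n k. res n J X = g J"
  using pt_expand_frags[of n k g] assms Phi_pt_expand[of _ n k g] res_cls
  by (intro bexI[of _ "TS.cls n k (pt_expand n k g)"]) (auto simp: H_T_L_T TS.carrier_T)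


section \<open>The subspace of symmetric classes\<close>

definition GL_part :: "nat \<Rightarrow> nat \<Rightarrow> coh set" where
  "GL_part n k = generate (add_monoid (H_T_L n k))
     {pure_tensor (C_zy n) (H_T_mod n k) (L_mod n) (GL_to_T n k A) (l * q) | A l q.
        A \<in> carrier (H_GL n k) \<and> l \<in> L_lam_y \<and> q \<in> Laurent_y}"

definition equivariant :: "nat \<Rightarrow> nat \<Rightarrow> (nat set \<Rightarrow> ratf) \<Rightarrow> bool" where
  "equivariant n k g \<longleftrightarrow> (\<forall>\<tau> J. \<tau> permutes {1..n} \<longrightarrow> J \<in> ksubsets n k \<longrightarrow> g (\<tau> ` J) = rs \<tau> (g J))"

lemma GL_gens: "{pure_tensor (C_zy n) (H_T_mod n k) (L_mod n) (GL_to_T n k A) (l * q) | A l q.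
        A \<in> carrier (H_GL n k) \<and> l \<in> L_lam_y \<and> q \<in> Laurent_y}
  = {TS.cls n k (frag_of (hc n k p, l * q)) | p l q. p \<in> GG n k \<and> l \<in> L_lam_y \<and> q \<in> Laurent_y}" (is "?L = ?R")
proof (rule equalityI; rule subsetI)
  fix X assume "X \<in> ?L"
  then obtain A l q where *: "X = TS.cls n k (frag_of (GL_to_T n k A, l * q))" "A \<in> carrier (H_GL n k)"
    "l \<in> L_lam_y" "q \<in> Laurent_y" unfolding TS.pure_T by blast
  then obtain p where "p \<in> GG n k" "A = J_GL n k +>\<^bsub>inv_GL n k\<^esub> p" unfolding carrier_H_GL by blast
  with * show "X \<in> ?R" using GL_to_T_coset[of p n k] by auto
next
  fix X assume "X \<in> ?R"
  then obtain p l q where *: "X = TS.cls n k (frag_of (hc n k p, l * q))" "p \<in> GG n k"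
    "l \<in> L_lam_y" "q \<in> Laurent_y" by blast
  then have "X = TS.cls n k (frag_of (GL_to_T n k (J_GL n k +>\<^bsub>inv_GL n k\<^esub> p), l * q))"
    using GL_to_T_coset[of p n k] by simp
  moreover have "J_GL n k +>\<^bsub>inv_GL n k\<^esub> p \<in> carrier (H_GL n k)" using *(2) unfolding carrier_H_GL by blast
  ultimately show "X \<in> ?L" using * unfolding TS.pure_T by blast
qed

lemma Pol_mult: "x \<in> Pol n \<Longrightarrow> y \<in> Pol n \<Longrightarrow> x * y \<in> Pol n"
  using comm_subring.mult_mem[OF field_subring.axioms[OF Pol_subring]] .

lemma Pol_diff: "x \<in> Pol n \<Longrightarrow> y \<in> Pol n \<Longrightarrow> x - y \<in> Pol n"
  using comm_subring.diff_mem[OF field_subring.axioms[OF Pol_subring]] .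

lemma lq_in_L: "l \<in> L_lam_y \<Longrightarrow> q \<in> Laurent_y \<Longrightarrow> l * q \<in> Pol n"
  using L_lam_y_le_Pol[of n] Laurent_y_le_Pol[of n] by (intro Pol_mult) auto

lemma image_ksubsets:
  assumes "\<tau> permutes {1..n}" "J \<in> ksubsets n k"
  shows "\<tau> ` J \<in> ksubsets n k"
  using assms permutes_image[OF assms(1)] card_image[OF inj_on_subset[OF permutes_inj_on[OF assms(1), of UNIV]], of J]
  by (auto simp: ksubsets_def)

text \<open>The permutation \<tau> moves x_J to the fixed point of \<tau>(J) but does not respect
  the increasing enumerations of the two sets and their complements; \<pi> and \<rho> repair this,
  and p is invariant under all three.\<close>

lemma GG_at_x:
  assumes p: "p \<in> GG n k" and \<tau>: "\<tau> permutes {1..n}" and J: "J \<in> ksubsets n k"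
  shows "psubst (at_x n (\<tau> ` J)) p = zsub \<tau> (psubst (at_x n J) p)"
proof -
  note J' = ksubsetsD[OF J] and tJ = image_ksubsets[OF \<tau> J]
  have inj: "inj_on \<tau> A" for A using permutes_inj_on[OF \<tau>] .
  have c: "{1..n} - \<tau> ` J = \<tau> ` ({1..n} - J)"
    using J' permutes_image[OF \<tau>] image_set_diff[OF permutes_inj[OF \<tau>], of "{1..n}" J] by simp
  have b1: "bij_betw (nth_elt J) {1..k} J" and b2: "bij_betw (nth_elt ({1..n} - J)) {1..n - k} ({1..n} - J)"
    using bij_betw_nth_elt[of J] bij_betw_nth_elt[of "{1..n} - J"] card_compl_ksubsets[OF J] J' by auto
  have e1: "bij_betw (nth_elt (\<tau> ` J)) {1..k} (\<tau> ` J)"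
    using bij_betw_nth_elt[of "\<tau> ` J"] ksubsetsD[OF tJ] by auto
  have e2: "bij_betw (nth_elt ({1..n} - \<tau> ` J)) {1..n - k} ({1..n} - \<tau> ` J)"
    using bij_betw_nth_elt[of "{1..n} - \<tau> ` J"] card_compl_ksubsets[OF tJ] by auto
  have h1: "bij_betw (\<tau> \<circ> nth_elt J) {1..k} (\<tau> ` J)"
    using b1 inj_on_imp_bij_betw[OF inj[of J]] by (rule bij_betw_trans)
  have h2: "bij_betw (\<tau> \<circ> nth_elt ({1..n} - J)) {1..n - k} ({1..n} - \<tau> ` J)"
    unfolding c using b2 inj_on_imp_bij_betw[OF inj[of "{1..n} - J"]] by (rule bij_betw_trans)
  obtain \<pi> where \<pi>: "\<pi> permutes {1..k}" "\<forall>r\<in>{1..k}. nth_elt (\<tau> ` J) (\<pi> r) = (\<tau> \<circ> nth_elt J) r"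
    using ex_permutes[OF h1 e1] by blast
  obtain \<rho> where \<rho>: "\<rho> permutes {1..n - k}"
    "\<forall>r\<in>{1..n - k}. nth_elt ({1..n} - \<tau> ` J) (\<rho> r) = (\<tau> \<circ> nth_elt ({1..n} - J)) r"
    using ex_permutes[OF h2 e2] by blast
  have "psubst (at_x n (\<tau> ` J)) p = psubst (at_x n (\<tau> ` J)) (psubst (permute_vars \<pi> \<rho> \<tau>) p)"
    using p \<pi> \<rho> \<tau> by (simp add: GG_def)
  also have "\<dots> = zsub \<tau> (psubst (at_x n J) p)"
    unfolding psubst_psubst
  proof (rule psubst_cong)
    show "p \<in> polys (Vall n k)" using p by (simp add: GG_def)
    fix v assume "v \<in> Vall n k"
    then show "psubst (at_x n (\<tau> ` J)) (permute_vars \<pi> \<rho> \<tau> v) = zsub \<tau> (at_x n J v)"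
      using \<pi> \<rho> by (cases v) (auto simp: Gam_def Vzy_def)
  qed
  finally show ?thesis .
qed

lemma rs_fix_loc:
  assumes "x \<in> loc {Lam, Y} D" "D \<subseteq> polys {Lam, Y}" "0 \<notin> D"
  shows "rs \<tau> x = x"
proof -
  obtain f ls where *: "x = Fract f (prod_list ls)" "f \<in> polys {Lam, Y}" "set ls \<subseteq> D"
    using assms(1) by (auto simp: loc_def)
  have g: "prod_list ls \<in> polys {Lam, Y}" using * assms(2) by (intro polys_prod_list) auto
  have fx: "zsub \<tau> p = p" if "p \<in> polys {Lam, Y}" for p
    by (rule psubst_eq_self[OF that]) auto
  have "zsub \<tau> (prod_list ls) \<noteq> 0" unfolding fx[OF g] using prod_list_nonzero[OF assms(3) *(3)] .
  then show ?thesis unfolding *(1) using fx[OF g] fx[OF *(2)] by (simp add: rsub_Fract del: psubst_prod_list)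
qed

lemma lam_forms_polys: "lam_forms \<subseteq> polys {Lam, Y}"
  by (auto simp: lam_forms_def intro!: polys_Var polys_add polys_mult)

lemma rs_L_lam_y: "l \<in> L_lam_y \<Longrightarrow> rs \<tau> l = l"
  using rs_fix_loc[of l lam_forms \<tau>] lam_forms_polys forms_nonzero by (auto simp: L_lam_y_loc)

lemma rs_Laurent_y: 
  assumes "q \<in> Laurent_y" shows "rs \<tau> q = q"
proof -
  obtain f m where *: "q = Fract f (Var Y ^ m)" "f \<in> polys {Y}" using assms by (auto simp: Laurent_y_def)
  have "Fract f (prod_list (replicate m (Var Y))) \<in> loc {Lam, Y} {Var Y}"
    using *(2) polys_mono[of "{Y}" "{Lam, Y}"] by (intro locI) auto
  then have "q \<in> loc {Lam, Y} {Var Y}" using *(1) by simp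
  then show ?thesis by (rule rs_fix_loc) (auto simp: polys_Var eq_commute[of 0])
qed

lemma GG_TT: "p \<in> GG n k \<Longrightarrow> p \<in> TT n k"
  using GG_le_TT by blast

lemma GL_part_D:
  assumes "X \<in> GL_part n k"
  shows "X \<in> carrier (H_T_L n k) \<and> (\<forall>J\<in>ksubsets n k. res n J X \<in> Pol n) \<and> equivariant n k (\<lambda>J. res n J X)"
proof -
  define Q where "Q u \<longleftrightarrow> u \<in> TS.frags n k \<and> (\<forall>J\<in>ksubsets n k. Phi n J u \<in> Pol n) \<and> equivariant n k (\<lambda>J. Phi n J u)" for u
  have Q0: "Q 0"
    using comm_subring.zero_mem[OF field_subring.axioms[OF Pol_subring]] by (auto simp: Q_def equivariant_def)
  have Qdiff: "Q (u - v)" if "Q u" "Q v" for u v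
    unfolding Q_def
  proof (intro conjI ballI)
    show "u - v \<in> TS.frags n k" using that by (auto simp: Q_def intro: TS.frags_diff)
    show "Phi n J (u - v) \<in> Pol n" if "J \<in> ksubsets n k" for J
      using that \<open>Q u\<close> \<open>Q v\<close> by (auto simp: Q_def Phi_diff intro: Pol_diff)
    show "equivariant n k (\<lambda>J. Phi n J (u - v))"
      using that by (auto simp: Q_def equivariant_def Phi_diff permutes_bij)
  qed
  have Qg: "Q (frag_of (hc n k p, l * q))" if p: "p \<in> GG n k" and lq: "l \<in> L_lam_y" "q \<in> Laurent_y" for p l q
    unfolding Q_def
  proof (intro conjI ballI)
    show "frag_of (hc n k p, l * q) \<in> TS.frags n k"
      using GG_TT[OF p] lq_in_L[OF lq] Pol_le_L by (intro TS.frags_of) (auto simp: H_T_mod_simps(1))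
    show "Phi n J (frag_of (hc n k p, l * q)) \<in> Pol n" if J: "J \<in> ksubsets n k" for J
    proof -
      have "psubst (at_x n J) p \<in> polys (Vlzy n)"
        using at_x_TT[OF J GG_TT[OF p]] polys_mono[of "Vzy n" "Vlzy n"] by auto
      then show ?thesis unfolding Phi_of[OF J]
        by (intro Pol_mult lq_in_L[OF lq]) (auto simp: Pol_def intro: to_fract_in_loc)
    qed
    show "equivariant n k (\<lambda>J. Phi n J (frag_of (hc n k p, l * q)))"
      unfolding equivariant_def
    proof (intro allI impI)
      fix \<tau> J assume \<tau>: "\<tau> permutes {1..n}" and J: "J \<in> ksubsets n k"
      have b: "bij \<tau>" using \<tau> by (rule permutes_bij)
      show "Phi n (\<tau> ` J) (frag_of (hc n k p, l * q)) = rs \<tau> (Phi n J (frag_of (hc n k p, l * q)))"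
        unfolding Phi_of[OF J] Phi_of[OF image_ksubsets[OF \<tau> J]] GG_at_x[OF p \<tau> J]
        using b by (simp add: rs_L_lam_y[OF lq(1)] rs_Laurent_y[OF lq(2)])
    qed
  qed
  have "\<exists>u. X = TS.cls n k u \<and> Q u"
    using assms unfolding GL_part_def GL_gens
  proof (induction rule: generate.induct)
    case one
    show ?case using Q0 by (auto simp: H_T_L_T TS.zero_T)
  next
    case (incl h)
    then show ?case using Qg by blast
  next
    case (inv h)
    then obtain p l q where *: "h = TS.cls n k (frag_of (hc n k p, l * q))" "Q (frag_of (hc n k p, l * q))"
      using Qg by blast
    then have "inv\<^bsub>add_monoid (H_T_L n k)\<^esub> h = TS.cls n k (0 - frag_of (hc n k p, l * q))"
      unfolding H_T_L_T by (simp add: TS.inv_T_cls Q_def)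
    then show ?case using Qdiff[OF Q0 *(2)] by blast
  next
    case (eng h1 h2)
    then obtain u v where *: "h1 = TS.cls n k u" "Q u" "h2 = TS.cls n k v" "Q v" by blast
    have "h1 \<otimes>\<^bsub>add_monoid (H_T_L n k)\<^esub> h2 = TS.cls n k (u - (0 - v))"
      by (simp add: * H_T_L_T TS.add_T)
    then show ?case using Qdiff[OF *(2) Qdiff[OF Q0 *(4)]] by blast
  qed
  then obtain u where u: "X = TS.cls n k u" "Q u" by blast
  have "equivariant n k (\<lambda>J. res n J X)"
    using u(2) unfolding u(1) Q_def equivariant_def by (auto simp: res_cls image_ksubsets)
  then show ?thesis using u by (auto simp: H_T_L_T TS.carrier_T Q_def res_cls)
qed

section \<open>From equivariant families back to classes\<close>

lemma GL_part_sum: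
  assumes "finite A" "\<And>i. i \<in> A \<Longrightarrow> TS.cls n k (f i) \<in> GL_part n k"
  shows "TS.cls n k (sum f A) \<in> GL_part n k"
  using assms
proof (induction A rule: finite_induct)
  case empty
  show ?case using generate.one[of "add_monoid (H_T_L n k)"] by (simp add: GL_part_def H_T_L_T TS.zero_T)
next
  case (insert i A)
  then have "TS.cls n k (f i) \<otimes>\<^bsub>add_monoid (H_T_L n k)\<^esub> TS.cls n k (sum f A) \<in> GL_part n k"
    unfolding GL_part_def by (intro generate.eng) auto
  then show ?case using insert.hyps by (simp add: H_T_L_T TS.add_T)
qed

text \<open>Separates the two kinds of scalars allowed in the generators of the subspace: forms
  \<lambda> + l y go to l, powers of y to q.\<close>

lemma inverse_denominator:
  assumes "set ds \<subseteq> insert (Var Y) lam_forms"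
  shows "\<exists>l\<in>L_lam_y. \<exists>q\<in>Laurent_y. inverse (to_fract (prod_list ds)) = l * q"
  using assms
proof (induction ds)
  case Nil
  have "1 \<in> L_lam_y" using comm_subring.one_mem[OF field_subring.axioms[OF L_lam_y_subring]] .
  moreover have "1 \<in> Laurent_y" unfolding Laurent_y_def
    by (intro CollectI exI[of _ 1] exI[of _ 0]) (simp add: One_fract_def)
  ultimately show ?case by (intro bexI[of _ 1]) auto
next
  case (Cons d ds)
  then obtain l q where lq: "l \<in> L_lam_y" "q \<in> Laurent_y" "inverse (to_fract (prod_list ds)) = l * q"
    by (meson list.set_intros(2) set_ConsD subset_code(1))
  show ?case
  proof (cases "d \<in> lam_forms")
    case True
    then have "inverse (to_fract d) * l \<in> L_lam_y"
      using comm_subring.mult_mem[OF field_subring.axioms[OF L_lam_y_subring] _ lq(1)]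
      by (auto simp: L_lam_y_loc intro: inverse_in_loc)
    then show ?thesis using lq by (intro bexI[of _ "inverse (to_fract d) * l"] bexI[of _ q]) auto
  next
    case False
    then have d: "d = Var Y" using Cons.prems by auto
    obtain f m where f: "q = Fract f (Var Y ^ m)" "f \<in> polys {Y}" using lq(2) by (auto simp: Laurent_y_def)
    have "inverse (to_fract (Var Y)) * q = Fract f (Var Y ^ Suc m)"
      by (simp add: f(1) to_fract_def)
    then have "inverse (to_fract d) * q \<in> Laurent_y" using f(2) d unfolding Laurent_y_def by blast
    then show ?thesis using lq by (intro bexI[of _ l] bexI[of _ "inverse (to_fract d) * q"]) auto
  qed
qed

text \<open>The symmetric group is transitive on the fixed points of one component, so an
  equivariant family is determined by any one of its members.\<close>

lemma ex_permutes_image: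
  assumes "J \<in> ksubsets n k" "J' \<in> ksubsets n k"
  shows "\<exists>\<tau>. \<tau> permutes {1..n} \<and> \<tau> ` J = J'"
proof -
  note J = ksubsetsD[OF assms(1)] and J' = ksubsetsD[OF assms(2)]
  obtain f where f: "bij_betw f J J'" using J J' by (metis finite_same_card_bij)
  have "card ({1..n} - J) = card ({1..n} - J')" using card_compl_ksubsets[OF assms(1)] card_compl_ksubsets[OF assms(2)] by simp
  then obtain g where g: "bij_betw g ({1..n} - J) ({1..n} - J')"
    by (metis finite_Diff finite_atLeastAtMost finite_same_card_bij)
  let ?t = "\<lambda>i. if i \<in> J then f i else if i \<in> {1..n} then g i else i"
  have 1: "bij_betw ?t J J'" using f by (rule bij_betw_cong[THEN iffD1, rotated]) auto
  have 2: "bij_betw ?t ({1..n} - J) ({1..n} - J')" using g by (rule bij_betw_cong[THEN iffD1, rotated]) auto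
  have "bij_betw ?t (J \<union> ({1..n} - J)) (J' \<union> ({1..n} - J'))"
    by (rule bij_betw_combine[OF 1 2]) auto
  moreover have "J \<union> ({1..n} - J) = {1..n}" "J' \<union> ({1..n} - J') = {1..n}" using J J' by auto
  ultimately have "?t permutes {1..n}" using J by (intro bij_imp_permutes) auto
  moreover have "?t ` J = J'" using 1 by (simp add: bij_betw_def)
  ultimately show ?thesis by blast
qed

text \<open>Moves the parameters \<open>z\<close> at the fixed point $x_{[k]}$ back to the variables $\gamma$.\<close>

fun lift :: "nat \<Rightarrow> var \<Rightarrow> cpoly" where
  "lift k (Z a) = (if a \<le> k then Var (G1 a) else Var (G2 (a - k)))"
| "lift k v = Var v"

lemma nth_elt_initial: "a \<in> {1..k} \<Longrightarrow> nth_elt {1..k} a = a"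
proof -
  assume a: "a \<in> {1..k}"
  have "sorted_list_of_set {1..k} = [1..<Suc k]"
    by (metis atLeastLessThanSuc_atLeastAtMost sorted_list_of_set_range)
  then show ?thesis using a by (simp add: nth_elt_def del: upt_Suc)
qed

lemma nth_elt_final: "k < a \<Longrightarrow> a \<le> n \<Longrightarrow> nth_elt ({1..n} - {1..k}) (a - k) = a"
proof -
  assume a: "k < a" "a \<le> n"
  have "{1..n} - {1..k} = {Suc k..<Suc n}" by auto
  then have "sorted_list_of_set ({1..n} - {1..k}) = [Suc k..<Suc n]"
    by (metis sorted_list_of_set_range)
  then show ?thesis using a by (simp add: nth_elt_def del: upt_Suc)
qed

lemma initial_ksubset: "k \<le> n \<Longrightarrow> {1..k} \<in> ksubsets n k"
  by (auto simp: ksubsets_def)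

lemma avg_polys:
  assumes "q \<in> polys (insert Y (Gam n k))" shows "avg n k q \<in> polys (insert Y (Gam n k))"
  unfolding avg_def
proof (intro polys_mult polys_sum polys_Cst polys_psubst[OF assms])
  fix \<pi> \<rho> v assume *: "\<pi> \<in> {\<pi>. \<pi> permutes {1..k}}" "\<rho> \<in> {\<rho>. \<rho> permutes {1..n - k}}" "v \<in> insert Y (Gam n k)"
  then show "permute_vars \<pi> \<rho> id v \<in> polys (insert Y (Gam n k))"
    using permutes_in_image[of \<pi> "{1..k}"] permutes_in_image[of \<rho> "{1..n - k}"]
    by (cases v) (auto simp: Gam_def intro!: polys_Var)
qed

text \<open>A polynomial without z is fixed by the permutations of z, so averaging over S_k x
  S_{n-k} already makes it invariant under all three groups.\<close>

lemma avg_GG: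
  assumes "q \<in> polys (insert Y (Gam n k))" shows "avg n k q \<in> GG n k"
proof -
  have "q \<in> polys (Vall n k)" using assms polys_mono[of "insert Y (Gam n k)" "Vall n k"] by (auto simp: Vzy_def)
  then have T: "avg n k q \<in> TT n k" by (rule avg_TT)
  have "psubst (permute_vars \<pi> \<rho> \<tau>) (avg n k q) = psubst (permute_vars \<pi> \<rho> id) (avg n k q)" for \<pi> \<rho> \<tau>
    by (rule psubst_cong[OF avg_polys[OF assms]]) (auto simp: Gam_def)
  note eq = this
  show ?thesis
    unfolding GG_def
  proof (intro CollectI conjI allI impI)
    show "avg n k q \<in> polys (Vall n k)" using T by (simp add: TT_def)
    fix \<pi> \<rho> \<tau> assume "\<pi> permutes {1..k} \<and> \<rho> permutes {1..n - k} \<and> \<tau> permutes {1..n}"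
    then show "psubst (permute_vars \<pi> \<rho> \<tau>) (avg n k q) = avg n k q"
      using T by (subst eq) (simp add: TT_def)
  qed
qed

lemma to_fract_sum: "to_fract (sum f A) = (\<Sum>x\<in>A. to_fract (f x))"
  by (induction A rule: infinite_finite_induct) auto

text \<open>The converse of \<open>GL_part_D\<close>. The denominator at x_[k] is free of z, so the
  stabilizer of [k] fixes the numerator F. Read with \<gamma> in place of z, F yields elements of
  \<open>GG\<close>; the class built from them has the right restriction at x_[k], and equivariance
  extends this to every x_J.\<close>

lemma GL_part_I:
  assumes n: "n \<ge> 1" and kn: "k \<le> n" and X: "X \<in> carrier (H_T_L n k)"
    and P: "\<And>J. J \<in> ksubsets n k \<Longrightarrow> res n J X \<in> Pol n" and eqv: "equivariant n k (\<lambda>J. res n J X)"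
  shows "X \<in> GL_part n k"
proof -
  let ?J = "{1..k}"
  note J0 = initial_ksubset[OF kn]
  obtain F ds where F: "res n ?J X = Fract F (prod_list ds)" "F \<in> polys (Vlzy n)" "set ds \<subseteq> insert (Var Y) lam_forms"
    using P[OF J0] by (auto simp: Pol_def loc_def)
  define D where "D = prod_list ds"
  have Dnz: "D \<noteq> 0" unfolding D_def using prod_list_nonzero[OF forms_nonzero(1) F(3)] .
  have Dp: "D \<in> polys {Lam, Y}"
    unfolding D_def using F(3) lam_forms_polys by (intro polys_prod_list) (auto intro: polys_Var)
  have Dfix: "zsub \<tau> D = D" for \<tau> by (rule psubst_eq_self[OF Dp]) auto
  have Fsym: "zsub \<tau> F = F" if \<tau>: "\<tau> permutes {1..n}" "\<tau> ` ?J = ?J" for \<tau>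
  proof -
    have "res n ?J X = rs \<tau> (res n ?J X)"
      using eqv \<tau> J0 unfolding equivariant_def by metis
    also have "\<dots> = Fract (zsub \<tau> F) D"
      unfolding F(1) D_def[symmetric] using Dnz Dfix by (simp add: rsub_Fract)
    finally show ?thesis using F(1) Dnz by (simp add: D_def[symmetric] eq_fract)
  qed
  define F' where "F' = psubst (lift k) F"
  have F'p: "F' \<in> polys (insert Lam (insert Y (Gam n k)))"
    unfolding F'_def
  proof (rule polys_psubst[OF F(2)])
    fix v assume "v \<in> Vlzy n"
    then consider a where "v = Z a" "a \<in> {1..n}" | "v = Lam" | "v = Y" by (auto simp: Vzy_def)
    then show "lift k v \<in> polys (insert Lam (insert Y (Gam n k)))"
    proof cases
      case (1 a)
      have "G1 a \<in> Gam n k" if "a \<le> k" using that 1(2) by (auto simp: Gam_def)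
      moreover have "G2 (a - k) \<in> Gam n k" if "\<not> a \<le> k"
        unfolding Gam_def using that 1(2) by (intro UnI2 imageI) auto
      ultimately show ?thesis using 1 by (auto intro: polys_Var)
    qed (auto intro: polys_Var)
  qed
  have F'sym: "sym_inv n k F'"
    unfolding sym_inv_def
  proof (intro allI impI)
    fix \<pi> \<rho> assume *: "\<pi> permutes {1..k} \<and> \<rho> permutes {1..n - k}"
    \<comment> \<open>The block permutation acting as \<pi> on the first k indices and as \<rho>,
      shifted by k, on the others. It fixes [k], and \<open>lift\<close> carries it to the pair
      (\<pi>, \<rho>) acting on \<gamma>.\<close>
    define \<tau> where "\<tau> a = (if a \<in> {1..k} then \<pi> a else if a \<in> {1..n} then k + \<rho> (a - k) else a)" for a
    have b1: "bij_betw \<tau> {1..k} {1..k}"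
      using * by (intro bij_betw_cong[THEN iffD1, rotated, OF permutes_imp_bij[of \<pi>]]) (auto simp: \<tau>_def)
    have m1: "bij_betw (\<lambda>a. a - k) ({1..n} - {1..k}) {1..n - k}"
      by (rule bij_betw_byWitness[of _ "\<lambda>a. a + k"]) auto
    have m2: "bij_betw (\<lambda>a. k + a) {1..n - k} ({1..n} - {1..k})"
      by (rule bij_betw_byWitness[of _ "\<lambda>a. a - k"]) auto
    have "bij_betw ((\<lambda>a. k + a) \<circ> (\<rho> \<circ> (\<lambda>a. a - k))) ({1..n} - {1..k}) ({1..n} - {1..k})"
      using bij_betw_trans[OF bij_betw_trans[OF m1 permutes_imp_bij] m2] * by blast
    then have b2: "bij_betw \<tau> ({1..n} - {1..k}) ({1..n} - {1..k})"
      by (rule bij_betw_cong[THEN iffD1, rotated]) (auto simp: \<tau>_def)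
    have "bij_betw \<tau> ({1..k} \<union> ({1..n} - {1..k})) ({1..k} \<union> ({1..n} - {1..k}))"
      by (rule bij_betw_combine[OF b1 b2]) auto
    moreover have "{1..k} \<union> ({1..n} - {1..k}) = {1..n}" using kn by auto
    ultimately have "\<tau> permutes {1..n}" using kn by (intro bij_imp_permutes) (auto simp: \<tau>_def)
    moreover have "\<tau> ` ?J = ?J" using b1 by (simp add: bij_betw_def)
    ultimately have "zsub \<tau> F = F" by (rule Fsym)
    then have "F' = psubst (lift k) (zsub \<tau> F)" by (simp add: F'_def)
    also have "\<dots> = psubst (permute_vars \<pi> \<rho> id) F'"
      unfolding F'_def psubst_psubst
    proof (rule psubst_cong[OF F(2)])
      fix v assume v: "v \<in> Vlzy n"
      show "psubst (lift k) (permute_vars id id \<tau> v) = psubst (permute_vars \<pi> \<rho> id) (lift k v)"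
      proof (cases v)
        case (Z a)
        with v have a: "a \<in> {1..n}" by (auto simp: Vzy_def)
        show ?thesis
        proof (cases "a \<le> k")
          case True
          then have "\<pi> a \<in> {1..k}" using a * permutes_in_image[of \<pi> "{1..k}" a] by simp
          then show ?thesis using a True Z by (simp add: \<tau>_def)
        next
          case False
          then have "a - k \<in> {1..n - k}" using a by auto
          then have "\<rho> (a - k) \<in> {1..n - k}" using * permutes_in_image[of \<rho> "{1..n - k}" "a - k"] by blast
          then show ?thesis using a False Z by (simp add: \<tau>_def)
        qed
      qed (use v in \<open>auto simp: Vzy_def\<close>)
    qed
    finally show "psubst (permute_vars \<pi> \<rho> id) F' = F'" ..
  qed
  \<comment> \<open>Each monomial of F' is split into \<open>q m\<close> and a power of \<lambda>:
    \<lambda> belongs to the scalars, whereas \<open>q m\<close>, in y and the \<gamma>, is to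
    represent a cohomology class.\<close>
  define q where "q m = Cst (Poly_Mapping.lookup F' m) *
    (\<Prod>v\<in>Poly_Mapping.keys m - {Lam}. Var v ^ Poly_Mapping.lookup m v)" for m
  define j where "j m = Poly_Mapping.lookup m Lam" for m :: "var \<Rightarrow>\<^sub>0 nat"
  let ?K = "Poly_Mapping.keys F'"
  have term_eq: "Cst (Poly_Mapping.lookup F' m) * (\<Prod>v\<in>Poly_Mapping.keys m. Var v ^ Poly_Mapping.lookup m v)
      = q m * Var Lam ^ j m" for m
  proof (cases "Lam \<in> Poly_Mapping.keys m")
    case True
    then show ?thesis by (simp add: q_def j_def prod.remove mult_ac)
  next
    case False
    then show ?thesis by (simp add: q_def j_def in_keys_iff)
  qed
  have qp: "q m \<in> polys (insert Y (Gam n k))" if "m \<in> ?K" for m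
  proof -
    have "Poly_Mapping.keys m \<subseteq> insert Lam (insert Y (Gam n k))"
      using F'p that by (auto simp: polys_def vars_def)
    then show ?thesis unfolding q_def by (intro polys_mult polys_Cst polys_prod polys_power polys_Var) auto
  qed
  have lamsym: "sym_inv n k (Var Lam ^ i)" for i by (simp add: sym_inv_def)
  have F'eq: "F' = (\<Sum>m\<in>?K. q m * Var Lam ^ j m)"
    using cpoly_expand[of F'] by (simp only: term_eq)
  \<comment> \<open>A single \<open>q m\<close> need not be invariant. Averaging makes every term
    invariant and does not change the sum, which is invariant already.\<close>
  have F'avg: "F' = (\<Sum>m\<in>?K. avg n k (q m) * Var Lam ^ j m)"
  proof -
    have "F' = avg n k F'" using avg_eq[OF F'sym] ..
    also have "\<dots> = avg n k (\<Sum>m\<in>?K. q m * Var Lam ^ j m)" using F'eq by (rule arg_cong)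
    also have "\<dots> = (\<Sum>m\<in>?K. avg n k (q m) * Var Lam ^ j m)" by (simp only: avg_sum avg_mult[OF lamsym])
    finally show ?thesis .
  qed
  obtain l y where ly: "l \<in> L_lam_y" "y \<in> Laurent_y" "inverse (to_fract D) = l * y"
    using inverse_denominator[OF F(3)] unfolding D_def by blast
  have lm: "to_fract (Var Lam ^ i) * l \<in> L_lam_y" for i
    using comm_subring.mult_mem[OF field_subring.axioms[OF L_lam_y_subring] _ ly(1)]
      to_fract_in_loc[of "Var Lam ^ i" "{Lam, Y}" lam_forms]
    by (auto simp: L_lam_y_loc polys_power polys_Var)
  define u where "u = (\<Sum>m\<in>?K. frag_of (hc n k (avg n k (q m)), (to_fract (Var Lam ^ j m) * l) * y))"
  have N: "TS.cls n k u \<in> GL_part n k"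
    unfolding u_def
  proof (rule GL_part_sum)
    fix m assume "m \<in> ?K"
    then have "TS.cls n k (frag_of (hc n k (avg n k (q m)), (to_fract (Var Lam ^ j m) * l) * y)) \<in>
      {TS.cls n k (frag_of (hc n k p, l * q)) | p l q. p \<in> GG n k \<and> l \<in> L_lam_y \<and> q \<in> Laurent_y}"
      using avg_GG[OF qp] lm[of "j m"] ly(2) by blast
    then show "TS.cls n k (frag_of (hc n k (avg n k (q m)), (to_fract (Var Lam ^ j m) * l) * y)) \<in> GL_part n k"
      unfolding GL_part_def GL_gens by (rule generate.incl)
  qed simp
  note ND = GL_part_D[OF N]
  have "Phi n ?J u = (\<Sum>m\<in>?K. to_fract (psubst (at_x n ?J) (avg n k (q m) * Var Lam ^ j m)) * inverse (to_fract D))"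
    unfolding u_def Phi_sum Phi_of[OF J0] ly(3) by (simp add: mult_ac)
  also have "\<dots> = to_fract (psubst (at_x n ?J) F') * inverse (to_fract D)"
  proof -
    have "psubst (at_x n ?J) F' = (\<Sum>m\<in>?K. psubst (at_x n ?J) (avg n k (q m) * Var Lam ^ j m))"
      by (subst F'avg) (simp only: psubst_sum)
    then show ?thesis by (simp only: to_fract_sum sum_distrib_right)
  qed
  also have "psubst (at_x n ?J) F' = psubst Var F"
    unfolding F'_def psubst_psubst
  proof (rule psubst_cong[OF F(2)])
    fix v assume "v \<in> Vlzy n"
    then show "psubst (at_x n ?J) (lift k v) = Var v"
      using nth_elt_initial[of _ k] nth_elt_final[of k _ n] by (cases v) (auto simp: Vzy_def)
  qed
  finally have "Phi n ?J u = Fract F D"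
    using Dnz by (simp add: to_fract_def)
  then have "Phi n ?J u = res n ?J X"
    by (simp only: F(1) D_def)
  then have r0: "res n ?J (TS.cls n k u) = res n ?J X" by (simp only: res_cls[OF J0])
  have "TS.cls n k u = X"
  proof (rule res_inj[OF n kn])
    fix J assume J: "J \<in> ksubsets n k"
    obtain \<tau> where \<tau>: "\<tau> permutes {1..n}" "\<tau> ` ?J = J" using ex_permutes_image[OF J0 J] by blast
    show "res n J (TS.cls n k u) = res n J X"
      using ND eqv \<tau> J0 r0 unfolding equivariant_def by metis
  qed (use ND X in auto)
  with N show ?thesis by simp
qed


section \<open>Weight functions as sums over bijections\<close>

text \<open>The symmetrization over S_k becomes a sum over bijections from I to the set T of values,
  sending i_r to t_{\<pi>(r)}. Neither I nor T then carries an enumeration, and relabelling sites or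
  permuting values is a reindexing of the sum.\<close>

definition bijs :: "nat set \<Rightarrow> 'a set \<Rightarrow> (nat \<Rightarrow> 'a) set" where
  "bijs I T = {f \<in> I \<rightarrow>\<^sub>E T. bij_betw f I T}"

definition wl :: "nat \<Rightarrow> nat set \<Rightarrow> 'a::field \<Rightarrow> (nat \<Rightarrow> 'a) \<Rightarrow> 'a \<Rightarrow> nat \<Rightarrow> nat \<Rightarrow> 'a \<Rightarrow> 'a" where
  "wl n I lam z y i a t = (if a < i then t - z a + y
     else if a = i then lam + t - z a - of_int (wt n i I) * y else t - z a)"

definition pairs :: "nat set \<Rightarrow> (nat \<times> nat) set" where
  "pairs I = {(i, j). i \<in> I \<and> j \<in> I \<and> i < j}"

definition wterm :: "nat \<Rightarrow> nat set \<Rightarrow> 'a::field \<Rightarrow> (nat \<Rightarrow> 'a) \<Rightarrow> 'a \<Rightarrow> (nat \<Rightarrow> 'a) \<Rightarrow> 'a" where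
  "wterm n I lam z y f = (\<Prod>i\<in>I. \<Prod>a\<in>{1..n}. wl n I lam z y i a (f i)) *
     (\<Prod>(i, j)\<in>pairs I. (f i - f j + y) / (f i - f j))"

definition wden :: "nat \<Rightarrow> nat set \<Rightarrow> 'a::field \<Rightarrow> 'a \<Rightarrow> 'a set \<Rightarrow> 'a" where
  "wden n I lam y T = C_fac n I lam 0 y * C_fac n I lam 1 y * (\<Prod>t\<in>T. \<Prod>t'\<in>T. t - t' + y)"

definition MM :: "nat \<Rightarrow> nat set \<Rightarrow> 'a::field \<Rightarrow> (nat \<Rightarrow> 'a) \<Rightarrow> 'a \<Rightarrow> 'a set \<Rightarrow> 'a" where
  "MM n I lam z y T = y ^ card I * (\<Sum>f\<in>bijs I T. wterm n I lam z y f) / wden n I lam y T"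

lemma finite_bijs [simp]: "finite I \<Longrightarrow> finite T \<Longrightarrow> finite (bijs I T)"
  unfolding bijs_def by (rule finite_subset[of _ "I \<rightarrow>\<^sub>E T"]) (auto intro: finite_PiE)

lemma finite_pairs [simp]: "finite I \<Longrightarrow> finite (pairs I)"
  unfolding pairs_def by (rule finite_subset[of _ "I \<times> I"]) auto

lemma bijsD:
  assumes "f \<in> bijs I T" shows "bij_betw f I T" "inj_on f I" "f ` I = T" "i \<in> I \<Longrightarrow> f i \<in> T"
  using assms by (auto simp: bijs_def bij_betw_def)

lemma bijs_neq: "f \<in> bijs I T \<Longrightarrow> (i, j) \<in> pairs I \<Longrightarrow> f i \<noteq> f j"
  using bijsD(2)[of f I T] by (auto simp: pairs_def inj_on_def)

lemma nth_elt_strict_mono: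
  assumes "finite I" "a \<in> {1..card I}" "b \<in> {1..card I}" "a < b"
  shows "nth_elt I a < nth_elt I b"
  unfolding nth_elt_def
  by (rule sorted_wrt_nth_less[OF strict_sorted_list_of_set]) (use assms in auto)

lemma nth_elt_less_iff:
  assumes "finite I" "a \<in> {1..card I}" "b \<in> {1..card I}"
  shows "nth_elt I a < nth_elt I b \<longleftrightarrow> a < b"
  using nth_elt_strict_mono[OF assms] nth_elt_strict_mono[OF assms(1,3,2)]
  by (metis less_asym linorder_less_linear nat_neq_iff)

lemma W_term_wterm:
  assumes I: "finite I" and f: "\<And>r. r \<in> {1..card I} \<Longrightarrow> f (nth_elt I r) = t r"
  shows "W_term n I lam t z y = wterm n I lam z y f"
proof -
  let ?e = "nth_elt I" and ?k = "card I"
  have e: "bij_betw ?e {1..?k} I" using bij_betw_nth_elt[OF I] .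
  have "(\<Prod>i\<in>I. \<Prod>a\<in>{1..n}. wl n I lam z y i a (f i)) = (\<Prod>r\<in>{1..?k}. \<Prod>a\<in>{1..n}. wl n I lam z y (?e r) a (f (?e r)))"
    using prod.reindex_bij_betw[OF e, of "\<lambda>i. \<Prod>a\<in>{1..n}. wl n I lam z y i a (f i)"] by simp
  also have "\<dots> = (\<Prod>r\<in>{1..?k}. \<Prod>a\<in>{1..n}. l_fac n I lam t z y r a)"
    by (intro prod.cong HOL.refl) (simp add: f wl_def l_fac_def)
  finally have 1: "(\<Prod>r\<in>{1..?k}. \<Prod>a\<in>{1..n}. l_fac n I lam t z y r a) = (\<Prod>i\<in>I. \<Prod>a\<in>{1..n}. wl n I lam z y i a (f i))" ..
  let ?P = "Sigma {1..?k} (\<lambda>a. {a<..?k})"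
  have b: "bij_betw (\<lambda>(a, b). (?e a, ?e b)) ?P (pairs I)"
  proof (rule bij_betw_imageI)
    show "inj_on (\<lambda>(a, b). (?e a, ?e b)) ?P"
    proof (rule inj_onI, clarify)
      fix a b a' b' assume *: "a \<in> {1..?k}" "b \<in> {a<..?k}" "a' \<in> {1..?k}" "b' \<in> {a'<..?k}"
        "?e a = ?e a'" "?e b = ?e b'"
      then have "b \<in> {1..?k}" "b' \<in> {1..?k}" by auto
      with * show "a = a' \<and> b = b'"
        using inj_onD[OF bij_betw_imp_inj_on[OF e], of a a'] inj_onD[OF bij_betw_imp_inj_on[OF e], of b b'] by blast
    qed
    show "(\<lambda>(a, b). (?e a, ?e b)) ` ?P = pairs I"
    proof (rule equalityI; rule subsetI)
      fix x assume "x \<in> (\<lambda>(a, b). (?e a, ?e b)) ` ?P"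
      then show "x \<in> pairs I"
        using nth_elt_in[OF I] nth_elt_strict_mono[OF I] by (auto simp: pairs_def)
    next
      fix x assume "x \<in> pairs I"
      then obtain i j where x: "x = (i, j)" "i \<in> I" "j \<in> I" "i < j" by (auto simp: pairs_def)
      obtain a b where ab: "a \<in> {1..?k}" "b \<in> {1..?k}" "i = ?e a" "j = ?e b"
        using x bij_betw_imp_surj_on[OF e] by blast
      then have "a < b" using x nth_elt_less_iff[OF I] by simp
      with ab x show "x \<in> (\<lambda>(a, b). (?e a, ?e b)) ` ?P" by force
    qed
  qed
  have "(\<Prod>(i, j)\<in>pairs I. (f i - f j + y) / (f i - f j)) = (\<Prod>(a, b)\<in>?P. (f (?e a) - f (?e b) + y) / (f (?e a) - f (?e b)))"
    using prod.reindex_bij_betw[OF b, of "\<lambda>(i, j). (f i - f j + y) / (f i - f j)"] by (simp add: case_prod_unfold)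
  also have "\<dots> = (\<Prod>(a, b)\<in>?P. (t a - t b + y) / (t a - t b))"
    by (intro prod.cong HOL.refl) (auto simp: f)
  also have "\<dots> = (\<Prod>a\<in>{1..?k}. \<Prod>b\<in>{a<..?k}. (t a - t b + y) / (t a - t b))"
    by (subst prod.Sigma) auto
  finally show ?thesis unfolding W_term_def wterm_def 1 by simp
qed

lemma W_plus_MM:
  assumes I: "finite I" and t: "inj_on t {1..card I}"
  shows "W_plus n I lam t z y = MM n I lam z y (t ` {1..card I})"
proof -
  let ?e = "nth_elt I" and ?k = "card I" and ?T = "t ` {1..card I}"
  have e: "bij_betw ?e {1..?k} I" using bij_betw_nth_elt[OF I] .
  have tb: "bij_betw t {1..?k} ?T" using t by (rule inj_on_imp_bij_betw)
  let ?ei = "inv_into {1..?k} ?e" and ?ti = "inv_into {1..?k} t"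
  have eib: "bij_betw ?ei I {1..?k}" using e by (rule bij_betw_inv_into)
  have tib: "bij_betw ?ti ?T {1..?k}" using tb by (rule bij_betw_inv_into)
  have ee: "?ei (?e r) = r" if "r \<in> {1..?k}" for r using e that by (simp add: bij_betw_def)
  have ei: "?e (?ei i) = i" "?ei i \<in> {1..?k}" if "i \<in> I" for i
    using bij_betw_inv_into_right[OF e that] bij_betwE[OF eib] that by auto
  have tt: "?ti (t r) = r" if "r \<in> {1..?k}" for r using t that by simp
  have ti: "t (?ti x) = x" if "x \<in> ?T" for x using that by (rule f_inv_into_f)
  \<comment> \<open>The map \<open>?j\<close> sends \<pi> to the bijection i_r \<mapsto>
    t_{\<pi>(r)}; \<open>?i\<close> is its inverse, extended by the identity to a permutation of all
    naturals.\<close>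
  let ?j = "\<lambda>\<pi>. \<lambda>i\<in>I. t (\<pi> (?ei i))" and ?i = "\<lambda>f r. if r \<in> {1..?k} then ?ti (f (?e r)) else r"
  have "(\<Sum>\<pi> | \<pi> permutes {1..?k}. W_term n I lam (t \<circ> \<pi>) z y) = (\<Sum>f\<in>bijs I ?T. wterm n I lam z y f)"
  proof (rule sum.reindex_bij_witness[of _ ?i ?j])
    fix \<pi> assume "\<pi> \<in> {\<pi>. \<pi> permutes {1..?k}}"
    then have \<pi>: "\<pi> permutes {1..?k}" by simp
    have \<pi>k: "\<pi> r \<in> {1..?k}" if "r \<in> {1..?k}" for r using permutes_in_image[OF \<pi>] that by blast
    have "\<pi> r = r" if "r \<notin> {1..?k}" for r using \<pi> that by (rule permutes_not_in)
    then show "?i (?j \<pi>) = \<pi>"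
      using ee \<pi>k tt nth_elt_in[OF I] by (intro ext) auto
    have "bij_betw (t \<circ> (\<pi> \<circ> ?ei)) I ?T"
      using bij_betw_trans[OF bij_betw_trans[OF eib permutes_imp_bij[OF \<pi>]] tb] .
    then have "bij_betw (?j \<pi>) I ?T" by (rule bij_betw_cong[THEN iffD1, rotated]) auto
    then show "?j \<pi> \<in> bijs I ?T" by (auto simp: bijs_def bij_betw_def)
    show "wterm n I lam z y (?j \<pi>) = W_term n I lam (t \<circ> \<pi>) z y"
      by (rule W_term_wterm[OF I, symmetric]) (use ee nth_elt_in[OF I] in auto)
  next
    fix f assume f: "f \<in> bijs I ?T"
    have "bij_betw (?ti \<circ> (f \<circ> ?e)) {1..?k} {1..?k}"
      using bij_betw_trans[OF bij_betw_trans[OF e bijsD(1)[OF f]] tib] .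
    then have "bij_betw (?i f) {1..?k} {1..?k}" by (rule bij_betw_cong[THEN iffD1, rotated]) auto
    then have "?i f permutes {1..?k}" by (rule bij_imp_permutes) (simp only: if_False)
    then show "?i f \<in> {\<pi>. \<pi> permutes {1..?k}}" unfolding mem_Collect_eq .
    show "?j (?i f) = f"
    proof
      fix i show "?j (?i f) i = f i"
        using f ei[of i] ti[of "f i"] bijsD(4)[OF f, of i] by (cases "i \<in> I") (auto simp: bijs_def PiE_def extensional_def)
    qed
  qed
  moreover have "(\<Prod>x\<in>?T. \<Prod>x'\<in>?T. x - x' + y) = e_fac I t y"
    unfolding e_fac_def by (subst prod.reindex[OF t], simp only: o_def, subst prod.reindex[OF t]) (simp add: o_def)
  ultimately show ?thesis by (simp add: W_plus_def W_def MM_def wden_def)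
qed

subsection \<open>Matrix entries in a subring\<close>

lemma (in field_subring) wl_mem:
  assumes "lam \<in> S" "y \<in> S" "z a \<in> S" "t \<in> S"
  shows "wl n I lam z y i a t \<in> S"
  using assms unfolding wl_def by (auto intro!: add_mem diff_mem mult_mem)

lemma (in field_subring) wden_inverse_mem:
  assumes y: "\<And>m::int. inverse (lam - of_int m * y) \<in> S"
    and T: "\<And>t t'. t \<in> T \<Longrightarrow> t' \<in> T \<Longrightarrow> inverse (t - t' + y) \<in> S"
  shows "inverse (wden n I lam y T) \<in> S"
  unfolding wden_def C_fac_def by (intro inverse_mult_mem inverse_prod_mem y T)

lemma (in field_subring) wterm_mem:
  assumes "lam \<in> S" "y \<in> S" "\<And>a. a \<in> {1..n} \<Longrightarrow> z a \<in> S" "\<And>i. i \<in> I \<Longrightarrow> f i \<in> S"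
    and "\<And>i j. (i, j) \<in> pairs I \<Longrightarrow> inverse (f i - f j) \<in> S"
  shows "wterm n I lam z y f \<in> S"
  unfolding wterm_def using assms
  by (intro mult_mem prod_mem wl_mem) (auto simp: pairs_def divide_inverse intro!: mult_mem add_mem diff_mem)

lemma (in field_subring) MM_mem:
  assumes "lam \<in> S" "y \<in> S" "\<And>a. a \<in> {1..n} \<Longrightarrow> z a \<in> S" "T \<subseteq> S"
    and "\<And>m::int. inverse (lam - of_int m * y) \<in> S"
    and "\<And>t t'. t \<in> T \<Longrightarrow> t' \<in> T \<Longrightarrow> t \<noteq> t' \<Longrightarrow> inverse (t - t') \<in> S"
    and "\<And>t t'. t \<in> T \<Longrightarrow> t' \<in> T \<Longrightarrow> inverse (t - t' + y) \<in> S"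
  shows "MM n I lam z y T \<in> S"
proof -
  have "wterm n I lam z y f \<in> S" if f: "f \<in> bijs I T" for f
    using bijsD(4)[OF f] bijs_neq[OF f] assms by (intro wterm_mem) (auto simp: pairs_def)
  then show ?thesis unfolding MM_def
    using assms by (intro divide_mem wden_inverse_mem mult_mem power_mem sum_mem)
qed

subsection \<open>Compatibility with substitution\<close>

lemma rsub_wterm:
  assumes lam: "regular \<sigma> lam" and y: "regular \<sigma> y" and z: "\<And>a. regular \<sigma> (z a)"
    and f: "\<And>i. i \<in> I \<Longrightarrow> regular \<sigma> (f i)" and inj: "inj_on (\<lambda>i. rsub \<sigma> (f i)) I"
  shows "regular \<sigma> (wterm n I lam z y f) \<and>
    rsub \<sigma> (wterm n I lam z y f) = wterm n I (rsub \<sigma> lam) (\<lambda>a. rsub \<sigma> (z a)) (rsub \<sigma> y) (\<lambda>i. rsub \<sigma> (f i))"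
proof -
  have 1: "regular \<sigma> (wl n I lam z y i a t) \<and>
    rsub \<sigma> (wl n I lam z y i a t) = wl n I (rsub \<sigma> lam) (\<lambda>a. rsub \<sigma> (z a)) (rsub \<sigma> y) i a (rsub \<sigma> t)"
    if "regular \<sigma> t" for i a t
    using lam y z that by (simp add: wl_def)
  have 2: "regular \<sigma> ((f i - f j + y) / (f i - f j)) \<and> rsub \<sigma> ((f i - f j + y) / (f i - f j))
      = (rsub \<sigma> (f i) - rsub \<sigma> (f j) + rsub \<sigma> y) / (rsub \<sigma> (f i) - rsub \<sigma> (f j))" if "(i, j) \<in> pairs I" for i j
  proof -
    have ij: "i \<in> I" "j \<in> I" "i \<noteq> j" using that by (auto simp: pairs_def)
    then have "rsub \<sigma> (f i) \<noteq> rsub \<sigma> (f j)" using inj by (auto simp: inj_on_def)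
    then show ?thesis using f[OF ij(1)] f[OF ij(2)] y by (simp add: regular_divide rsub_divide)
  qed
  have p1: "regular \<sigma> (\<Prod>i\<in>I. \<Prod>a\<in>{1..n}. wl n I lam z y i a (f i)) \<and>
    rsub \<sigma> (\<Prod>i\<in>I. \<Prod>a\<in>{1..n}. wl n I lam z y i a (f i)) =
     (\<Prod>i\<in>I. \<Prod>a\<in>{1..n}. wl n I (rsub \<sigma> lam) (\<lambda>a. rsub \<sigma> (z a)) (rsub \<sigma> y) i a (rsub \<sigma> (f i)))"
    using 1 f by (simp add: regular_prod rsub_prod)
  have p2: "regular \<sigma> (\<Prod>(i, j)\<in>pairs I. (f i - f j + y) / (f i - f j)) \<and>
    rsub \<sigma> (\<Prod>(i, j)\<in>pairs I. (f i - f j + y) / (f i - f j)) =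
    (\<Prod>(i, j)\<in>pairs I. (rsub \<sigma> (f i) - rsub \<sigma> (f j) + rsub \<sigma> y) / (rsub \<sigma> (f i) - rsub \<sigma> (f j)))"
  proof -
    have r: "regular \<sigma> (case x of (i, j) \<Rightarrow> (f i - f j + y) / (f i - f j))" if "x \<in> pairs I" for x
      using 2 that by (cases x) auto
    show ?thesis
      using regular_rsub_prod[of "pairs I" \<sigma> "\<lambda>(i, j). (f i - f j + y) / (f i - f j)", OF r] 2
      by (auto intro!: prod.cong)
  qed
  show ?thesis unfolding wterm_def using p1 p2 by simp
qed

lemma bijs_image:
  assumes "inj_on h T" "finite I" "finite T"
  shows "bij_betw (\<lambda>f. \<lambda>i\<in>I. h (f i)) (bijs I T) (bijs I (h ` T))"
proof (rule bij_betw_byWitness[where f' = "\<lambda>g. \<lambda>i\<in>I. inv_into T h (g i)"])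
  have hb: "bij_betw h T (h ` T)" using assms(1) by (rule inj_on_imp_bij_betw)
  have hi: "bij_betw (inv_into T h) (h ` T) T" using hb by (rule bij_betw_inv_into)
  show "\<forall>f\<in>bijs I T. (\<lambda>i\<in>I. inv_into T h ((\<lambda>i\<in>I. h (f i)) i)) = f"
    using assms(1) by (auto simp: bijs_def PiE_def extensional_def bij_betw_def intro!: ext)
  show "\<forall>g\<in>bijs I (h ` T). (\<lambda>i\<in>I. h ((\<lambda>i\<in>I. inv_into T h (g i)) i)) = g"
  proof
    fix g assume g: "g \<in> bijs I (h ` T)"
    show "(\<lambda>i\<in>I. h ((\<lambda>i\<in>I. inv_into T h (g i)) i)) = g"
    proof
      fix i show "(\<lambda>i\<in>I. h ((\<lambda>i\<in>I. inv_into T h (g i)) i)) i = g i"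
        using g f_inv_into_f[OF bijsD(4)[OF g]] by (cases "i \<in> I") (auto simp: bijs_def PiE_def extensional_def)
    qed
  qed
  show "(\<lambda>f. \<lambda>i\<in>I. h (f i)) ` bijs I T \<subseteq> bijs I (h ` T)"
  proof (rule image_subsetI)
    fix f assume "f \<in> bijs I T"
    then have "bij_betw (h \<circ> f) I (h ` T)" using bij_betw_trans[OF bijsD(1) hb] by blast
    then have "bij_betw (\<lambda>i\<in>I. h (f i)) I (h ` T)" by (rule bij_betw_cong[THEN iffD1, rotated]) auto
    then show "(\<lambda>i\<in>I. h (f i)) \<in> bijs I (h ` T)" by (auto simp: bijs_def bij_betw_def)
  qed
  show "(\<lambda>g. \<lambda>i\<in>I. inv_into T h (g i)) ` bijs I (h ` T) \<subseteq> bijs I T"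
  proof (rule image_subsetI)
    fix g assume "g \<in> bijs I (h ` T)"
    then have "bij_betw (inv_into T h \<circ> g) I T" using bij_betw_trans[OF bijsD(1) hi] by blast
    then have "bij_betw (\<lambda>i\<in>I. inv_into T h (g i)) I T" by (rule bij_betw_cong[THEN iffD1, rotated]) auto
    then show "(\<lambda>i\<in>I. inv_into T h (g i)) \<in> bijs I T" by (auto simp: bijs_def bij_betw_def)
  qed
qed

lemma wterm_cong:
  assumes "\<And>i. i \<in> I \<Longrightarrow> f i = g i" shows "wterm n I lam z y f = wterm n I lam z y g"
  unfolding wterm_def using assms by (auto intro!: arg_cong2[where f = "(*)"] prod.cong simp: pairs_def)

lemma rsub_MM:
  assumes I: "finite I" "finite T" and lam: "regular \<sigma> lam" and y: "regular \<sigma> y" and z: "\<And>a. regular \<sigma> (z a)"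
    and T: "\<And>t. t \<in> T \<Longrightarrow> regular \<sigma> t" and inj: "inj_on (rsub \<sigma>) T"
    and den: "wden n I (rsub \<sigma> lam) (rsub \<sigma> y) (rsub \<sigma> ` T) \<noteq> 0"
  shows "regular \<sigma> (MM n I lam z y T) \<and>
    rsub \<sigma> (MM n I lam z y T) = MM n I (rsub \<sigma> lam) (\<lambda>a. rsub \<sigma> (z a)) (rsub \<sigma> y) (rsub \<sigma> ` T)"
proof -
  have w: "regular \<sigma> (wterm n I lam z y f) \<and>
    rsub \<sigma> (wterm n I lam z y f) = wterm n I (rsub \<sigma> lam) (\<lambda>a. rsub \<sigma> (z a)) (rsub \<sigma> y) (\<lambda>i\<in>I. rsub \<sigma> (f i))"
    if f: "f \<in> bijs I T" for f
  proof -
    have "inj_on (\<lambda>i. rsub \<sigma> (f i)) I"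
      using comp_inj_on[OF bijsD(2)[OF f], of "rsub \<sigma>"] inj bijsD(3)[OF f] by (simp add: o_def)
    then have "regular \<sigma> (wterm n I lam z y f) \<and>
      rsub \<sigma> (wterm n I lam z y f) = wterm n I (rsub \<sigma> lam) (\<lambda>a. rsub \<sigma> (z a)) (rsub \<sigma> y) (\<lambda>i. rsub \<sigma> (f i))"
      by (intro rsub_wterm lam y z T bijsD(4)[OF f])
    moreover have "wterm n I (rsub \<sigma> lam) (\<lambda>a. rsub \<sigma> (z a)) (rsub \<sigma> y) (\<lambda>i. rsub \<sigma> (f i)) =
      wterm n I (rsub \<sigma> lam) (\<lambda>a. rsub \<sigma> (z a)) (rsub \<sigma> y) (\<lambda>i\<in>I. rsub \<sigma> (f i))"
      by (rule wterm_cong) simp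
    ultimately show ?thesis by simp
  qed
  have s: "regular \<sigma> (\<Sum>f\<in>bijs I T. wterm n I lam z y f) \<and> rsub \<sigma> (\<Sum>f\<in>bijs I T. wterm n I lam z y f)
     = (\<Sum>f\<in>bijs I (rsub \<sigma> ` T). wterm n I (rsub \<sigma> lam) (\<lambda>a. rsub \<sigma> (z a)) (rsub \<sigma> y) f)"
    using w sum.reindex_bij_betw[OF bijs_image[OF inj I], of "wterm n I (rsub \<sigma> lam) (\<lambda>a. rsub \<sigma> (z a)) (rsub \<sigma> y)"]
    by (simp add: regular_sum rsub_sum)
  have c: "regular \<sigma> (C_fac n I lam r y) \<and> rsub \<sigma> (C_fac n I lam r y) = C_fac n I (rsub \<sigma> lam) r (rsub \<sigma> y)" for r
    unfolding C_fac_def using lam y by (simp add: regular_prod rsub_prod)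
  have e: "regular \<sigma> (\<Prod>t\<in>T. \<Prod>t'\<in>T. t - t' + y) \<and>
    rsub \<sigma> (\<Prod>t\<in>T. \<Prod>t'\<in>T. t - t' + y) = (\<Prod>t\<in>rsub \<sigma> ` T. \<Prod>t'\<in>rsub \<sigma> ` T. t - t' + rsub \<sigma> y)"
    using T y by (simp add: regular_prod rsub_prod prod.reindex[OF inj])
  have d: "regular \<sigma> (wden n I lam y T) \<and> rsub \<sigma> (wden n I lam y T) = wden n I (rsub \<sigma> lam) (rsub \<sigma> y) (rsub \<sigma> ` T)"
    unfolding wden_def using c e by simp
  show ?thesis unfolding MM_def using d den s y
    by (simp add: regular_divide rsub_divide regular_rsub_power)
qed

subsection \<open>Triangularity\<close>

text \<open>If z_c is assigned to position i with i < c, then row i contains the factor t - z_c at t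
  = z_c. Hence nonzero summands never move an index up.\<close>

lemma wterm_nonzeroD:
  assumes z: "inj_on z {1..n}" and J: "J \<subseteq> {1..n}" and I: "I \<subseteq> {1..n}"
    and f: "f \<in> bijs I (z ` J)" and nz: "wterm n I lam z y f \<noteq> 0"
  obtains \<phi> where "bij_betw \<phi> I J" "\<And>i. i \<in> I \<Longrightarrow> f i = z (\<phi> i) \<and> \<phi> i \<le> i"
proof -
  define \<phi> where "\<phi> i = inv_into J z (f i)" for i
  have zJ: "inj_on z J" using z J by (rule inj_on_subset)
  have "bij_betw (inv_into J z) (z ` J) J" using bij_betw_inv_into[OF inj_on_imp_bij_betw[OF zJ]] .
  then have b: "bij_betw \<phi> I J"
    using bij_betw_trans[OF bijsD(1)[OF f]] unfolding \<phi>_def[abs_def] o_def by blast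
  have fz: "f i = z (\<phi> i)" if "i \<in> I" for i
    unfolding \<phi>_def using bijsD(4)[OF f that] by (simp add: f_inv_into_f)
  have "\<phi> i \<le> i" if i: "i \<in> I" for i
  proof (rule ccontr)
    assume "\<not> \<phi> i \<le> i"
    moreover have "\<phi> i \<in> {1..n}" using bij_betwE[OF b] i J by blast
    ultimately have "wl n I lam z y i (\<phi> i) (f i) = 0" by (simp add: wl_def fz[OF i])
    then have "(\<Prod>a\<in>{1..n}. wl n I lam z y i a (f i)) = 0"
      using \<open>\<phi> i \<in> {1..n}\<close> by (intro prod_zero) auto
    then have "(\<Prod>i\<in>I. \<Prod>a\<in>{1..n}. wl n I lam z y i a (f i)) = 0"
      using i finite_subset[OF I] by (intro prod_zero) auto
    then show False using nz by (simp add: wterm_def)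
  qed
  with b fz show ?thesis using that by blast
qed

text \<open>The sum of the elements is a linear substitute for the order on subsets: a bijection
  that moves no element up lowers the sum unless it is the identity.\<close>

lemma bij_le_sum:
  assumes "finite I" "bij_betw \<phi> I J" "\<And>i. i \<in> I \<Longrightarrow> \<phi> i \<le> (i::nat)"
  shows "\<Sum>J \<le> \<Sum>I" "\<Sum>J = \<Sum>I \<Longrightarrow> i \<in> I \<Longrightarrow> \<phi> i = i"
proof -
  have e: "\<Sum>J = (\<Sum>i\<in>I. \<phi> i)" using sum.reindex_bij_betw[OF assms(2), of id] by simp
  then show "\<Sum>J \<le> \<Sum>I" using assms(3) by (simp add: sum_mono)
  show "\<phi> i = i" if "\<Sum>J = \<Sum>I" "i \<in> I"
  proof (rule ccontr)
    assume "\<phi> i \<noteq> i"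
    then have "(\<Sum>i\<in>I. \<phi> i) < (\<Sum>i\<in>I. i)"
      using assms that(2) by (intro sum_strict_mono_ex1) (auto intro!: bexI[of _ i] simp: le_neq_implies_less)
    then show False using e that by simp
  qed
qed

lemma MM_triangular:
  assumes z: "inj_on z {1..n}" and J: "J \<subseteq> {1..n}" and I: "I \<subseteq> {1..n}"
    and nz: "MM n I lam z y (z ` J) \<noteq> 0"
  shows "\<Sum>J < \<Sum>I \<or> J = I"
proof -
  have "(\<Sum>f\<in>bijs I (z ` J). wterm n I lam z y f) \<noteq> 0" using nz by (auto simp: MM_def)
  then obtain f where f: "f \<in> bijs I (z ` J)" "wterm n I lam z y f \<noteq> 0"
    by (meson sum.not_neutral_contains_not_neutral)
  obtain \<phi> where \<phi>: "bij_betw \<phi> I J" "\<And>i. i \<in> I \<Longrightarrow> f i = z (\<phi> i) \<and> \<phi> i \<le> i"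
    using wterm_nonzeroD[OF z J I f] by blast
  note s = bij_le_sum[OF finite_subset[OF I finite_atLeastAtMost] \<phi>(1)]
  show ?thesis
  proof (cases "\<Sum>J = \<Sum>I")
    case True
    then have "\<phi> i = i" if "i \<in> I" for i using s(2) \<phi>(2) that by blast
    then have "J = I" using bij_betw_imp_surj_on[OF \<phi>(1)] by force
    then show ?thesis by simp
  next
    case False
    then show ?thesis using s(1) \<phi>(2) by (simp add: le_neq_implies_less)
  qed
qed

lemma sum_bijs_diag:
  assumes z: "inj_on z {1..n}" and I: "I \<subseteq> {1..n}"
  shows "(\<Sum>f\<in>bijs I (z ` I). wterm n I lam z y f) = wterm n I lam z y z"
proof -
  have fin: "finite I" using I by (rule finite_subset) simp
  let ?g = "\<lambda>i\<in>I. z i"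
  have "bij_betw z I (z ` I)" using z I by (meson inj_on_imp_bij_betw inj_on_subset)
  then have "bij_betw ?g I (z ` I)" by (rule bij_betw_cong[THEN iffD1, rotated]) auto
  then have g: "?g \<in> bijs I (z ` I)" by (auto simp: bijs_def bij_betw_def)
  have "wterm n I lam z y f = 0" if f: "f \<in> bijs I (z ` I) - {?g}" for f
  proof (rule ccontr)
    assume nz: "wterm n I lam z y f \<noteq> 0"
    obtain \<phi> where \<phi>: "bij_betw \<phi> I I" "\<And>i. i \<in> I \<Longrightarrow> f i = z (\<phi> i) \<and> \<phi> i \<le> i"
      using wterm_nonzeroD[OF z I I _ nz] f by blast
    have "\<phi> i = i" if "i \<in> I" for i using bij_le_sum(2)[OF fin \<phi>(1) _ HOL.refl that] \<phi>(2) by blast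
    then have "f = ?g" using \<phi>(2) f by (auto simp: bijs_def PiE_def extensional_def intro!: ext)
    then show False using f by simp
  qed
  then have "(\<Sum>f\<in>bijs I (z ` I). wterm n I lam z y f) = (\<Sum>f\<in>{?g}. wterm n I lam z y f)"
    using g fin by (intro sum.mono_neutral_right) auto
  then show ?thesis using wterm_cong[of I ?g z] by simp
qed

lemma prod_pairs_swap: "(\<Prod>(i, j)\<in>pairs I. h i j) = (\<Prod>i\<in>I. \<Prod>j\<in>{j \<in> I. i < j}. h i j)" if "finite I"
proof -
  have "pairs I = Sigma I (\<lambda>i. {j \<in> I. i < j})" by (auto simp: pairs_def)
  then show ?thesis using that by (simp add: prod.Sigma)
qed

text \<open>Only the identity bijection contributes. In its summand the factors with both indices in
  I cancel against e_k and the denominators of the pairs, and the factor a = i cancels C^(0). What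
  remains are C^(1) and the pairs i in I, a outside I, with a term y exactly when a < i.\<close>

lemma MM_diag:
  assumes z: "inj_on z {1..n}" and I: "I \<subseteq> {1..n}" and y: "y \<noteq> 0"
    and lam: "\<And>m::int. lam - of_int m * y \<noteq> 0"
    and zy: "\<And>a b. a \<in> {1..n} \<Longrightarrow> b \<in> {1..n} \<Longrightarrow> z a - z b + y \<noteq> 0"
  shows "MM n I lam z y (z ` I) = (\<Prod>i\<in>I. inverse (lam - of_int (wt n i I + 1) * y)) *
    (\<Prod>i\<in>I. \<Prod>a\<in>{a \<in> {1..n} - I. a < i}. z i - z a + y) * (\<Prod>i\<in>I. \<Prod>a\<in>{a \<in> {1..n} - I. i < a}. z i - z a)"
proof -
  have fin: "finite I" using I by (rule finite_subset) simp
  have zI: "inj_on z I" using z I by (rule inj_on_subset)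
  define A where "A = (\<Prod>i\<in>I. \<Prod>a\<in>{a \<in> I. a < i}. z i - z a + y)"
  define B where "B = (\<Prod>i\<in>I. \<Prod>a\<in>{a \<in> I. i < a}. z i - z a + y)"
  define E where "E = (\<Prod>i\<in>I. \<Prod>a\<in>{a \<in> I. i < a}. z i - z a)"
  define A' where "A' = (\<Prod>i\<in>I. \<Prod>a\<in>{a \<in> {1..n} - I. a < i}. z i - z a + y)"
  define E' where "E' = (\<Prod>i\<in>I. \<Prod>a\<in>{a \<in> {1..n} - I. i < a}. z i - z a)"
  define C0 where "C0 = (\<Prod>i\<in>I. lam - of_int (wt n i I) * y)"
  have nz: "A \<noteq> 0" "B \<noteq> 0" "E \<noteq> 0" "C0 \<noteq> 0" "C_fac n I lam 1 y \<noteq> 0"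
  proof -
    have zyI: "z a - z b + y \<noteq> 0" if "a \<in> I" "b \<in> I" for a b using zy[of a b] that I by blast
    then show "A \<noteq> 0" "B \<noteq> 0" unfolding A_def B_def using fin by (simp_all add: prod_zero_iff)
    show "E \<noteq> 0" unfolding E_def using fin zI by (auto simp: prod_zero_iff inj_on_def)
    show "C0 \<noteq> 0" "C_fac n I lam 1 y \<noteq> 0" unfolding C0_def C_fac_def using fin lam by (simp_all only: prod_zero_iff) blast+
  qed
  have row: "(\<Prod>a\<in>{1..n}. wl n I lam z y i a (z i)) = (\<Prod>a\<in>{a \<in> I. a < i}. z i - z a + y) * (\<Prod>a\<in>{a \<in> {1..n} - I. a < i}. z i - z a + y)
     * (lam - of_int (wt n i I) * y) * (\<Prod>a\<in>{a \<in> I. i < a}. z i - z a) * (\<Prod>a\<in>{a \<in> {1..n} - I. i < a}. z i - z a)"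
    if i: "i \<in> I" for i
  proof -
    let ?g = "\<lambda>a. wl n I lam z y i a (z i)"
    define S1 where "S1 = {a \<in> I. a < i}"
    define S2 where "S2 = {a \<in> {1..n} - I. a < i}"
    define S3 where "S3 = {a \<in> I. i < a}"
    define S4 where "S4 = {a \<in> {1..n} - I. i < a}"
    have f: "finite S1" "finite S2" "finite S3" "finite S4"
      unfolding S1_def S2_def S3_def S4_def using fin by simp_all
    have d: "S1 \<inter> S2 = {}" "S3 \<inter> S4 = {}" "(S1 \<union> S2) \<inter> insert i (S3 \<union> S4) = {}" "i \<notin> S3 \<union> S4"
      unfolding S1_def S2_def S3_def S4_def using i by auto
    have u: "{1..n} = (S1 \<union> S2) \<union> insert i (S3 \<union> S4)"
      unfolding S1_def S2_def S3_def S4_def using I i by auto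
    have "prod ?g {1..n} = prod ?g ((S1 \<union> S2) \<union> insert i (S3 \<union> S4))"
      using u by (rule arg_cong)
    also have "\<dots> = prod ?g S1 * prod ?g S2 * (?g i * (prod ?g S3 * prod ?g S4))"
      using f d by (simp add: prod.union_disjoint)
    also have "prod ?g S1 = (\<Prod>a\<in>S1. z i - z a + y)"
      by (rule prod.cong) (auto simp: wl_def S1_def)
    also have "prod ?g S2 = (\<Prod>a\<in>S2. z i - z a + y)"
      by (rule prod.cong) (auto simp: wl_def S2_def)
    also have "prod ?g S3 = (\<Prod>a\<in>S3. z i - z a)"
      by (rule prod.cong) (auto simp: wl_def S3_def)
    also have "prod ?g S4 = (\<Prod>a\<in>S4. z i - z a)"
      by (rule prod.cong) (auto simp: wl_def S4_def)
    also have "?g i = lam - of_int (wt n i I) * y" by (simp add: wl_def)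
    finally show ?thesis unfolding S1_def S2_def S3_def S4_def by (simp only: mult_ac)
  qed
  have pr: "(\<Prod>(i, j)\<in>pairs I. (z i - z j + y) / (z i - z j)) = B / E"
    using fin by (simp add: prod_pairs_swap B_def E_def prod_dividef)
  have "(\<Prod>i\<in>I. \<Prod>a\<in>{1..n}. wl n I lam z y i a (z i)) = A * A' * C0 * E * E'"
    unfolding A_def A'_def C0_def E_def E'_def prod.distrib[symmetric] using row by (rule prod.cong[OF HOL.refl])
  then have w: "wterm n I lam z y z = A * A' * C0 * E' * B"
    unfolding wterm_def pr using nz(3) by simp
  have "(\<Prod>t\<in>z ` I. \<Prod>t'\<in>z ` I. t - t' + y) = (\<Prod>i\<in>I. \<Prod>j\<in>I. z i - z j + y)"
    using zI by (simp add: prod.reindex)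
  also have "\<dots> = (\<Prod>i\<in>I. (\<Prod>a\<in>{a \<in> I. a < i}. z i - z a + y) * (y * (\<Prod>a\<in>{a \<in> I. i < a}. z i - z a + y)))"
  proof (intro prod.cong HOL.refl)
    fix i assume i: "i \<in> I"
    define S1 where "S1 = {a \<in> I. a < i}"
    define S3 where "S3 = {a \<in> I. i < a}"
    have f: "finite S1" "finite S3" unfolding S1_def S3_def using fin by simp_all
    have d: "S1 \<inter> insert i S3 = {}" "i \<notin> S3" unfolding S1_def S3_def by auto
    have "I = S1 \<union> insert i S3" unfolding S1_def S3_def using i by auto
    then have "(\<Prod>j\<in>I. z i - z j + y) = (\<Prod>j\<in>S1 \<union> insert i S3. z i - z j + y)" by (rule arg_cong)
    also have "\<dots> = (\<Prod>a\<in>S1. z i - z a + y) * (y * (\<Prod>a\<in>S3. z i - z a + y))"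
      using f d by (simp add: prod.union_disjoint)
    finally show "(\<Prod>j\<in>I. z i - z j + y) = (\<Prod>a\<in>{a \<in> I. a < i}. z i - z a + y) * (y * (\<Prod>a\<in>{a \<in> I. i < a}. z i - z a + y))"
      unfolding S1_def S3_def .
  qed
  also have "\<dots> = A * (y ^ card I * B)"
    by (simp add: prod.distrib A_def B_def)
  finally have e: "(\<Prod>t\<in>z ` I. \<Prod>t'\<in>z ` I. t - t' + y) = A * (y ^ card I * B)" .
  have "MM n I lam z y (z ` I) = y ^ card I * (A * A' * C0 * E' * B) / (C0 * C_fac n I lam 1 y * (A * (y ^ card I * B)))"
    unfolding MM_def sum_bijs_diag[OF z I] w wden_def e by (simp add: C0_def C_fac_def)
  also have "\<dots> = inverse (C_fac n I lam 1 y) * A' * E'"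
    using nz y by (simp add: field_simps)
  finally show ?thesis unfolding A'_def E'_def C_fac_def prod_inversef[symmetric] by simp
qed


section \<open>Poles of the stable envelope matrix and of its inverse\<close>

abbreviation zz :: "nat \<Rightarrow> ratf" where "zz a \<equiv> rvar (Z a)"

definition lamv :: "int \<Rightarrow> ratf" where
  "lamv l = rvar Lam + of_int l * rvar Y"

text \<open>The restriction of $\kappa_{\mathrm{id},I}$ to $x_J$.\<close>

definition Mt :: "nat \<Rightarrow> int \<Rightarrow> nat set \<Rightarrow> nat set \<Rightarrow> ratf" where
  "Mt n l I J = (if card I = card J then MM n I (lamv l) zz (rvar Y) (zz ` J) else 0)"

lemma inj_zz: "inj_on zz A"
  by (auto simp: inj_on_def)

lemma lamv_to_fract: "lamv l = to_fract (Var Lam + of_int l * Var Y)"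
  by (simp add: lamv_def of_int_fract)

lemma lamv_shift: "lamv l - of_int m * rvar Y = lamv (l - m)"
  by (simp add: lamv_def algebra_simps)

lemma lamv_nonzero: "lamv l \<noteq> 0"
  by (simp only: lamv_to_fract to_fract_eq_0_iff lam_form_nonzero not_False_eq_True)

lemma lamv_diff_nonzero: "lamv l - of_int m * rvar Y \<noteq> 0"
  unfolding lamv_shift by (rule lamv_nonzero)

lemma zzy_to_fract: "zz a - zz b + rvar Y = to_fract (Var (Z a) - (Var (Z b) - Var Y))"
  by (simp add: to_fract_diff)

lemma zz_to_fract: "zz a - zz b = to_fract (Var (Z a) - Var (Z b))"
  by (simp add: to_fract_diff)

lemma zzy_nonzero: "zz a - zz b + rvar Y \<noteq> 0"
  by (simp only: zzy_to_fract to_fract_eq_0_iff zydiff_nonzero not_False_eq_True)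

lemma Sfull_to_fract: "p \<in> polys (Vlzy n) \<Longrightarrow> to_fract p \<in> Sfull n"
  unfolding Sfull_def by (rule to_fract_in_loc)

lemma Sfull_zz: "a \<in> {1..n} \<Longrightarrow> zz a \<in> Sfull n" and Sfull_y: "rvar Y \<in> Sfull n"
  and Sfull_lamv: "lamv l \<in> Sfull n"
  unfolding lamv_to_fract by (rule Sfull_to_fract; auto simp: Vzy_def intro!: polys_Var polys_add polys_mult)+

lemma Sfull_inverse_y: "inverse (rvar Y) \<in> Sfull n"
  unfolding Sfull_def by (rule inverse_in_loc) simp

lemma Sfull_inverse_lamv: "inverse (lamv l) \<in> Sfull n"
  unfolding Sfull_def lamv_to_fract by (rule inverse_in_loc) (auto simp: lam_forms_def)

lemma Sfull_inverse_zz: "a \<in> {1..n} \<Longrightarrow> b \<in> {1..n} \<Longrightarrow> a \<noteq> b \<Longrightarrow> inverse (zz a - zz b) \<in> Sfull n"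
  unfolding Sfull_def zz_to_fract by (rule inverse_in_loc) (auto simp: zdiffs_def)

lemma Sfull_inverse_zzy:
  assumes "a \<in> {1..n}" "b \<in> {1..n}" shows "inverse (zz a - zz b + rvar Y) \<in> Sfull n"
proof (cases "a = b")
  case True
  then show ?thesis using Sfull_inverse_y by simp
next
  case False
  then have "Var (Z a) - (Var (Z b) - Var Y) \<in> zydiffs n" using assms unfolding zydiffs_def by blast
  then show ?thesis unfolding Sfull_def zzy_to_fract by (intro inverse_in_loc) blast
qed

lemma Mt_Sfull:
  assumes "J \<subseteq> {1..n}" shows "Mt n l I J \<in> Sfull n"
proof -
  interpret field_subring "Sfull n" by (rule Sfull_subring)
  have "MM n I (lamv l) zz (rvar Y) (zz ` J) \<in> Sfull n"
  proof (rule MM_mem)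
    show "zz ` J \<subseteq> Sfull n" using assms Sfull_zz by blast
    show "inverse (lamv l - of_int m * rvar Y) \<in> Sfull n" for m
      unfolding lamv_shift by (rule Sfull_inverse_lamv)
    fix t t' assume "t \<in> zz ` J" "t' \<in> zz ` J"
    then obtain a b where ab: "a \<in> {1..n}" "b \<in> {1..n}" "t = zz a" "t' = zz b" using assms by blast
    then show "inverse (t - t' + rvar Y) \<in> Sfull n" using Sfull_inverse_zzy by simp
    show "inverse (t - t') \<in> Sfull n" if "t \<noteq> t'" using ab that by (auto intro!: Sfull_inverse_zz)
  qed (auto intro: Sfull_zz Sfull_y Sfull_lamv)
  then show ?thesis by (simp add: Mt_def)
qed

lemma Mt_diag:
  assumes "I \<subseteq> {1..n}"
  shows "Mt n l I I = (\<Prod>i\<in>I. inverse (lamv (l - (wt n i I + 1)))) *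
    (\<Prod>i\<in>I. \<Prod>a\<in>{a \<in> {1..n} - I. a < i}. zz i - zz a + rvar Y) * (\<Prod>i\<in>I. \<Prod>a\<in>{a \<in> {1..n} - I. i < a}. zz i - zz a)"
  using MM_diag[OF inj_zz assms, of "rvar Y" "lamv l"] lamv_diff_nonzero zzy_nonzero
  by (simp add: Mt_def lamv_shift del: of_int_add)

lemma finite_sub: "I \<subseteq> {1..n::nat} \<Longrightarrow> finite I"
  by (rule finite_subset) auto

lemma Mt_diag_nonzero: "I \<subseteq> {1..n} \<Longrightarrow> Mt n l I I \<noteq> 0"
  unfolding Mt_diag using finite_sub[of I n] lamv_nonzero zzy_nonzero
  by (auto simp: prod_zero_iff)

text \<open>Lists all possible poles of an inverse pivot; the order of the indices decides which of
  the two forms a pair contributes.\<close>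

lemma inverse_Mt_diag_mem:
  assumes S: "field_subring S" and I: "I \<subseteq> {1..n}" and lam: "\<And>l. lamv l \<in> S"
    and "\<And>i a. i \<in> I \<Longrightarrow> a \<in> {1..n} - I \<Longrightarrow> a < i \<Longrightarrow> inverse (zz i - zz a + rvar Y) \<in> S"
    and "\<And>i a. i \<in> I \<Longrightarrow> a \<in> {1..n} - I \<Longrightarrow> i < a \<Longrightarrow> inverse (zz i - zz a) \<in> S"
  shows "inverse (Mt n l I I) \<in> S"
proof -
  interpret field_subring S by fact
  show ?thesis unfolding Mt_diag[OF I] using assms by (intro inverse_mult_mem inverse_prod_mem) auto
qed

lemma inverse_Mt_Sfull: "I \<subseteq> {1..n} \<Longrightarrow> inverse (Mt n l I I) \<in> Sfull n"
  by (rule inverse_Mt_diag_mem[OF Sfull_subring])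
    (auto intro!: Sfull_lamv Sfull_inverse_zzy Sfull_inverse_zz)

lemma Mt_triangular: "I \<subseteq> {1..n} \<Longrightarrow> J \<subseteq> {1..n} \<Longrightarrow> Mt n l I J \<noteq> 0 \<Longrightarrow> \<Sum>J < \<Sum>I \<or> J = I"
  using MM_triangular[OF inj_zz, of J n I "lamv l" "rvar Y"] by (auto simp: Mt_def split: if_splits)

subsection \<open>The triangular system\<close>

text \<open>Downward induction on the sum of the elements: in the equation at J, apart from the
  pivot, only unknowns u I with larger sum occur.\<close>

lemma subset_sum_induct [consumes 1, case_names less]:
  assumes "J \<subseteq> {1..n::nat}"
    and step: "\<And>J. J \<subseteq> {1..n} \<Longrightarrow> (\<And>I. I \<subseteq> {1..n} \<Longrightarrow> \<Sum>J < \<Sum>I \<Longrightarrow> P I) \<Longrightarrow> P J"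
  shows "P J"
  using assms(1)
proof (induction "\<Sum>{1..n} - \<Sum>J" arbitrary: J rule: less_induct)
  case less
  show ?case
  proof (rule step[OF less.prems])
    fix I assume I: "I \<subseteq> {1..n}" "\<Sum>J < \<Sum>I"
    have "\<Sum>I \<le> \<Sum>{1..n}" using I(1) by (intro sum_mono2) auto
    then show "P I" using I less.hyps by simp
  qed
qed

text \<open>The restriction of Stab(u) to x_J: the transpose of \<open>Mt\<close> applied to the
  coordinate vector u.\<close>

definition Mapply :: "nat \<Rightarrow> int \<Rightarrow> (nat set \<Rightarrow> ratf) \<Rightarrow> nat set \<Rightarrow> ratf" where
  "Mapply n l u J = (\<Sum>I\<in>Pow {1..n}. Mt n l I J * u I)"

lemma Mapply_split:
  assumes "J \<subseteq> {1..n}"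
  shows "Mapply n l u J = Mt n l J J * u J + (\<Sum>I\<in>Pow {1..n} - {J}. Mt n l I J * u I)"
  unfolding Mapply_def using assms by (subst sum.remove[of _ J]) auto

lemma Mapply_solve_mem:
  assumes S: "field_subring S" and M: "\<And>I J. I \<subseteq> {1..n} \<Longrightarrow> J \<subseteq> {1..n} \<Longrightarrow> Mt n l I J \<in> S"
    and D: "\<And>I. I \<subseteq> {1..n} \<Longrightarrow> inverse (Mt n l I I) \<in> S"
    and g: "\<And>J. J \<subseteq> {1..n} \<Longrightarrow> Mapply n l u J \<in> S" and J: "J \<subseteq> {1..n}"
  shows "u J \<in> S"
  using J
proof (induction rule: subset_sum_induct)
  case (less J)
  interpret field_subring S by fact
  have "Mt n l I J * u I \<in> S" if I: "I \<in> Pow {1..n} - {J}" for I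
  proof (cases "Mt n l I J = 0")
    case False
    then have "\<Sum>J < \<Sum>I" using Mt_triangular[of I n J l] I less.hyps by auto
    then show ?thesis using less.IH[of I] M[of I J] I less.hyps by auto
  qed simp
  then have "(\<Sum>I\<in>Pow {1..n} - {J}. Mt n l I J * u I) \<in> S" by (rule sum_mem)
  then have "inverse (Mt n l J J) * (Mapply n l u J - (\<Sum>I\<in>Pow {1..n} - {J}. Mt n l I J * u I)) \<in> S"
    using D[OF less.hyps] g[OF less.hyps] by (intro mult_mem diff_mem)
  also have "inverse (Mt n l J J) * (Mapply n l u J - (\<Sum>I\<in>Pow {1..n} - {J}. Mt n l I J * u I)) = u J"
    unfolding Mapply_split[OF less.hyps] using Mt_diag_nonzero[OF less.hyps] by simp
  finally show ?case .
qed

lemma Mapply_diff: "Mapply n l (\<lambda>I. u I - v I) J = Mapply n l u J - Mapply n l v J"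
  by (simp add: Mapply_def right_diff_distrib sum_subtractf)

lemma Mapply_inj:
  assumes eq: "\<And>J. J \<subseteq> {1..n} \<Longrightarrow> Mapply n l u J = Mapply n l v J" and J: "J \<subseteq> {1..n}"
  shows "u J = v J"
  using J
proof (induction rule: subset_sum_induct)
  case (less J)
  have "Mt n l I J * (u I - v I) = 0" if I: "I \<in> Pow {1..n} - {J}" for I
  proof (cases "Mt n l I J = 0")
    case False
    then have "\<Sum>J < \<Sum>I" using Mt_triangular[of I n J l] I less.hyps by auto
    then show ?thesis using less.IH[of I] I by auto
  qed simp
  then have "(\<Sum>I\<in>Pow {1..n} - {J}. Mt n l I J * (u I - v I)) = 0" by (intro sum.neutral) blast
  then have "Mapply n l (\<lambda>I. u I - v I) J = Mt n l J J * (u J - v J)"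
    unfolding Mapply_split[OF less.hyps] by simp
  moreover have "Mapply n l (\<lambda>I. u I - v I) J = 0" using eq[OF less.hyps] by (simp add: Mapply_diff)
  ultimately show ?case using Mt_diag_nonzero[OF less.hyps] by simp
qed

lemma Mapply_surj: "\<exists>u. \<forall>J. J \<subseteq> {1..n} \<longrightarrow> Mapply n l u J = g J"
proof -
  \<comment> \<open>The number m counts the levels, from the largest sum downwards, on which the
    equations have been solved.\<close>
  have "\<exists>u. \<forall>J. J \<subseteq> {1..n} \<longrightarrow> \<Sum>J + m > \<Sum>{1..n} \<longrightarrow> Mapply n l u J = g J" for m
  proof (induction m)
    case 0
    have "\<Sum>J \<le> \<Sum>{1..n}" if "J \<subseteq> {1..n}" for J using that by (intro sum_mono2) auto
    then have "\<not> \<Sum>{1..n} < \<Sum>J + 0" if "J \<subseteq> {1..n}" for J using that by (simp add: leD)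
    then show ?case by blast
  next
    case (Suc m)
    then obtain u where u: "\<And>J. J \<subseteq> {1..n} \<Longrightarrow> \<Sum>J + m > \<Sum>{1..n} \<Longrightarrow> Mapply n l u J = g J" by blast
    define R where "R J = (\<Sum>I\<in>Pow {1..n} - {J}. Mt n l I J * u I)" for J
    \<comment> \<open>Only the unknowns on the next level change. They do not enter the equations
      solved before, which involve larger sums only.\<close>
    define u' where "u' I = (if \<Sum>I + m = \<Sum>{1..n} then (g I - R I) / Mt n l I I else u I)" for I
    have "Mapply n l u' J = g J" if J: "J \<subseteq> {1..n}" and s: "\<Sum>J + Suc m > \<Sum>{1..n}" for J
    proof (cases "\<Sum>J + m > \<Sum>{1..n}")
      case True
      have "Mt n l I J * u' I = Mt n l I J * u I" if I: "I \<in> Pow {1..n}" for I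
      proof (cases "Mt n l I J = 0")
        case False
        then have "\<Sum>J \<le> \<Sum>I" using Mt_triangular[of I n J l] I J by auto
        then show ?thesis using True by (simp add: u'_def)
      qed simp
      then have "Mapply n l u' J = Mapply n l u J" unfolding Mapply_def by (rule sum.cong[OF HOL.refl])
      then show ?thesis using u[OF J True] by simp
    next
      case False
      then have e: "\<Sum>J + m = \<Sum>{1..n}" using s by linarith
      have "Mt n l I J * u' I = Mt n l I J * u I" if I: "I \<in> Pow {1..n} - {J}" for I
      proof (cases "Mt n l I J = 0")
        case False
        then have "\<Sum>J < \<Sum>I" using Mt_triangular[of I n J l] I J by auto
        then show ?thesis using e by (simp add: u'_def)
      qed simp
      then have "(\<Sum>I\<in>Pow {1..n} - {J}. Mt n l I J * u' I) = R J" unfolding R_def by (rule sum.cong[OF HOL.refl])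
      then have "Mapply n l u' J = Mt n l J J * u' J + R J"
        unfolding Mapply_split[OF J] by simp
      then show ?thesis using e Mt_diag_nonzero[OF J] by (simp add: u'_def)
    qed
    then show ?case by blast
  qed
  from this[of "Suc (\<Sum>{1..n})"] show ?thesis by (auto simp: less_Suc_eq_le trans_le_add2)
qed

subsection \<open>No poles at $z_i=z_a-y$ for $i<a$\<close>

abbreviation sB :: "nat \<Rightarrow> nat \<Rightarrow> var \<Rightarrow> cpoly" where
  "sB i a \<equiv> Var(Z i := Var (Z a) - Var Y)"

lemma regular_inverse_to_fract: "psubst \<sigma> p \<noteq> 0 \<Longrightarrow> regular \<sigma> (inverse (to_fract p))"
  by (rule regular_inverse) auto

lemma sB_lamv: "regular (sB i a) (inverse (lamv l))"
  unfolding lamv_to_fract by (rule regular_inverse_to_fract) (simp add: lam_form_nonzero)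

lemma sB_zzy:
  assumes "i \<noteq> a" "(j, j') \<noteq> (i, a)"
  shows "psubst (sB i a) (Var (Z j) - (Var (Z j') - Var Y)) \<noteq> 0"
proof -
  consider "j = i" "j' = i" | "j = i" "j' \<noteq> i" "j' \<noteq> a" | "j \<noteq> i" "j' = i" | "j \<noteq> i" "j' \<noteq> i"
    using assms by auto
  then show ?thesis
  proof cases
    case 1
    then show ?thesis by simp
  next
    case 2
    then have "psubst (sB i a) (Var (Z j) - (Var (Z j') - Var Y)) = Var (Z a) - Var (Z j')" by simp
    then show ?thesis using 2 by simp
  next
    case 3
    \<comment> \<open>The index j may equal a here; the term 2 y then keeps the value
      nonzero.\<close>
    then have "psubst (sB i a) (Var (Z j) - (Var (Z j') - Var Y)) = Var (Z j) - (Var (Z a) - 2 * Var Y)" by (simp add: algebra_simps)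
    moreover have "\<dots> \<noteq> 0"
      by (rule psubst_nonzero_imp[of "\<lambda>v. if v = Y then 1 else 0"]) simp
    ultimately show ?thesis by metis
  next
    case 4
    then have "psubst (sB i a) (Var (Z j) - (Var (Z j') - Var Y)) = Var (Z j) - (Var (Z j') - Var Y)" by simp
    then show ?thesis using zydiff_nonzero(1) by metis
  qed
qed

lemma sB_zz: 
  assumes "i \<noteq> a" "j \<noteq> j'" shows "psubst (sB i a) (Var (Z j) - Var (Z j')) \<noteq> 0"
proof -
  consider "j = i" "j' \<noteq> i" | "j \<noteq> i" "j' = i" | "j \<noteq> i" "j' \<noteq> i" using assms by auto
  then show ?thesis
  proof cases
    case 1
    then have "psubst (sB i a) (Var (Z j) - Var (Z j')) = Var (Z a) - Var Y - Var (Z j')" by simp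
    moreover have "\<dots> \<noteq> 0"
      by (rule psubst_nonzero_imp[of "\<lambda>v. if v = Y then 1 else 0"]) simp
    ultimately show ?thesis by metis
  next
    case 2
    then have "psubst (sB i a) (Var (Z j) - Var (Z j')) = Var (Z j) - (Var (Z a) - Var Y)" by simp
    then show ?thesis using zydiff_nonzero(1) by metis
  qed (use assms in simp)
qed

lemma regular_inverse_zz: "psubst \<sigma> (Var (Z j) - Var (Z j')) \<noteq> 0 \<Longrightarrow> regular \<sigma> (inverse (zz j - zz j'))"
  unfolding zz_to_fract by (rule regular_inverse_to_fract)

lemma regular_inverse_zzy: "psubst \<sigma> (Var (Z j) - (Var (Z j') - Var Y)) \<noteq> 0 \<Longrightarrow> regular \<sigma> (inverse (zz j - zz j' + rvar Y))"
  unfolding zzy_to_fract by (rule regular_inverse_to_fract)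

lemma regular_lamv: "regular \<sigma> (lamv l)"
  unfolding lamv_to_fract by simp

lemma sB_inverse_zz: "i \<noteq> a \<Longrightarrow> j \<noteq> j' \<Longrightarrow> regular (sB i a) (inverse (zz j - zz j'))"
  by (rule regular_inverse_zz, rule sB_zz)

lemma sB_inverse_zzy: "i \<noteq> a \<Longrightarrow> (j, j') \<noteq> (i, a) \<Longrightarrow> regular (sB i a) (inverse (zz j - zz j' + rvar Y))"
  by (rule regular_inverse_zzy, rule sB_zzy)

text \<open>A pivot contains z_j - z_c + y only for c < j, hence never the form z_i - z_a + y with i
  < a. This is the origin of the restriction to i < a.\<close>

lemma sB_inverse_Mt:
  assumes "I \<subseteq> {1..n}" "i < a"
  shows "regular (sB i a) (inverse (Mt n l I I))"
proof -
  have "inverse (Mt n l I I) \<in> {x. regular (sB i a) x}"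
    by (rule inverse_Mt_diag_mem[OF field_subring_regular assms(1)])
      (use assms(2) in \<open>auto simp only: mem_Collect_eq prod.inject intro!: regular_lamv sB_inverse_zz sB_inverse_zzy\<close>)
  then show ?thesis by simp
qed

lemma prod_factor_out:
  assumes "finite A" "x \<in> A" "f x = c * r" "regular \<sigma> r" "\<And>x'. x' \<in> A \<Longrightarrow> x' \<noteq> x \<Longrightarrow> regular \<sigma> (f x')"
  shows "\<exists>r'. regular \<sigma> r' \<and> prod f A = c * r'"
proof -
  have "prod f A = c * (r * prod f (A - {x}))"
    using assms by (subst prod.remove[of _ x]) (auto simp: mult.assoc)
  moreover have "regular \<sigma> (r * prod f (A - {x}))" using assms by (intro regular_mult regular_prod) auto
  ultimately show ?thesis by blast
qed

text \<open>Let z_i and z_a sit at the positions i0 and i1. If i0 < i1, the pair (i0, i1)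
  contributes z_i - z_a + y. Otherwise a \<le> i1 < i0, since indices never move up, and then row i0
  contains t - z_a + y at t = z_i.\<close>

lemma sB_wterm:
  assumes I: "I \<subseteq> {1..n}" and J: "J \<subseteq> {1..n}" and ia: "i \<in> J" "a \<in> J" "i < a"
    and f: "f \<in> bijs I (zz ` J)"
  shows "\<exists>r. regular (sB i a) r \<and> wterm n I (lamv l) zz (rvar Y) f = (zz i - zz a + rvar Y) * r"
proof (cases "wterm n I (lamv l) zz (rvar Y) f = 0")
  case True
  then show ?thesis by (intro exI[of _ 0]) simp
next
  case False
  let ?\<sigma> = "sB i a" and ?c = "zz i - zz a + rvar Y"
  have fin: "finite I" using I by (rule finite_sub)
  obtain \<phi> where \<phi>: "bij_betw \<phi> I J" "\<And>i. i \<in> I \<Longrightarrow> f i = zz (\<phi> i) \<and> \<phi> i \<le> i"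
    using wterm_nonzeroD[OF inj_zz J I f False] by blast
  obtain i0 i1 where i01: "i0 \<in> I" "\<phi> i0 = i" "i1 \<in> I" "\<phi> i1 = a"
    using ia(1,2) bij_betw_imp_surj_on[OF \<phi>(1)] by blast
  have reg_wl: "regular ?\<sigma> (wl n I (lamv l) zz (rvar Y) j b (f j))" if "j \<in> I" for j b
    using \<phi>(2)[OF that] by (simp add: wl_def regular_lamv)
  have reg_pair: "regular ?\<sigma> ((f j - f j' + rvar Y) / (f j - f j'))" if "(j, j') \<in> pairs I" for j j'
  proof -
    have jj: "j \<in> I" "j' \<in> I" "j \<noteq> j'" using that by (auto simp: pairs_def)
    then have "\<phi> j \<noteq> \<phi> j'" using bij_betw_imp_inj_on[OF \<phi>(1)] by (auto simp: inj_on_def)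
    then have "regular ?\<sigma> (inverse (zz (\<phi> j) - zz (\<phi> j')))"
      by (intro sB_inverse_zz) (use ia in auto)
    then show ?thesis using \<phi>(2)[OF jj(1)] \<phi>(2)[OF jj(2)] by (simp add: divide_inverse)
  qed
  have reg1: "regular ?\<sigma> (\<Prod>j\<in>I. \<Prod>b\<in>{1..n}. wl n I (lamv l) zz (rvar Y) j b (f j))"
    by (intro regular_prod reg_wl)
  have reg2: "regular ?\<sigma> (\<Prod>(j, j')\<in>pairs I. (f j - f j' + rvar Y) / (f j - f j'))"
    using reg_pair by (intro regular_prod) auto
  show ?thesis
  proof (cases "i0 < i1")
    case True
    have "regular ?\<sigma> (inverse (zz i - zz a))" by (intro sB_inverse_zz) (use ia in auto)
    moreover have "(i0, i1) \<in> pairs I" using True i01 by (simp add: pairs_def)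
    moreover have "(case (i0, i1) of (j, j') \<Rightarrow> (f j - f j' + rvar Y) / (f j - f j')) = ?c * inverse (zz i - zz a)"
      using \<phi>(2)[OF i01(1)] \<phi>(2)[OF i01(3)] i01 by (simp add: divide_inverse)
    ultimately obtain r' where "regular ?\<sigma> r'" "(\<Prod>(j, j')\<in>pairs I. (f j - f j' + rvar Y) / (f j - f j')) = ?c * r'"
      using prod_factor_out[of "pairs I" "(i0, i1)" "\<lambda>(j, j'). (f j - f j' + rvar Y) / (f j - f j')" ?c "inverse (zz i - zz a)" ?\<sigma>]
        fin reg_pair by auto
    with reg1 show ?thesis unfolding wterm_def
      by (intro exI[of _ "(\<Prod>j\<in>I. \<Prod>b\<in>{1..n}. wl n I (lamv l) zz (rvar Y) j b (f j)) * r'"]) (simp add: mult_ac)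
  next
    case False
    have ain: "a \<in> {1..n}" using ia J by blast
    have "i0 \<noteq> i1" using i01 ia by auto
    then have "a < i0" using \<phi>(2)[OF i01(3)] i01 False by auto
    then have "wl n I (lamv l) zz (rvar Y) i0 a (f i0) = ?c * 1" using \<phi>(2)[OF i01(1)] i01 by (simp add: wl_def)
    then obtain r where r: "regular ?\<sigma> r" "(\<Prod>b\<in>{1..n}. wl n I (lamv l) zz (rvar Y) i0 b (f i0)) = ?c * r"
      using prod_factor_out[OF finite_atLeastAtMost ain _ regular_1, of "\<lambda>b. wl n I (lamv l) zz (rvar Y) i0 b (f i0)" ?c ?\<sigma>]
        reg_wl[OF i01(1)] by blast
    obtain r' where "regular ?\<sigma> r'" "(\<Prod>j\<in>I. \<Prod>b\<in>{1..n}. wl n I (lamv l) zz (rvar Y) j b (f j)) = ?c * r'"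
      using prod_factor_out[of I i0 "\<lambda>j. \<Prod>b\<in>{1..n}. wl n I (lamv l) zz (rvar Y) j b (f j)" ?c r ?\<sigma>, OF fin i01(1) r(2,1)]
        reg_wl by (auto intro!: regular_prod)
    with reg2 show ?thesis unfolding wterm_def
      by (intro exI[of _ "r' * (\<Prod>(j, j')\<in>pairs I. (f j - f j' + rvar Y) / (f j - f j'))"]) (simp add: mult_ac)
  qed
qed

text \<open>The only denominator that vanishes on the hyperplane is the factor z_i - z_a + y of e_k.
  It occurs once, and only if i and a both lie in J; then it divides every summand by
  \<open>sB_wterm\<close>.\<close>

lemma sB_Mt:
  assumes I: "I \<subseteq> {1..n}" and J: "J \<subseteq> {1..n}" and ia: "i < a"
  shows "regular (sB i a) (Mt n l I J)"
proof (cases "i \<in> J \<and> a \<in> J")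
  case False
  interpret field_subring "{x. regular (sB i a) x}" by (rule field_subring_regular)
  have "MM n I (lamv l) zz (rvar Y) (zz ` J) \<in> {x. regular (sB i a) x}"
  proof (rule MM_mem)
    show "inverse (lamv l - of_int m * rvar Y) \<in> {x. regular (sB i a) x}" for m
      unfolding lamv_shift using sB_lamv by simp
    fix t t' assume "t \<in> zz ` J" "t' \<in> zz ` J"
    then obtain j j' where j: "j \<in> J" "j' \<in> J" "t = zz j" "t' = zz j'" by blast
    then have "(j, j') \<noteq> (i, a)" using False by auto
    then show "inverse (t - t' + rvar Y) \<in> {x. regular (sB i a) x}"
      unfolding j mem_Collect_eq using ia by (intro sB_inverse_zzy) auto
    show "inverse (t - t') \<in> {x. regular (sB i a) x}" if "t \<noteq> t'"
      using that ia unfolding j mem_Collect_eq by (intro sB_inverse_zz) auto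
  qed (auto simp: regular_lamv)
  then show ?thesis by (simp add: Mt_def)
next
  case True
  let ?\<sigma> = "sB i a" and ?c = "zz i - zz a + rvar Y"
  have fJ: "finite J" using J by (rule finite_sub)
  define e where "e = (\<Prod>(j, j')\<in>J \<times> J - {(i, a)}. zz j - zz j' + rvar Y)"
  have e: "(\<Prod>t\<in>zz ` J. \<Prod>t'\<in>zz ` J. t - t' + rvar Y) = ?c * e"
  proof -
    have "(\<Prod>t\<in>zz ` J. \<Prod>t'\<in>zz ` J. t - t' + rvar Y) = (\<Prod>(j, j')\<in>J \<times> J. zz j - zz j' + rvar Y)"
      unfolding prod.reindex[OF inj_zz] o_def by (rule prod.cartesian_product)
    also have "\<dots> = ?c * e" unfolding e_def using True fJ by (subst prod.remove[of _ "(i, a)"]) auto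
    finally show ?thesis .
  qed
  have re: "regular ?\<sigma> (inverse e)"
    unfolding e_def prod_inversef[symmetric]
  proof (rule regular_prod)
    fix x assume x: "x \<in> J \<times> J - {(i, a)}"
    obtain j j' where xj: "x = (j, j')" by (cases x)
    with x have "(j, j') \<noteq> (i, a)" by auto
    then have "regular ?\<sigma> (inverse (zz j - zz j' + rvar Y))" using ia by (intro sB_inverse_zzy) auto
    then show "regular ?\<sigma> ((inverse \<circ> (\<lambda>(j, j'). zz j - zz j' + rvar Y)) x)" by (simp add: xj)
  qed
  have rC: "regular ?\<sigma> (inverse (C_fac n I (lamv l) r (rvar Y)))" for r
    unfolding C_fac_def prod_inversef[symmetric] lamv_shift by (intro regular_prod) (simp add: sB_lamv)
  have "regular ?\<sigma> (rvar Y ^ card I * wterm n I (lamv l) zz (rvar Y) f / wden n I (lamv l) (rvar Y) (zz ` J))"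
    if f: "f \<in> bijs I (zz ` J)" for f
  proof -
    obtain r where r: "regular ?\<sigma> r" "wterm n I (lamv l) zz (rvar Y) f = ?c * r"
      using sB_wterm[OF I J _ _ ia f] True by blast
    have "rvar Y ^ card I * wterm n I (lamv l) zz (rvar Y) f / wden n I (lamv l) (rvar Y) (zz ` J)
      = rvar Y ^ card I * r * inverse (C_fac n I (lamv l) 0 (rvar Y)) * inverse (C_fac n I (lamv l) 1 (rvar Y)) * inverse e"
      unfolding wden_def e r(2) divide_inverse inverse_mult_distrib using zzy_nonzero[of i a] by simp
    then show ?thesis using r re rC by (simp add: regular_rsub_power)
  qed
  then have "regular ?\<sigma> (MM n I (lamv l) zz (rvar Y) (zz ` J))"
    unfolding MM_def sum_distrib_left sum_divide_distrib by (rule regular_sum)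
  then show ?thesis by (simp add: Mt_def)
qed


subsection \<open>No poles at $z_a=z_b$\<close>

abbreviation sC :: "nat \<Rightarrow> nat \<Rightarrow> var \<Rightarrow> cpoly" where
  "sC a b \<equiv> Var(Z a := Var (Z b))"

definition collapse :: "nat \<Rightarrow> nat \<Rightarrow> nat \<Rightarrow> nat" where
  "collapse a b j = (if j = a then b else j)"

lemma rsub_sC_zz: "rsub (sC a b) (zz j) = zz (collapse a b j)"
  by (simp add: collapse_def)

lemma rsub_sC_y: "rsub (sC a b) (rvar Y) = rvar Y" and rsub_sC_lamv: "rsub (sC a b) (lamv l) = lamv l"
  by (simp_all add: lamv_to_fract)

lemma sC_inverse_zzy: "regular (sC a b) (inverse (zz j - zz j' + rvar Y))"
proof (rule regular_inverse)
  have "rsub (sC a b) (zz j - zz j' + rvar Y) = zz (collapse a b j) - zz (collapse a b j') + rvar Y"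
    by (simp add: collapse_def)
  then show "rsub (sC a b) (zz j - zz j' + rvar Y) \<noteq> 0" using zzy_nonzero by metis
qed simp

lemma sC_inverse_zz:
  assumes "collapse a b j \<noteq> collapse a b j'" shows "regular (sC a b) (inverse (zz j - zz j'))"
  by (rule regular_inverse) (use assms in \<open>auto simp: collapse_def split: if_splits\<close>)

lemma sC_inverse_lamv: "regular (sC a b) (inverse (lamv l))"
  by (rule regular_inverse) (auto simp: regular_lamv rsub_sC_lamv lamv_nonzero)

lemma wden_nonzero:
  assumes "finite K" "finite J" shows "wden n K (lamv l) (rvar Y) (zz ` J) \<noteq> 0"
proof -
  have "C_fac n K (lamv l) r (rvar Y) \<noteq> 0" for r
    unfolding C_fac_def using assms lamv_diff_nonzero by (auto simp: prod_zero_iff simp del: of_int_add)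
  moreover have "(\<Prod>t\<in>zz ` J. \<Prod>t'\<in>zz ` J. t - t' + rvar Y) \<noteq> 0"
    unfolding prod.reindex[OF inj_zz] o_def using assms zzy_nonzero by (simp add: prod_zero_iff)
  ultimately show ?thesis by (simp add: wden_def)
qed

text \<open>Unless J contains both a and b, the values substituted for t stay distinct at z_a = z_b,
  and the weight function can be specialized as it stands.\<close>

lemma sC_Mt_simple:
  assumes I: "I \<subseteq> {1..n}" and J: "J \<subseteq> {1..n}" and ab: "a \<noteq> b" "\<not> (a \<in> J \<and> b \<in> J)" and card: "card I = card J"
  shows "regular (sC a b) (Mt n l I J) \<and> rsub (sC a b) (Mt n l I J) =
    MM n I (lamv l) (\<lambda>j. zz (collapse a b j)) (rvar Y) (zz ` collapse a b ` J)"
proof -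
  have inj: "inj_on (rsub (sC a b)) (zz ` J)"
    using ab by (auto simp: inj_on_def collapse_def rsub_sC_zz split: if_splits)
  have img: "rsub (sC a b) ` zz ` J = zz ` collapse a b ` J"
    by (simp add: image_image rsub_sC_zz del: rsub_to_fract)
  have "wden n I (rsub (sC a b) (lamv l)) (rsub (sC a b) (rvar Y)) (rsub (sC a b) ` zz ` J) \<noteq> 0"
    unfolding img rsub_sC_y rsub_sC_lamv by (rule wden_nonzero) (use finite_sub[OF I] finite_sub[OF J] in auto)
  moreover have "regular (sC a b) t" if "t \<in> zz ` J" for t using that by auto
  ultimately have "regular (sC a b) (MM n I (lamv l) zz (rvar Y) (zz ` J)) \<and>
    rsub (sC a b) (MM n I (lamv l) zz (rvar Y) (zz ` J)) = MM n I (rsub (sC a b) (lamv l))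
      (\<lambda>a'. rsub (sC a b) (zz a')) (rsub (sC a b) (rvar Y)) (rsub (sC a b) ` zz ` J)"
    by (intro rsub_MM inj finite_sub[OF I] finite_imageI[OF finite_sub[OF J]] regular_lamv regular_to_fract)
  then
  show ?thesis unfolding img rsub_sC_y rsub_sC_lamv rsub_sC_zz Mt_def using card by auto
qed

text \<open>Characteristic different from 2, needed where a sum is shown to equal its own
  negative.\<close>

lemma ratf_double_zero: "x = - x \<Longrightarrow> x = (0::ratf)"
proof -
  assume "x = - x"
  then have "of_int 2 * x = 0" by (simp add: eq_neg_iff_add_eq_0)
  moreover have "(of_int 2 :: cpoly) \<noteq> 0" unfolding of_int_eq_Cst by simp
  then have "(of_int 2 :: ratf) \<noteq> 0" unfolding of_int_fract by (simp only: to_fract_eq_0_iff not_False_eq_True)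
  ultimately show ?thesis using mult_eq_0_iff by blast
qed

lemma sC_div:
  assumes "regular (sC a b) x" "rsub (sC a b) x = 0" "a \<noteq> b"
  shows "regular (sC a b) (x / (zz a - zz b))"
proof -
  obtain p q where pq: "x = Fract p q" "q \<noteq> 0" "psubst (sC a b) q \<noteq> 0" "rsub (sC a b) x = Fract (psubst (sC a b) p) (psubst (sC a b) q)"
    using assms(1) by (rule regular_cases)
  then have "psubst (sC a b) p = 0" using assms(2) by (simp add: Zero_fract_def eq_fract)
  then have "Var (Z a) - Var (Z b) dvd p" by (rule dvd_if_psubst_0)
  then obtain p' where p': "p = (Var (Z a) - Var (Z b)) * p'" by (elim dvdE)
  have "x / (zz a - zz b) = Fract p' q"
    unfolding pq(1) p' zz_to_fract using assms(3) pq(2)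
    by (simp add: to_fract_def eq_fract mult_ac)
  then show ?thesis using pq(3) by (simp add: regular_Fract)
qed

text \<open>The residue of a summand of the weight function along $z_a=z_b$, when both $z_a$ and $z_b$ are
  substituted for \<open>t\<close>-variables; \<open>p\<close>, \<open>q\<close> are the positions at which they occur.\<close>

lemma sC_wterm:
  assumes I: "I \<subseteq> {1..n}" and ab: "a \<noteq> b" and f: "f \<in> bijs I (zz ` J)"
    and pq: "(p, q) \<in> pairs I" "f p = zz a \<and> f q = zz b \<or> f p = zz b \<and> f q = zz a"
  shows "regular (sC a b) ((zz a - zz b) * wterm n I (lamv l) zz (rvar Y) f) \<and>
    rsub (sC a b) ((zz a - zz b) * wterm n I (lamv l) zz (rvar Y) f) =
     (if f p = zz a then 1 else - 1) * rvar Y *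
       ((\<Prod>i\<in>I. \<Prod>c\<in>{1..n}. wl n I (lamv l) (\<lambda>j. zz (collapse a b j)) (rvar Y) i c (rsub (sC a b) (f i))) *
       (\<Prod>(i, j)\<in>pairs I - {(p, q)}. (rsub (sC a b) (f i) - rsub (sC a b) (f j) + rvar Y) / (rsub (sC a b) (f i) - rsub (sC a b) (f j))))"
proof -
  let ?\<sigma> = "sC a b" and ?d = "zz a - zz b"
  have fin: "finite I" using I by (rule finite_sub)
  have fz: "\<exists>c. f i = zz c" if "i \<in> I" for i using bijsD(4)[OF f that] by blast
  have fr: "regular ?\<sigma> (f i)" if "i \<in> I" for i using fz[OF that] by auto
  have pqI: "p \<in> I" "q \<in> I" "p < q" using pq(1) by (auto simp: pairs_def)
  \<comment> \<open>The substitution identifies only z_a with z_b and f is injective, so (p, q) is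
    the only pair whose difference dies.\<close>
  have neq: "rsub ?\<sigma> (f i) \<noteq> rsub ?\<sigma> (f j)" if ij: "(i, j) \<in> pairs I - {(p, q)}" for i j
  proof
    assume e: "rsub ?\<sigma> (f i) = rsub ?\<sigma> (f j)"
    have ij': "i \<in> I" "j \<in> I" "i < j" using ij by (auto simp: pairs_def)
    obtain c d where cd: "f i = zz c" "f j = zz d" using fz ij' by blast
    have "f i \<noteq> f j" using bijsD(2)[OF f] ij' by (auto simp: inj_on_def)
    with cd e have "c = a \<and> d = b \<or> c = b \<and> d = a"
      by (auto simp: collapse_def split: if_splits)
    then have fij: "f i = zz a \<and> f j = zz b \<or> f i = zz b \<and> f j = zz a" using cd by auto
    have inj: "x = x'" if "x \<in> I" "x' \<in> I" "f x = f x'" for x x'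
      using inj_onD[OF bijsD(2)[OF f] that(3,1,2)] .
    have "i = p \<and> j = q \<or> i = q \<and> j = p"
      using fij pq(2) inj[OF ij'(1) pqI(1)] inj[OF ij'(1) pqI(2)] inj[OF ij'(2) pqI(1)] inj[OF ij'(2) pqI(2)] by metis
    then show False using ij ij' pqI by auto
  qed
  let ?b = "\<lambda>(i, j). (f i - f j + rvar Y) / (f i - f j)"
  let ?rb = "\<lambda>(i, j). (rsub ?\<sigma> (f i) - rsub ?\<sigma> (f j) + rvar Y) / (rsub ?\<sigma> (f i) - rsub ?\<sigma> (f j))"
  have rb: "regular ?\<sigma> (?b x) \<and> rsub ?\<sigma> (?b x) = ?rb x" if x: "x \<in> pairs I - {(p, q)}" for x
  proof -
    obtain i j where xij: "x = (i, j)" by (cases x)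
    then have "regular ?\<sigma> (f i)" "regular ?\<sigma> (f j)" using x fr by (auto simp: pairs_def)
    then show ?thesis using neq[of i j] x unfolding xij
      by (auto simp: rsub_divide rsub_sC_y intro!: regular_divide)
  qed
  have rest: "regular ?\<sigma> (prod ?b (pairs I - {(p, q)})) \<and> rsub ?\<sigma> (prod ?b (pairs I - {(p, q)})) = prod ?rb (pairs I - {(p, q)})"
    using regular_rsub_prod[of "pairs I - {(p, q)}" ?\<sigma> ?b] rb by (auto intro!: prod.cong)
  have wl: "regular ?\<sigma> (wl n I (lamv l) zz (rvar Y) i c (f i)) \<and> rsub ?\<sigma> (wl n I (lamv l) zz (rvar Y) i c (f i))
     = wl n I (lamv l) (\<lambda>j. zz (collapse a b j)) (rvar Y) i c (rsub ?\<sigma> (f i))" if "i \<in> I" for i c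
    using fr[OF that] by (simp add: wl_def regular_lamv rsub_sC_lamv rsub_sC_y rsub_sC_zz del: rsub_to_fract)
  let ?L = "\<Prod>i\<in>I. \<Prod>c\<in>{1..n}. wl n I (lamv l) zz (rvar Y) i c (f i)"
  let ?RL = "\<Prod>i\<in>I. \<Prod>c\<in>{1..n}. wl n I (lamv l) (\<lambda>j. zz (collapse a b j)) (rvar Y) i c (rsub ?\<sigma> (f i))"
  have L: "regular ?\<sigma> ?L \<and> rsub ?\<sigma> ?L = ?RL"
    using wl by (simp add: regular_prod rsub_prod)
  \<comment> \<open>The factor of the pair (p, q) multiplied by z_a - z_b. At z_a = z_b it becomes y
    or -y, according to which of the two parameters comes first; this is the sign in the
    residue.\<close>
  define c where "c = (if f p = zz a then ?d + rvar Y else ?d - rvar Y)"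
  have dnz: "?d \<noteq> 0" using ab by simp
  have c: "?d * ?b (p, q) = c"
  proof (cases "f p = zz a")
    case True
    then have "f q = zz b" using pq(2) ab by auto
    then show ?thesis using True dnz by (simp add: c_def)
  next
    case False
    then have "f p = zz b" "f q = zz a" using pq(2) by auto
    then show ?thesis using False ab by (simp add: c_def field_simps)
  qed
  have rc: "regular ?\<sigma> c" "rsub ?\<sigma> c = (if f p = zz a then 1 else - 1) * rvar Y"
    using ab by (auto simp: c_def)
  have "prod ?b (pairs I) = ?b (p, q) * prod ?b (pairs I - {(p, q)})"
    using pq(1) fin by (intro prod.remove) auto
  then have "?d * wterm n I (lamv l) zz (rvar Y) f = ?d * ?b (p, q) * (?L * prod ?b (pairs I - {(p, q)}))"
    unfolding wterm_def by (simp only: mult_ac)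
  also have "\<dots> = c * (?L * prod ?b (pairs I - {(p, q)}))" by (simp only: c)
  finally have "?d * wterm n I (lamv l) zz (rvar Y) f = c * (?L * prod ?b (pairs I - {(p, q)}))" .
  then show ?thesis using rc L rest by simp
qed

text \<open>Each summand has at most a simple pole. Exchanging the values z_a and z_b in f permutes
  the summands and reverses the sign of the residue, so the total residue equals its own negative
  and vanishes.\<close>

lemma sC_Mt_both:
  assumes I: "I \<subseteq> {1..n}" and J: "J \<subseteq> {1..n}" and ab: "a \<noteq> b" "a \<in> J" "b \<in> J"
  shows "regular (sC a b) (MM n I (lamv l) zz (rvar Y) (zz ` J))"
proof -
  let ?\<sigma> = "sC a b" and ?d = "zz a - zz b" and ?T = "zz ` J"
  let ?w = "\<lambda>f. ?d * wterm n I (lamv l) zz (rvar Y) f"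
  have fin: "finite I" "finite ?T" using finite_sub[OF I] finite_sub[OF J] by auto
  define sw where "sw = transpose (zz a) (zz b)"
  have swT: "sw ` ?T = ?T" unfolding sw_def using ab by (simp add: transpose_image_eq)
  have swr: "rsub ?\<sigma> (sw x) = rsub ?\<sigma> x" for x by (simp add: sw_def transpose_def)
  have sum_bij: "bij_betw (\<lambda>f. \<lambda>i\<in>I. sw (f i)) (bijs I ?T) (bijs I ?T)"
    using bijs_image[of sw ?T I] fin swT by (simp add: sw_def)
  have key: "regular ?\<sigma> (?w f) \<and> rsub ?\<sigma> (?w f) = - rsub ?\<sigma> (?w (\<lambda>i\<in>I. sw (f i)))"
    if f: "f \<in> bijs I ?T" for f
  proof -
    have "zz a \<in> f ` I" "zz b \<in> f ` I" unfolding bijsD(3)[OF f] using ab by blast+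
    then obtain i j where ij: "i \<in> I" "j \<in> I" "f i = zz a" "f j = zz b"
      unfolding image_iff by metis
    have "i \<noteq> j" using ij ab by auto
    define p where "p = min i j"
    define q where "q = max i j"
    have pq: "(p, q) \<in> pairs I" using ij \<open>i \<noteq> j\<close> by (auto simp: p_def q_def pairs_def min_def max_def)
    have fpq: "f p = zz a \<and> f q = zz b \<or> f p = zz b \<and> f q = zz a"
      using ij by (auto simp: p_def q_def min_def max_def)
    let ?g = "\<lambda>i\<in>I. sw (f i)"
    have g: "?g \<in> bijs I ?T" using bij_betwE[OF sum_bij] f by blast
    have pqI: "p \<in> I" "q \<in> I" using pq by (auto simp: pairs_def)
    have gpq: "?g p = zz a \<and> ?g q = zz b \<or> ?g p = zz b \<and> ?g q = zz a"
      using fpq pqI by (auto simp: sw_def)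
    have sg: "(if ?g p = zz a then 1 else - 1) = - (if f p = zz a then 1 else - 1 :: ratf)"
      using fpq pqI ab by (auto simp: sw_def)
    have 1: "(\<Prod>i\<in>I. \<Prod>c\<in>{1..n}. wl n I (lamv l) (\<lambda>j. zz (collapse a b j)) (rvar Y) i c (rsub ?\<sigma> (?g i)))
       = (\<Prod>i\<in>I. \<Prod>c\<in>{1..n}. wl n I (lamv l) (\<lambda>j. zz (collapse a b j)) (rvar Y) i c (rsub ?\<sigma> (f i)))"
      by (intro prod.cong HOL.refl) (simp add: swr)
    have 2: "(\<Prod>(i, j)\<in>pairs I - {(p, q)}. (rsub ?\<sigma> (?g i) - rsub ?\<sigma> (?g j) + rvar Y) / (rsub ?\<sigma> (?g i) - rsub ?\<sigma> (?g j)))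
       = (\<Prod>(i, j)\<in>pairs I - {(p, q)}. (rsub ?\<sigma> (f i) - rsub ?\<sigma> (f j) + rvar Y) / (rsub ?\<sigma> (f i) - rsub ?\<sigma> (f j)))"
      by (intro prod.cong HOL.refl) (auto simp: swr pairs_def)
    show ?thesis
      using sC_wterm[OF I ab(1) f pq fpq, of l] sC_wterm[OF I ab(1) g pq gpq, of l]
      unfolding 1 2 sg by (simp only: mult_minus_left minus_minus simp_thms)
  qed
  have reg: "regular ?\<sigma> (\<Sum>f\<in>bijs I ?T. ?w f)" using key by (intro regular_sum) blast
  have "rsub ?\<sigma> (\<Sum>f\<in>bijs I ?T. ?w f) = (\<Sum>f\<in>bijs I ?T. rsub ?\<sigma> (?w f))"
    using key by (intro rsub_sum) blast
  also have "\<dots> = (\<Sum>f\<in>bijs I ?T. - rsub ?\<sigma> (?w (\<lambda>i\<in>I. sw (f i))))"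
    using key by (intro sum.cong) auto
  also have "\<dots> = - (\<Sum>f\<in>bijs I ?T. rsub ?\<sigma> (?w f))"
    using sum.reindex_bij_betw[OF sum_bij, of "\<lambda>f. rsub ?\<sigma> (?w f)"] by (simp only: sum_negf)
  also have "(\<Sum>f\<in>bijs I ?T. rsub ?\<sigma> (?w f)) = rsub ?\<sigma> (\<Sum>f\<in>bijs I ?T. ?w f)"
    using key by (intro rsub_sum[symmetric]) blast
  finally have "rsub ?\<sigma> (\<Sum>f\<in>bijs I ?T. ?w f) = 0" by (rule ratf_double_zero)
  from sC_div[OF reg this ab(1)] have S: "regular ?\<sigma> (\<Sum>f\<in>bijs I ?T. wterm n I (lamv l) zz (rvar Y) f)"
    using ab(1) by (simp add: sum_distrib_left[symmetric])
  have C: "regular ?\<sigma> (inverse (C_fac n I (lamv l) r (rvar Y)))" for r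
    unfolding C_fac_def prod_inversef[symmetric] lamv_shift by (intro regular_prod) (simp add: sC_inverse_lamv)
  have e: "regular ?\<sigma> (inverse (\<Prod>t\<in>?T. \<Prod>t'\<in>?T. t - t' + rvar Y))"
    unfolding prod.reindex[OF inj_zz] o_def prod_inversef[symmetric]
    by (intro regular_prod) (simp add: prod_inversef[symmetric] regular_prod sC_inverse_zzy)
  have "MM n I (lamv l) zz (rvar Y) ?T = rvar Y ^ card I * (\<Sum>f\<in>bijs I ?T. wterm n I (lamv l) zz (rvar Y) f) *
     (inverse (C_fac n I (lamv l) 0 (rvar Y)) * inverse (C_fac n I (lamv l) 1 (rvar Y)) * inverse (\<Prod>t\<in>?T. \<Prod>t'\<in>?T. t - t' + rvar Y))"
    unfolding MM_def wden_def divide_inverse inverse_mult_distrib ..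
  then show ?thesis using S C e by (simp add: regular_rsub_power)
qed

lemma sC_Mt:
  assumes "I \<subseteq> {1..n}" "J \<subseteq> {1..n}" "a \<noteq> b" shows "regular (sC a b) (Mt n l I J)"
proof (cases "card I = card J")
  case True
  then show ?thesis
    using sC_Mt_simple[OF assms _ True, of l] sC_Mt_both[OF assms, of l]
    by (cases "a \<in> J \<and> b \<in> J") (auto simp: Mt_def)
qed (simp add: Mt_def)

definition flip :: "nat \<Rightarrow> nat \<Rightarrow> nat set \<Rightarrow> nat set" where
  "flip a b J = insert b (J - {a})"

text \<open>At z_a = z_b the sets J and \<open>flip a b J\<close> yield the same set of values for
  t, and \<open>MM\<close> depends on J only through this set.\<close>

lemma sC_GKM:
  assumes I: "I \<subseteq> {1..n}" and J: "J \<subseteq> {1..n}" and ab: "a \<in> J" "b \<notin> J" "b \<in> {1..n}"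
  shows "rsub (sC a b) (Mt n l I J) = rsub (sC a b) (Mt n l I (flip a b J))"
proof -
  have J': "flip a b J \<subseteq> {1..n}" using J ab by (auto simp: flip_def)
  have c: "card (flip a b J) = card J"
  proof -
    have "card (flip a b J) = Suc (card (J - {a}))"
      unfolding flip_def using ab finite_sub[OF J] by (intro card_insert_disjoint) auto
    also have "\<dots> = card J" using finite_sub[OF J] ab(1) by (rule card_Suc_Diff1)
    finally show ?thesis .
  qed
  have "a \<noteq> b" using ab by auto
  have im: "collapse a b ` J = collapse a b ` flip a b J"
    using ab by (auto simp: collapse_def flip_def image_iff split: if_splits)
  show ?thesis
  proof (cases "card I = card J")
    case True
    have "\<not> (a \<in> J \<and> b \<in> J)" "\<not> (a \<in> flip a b J \<and> b \<in> flip a b J)" using ab \<open>a \<noteq> b\<close> by (auto simp: flip_def)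
    then show ?thesis
      using sC_Mt_simple[OF I J \<open>a \<noteq> b\<close> _ True, of l] sC_Mt_simple[OF I J' \<open>a \<noteq> b\<close> _ True[folded c], of l] im by simp
  qed (simp add: Mt_def c)
qed

lemma sC_inverse_Mt:
  assumes I: "I \<subseteq> {1..n}" and ab: "a < b" "\<not> (a \<in> I \<and> b \<notin> I)"
  shows "regular (sC a b) (inverse (Mt n l I I))"
proof -
  have "inverse (Mt n l I I) \<in> {x. regular (sC a b) x}"
  proof (rule inverse_Mt_diag_mem[OF field_subring_regular I]; unfold mem_Collect_eq)
    fix i c assume ic: "i \<in> I" "c \<in> {1..n} - I" "i < c"
    then have "collapse a b i \<noteq> collapse a b c" using ab by (auto simp: collapse_def)
    then show "regular (sC a b) (inverse (zz i - zz c))" by (rule sC_inverse_zz)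
  qed (rule regular_lamv sC_inverse_zzy)+
  then show ?thesis by simp
qed

text \<open>The pair (a, b) is the only one with first index in I and second outside that collapses,
  so the pivot contains z_a - z_b exactly once.\<close>

lemma sC_inverse_Mt':
  assumes I: "I \<subseteq> {1..n}" and ab: "a < b" "a \<in> I" "b \<notin> I" "b \<in> {1..n}"
  shows "regular (sC a b) ((zz a - zz b) * inverse (Mt n l I I))"
proof -
  let ?\<sigma> = "sC a b" and ?d = "zz a - zz b"
  have fin: "finite I" using I by (rule finite_sub)
  have ic: "regular ?\<sigma> (inverse (zz i - zz c))" if "i \<in> I" "c \<in> {1..n} - I" "(i, c) \<noteq> (a, b)" for i c
  proof (rule sC_inverse_zz)
    show "collapse a b i \<noteq> collapse a b c" using that ab by (auto simp: collapse_def)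
  qed
  obtain r where r: "regular ?\<sigma> r" "(\<Prod>c\<in>{c \<in> {1..n} - I. a < c}. inverse (zz a - zz c)) = inverse ?d * r"
    using prod_factor_out[of "{c \<in> {1..n} - I. a < c}" b "\<lambda>c. inverse (zz a - zz c)" "inverse ?d" 1 ?\<sigma>] ic[OF ab(2)] ab by auto
  obtain r' where r': "regular ?\<sigma> r'" "(\<Prod>i\<in>I. \<Prod>c\<in>{c \<in> {1..n} - I. i < c}. inverse (zz i - zz c)) = inverse ?d * r'"
    using prod_factor_out[of I a "\<lambda>i. \<Prod>c\<in>{c \<in> {1..n} - I. i < c}. inverse (zz i - zz c)" "inverse ?d" r ?\<sigma>, OF fin ab(2) r(2,1)]
      ic by (auto intro!: regular_prod)
  have 1: "regular ?\<sigma> (\<Prod>i\<in>I. lamv (l - (wt n i I + 1)))" by (intro regular_prod regular_lamv)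
  have 2: "regular ?\<sigma> (\<Prod>i\<in>I. \<Prod>c\<in>{c \<in> {1..n} - I. c < i}. inverse (zz i - zz c + rvar Y))"
    by (intro regular_prod sC_inverse_zzy)
  have "inverse (Mt n l I I) = (\<Prod>i\<in>I. lamv (l - (wt n i I + 1))) *
    (\<Prod>i\<in>I. \<Prod>c\<in>{c \<in> {1..n} - I. c < i}. inverse (zz i - zz c + rvar Y)) * (\<Prod>i\<in>I. \<Prod>c\<in>{c \<in> {1..n} - I. i < c}. inverse (zz i - zz c))"
    unfolding Mt_diag[OF I] by (simp add: prod_inversef[symmetric])
  then have "?d * inverse (Mt n l I I) = (\<Prod>i\<in>I. lamv (l - (wt n i I + 1))) *
    (\<Prod>i\<in>I. \<Prod>c\<in>{c \<in> {1..n} - I. c < i}. inverse (zz i - zz c + rvar Y)) * r'"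
    unfolding r'(2) using ab by simp
  then show ?thesis using 1 2 r'(1) by simp
qed

lemma sum_flip:
  assumes "a \<in> J" "b \<notin> J" "finite J" "a < b" shows "\<Sum>J < \<Sum>(flip a b J)"
proof -
  have "\<Sum>J = a + \<Sum>(J - {a})" using assms by (intro sum.remove) auto
  then show ?thesis using assms by (simp add: flip_def)
qed

text \<open>Where the pivot at J vanishes on z_a = z_b, the equation at J is replaced by its
  difference from the equation at J' = \<open>flip a b J\<close>. The sum of J' is larger, so u J
  keeps its pivot; all other coefficients and the right-hand side are divisible by z_a - z_b, and
  dividing by it makes the pivot invertible.\<close>

lemma Mapply_solve_sC:
  assumes ab: "a < b" "b \<in> {1..n}"
    and g: "\<And>J. J \<subseteq> {1..n} \<Longrightarrow> regular (sC a b) (Mapply n l u J)"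
    and gkm: "\<And>J. J \<subseteq> {1..n} \<Longrightarrow> a \<in> J \<Longrightarrow> b \<notin> J \<Longrightarrow>
      rsub (sC a b) (Mapply n l u J) = rsub (sC a b) (Mapply n l u (flip a b J))"
    and J: "J \<subseteq> {1..n}"
  shows "regular (sC a b) (u J)"
  using J
proof (induction rule: subset_sum_induct)
  case (less J)
  let ?\<sigma> = "sC a b" and ?d = "zz a - zz b"
  note J = less.hyps
  have neq: "a \<noteq> b" using ab by simp
  show ?case
  proof (cases "a \<in> J \<and> b \<notin> J")
    case False
    have "regular ?\<sigma> (Mt n l I J * u I)" if I: "I \<in> Pow {1..n} - {J}" for I
    proof (cases "Mt n l I J = 0")
      case False
      then have "\<Sum>J < \<Sum>I" using Mt_triangular[of I n J l] I J by auto
      then have "regular ?\<sigma> (u I)" using less.IH I by blast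
      moreover have "regular ?\<sigma> (Mt n l I J)" using sC_Mt[of I n J] I J neq by blast
      ultimately show ?thesis by (rule regular_mult[rotated])
    qed simp
    then have s: "regular ?\<sigma> (\<Sum>I\<in>Pow {1..n} - {J}. Mt n l I J * u I)" by (rule regular_sum)
    have "u J = inverse (Mt n l J J) * (Mapply n l u J - (\<Sum>I\<in>Pow {1..n} - {J}. Mt n l I J * u I))"
      unfolding Mapply_split[OF J] using Mt_diag_nonzero[OF J] by simp
    moreover have "regular ?\<sigma> \<dots>"
      using s g[OF J] sC_inverse_Mt[OF J ab(1) False] by (intro regular_mult regular_diff)
    ultimately show ?thesis by (simp only:)
  next
    case True
    define J' where "J' = flip a b J"
    have J': "J' \<subseteq> {1..n}" using J ab by (auto simp: J'_def flip_def)
    have sJ: "\<Sum>J < \<Sum>J'" unfolding J'_def using True ab finite_sub[OF J] by (intro sum_flip) auto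
    \<comment> \<open>By triangularity, u J does not occur in the equation at J'.\<close>
    have z: "Mt n l J J' = 0" using Mt_triangular[OF J J', of l] sJ by auto
    have dnz: "?d \<noteq> 0" using neq by simp
    have t: "regular ?\<sigma> ((Mt n l I J - Mt n l I J') * u I / ?d)" if I: "I \<in> Pow {1..n} - {J}" for I
    proof (cases "\<Sum>J < \<Sum>I")
      case True
      have "regular ?\<sigma> ((Mt n l I J - Mt n l I J') / ?d)"
        using sC_GKM[of I n J a b l] I J J' ab \<open>a \<in> J \<and> b \<notin> J\<close> sC_Mt[of I n J a b l] sC_Mt[of I n J' a b l] neq
        by (intro sC_div) (auto simp: J'_def)
      then have "regular ?\<sigma> ((Mt n l I J - Mt n l I J') / ?d * u I)"
        using less.IH[of I] I True by (intro regular_mult) blast+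
      then show ?thesis by simp
    next
      case False
      then have "Mt n l I J = 0" "Mt n l I J' = 0"
        using Mt_triangular[of I n J l] Mt_triangular[of I n J' l] I J J' sJ by auto
      then show ?thesis by simp
    qed
    have s: "regular ?\<sigma> (\<Sum>I\<in>Pow {1..n} - {J}. (Mt n l I J - Mt n l I J') * u I / ?d)"
      using t by (rule regular_sum)
    have "Mapply n l u J - Mapply n l u J' = (\<Sum>I\<in>Pow {1..n}. (Mt n l I J - Mt n l I J') * u I)"
      by (simp add: Mapply_def sum_subtractf left_diff_distrib)
    also have "\<dots> = Mt n l J J * u J + (\<Sum>I\<in>Pow {1..n} - {J}. (Mt n l I J - Mt n l I J') * u I)"
      using J z by (subst sum.remove[of _ J]) auto
    finally have e: "(Mapply n l u J - Mapply n l u J') / ?d - (\<Sum>I\<in>Pow {1..n} - {J}. (Mt n l I J - Mt n l I J') * u I / ?d)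
      = Mt n l J J * u J / ?d"
      by (simp add: sum_divide_distrib add_divide_distrib)
    have "regular ?\<sigma> ((Mapply n l u J - Mapply n l u J') / ?d)"
      using gkm[OF J] g[OF J] g[OF J'] True neq by (intro sC_div) (auto simp: J'_def)
    then have "regular ?\<sigma> (Mt n l J J * u J / ?d)" using s unfolding e[symmetric] by (rule regular_diff)
    moreover have "regular ?\<sigma> (?d * inverse (Mt n l J J))"
      using sC_inverse_Mt'[OF J ab(1) _ _ ab(2), of l] True by blast
    ultimately have "regular ?\<sigma> (?d * inverse (Mt n l J J) * (Mt n l J J * u J / ?d))"
      by (rule regular_mult[rotated])
    moreover have "?d * inverse (Mt n l J J) * (Mt n l J J * u J / ?d) = u J"
      using dnz Mt_diag_nonzero[OF J, of l] by (simp add: field_simps)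
    ultimately show ?thesis by (simp only:)
  qed
qed


section \<open>Exchange relations for the weight functions\<close>

text \<open>The weight w(i, I) is the eigenvalue of h on the factors to the right of i. This ties
  the weight functions to the dynamical shift of R.\<close>

lemma wt_eps:
  assumes "I \<subseteq> {1..n}" shows "wt n i I = (\<Sum>m\<in>{i<..n}. eps (factor m I))"
proof -
  have "(\<Sum>m\<in>{i<..n}. eps (factor m I)) = (\<Sum>m\<in>{i<..n}. if m \<in> I then 1 else - 1)"
    by (intro sum.cong) (auto simp: factor_def)
  also have "\<dots> = (\<Sum>m\<in>{i<..n} \<inter> {m. m \<in> I}. 1) + (\<Sum>m\<in>{i<..n} \<inter> - {m. m \<in> I}. - 1)"
    by (rule sum.If_cases) simp
  also have "{i<..n} \<inter> {m. m \<in> I} = {j \<in> I. i < j}" using assms by auto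
  also have "{i<..n} \<inter> - {m. m \<in> I} = {j \<in> {1..n} - I. i < j}" by auto
  finally show ?thesis by (simp add: wt_def)
qed

section \<open>Identities behind the exchange relations for two neighbouring sites\<close>

lemma exchange_identity_a:
  "\<mu> * (za - zb - y) * (k * ((\<mu> + y + t - zb) * (t - za))) =
   - ((\<mu> + (za - zb)) * y) * (k * ((\<mu> + y + t - za) * (t - zb))) +
   (\<mu> + y) * (za - zb) * (k * ((t - za + y) * (\<mu> + t - zb)))" for \<mu> :: "'a::field"
  by Groebner_Basis.algebra

lemma exchange_identity_b:
  "\<mu> * (za - zb - y) * (k * ((t - zb + y) * (\<mu> + t - za))) =
   (\<mu> - y) * (za - zb) * (k * ((\<mu> + y + t - za) * (t - zb))) -
   (\<mu> - (za - zb)) * y * (k * ((t - za + y) * (\<mu> + t - zb)))" for \<mu> :: "'a::field"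
  by Groebner_Basis.algebra

text \<open>With both sites occupied the product of the two rows is not symmetric in za and zb, but
  its antisymmetrization in x and x' is.\<close>

lemma exchange_identity_ab:
  "(\<mu> - y + x - zb) * (x - za) * ((x' - zb + y) * (\<mu> + x' - za)) * (x - x' + y) -
   (\<mu> - y + x' - zb) * (x' - za) * ((x - zb + y) * (\<mu> + x - za)) * (x' - x + y) =
   (\<mu> - y + x - za) * (x - zb) * ((x' - za + y) * (\<mu> + x' - zb)) * (x - x' + y) -
   (\<mu> - y + x' - za) * (x' - zb) * ((x - za + y) * (\<mu> + x - zb)) * (x' - x + y)" for \<mu> :: "'a::field"
  by Groebner_Basis.algebra

lemma exchange_normalize_a:
  fixes \<mu> :: "'a::field"
  assumes "\<mu> \<noteq> 0" "e \<noteq> 0" "p \<noteq> 0" "q \<noteq> 0"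
  shows "u * ((- m * SA + p * d * SB) / (\<mu> * e)) / (p * \<mu> * c) =
    - (m / (\<mu> * e)) * (u * SA / (p * \<mu> * c)) + q * d / (\<mu> * e) * (u * SB / (\<mu> * q * c))"
  \<comment> \<open>The set T is arbitrary, so the common part c of the denominators may vanish;
    both sides are then 0 by the convention for division by 0.\<close>
  by (cases "c = 0") (simp, use assms in \<open>simp add: field_simps\<close>)

lemma exchange_normalize_b:
  fixes \<mu> :: "'a::field"
  assumes "\<mu> \<noteq> 0" "e \<noteq> 0" "p \<noteq> 0" "q \<noteq> 0"
  shows "u * ((q * d * SA - m * SB) / (\<mu> * e)) / (\<mu> * q * c) =
    p * d / (\<mu> * e) * (u * SA / (p * \<mu> * c)) - m / (\<mu> * e) * (u * SB / (\<mu> * q * c))"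
  by (cases "c = 0") (simp, use assms in \<open>simp add: field_simps\<close>)

locale adjacent =
  fixes n a :: nat and I0 :: "nat set"
  assumes a: "1 \<le> a" "Suc a \<le> n" and I0: "I0 \<subseteq> {1..n}" "a \<notin> I0" "Suc a \<notin> I0"
begin

abbreviation "b \<equiv> Suc a"
abbreviation "s \<equiv> transpose a b"
definition "Ia = insert a I0"
definition "Ib = insert b I0"
definition "Iab = insert a (insert b I0)"
text \<open>The eigenvalue of h to the right of both sites. It does not depend on their occupation,
  and \<lambda> - X y is the dynamical argument \<mu> of the R-matrix acting on them.\<close>

definition "X = (\<Sum>m\<in>{b<..n}. eps (factor m I0))"

lemma fin [simp]: "finite I0"
  using I0(1) by (rule finite_sub)

lemma subs: "Ia \<subseteq> {1..n}" "Ib \<subseteq> {1..n}" "Iab \<subseteq> {1..n}"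
  using a I0 by (auto simp: Ia_def Ib_def Iab_def)

lemma finI [simp]: "finite Ia" "finite Ib" "finite Iab"
  using fin by (simp_all add: Ia_def Ib_def Iab_def)

lemma cards: "card Ia = card Ib"
  using I0 by (simp add: Ia_def Ib_def)

lemma s_I0: "i \<in> I0 \<Longrightarrow> s i = i"
  using I0 by (auto simp: transpose_def)

lemma s_perm: "s permutes {1..n}"
  using a by (intro permutes_swap_id) auto

lemma eps_tail: "J - {a, b} = I0 \<Longrightarrow> (\<Sum>m\<in>{b<..n}. eps (factor m J)) = X"
  unfolding X_def by (intro sum.cong) (auto simp: factor_def)

lemma wt_b: "J \<subseteq> {1..n} \<Longrightarrow> J - {a, b} = I0 \<Longrightarrow> wt n b J = X"
  by (simp add: wt_eps eps_tail)

lemma wt_a: "J \<subseteq> {1..n} \<Longrightarrow> J - {a, b} = I0 \<Longrightarrow> wt n a J = eps (factor b J) + X"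
proof -
  assume J: "J \<subseteq> {1..n}" "J - {a, b} = I0"
  have "{a<..n} = insert b {b<..n}" using a by auto
  then show ?thesis using J by (simp add: wt_eps eps_tail)
qed

lemma wt_I0: "i \<in> I0 \<Longrightarrow> wt n i Ia = wt n i Ib"
proof -
  assume i: "i \<in> I0"
  then have ni: "i \<noteq> a" "i \<noteq> b" using I0 by auto
  have "(\<Sum>m\<in>{i<..n}. eps (factor m Ia)) = (\<Sum>m\<in>{i<..n}. eps (factor m Ib))"
  proof (rule sum.reindex_bij_witness[of _ s s])
    fix m assume "m \<in> {i<..n}"
    then show "s m \<in> {i<..n}" using ni a by (auto simp: transpose_def)
    then show "s m \<in> {i<..n}" .
    show "eps (factor (s m) Ib) = eps (factor m Ia)"
      using I0 by (auto simp: factor_def Ia_def Ib_def transpose_def)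
  qed auto
  then show ?thesis using subs by (simp add: wt_eps)
qed

context
  fixes lam y :: "'f::field" and z :: "nat \<Rightarrow> 'f"
begin

definition row :: "nat set \<Rightarrow> (nat \<Rightarrow> 'f) \<Rightarrow> nat \<Rightarrow> 'f \<Rightarrow> 'f" where
  "row J z' i t = (\<Prod>c\<in>{1..n}. wl n J lam z' y i c t)"

text \<open>The part of row a or b without z_a and z_b. It is the same for both rows because no
  index lies strictly between a and b.\<close>

definition rowA :: "'f \<Rightarrow> 'f" where
  "rowA t = (\<Prod>c\<in>{1..n} - {a, b}. if c < a then t - z c + y else t - z c)"

text \<open>For i other than a and b, the neighbours a and b lie on the same side of i, so row i is
  symmetric in z_a and z_b.\<close>

lemma row_swap:
  assumes "i \<noteq> a" "i \<noteq> b" shows "row J (z \<circ> s) i t = row J z i t"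
proof -
  have "wl n J lam (z \<circ> s) y i c t = wl n J lam z y i (s c) t" for c
    using assms by (auto simp: wl_def transpose_def)
  then show ?thesis unfolding row_def
    using prod_permutes[OF s_perm, of "\<lambda>c. wl n J lam z y i c t"] by simp
qed

lemma row_split:
  assumes "i = a \<or> i = b" "z' = z \<or> z' = z \<circ> s"
  shows "row J z' i t = rowA t * (wl n J lam z' y i a t * wl n J lam z' y i b t)"
proof -
  have "row J z' i t = wl n J lam z' y i a t * (wl n J lam z' y i b t * (\<Prod>c\<in>{1..n} - {a} - {b}. wl n J lam z' y i c t))"
    unfolding row_def using a by (subst prod.remove[of _ a], simp, simp, subst prod.remove[of _ b]) auto
  also have "(\<Prod>c\<in>{1..n} - {a} - {b}. wl n J lam z' y i c t) = rowA t"
    unfolding rowA_def using assms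
    by (intro prod.cong) (auto simp: wl_def transpose_def)
  finally show ?thesis by (simp add: mult_ac)
qed

lemma row_I0: "i \<in> I0 \<Longrightarrow> row Ia z' i t = row Ib z' i t"
  unfolding row_def by (intro prod.cong HOL.refl) (simp add: wl_def wt_I0)

lemma wterm_row: "wterm n J lam z' y f = (\<Prod>i\<in>J. row J z' i (f i)) * (\<Prod>(i, j)\<in>pairs J. (f i - f j + y) / (f i - f j))"
  by (simp add: wterm_def row_def)

subsection \<open>None of the two sites occupied\<close>

lemma exchange_none: "MM n I0 lam (z \<circ> s) y T = MM n I0 lam z y T"
proof -
  have "wterm n I0 lam (z \<circ> s) y f = wterm n I0 lam z y f" for f
  proof -
    have "(\<Prod>i\<in>I0. row I0 (z \<circ> s) i (f i)) = (\<Prod>i\<in>I0. row I0 z i (f i))"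
      by (intro prod.cong HOL.refl row_swap) (use I0 in auto)
    then show ?thesis by (simp add: wterm_row)
  qed
  then show ?thesis by (simp add: MM_def)
qed

subsection \<open>One site occupied\<close>

text \<open>The factor shared by the summands for Ia and Ib and for both orders of the parameters;
  what is left over are the four products in \<open>wl_vals\<close>.\<close>

definition K1 :: "(nat \<Rightarrow> 'f) \<Rightarrow> 'f" where
  "K1 f = (\<Prod>i\<in>I0. row Ia z i (f i)) * rowA (f a) * (\<Prod>(i, j)\<in>pairs Ia. (f i - f j + y) / (f i - f j))"

text \<open>The transposition reverses no pair other than (a, b), and neither Ia nor Ib contains
  both sites.\<close>

lemma pairs_s: "bij_betw (\<lambda>(i, j). (s i, s j)) (pairs Ia) (pairs Ib)"
proof (rule bij_betw_byWitness[of _ "\<lambda>(i, j). (s i, s j)"])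
  have m: "s i < s j" if "i < j" "\<not> (i = a \<and> j = b)" for i j
    using that by (auto simp: transpose_def)
  show "(\<lambda>(i, j). (s i, s j)) ` pairs Ia \<subseteq> pairs Ib" "(\<lambda>(i, j). (s i, s j)) ` pairs Ib \<subseteq> pairs Ia"
    using I0 s_I0 m by (auto simp: pairs_def Ia_def Ib_def)
qed (auto simp: transpose_involutory)

lemma wterm_Ia:
  assumes "z' = z \<or> z' = z \<circ> s"
  shows "wterm n Ia lam z' y f = K1 f * (wl n Ia lam z' y a a (f a) * wl n Ia lam z' y a b (f a))"
proof -
  have "(\<Prod>i\<in>Ia. row Ia z' i (f i)) = row Ia z' a (f a) * (\<Prod>i\<in>I0. row Ia z' i (f i))"
    unfolding Ia_def using I0 by simp
  also have "(\<Prod>i\<in>I0. row Ia z' i (f i)) = (\<Prod>i\<in>I0. row Ia z i (f i))"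
    using assms I0 by (intro prod.cong HOL.refl) (auto intro!: row_swap)
  finally show ?thesis unfolding wterm_row K1_def by (simp add: row_split[OF _ assms] mult_ac)
qed

lemma wterm_Ib:
  assumes "z' = z \<or> z' = z \<circ> s"
  shows "wterm n Ib lam z' y (f \<circ> s) = K1 f * (wl n Ib lam z' y b a (f a) * wl n Ib lam z' y b b (f a))"
proof -
  have "(\<Prod>i\<in>Ib. row Ib z' i ((f \<circ> s) i)) = row Ib z' b (f a) * (\<Prod>i\<in>I0. row Ib z' i ((f \<circ> s) i))"
    unfolding Ib_def using I0 by simp
  also have "(\<Prod>i\<in>I0. row Ib z' i ((f \<circ> s) i)) = (\<Prod>i\<in>I0. row Ia z i (f i))"
  proof (intro prod.cong HOL.refl)
    fix i assume i: "i \<in> I0"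
    have "row Ib z' i ((f \<circ> s) i) = row Ia z' i (f i)" using i by (simp add: s_I0 row_I0)
    also have "\<dots> = row Ia z i (f i)" using assms i I0 by (auto intro!: row_swap)
    finally show "row Ib z' i ((f \<circ> s) i) = row Ia z i (f i)" .
  qed
  finally have 1: "(\<Prod>i\<in>Ib. row Ib z' i ((f \<circ> s) i)) = row Ib z' b (f a) * (\<Prod>i\<in>I0. row Ia z i (f i))" .
  have 2: "(\<Prod>(i, j)\<in>pairs Ib. ((f \<circ> s) i - (f \<circ> s) j + y) / ((f \<circ> s) i - (f \<circ> s) j))
    = (\<Prod>(i, j)\<in>pairs Ia. (f i - f j + y) / (f i - f j))"
    using prod.reindex_bij_betw[OF pairs_s, of "\<lambda>(i, j). ((f \<circ> s) i - (f \<circ> s) j + y) / ((f \<circ> s) i - (f \<circ> s) j)"]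
    by (simp add: case_prod_unfold)
  show ?thesis unfolding wterm_row 1 2 K1_def by (simp add: row_split[OF _ assms] mult_ac)
qed

lemma bijs_s: "bij_betw (\<lambda>f. f \<circ> s) (bijs Ia T) (bijs Ib T)"
proof (rule bij_betw_byWitness[of _ "\<lambda>f. f \<circ> s"])
  have sI: "s ` Ia = Ib" "s ` Ib = Ia"
    using I0 s_I0 by (auto simp: Ia_def Ib_def image_iff)
  have b1: "bij_betw s Ia Ib" and b2: "bij_betw s Ib Ia"
    using sI inj_on_subset[OF inj_transpose[of a b]] by (auto simp: bij_betw_def)
  have m: "f \<circ> s \<in> bijs J T" if "f \<in> bijs J' T" "bij_betw s J J'" "\<And>i. i \<notin> J \<Longrightarrow> s i \<notin> J'" for f J J'
  proof -
    have "bij_betw (f \<circ> s) J T" using bij_betw_trans[OF that(2) bijsD(1)[OF that(1)]] .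
    then show ?thesis using that(1,3) by (auto simp: bijs_def PiE_def extensional_def bij_betw_def)
  qed
  have n1: "s i \<notin> Ib" if "i \<notin> Ia" for i using that sI(2) by (metis imageI transpose_involutory)
  have n2: "s i \<notin> Ia" if "i \<notin> Ib" for i using that sI(1) by (metis imageI transpose_involutory)
  show "(\<lambda>f. f \<circ> s) ` bijs Ia T \<subseteq> bijs Ib T" using m[OF _ b2 n2] by blast
  show "(\<lambda>f. f \<circ> s) ` bijs Ib T \<subseteq> bijs Ia T" using m[OF _ b1 n1] by blast
qed (auto simp: o_assoc[symmetric])

definition SA :: "(nat \<Rightarrow> 'f) \<Rightarrow> 'f set \<Rightarrow> 'f" where
  "SA z' T = (\<Sum>f\<in>bijs Ia T. wterm n Ia lam z' y f)"
definition SB :: "(nat \<Rightarrow> 'f) \<Rightarrow> 'f set \<Rightarrow> 'f" where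
  "SB z' T = (\<Sum>f\<in>bijs Ib T. wterm n Ib lam z' y f)"

lemma SB_Ia: "SB z' T = (\<Sum>f\<in>bijs Ia T. wterm n Ib lam z' y (f \<circ> s))"
  unfolding SB_def using sum.reindex_bij_betw[OF bijs_s, of "\<lambda>f. wterm n Ib lam z' y f" T] by simp

context
  fixes \<mu> d :: 'f
  assumes mu: "\<mu> = lam - of_int X * y" "\<mu> \<noteq> 0" and d: "d = z a - z b" "d - y \<noteq> 0"
begin

lemma wl_vals:
  "wl n Ia lam z y a a t * wl n Ia lam z y a b t = (\<mu> + y + t - z a) * (t - z b)"
  "wl n Ia lam (z \<circ> s) y a a t * wl n Ia lam (z \<circ> s) y a b t = (\<mu> + y + t - z b) * (t - z a)"
  "wl n Ib lam z y b a t * wl n Ib lam z y b b t = (t - z a + y) * (\<mu> + t - z b)"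
  "wl n Ib lam (z \<circ> s) y b a t * wl n Ib lam (z \<circ> s) y b b t = (t - z b + y) * (\<mu> + t - z a)"
proof -
  have "wt n a Ia = X - 1" "wt n b Ib = X"
    using wt_a[of Ia] wt_b[of Ib] subs I0 by (auto simp: Ia_def Ib_def factor_def)
  note w = this
  show "wl n Ia lam z y a a t * wl n Ia lam z y a b t = (\<mu> + y + t - z a) * (t - z b)"
  "wl n Ia lam (z \<circ> s) y a a t * wl n Ia lam (z \<circ> s) y a b t = (\<mu> + y + t - z b) * (t - z a)"
  "wl n Ib lam z y b a t * wl n Ib lam z y b b t = (t - z a + y) * (\<mu> + t - z b)"
  "wl n Ib lam (z \<circ> s) y b a t * wl n Ib lam (z \<circ> s) y b b t = (t - z b + y) * (\<mu> + t - z a)"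
    by (simp_all add: wl_def w mu(1) algebra_simps)
qed

lemma SA_exchange: "\<mu> * (d - y) * SA (z \<circ> s) T = - ((\<mu> + d) * y) * SA z T + (\<mu> + y) * d * SB z T"
proof -
  have "\<mu> * (d - y) * wterm n Ia lam (z \<circ> s) y f =
    - ((\<mu> + d) * y) * wterm n Ia lam z y f + (\<mu> + y) * d * wterm n Ib lam z y (f \<circ> s)" for f
  proof -
    have e1: "wterm n Ia lam (z \<circ> s) y f = K1 f * ((\<mu> + y + f a - z b) * (f a - z a))"
      using wterm_Ia[OF disjI2[OF HOL.refl], of f] by (simp only: wl_vals)
    have e2: "wterm n Ia lam z y f = K1 f * ((\<mu> + y + f a - z a) * (f a - z b))"
      using wterm_Ia[OF disjI1[OF HOL.refl], of f] by (simp only: wl_vals)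
    have e3: "wterm n Ib lam z y (f \<circ> s) = K1 f * ((f a - z a + y) * (\<mu> + f a - z b))"
      using wterm_Ib[OF disjI1[OF HOL.refl], of f] by (simp only: wl_vals)
    show ?thesis unfolding e1 e2 e3 d(1) by (rule exchange_identity_a)
  qed
  then show ?thesis unfolding SA_def SB_Ia by (simp only: sum_distrib_left sum.distrib[symmetric])
qed

lemma SB_exchange: "\<mu> * (d - y) * SB (z \<circ> s) T = (\<mu> - y) * d * SA z T - (\<mu> - d) * y * SB z T"
proof -
  have "\<mu> * (d - y) * wterm n Ib lam (z \<circ> s) y (f \<circ> s) =
    (\<mu> - y) * d * wterm n Ia lam z y f - (\<mu> - d) * y * wterm n Ib lam z y (f \<circ> s)" for f
  proof -
    have e1: "wterm n Ib lam (z \<circ> s) y (f \<circ> s) = K1 f * ((f a - z b + y) * (\<mu> + f a - z a))"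
      using wterm_Ib[OF disjI2[OF HOL.refl], of f] by (simp only: wl_vals)
    have e2: "wterm n Ia lam z y f = K1 f * ((\<mu> + y + f a - z a) * (f a - z b))"
      using wterm_Ia[OF disjI1[OF HOL.refl], of f] by (simp only: wl_vals)
    have e3: "wterm n Ib lam z y (f \<circ> s) = K1 f * ((f a - z a + y) * (\<mu> + f a - z b))"
      using wterm_Ib[OF disjI1[OF HOL.refl], of f] by (simp only: wl_vals)
    show ?thesis unfolding e1 e2 e3 d(1) by (rule exchange_identity_b)
  qed
  then show ?thesis unfolding SA_def SB_Ia by (simp only: sum_distrib_left sum_subtractf[symmetric])
qed

context
  assumes lam: "\<And>m::int. lam - of_int m * y \<noteq> 0"
begin

lemma mu_pm: "\<mu> + y \<noteq> 0" "\<mu> - y \<noteq> 0"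
proof -
  have "\<mu> + y = lam - of_int (X - 1) * y" "\<mu> - y = lam - of_int (X + 1) * y"
    by (simp_all add: mu(1) algebra_simps)
  then show "\<mu> + y \<noteq> 0" "\<mu> - y \<noteq> 0" using lam by metis+
qed

text \<open>Site a of Ia has weight X - 1 and site b of Ib has weight X, so C^(0) C^(1) contributes
  (\<mu> + y) \<mu> and \<mu> (\<mu> - y), respectively. The ratio of the two interchanges \<mu> + y
  and \<mu> - y in the coefficients linking \<open>SA\<close> and \<open>SB\<close>, which then
  become entries of R.\<close>

lemma wden_one:
  "\<exists>c. wden n Ia lam y T = (\<mu> + y) * \<mu> * c \<and> wden n Ib lam y T = \<mu> * (\<mu> - y) * c"
proof -
  define Cc where "Cc r = (\<Prod>i\<in>I0. lam - of_int (wt n i Ia + r) * y)" for r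
  have w: "wt n a Ia = X - 1" "wt n b Ib = X"
    using wt_a[of Ia] wt_b[of Ib] subs I0 by (auto simp: Ia_def Ib_def factor_def)
  have A: "C_fac n Ia lam r y = (lam - of_int (X - 1 + r) * y) * Cc r" for r
    unfolding C_fac_def Cc_def using I0 w by (subst Ia_def) (simp add: prod.insert)
  have "C_fac n Ib lam r y = (lam - of_int (X + r) * y) * (\<Prod>i\<in>I0. lam - of_int (wt n i Ib + r) * y)" for r
    unfolding C_fac_def using I0 w by (subst Ib_def) (simp add: prod.insert)
  then have B: "C_fac n Ib lam r y = (lam - of_int (X + r) * y) * Cc r" for r
    unfolding Cc_def using wt_I0 by (simp cong: prod.cong)
  have "lam - of_int (X - 1 + 0) * y = \<mu> + y" "lam - of_int (X - 1 + 1) * y = \<mu>"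
    "lam - of_int (X + 0) * y = \<mu>" "lam - of_int (X + 1) * y = \<mu> - y"
    by (simp_all add: mu(1) algebra_simps)
  then show ?thesis unfolding wden_def A B
    by (intro exI[of _ "Cc 0 * Cc 1 * (\<Prod>t\<in>T. \<Prod>t'\<in>T. t - t' + y)"]) (simp only: mult_ac)
qed

lemma exchange_a:
  "MM n Ia lam (z \<circ> s) y T = - ((\<mu> + d) * y / (\<mu> * (d - y))) * MM n Ia lam z y T
     + (\<mu> - y) * d / (\<mu> * (d - y)) * MM n Ib lam z y T"
proof -
  obtain c where c: "wden n Ia lam y T = (\<mu> + y) * \<mu> * c" "wden n Ib lam y T = \<mu> * (\<mu> - y) * c"
    using wden_one by blast
  have S: "SA (z \<circ> s) T = (- ((\<mu> + d) * y) * SA z T + (\<mu> + y) * d * SB z T) / (\<mu> * (d - y))"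
    using SA_exchange[of T] mu(2) d(2) by (simp add: eq_divide_eq mult_ac)
  show ?thesis
    unfolding MM_def c SA_def[symmetric] SB_def[symmetric] S cards
    by (rule exchange_normalize_a[OF mu(2) d(2) mu_pm])
qed

lemma exchange_b:
  "MM n Ib lam (z \<circ> s) y T = (\<mu> + y) * d / (\<mu> * (d - y)) * MM n Ia lam z y T
     - (\<mu> - d) * y / (\<mu> * (d - y)) * MM n Ib lam z y T"
proof -
  obtain c where c: "wden n Ia lam y T = (\<mu> + y) * \<mu> * c" "wden n Ib lam y T = \<mu> * (\<mu> - y) * c"
    using wden_one by blast
  have S: "SB (z \<circ> s) T = ((\<mu> - y) * d * SA z T - (\<mu> - d) * y * SB z T) / (\<mu> * (d - y))"
    using SB_exchange[of T] mu(2) d(2) by (simp add: eq_divide_eq mult_ac)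
  show ?thesis
    unfolding MM_def c SA_def[symmetric] SB_def[symmetric] S cards
    by (rule exchange_normalize_b[OF mu(2) d(2) mu_pm])
qed

end

end

subsection \<open>Both sites occupied\<close>

definition K2 :: "(nat \<Rightarrow> 'f) \<Rightarrow> 'f" where
  "K2 f = (\<Prod>i\<in>I0. row Iab z i (f i)) * rowA (f a) * rowA (f b) *
     (\<Prod>(i, j)\<in>pairs Iab - {(a, b)}. (f i - f j + y) / (f i - f j))"

lemma K2_swap: "K2 (f \<circ> s) = K2 f"
proof -
  have b: "bij_betw (\<lambda>(i, j). (s i, s j)) (pairs Iab - {(a, b)}) (pairs Iab - {(a, b)})"
  proof (rule bij_betw_byWitness[of _ "\<lambda>(i, j). (s i, s j)"])
    have m: "s i < s j" if "i < j" "\<not> (i = a \<and> j = b)" for i j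
      using that by (auto simp: transpose_def)
    have n: "\<not> (s i = a \<and> s j = b)" if "i < j" for i j using that by (auto simp: transpose_def split: if_splits)
    have sI: "s i \<in> Iab" if "i \<in> Iab" for i using that s_I0 by (auto simp: Iab_def)
    have "(s i, s j) \<in> pairs Iab - {(a, b)}" if "(i, j) \<in> pairs Iab - {(a, b)}" for i j
      using that sI m n by (auto simp: pairs_def)
    then show "(\<lambda>(i, j). (s i, s j)) ` (pairs Iab - {(a, b)}) \<subseteq> pairs Iab - {(a, b)}" by auto
    then show "(\<lambda>(i, j). (s i, s j)) ` (pairs Iab - {(a, b)}) \<subseteq> pairs Iab - {(a, b)}" .
  qed (auto simp: transpose_involutory)
  have 1: "(\<Prod>i\<in>I0. row Iab z i ((f \<circ> s) i)) = (\<Prod>i\<in>I0. row Iab z i (f i))"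
    by (intro prod.cong HOL.refl) (simp add: s_I0)
  have 2: "(\<Prod>(i, j)\<in>pairs Iab - {(a, b)}. ((f \<circ> s) i - (f \<circ> s) j + y) / ((f \<circ> s) i - (f \<circ> s) j))
    = (\<Prod>(i, j)\<in>pairs Iab - {(a, b)}. (f i - f j + y) / (f i - f j))"
    using prod.reindex_bij_betw[OF b, of "\<lambda>(i, j). (f i - f j + y) / (f i - f j)"]
    by (simp add: case_prod_unfold)
  show ?thesis unfolding K2_def 1 2 by simp
qed

lemma wterm_Iab:
  assumes "z' = z \<or> z' = z \<circ> s"
  shows "wterm n Iab lam z' y f = K2 f * ((wl n Iab lam z' y a a (f a) * wl n Iab lam z' y a b (f a)) *
    (wl n Iab lam z' y b a (f b) * wl n Iab lam z' y b b (f b)) * ((f a - f b + y) / (f a - f b)))"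
proof -
  have "(\<Prod>i\<in>Iab. row Iab z' i (f i)) = row Iab z' a (f a) * (row Iab z' b (f b) * (\<Prod>i\<in>I0. row Iab z' i (f i)))"
    by (subst (1) Iab_def) (use I0 in simp)
  also have "(\<Prod>i\<in>I0. row Iab z' i (f i)) = (\<Prod>i\<in>I0. row Iab z i (f i))"
    using assms I0 by (intro prod.cong HOL.refl) (auto intro!: row_swap)
  finally have 1: "(\<Prod>i\<in>Iab. row Iab z' i (f i)) = row Iab z' a (f a) * (row Iab z' b (f b) * (\<Prod>i\<in>I0. row Iab z i (f i)))" .
  have "(a, b) \<in> pairs Iab" by (simp add: pairs_def Iab_def)
  then have 2: "(\<Prod>(i, j)\<in>pairs Iab. (f i - f j + y) / (f i - f j)) =
    (f a - f b + y) / (f a - f b) * (\<Prod>(i, j)\<in>pairs Iab - {(a, b)}. (f i - f j + y) / (f i - f j))"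
    by (subst prod.remove[of _ "(a, b)"]) auto
  show ?thesis unfolding wterm_row 1 2 K2_def row_split[OF disjI1[OF HOL.refl] assms] row_split[OF disjI2[OF HOL.refl] assms]
    by (simp only: mult_ac)
qed

text \<open>The summands of f and f \<circ> s share \<open>K2\<close> and have opposite denominators
  x - x' and x' - x; their sum is therefore an antisymmetrization, to which
  \<open>exchange_identity_ab\<close> applies.\<close>

lemma wterm_pair:
  assumes f: "f \<in> bijs Iab T"
  shows "wterm n Iab lam (z \<circ> s) y f + wterm n Iab lam (z \<circ> s) y (f \<circ> s) = wterm n Iab lam z y f + wterm n Iab lam z y (f \<circ> s)"
proof -
  define \<mu> where "\<mu> = lam - of_int X * y"
  have w: "wt n a Iab = X + 1" "wt n b Iab = X"
    using wt_a[of Iab] wt_b[of Iab] subs I0 by (auto simp: Iab_def factor_def)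
  have v: "wl n Iab lam z y a a t * wl n Iab lam z y a b t = (\<mu> - y + t - z a) * (t - z b)"
    "wl n Iab lam (z \<circ> s) y a a t * wl n Iab lam (z \<circ> s) y a b t = (\<mu> - y + t - z b) * (t - z a)"
    "wl n Iab lam z y b a t * wl n Iab lam z y b b t = (t - z a + y) * (\<mu> + t - z b)"
    "wl n Iab lam (z \<circ> s) y b a t * wl n Iab lam (z \<circ> s) y b b t = (t - z b + y) * (\<mu> + t - z a)" for t
    by (simp_all add: wl_def w \<mu>_def algebra_simps)
  have "(a, b) \<in> pairs Iab" by (simp add: pairs_def Iab_def)
  then have nz: "f a - f b \<noteq> 0" using bijs_neq[OF f] by simp
  define x where "x = f a"
  define x' where "x' = f b"
  define h where "h = inverse (x - x')"
  have h: "(x - x') * h = 1" "inverse (x' - x) = - h"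
    using nz inverse_minus_eq[of "x - x'"] by (auto simp: h_def x_def x'_def)
  define A where "A = (\<mu> - y + x - z a) * (x - z b) * ((x' - z a + y) * (\<mu> + x' - z b)) * (x - x' + y)"
  define B where "B = (\<mu> - y + x' - z a) * (x' - z b) * ((x - z a + y) * (\<mu> + x - z b)) * (x' - x + y)"
  define A' where "A' = (\<mu> - y + x - z b) * (x - z a) * ((x' - z b + y) * (\<mu> + x' - z a)) * (x - x' + y)"
  define B' where "B' = (\<mu> - y + x' - z b) * (x' - z a) * ((x - z b + y) * (\<mu> + x - z a)) * (x' - x + y)"
  have key: "A' - B' = A - B" unfolding A_def B_def A'_def B'_def by (rule exchange_identity_ab)
  have "wterm n Iab lam z y f = K2 f * (A * inverse (x - x'))"
    "wterm n Iab lam z y (f \<circ> s) = K2 f * (B * inverse (x' - x))"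
    "wterm n Iab lam (z \<circ> s) y f = K2 f * (A' * inverse (x - x'))"
    "wterm n Iab lam (z \<circ> s) y (f \<circ> s) = K2 f * (B' * inverse (x' - x))"
    unfolding wterm_Iab[OF disjI1[OF HOL.refl]] wterm_Iab[OF disjI2[OF HOL.refl]] v K2_swap
      A_def B_def A'_def B'_def x_def x'_def divide_inverse
    by (simp_all add: mult_ac)
  then have e: "wterm n Iab lam z y f = K2 f * (A * h)" "wterm n Iab lam z y (f \<circ> s) = K2 f * (B * - h)"
    "wterm n Iab lam (z \<circ> s) y f = K2 f * (A' * h)" "wterm n Iab lam (z \<circ> s) y (f \<circ> s) = K2 f * (B' * - h)"
    unfolding h(2) h_def[symmetric] .
  have "wterm n Iab lam (z \<circ> s) y f + wterm n Iab lam (z \<circ> s) y (f \<circ> s) = K2 f * ((A' - B') * h)"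
    unfolding e by (simp add: algebra_simps)
  also have "\<dots> = wterm n Iab lam z y f + wterm n Iab lam z y (f \<circ> s)"
    unfolding e key by (simp add: algebra_simps)
  finally show ?thesis .
qed

lemma bijs_s2: "bij_betw (\<lambda>f. f \<circ> s) (bijs Iab T) (bijs Iab T)"
proof (rule bij_betw_byWitness[of _ "\<lambda>f. f \<circ> s"])
  have sI: "s ` Iab = Iab"
    using s_I0 by (auto simp: Iab_def image_iff)
  have b1: "bij_betw s Iab Iab"
    using sI inj_on_subset[OF inj_transpose[of a b]] by (auto simp: bij_betw_def)
  have n1: "s i \<notin> Iab" if "i \<notin> Iab" for i using that sI by (metis imageI transpose_involutory)
  have m: "f \<circ> s \<in> bijs Iab T" if "f \<in> bijs Iab T" for f
  proof -
    have "bij_betw (f \<circ> s) Iab T" using bij_betw_trans[OF b1 bijsD(1)[OF that]] .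
    then show ?thesis using that n1 by (auto simp: bijs_def PiE_def extensional_def bij_betw_def)
  qed
  show "(\<lambda>f. f \<circ> s) ` bijs Iab T \<subseteq> bijs Iab T" using m by blast
  then show "(\<lambda>f. f \<circ> s) ` bijs Iab T \<subseteq> bijs Iab T" .
qed (auto simp: o_assoc[symmetric])

text \<open>Pairing f with f \<circ> s counts each bijection twice, so the conclusion needs
  cancellation of 2, supplied by \<open>two\<close>.\<close>

lemma exchange_both:
  assumes two: "\<And>x::'f. x = - x \<Longrightarrow> x = 0"
  shows "MM n Iab lam (z \<circ> s) y T = MM n Iab lam z y T"
proof -
  let ?S = "\<lambda>z'. \<Sum>f\<in>bijs Iab T. wterm n Iab lam z' y f"
  have sw: "(\<Sum>f\<in>bijs Iab T. wterm n Iab lam z' y (f \<circ> s)) = ?S z'" for z'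
    using sum.reindex_bij_betw[OF bijs_s2, of "\<lambda>f. wterm n Iab lam z' y f" T] by simp
  have "?S (z \<circ> s) + ?S (z \<circ> s) = (\<Sum>f\<in>bijs Iab T. wterm n Iab lam (z \<circ> s) y f + wterm n Iab lam (z \<circ> s) y (f \<circ> s))"
    by (simp only: sum.distrib sw)
  also have "\<dots> = (\<Sum>f\<in>bijs Iab T. wterm n Iab lam z y f + wterm n Iab lam z y (f \<circ> s))"
    by (intro sum.cong HOL.refl wterm_pair)
  also have "\<dots> = ?S z + ?S z" by (simp only: sum.distrib sw)
  finally have "(?S (z \<circ> s) - ?S z) + (?S (z \<circ> s) - ?S z) = 0"
    unfolding add_diff_add[symmetric] by (simp only: diff_self)
  then have "?S (z \<circ> s) - ?S z = - (?S (z \<circ> s) - ?S z)" by (simp only: eq_neg_iff_add_eq_0)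
  then have "?S (z \<circ> s) - ?S z = 0" by (rule two)
  then have "?S (z \<circ> s) = ?S z" by (simp only: right_minus_eq)
  then show ?thesis unfolding MM_def by (simp only:)
qed

end

end

definition tailh :: "nat \<Rightarrow> nat \<Rightarrow> nat set \<Rightarrow> int" where
  "tailh n j I = (\<Sum>m\<in>{j<..n}. eps (factor m I))"

text \<open>The labels enter R in the order (a+1, a) and leave it in the order (a, a+1); this
  reversal is the permutation P in the R-check-matrix.\<close>

lemma exchange:
  fixes lam y :: "'f::field" and z :: "nat \<Rightarrow> 'f"
  assumes a: "1 \<le> a" "Suc a \<le> n" and I: "I \<subseteq> {1..n}"
    and two: "\<And>x::'f. x = - x \<Longrightarrow> x = 0" and lam: "\<And>m::int. lam - of_int m * y \<noteq> 0"
    and d: "z a - z (Suc a) - y \<noteq> 0"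
  shows "MM n I lam (z \<circ> transpose a (Suc a)) y T = (\<Sum>c\<in>{I1, I2}. \<Sum>e\<in>{I1, I2}.
    Rmat (lam - of_int (tailh n (Suc a) I) * y) (z a - z (Suc a)) y (c, e) (factor (Suc a) I, factor a I) *
    MM n (set_factor a c (set_factor (Suc a) e I)) lam z y T)"
proof -
  let ?I0 = "I - {a, Suc a}"
  interpret adjacent n a ?I0 by standard (use a I in auto)
  have X: "tailh n (Suc a) I = X" unfolding tailh_def by (rule eps_tail) simp
  note ex = exchange_none[of lam z y T] exchange_a[OF HOL.refl lam HOL.refl d lam, of T]
    exchange_b[OF HOL.refl lam HOL.refl d lam, of T] exchange_both[of lam z y T, OF two]
  consider "a \<in> I" "Suc a \<in> I" | "a \<in> I" "Suc a \<notin> I" | "a \<notin> I" "Suc a \<in> I" | "a \<notin> I" "Suc a \<notin> I" by blast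
  then show ?thesis
  proof cases
    case 1
    then have "Iab = I" unfolding Iab_def by auto
    moreover have "insert a (insert (Suc a) I) = I" using 1 by auto
    ultimately show ?thesis using ex(4) 1 by (simp add: factor_def set_factor_def)
  next
    case 2
    then have "Ia = I" "insert a (I - {Suc a}) = I" "insert (Suc a) I - {a} = Ib"
      unfolding Ia_def Ib_def by auto
    then show ?thesis using ex(2) 2 by (simp add: factor_def set_factor_def X)
  next
    case 3
    then have "Ib = I" "insert a (I - {Suc a}) = Ia" "insert (Suc a) I - {a} = I"
      unfolding Ia_def Ib_def by auto
    then show ?thesis using ex(3) 3 by (simp add: factor_def set_factor_def X)
  next
    case 4
    then have "?I0 = I" "I - {Suc a} - {a} = I" by auto
    then show ?thesis using ex(1) 4 by (simp add: factor_def set_factor_def)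
  qed
qed


section \<open>The dynamical Yang-Baxter equation\<close>

lemma factor_set_factor [simp]: "factor i (set_factor j c I) = (if i = j then c else factor i I)"
  by (cases c) (auto simp: factor_def set_factor_def)

lemma set_factor_same [simp]: "factor j I = c \<Longrightarrow> set_factor j c I = I"
  by (auto simp: factor_def set_factor_def split: if_splits)

lemma set_factor_idem [simp]: "set_factor j c (set_factor j d I) = set_factor j c I"
  by (auto simp: set_factor_def)

lemma set_factor_commute: "i \<noteq> j \<Longrightarrow> set_factor i c (set_factor j d I) = set_factor j d (set_factor i c I)"
  by (auto simp: set_factor_def)

lemma tailh_set_factor [simp]:
  "tailh n j (set_factor m c I) = tailh n j I + (if j < m \<and> m \<le> n then eps c - eps (factor m I) else 0)"
proof (cases "j < m \<and> m \<le> n")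
  case True
  then have m: "m \<in> {j<..n}" by auto
  have "tailh n j (set_factor m c I) = eps c + (\<Sum>i\<in>{j<..n} - {m}. eps (factor i (set_factor m c I)))"
    unfolding tailh_def using m by (subst sum.remove[of _ m]) auto
  also have "(\<Sum>i\<in>{j<..n} - {m}. eps (factor i (set_factor m c I))) = (\<Sum>i\<in>{j<..n} - {m}. eps (factor i I))"
    by (intro sum.cong) auto
  also have "\<dots> = tailh n j I - eps (factor m I)"
    unfolding tailh_def using m by (subst (2) sum.remove[of _ m]) auto
  finally show ?thesis using True by simp
next
  case False
  then have "factor i (set_factor m c I) = factor i I" if "i \<in> {j<..n}" for i using that by auto
  then have "tailh n j (set_factor m c I) = tailh n j I" unfolding tailh_def by (intro sum.cong) auto
  then show ?thesis unfolding if_not_P[OF False] by simp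
qed

text \<open>The dynamical argument is recorded as an integer number k of steps of y, so shifts on
  two sides of an identity are compared by integer arithmetic before R is unfolded.\<close>

definition Rm :: "'f::field \<Rightarrow> 'f \<Rightarrow> int \<Rightarrow> 'f \<Rightarrow> ind \<times> ind \<Rightarrow> ind \<times> ind \<Rightarrow> 'f" where
  "Rm lam y k x p q = Rmat (lam - of_int k * y) x y p q"

lemma Rm_simps [simp]:
  "Rm lam y k x (I1, I1) (I1, I1) = 1" "Rm lam y k x (I2, I2) (I2, I2) = 1"
  "Rm lam y k x (I1, I1) (I1, I2) = 0" "Rm lam y k x (I1, I1) (I2, I1) = 0" "Rm lam y k x (I1, I1) (I2, I2) = 0"
  "Rm lam y k x (I2, I2) (I1, I1) = 0" "Rm lam y k x (I2, I2) (I1, I2) = 0" "Rm lam y k x (I2, I2) (I2, I1) = 0"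
  "Rm lam y k x (I1, I2) (I1, I1) = 0" "Rm lam y k x (I1, I2) (I2, I2) = 0"
  "Rm lam y k x (I2, I1) (I1, I1) = 0" "Rm lam y k x (I2, I1) (I2, I2) = 0"
  by (simp_all add: Rm_def)

definition Rop :: "nat \<Rightarrow> 'f::field \<Rightarrow> 'f \<Rightarrow> nat \<Rightarrow> 'f \<Rightarrow> (ind \<Rightarrow> nat set \<Rightarrow> 'f) \<Rightarrow> ind \<Rightarrow> nat set \<Rightarrow> 'f" where
  "Rop n lam y j x \<psi> e I = (\<Sum>b\<in>{I1, I2}. \<Sum>c\<in>{I1, I2}.
     Rm lam y (tailh n j I) x (e, factor j I) (b, c) * \<psi> b (set_factor j c I))"

text \<open>$R^{(a,a+1)}P^{(a,a+1)}$, where for \<open>\<delta> = 1\<close> the shift of $\lambda$ includes the auxiliary factor.\<close>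

definition Chk :: "nat \<Rightarrow> 'f::field \<Rightarrow> 'f \<Rightarrow> nat \<Rightarrow> 'f \<Rightarrow> int \<Rightarrow> (ind \<Rightarrow> nat set \<Rightarrow> 'f) \<Rightarrow> ind \<Rightarrow> nat set \<Rightarrow> 'f" where
  "Chk n lam y a x \<delta> \<psi> e I = (\<Sum>c\<in>{I1, I2}. \<Sum>d\<in>{I1, I2}.
     Rm lam y (tailh n (Suc a) I + \<delta> * eps e) x (factor a I, factor (Suc a) I) (c, d) *
     \<psi> e (set_factor a d (set_factor (Suc a) c I)))"

text \<open>The dynamical shift of R^(0,j) sees the sites a and a+1 only through their total weight,
  which the R-check-matrix conserves; the shift of the latter sees neither site j nor the auxiliary
  factor.\<close>

lemma Chk_Rop_left:
  assumes "j < a" "Suc a \<le> n"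
  shows "Chk n lam y a x 0 (Rop n lam y j x' \<psi>) = Rop n lam y j x' (Chk n lam y a x 0 \<psi>)"
proof (intro ext)
  fix e I
  note [simp] = set_factor_commute[of a "Suc a"] set_factor_commute[of j "Suc a"] set_factor_commute[of j a]
  show "Chk n lam y a x 0 (Rop n lam y j x' \<psi>) e I = Rop n lam y j x' (Chk n lam y a x 0 \<psi>) e I"
    using assms
    by (cases e; cases "factor a I"; cases "factor (Suc a) I"; cases "factor j I") (simp_all add: Chk_def Rop_def algebra_simps)
qed

text \<open>Here R^(0,j) changes the weight of site j, on which the shift of the R-check-matrix
  depends. It conserves the sum with the weight of the auxiliary factor, hence the choice \<delta> =
  1.\<close>

lemma Chk_Rop_right:
  assumes "Suc a < j" "j \<le> n"
  shows "Chk n lam y a x 1 (Rop n lam y j x' \<psi>) = Rop n lam y j x' (Chk n lam y a x 1 \<psi>)"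
proof (intro ext)
  fix e I
  note [simp] = set_factor_commute[of a "Suc a"] set_factor_commute[of j "Suc a"] set_factor_commute[of j a]
  show "Chk n lam y a x 1 (Rop n lam y j x' \<psi>) e I = Rop n lam y j x' (Chk n lam y a x 1 \<psi>) e I"
    using assms
    by (cases e; cases "factor a I"; cases "factor (Suc a) I"; cases "factor j I") (simp_all add: Chk_def Rop_def algebra_simps)
qed

lemma tailh_Suc: "Suc a \<le> n \<Longrightarrow> tailh n a I = eps (factor (Suc a) I) + tailh n (Suc a) I"
proof -
  assume "Suc a \<le> n"
  then have "{a<..n} = insert (Suc a) {Suc a<..n}" by auto
  then show ?thesis by (simp add: tailh_def)
qed

text \<open>The dynamical Yang-Baxter equation for the factors 0, a, a+1. Crossing the auxiliary
  line changes \<delta> from 0 to 1.\<close>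

lemma Chk_Rop_Rop:
  fixes lam y :: "'f::field"
  assumes "1 \<le> a" "Suc a \<le> n" and x: "x = xb - xa"
    and nz: "\<And>m::int. lam - of_int m * y \<noteq> 0" "xa - y \<noteq> 0" "xb - y \<noteq> 0" "x - y \<noteq> 0"
  shows "Chk n lam y a x 0 (Rop n lam y a xb (Rop n lam y (Suc a) xa \<psi>)) =
    Rop n lam y a xa (Rop n lam y (Suc a) xb (Chk n lam y a x 1 \<psi>))"
proof (intro ext)
  fix e I
  note [simp] = set_factor_commute[of a "Suc a"]
  define t where "t = tailh n (Suc a) I"
  define \<mu> where "\<mu> = lam - of_int t * y"
  have nzm: "\<mu> \<noteq> 0" "\<mu> - y \<noteq> 0" "\<mu> + y \<noteq> 0"
    using nz(1)[of t] nz(1)[of "t + 1"] nz(1)[of "t - 1"]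
    by (simp_all add: \<mu>_def algebra_simps)
  have l: "lam - of_int t * y = \<mu>" "lam - of_int (1 + t) * y = \<mu> - y" "lam - of_int (t - 1) * y = \<mu> + y"
    by (simp_all add: \<mu>_def algebra_simps)
  have xb: "xb = xa + x" using x by simp
  have nzx: "xa + x - y \<noteq> 0" using nz(3) xb by simp
  have nzx': "\<mu> \<noteq> 0" "\<mu> \<noteq> y" "\<mu> - y \<noteq> 0" "\<mu> + y \<noteq> 0" "xa \<noteq> y" "xa - y \<noteq> 0" "x \<noteq> y" "x - y \<noteq> 0"
     "xa + x - y \<noteq> 0" "xa + x \<noteq> y"
    using nzm nz(2,4) nzx by auto
  note R = Rm_def l Rmat.simps
  show "Chk n lam y a x 0 (Rop n lam y a xb (Rop n lam y (Suc a) xa \<psi>)) e I =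
    Rop n lam y a xa (Rop n lam y (Suc a) xb (Chk n lam y a x 1 \<psi>)) e I"
    \<comment> \<open>If all three labels agree, R acts as 1. The six mixed cases leave rational
      identities, which become polynomial once the denominators are cleared.\<close>
    apply (cases e; cases "factor a I"; cases "factor (Suc a) I")
           apply (simp_all add: Chk_def Rop_def tailh_Suc assms(2) algebra_simps t_def[symmetric])
    subgoal premises unfolding R xb by (simp add: divide_simps nzx', Groebner_Basis.algebra)
    subgoal premises unfolding R xb by (simp add: divide_simps nzx', Groebner_Basis.algebra)
    subgoal premises unfolding R xb by (simp add: divide_simps nzx', Groebner_Basis.algebra)
    subgoal premises unfolding R xb by (simp add: divide_simps nzx', Groebner_Basis.algebra)
    subgoal premises unfolding R xb by (simp add: divide_simps nzx', Groebner_Basis.algebra)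
    subgoal premises unfolding R xb by (simp add: divide_simps nzx', Groebner_Basis.algebra)
    done
qed


section \<open>The L-operators\<close>

text \<open>A common lower bound N gives the convolution a range independent of the actual orders of
  the series, so products of different pairs of series can be compared term by term.\<close>

lemma fls_times_nth_wide:
  fixes f g :: "'f::field fls"
  assumes "N \<le> fls_subdegree f" "N \<le> fls_subdegree g"
  shows "fls_nth (f * g) n = (\<Sum>i=N..n - N. fls_nth f i * fls_nth g (n - i))"
proof -
  have "fls_nth (f * g) n = (\<Sum>i=fls_subdegree f..n - fls_subdegree g. fls_nth f i * fls_nth g (n - i))"
    by (rule fls_times_nth(2))
  also have "\<dots> = (\<Sum>i=N..n - N. fls_nth f i * fls_nth g (n - i))"
  proof (rule sum.mono_neutral_left)
    show "{fls_subdegree f..n - fls_subdegree g} \<subseteq> {N..n - N}" using assms by auto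
    show "\<forall>i\<in>{N..n - N} - {fls_subdegree f..n - fls_subdegree g}. fls_nth f i * fls_nth g (n - i) = 0"
    proof
      fix i assume "i \<in> {N..n - N} - {fls_subdegree f..n - fls_subdegree g}"
      then have "i < fls_subdegree f \<or> n - i < fls_subdegree g" by auto
      then show "fls_nth f i * fls_nth g (n - i) = 0" by auto
    qed
  qed simp
  finally show ?thesis .
qed

text \<open>As \<open>fls_X\<close> is 1/w, this is the geometric series of 1/(w - c) at w =
  \<infinity>.\<close>

lemma fls_const_geometric:
  fixes c :: "'f::field"
  shows "inverse (fls_X_inv - fls_const c) = fls_X * fps_to_fls (Abs_fps (\<lambda>n. c ^ n))"
    "fls_X_inv - fls_const c \<noteq> 0"
proof -
  let ?A = "Abs_fps (\<lambda>n. c ^ n)"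
  have A: "?A - fps_const c * (fps_X * ?A) = 1"
  proof (rule fps_ext)
    fix m show "fps_nth (?A - fps_const c * (fps_X * ?A)) m = fps_nth 1 m"
      by (cases m) simp_all
  qed
  have "(fls_X_inv - fls_const c) * (fls_X * fps_to_fls ?A) =
      fls_X_inv * fls_X * fps_to_fls ?A - fls_const c * (fls_X * fps_to_fls ?A)"
    by (simp add: algebra_simps)
  also have "\<dots> = fps_to_fls (?A - fps_const c * (fps_X * ?A))"
    by (simp add: fls_times_fps_to_fls fls_X_inv_times_conv_shift fls_X_times_conv_shift)
  finally have e: "(fls_X_inv - fls_const c) * (fls_X * fps_to_fls ?A) = 1" using A by simp
  then show "fls_X_inv - fls_const c \<noteq> 0" by auto
  show "inverse (fls_X_inv - fls_const c) = fls_X * fps_to_fls ?A"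
    using e by (rule inverse_unique)
qed

lemma fls_inverse_linear_nth:
  "fls_nth (inverse (fls_X_inv - fls_const c)) m = (if m \<le> 0 then 0 else c ^ nat (m - 1))" for c :: "'f::field"
  unfolding fls_const_geometric by (auto simp: fls_X_times_conv_shift)

text \<open>A relation between two fields that is compatible with the ring operations: both the graph of a
  homomorphism and the diagonal of a subring are of this form.\<close>

locale ring_relation =
  fixes P :: "'f::field \<Rightarrow> 'f \<Rightarrow> bool"
  assumes P_0: "P 0 0" and P_1: "P 1 1"
    and P_add: "P a a' \<Longrightarrow> P b b' \<Longrightarrow> P (a + b) (a' + b')"
    and P_diff: "P a a' \<Longrightarrow> P b b' \<Longrightarrow> P (a - b) (a' - b')"
    and P_mult: "P a a' \<Longrightarrow> P b b' \<Longrightarrow> P (a * b) (a' * b')"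
begin

lemma P_sum: "(\<And>i. i \<in> A \<Longrightarrow> P (f i) (g i)) \<Longrightarrow> P (sum f A) (sum g A)"
  by (induction A rule: infinite_finite_induct) (auto simp: P_0 P_add)

lemma P_power: "P a a' \<Longrightarrow> P (a ^ m) (a' ^ m)"
  by (induction m) (auto simp: P_1 P_mult)

lemma P_of_int: "P (of_int m) (of_int m)"
proof -
  have n: "P (of_nat k) (of_nat k)" for k by (induction k) (auto simp: P_0 P_1 P_add)
  obtain k l where "m = int k - int l" by (rule int_diff_cases)
  then have "(of_int m :: 'f) = of_nat k - of_nat l" by simp
  then show ?thesis by (simp only: P_diff n)
qed

definition Q :: "'f fls \<Rightarrow> 'f fls \<Rightarrow> bool" where
  "Q F G \<longleftrightarrow> (\<forall>m. P (fls_nth F m) (fls_nth G m))"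

lemma Q_nth: "Q F G \<Longrightarrow> P (fls_nth F m) (fls_nth G m)"
  by (simp add: Q_def)

lemma Q_const: "P a a' \<Longrightarrow> Q (fls_const a) (fls_const a')"
  by (simp add: Q_def P_0)

lemma Q_0: "Q 0 0"
  by (simp add: Q_def P_0)

lemma Q_1: "Q 1 1"
  using Q_const[OF P_1] by simp

lemma Q_X_inv: "Q fls_X_inv fls_X_inv"
  by (simp add: Q_def P_0 P_1)

lemma Q_add: "Q F G \<Longrightarrow> Q F' G' \<Longrightarrow> Q (F + F') (G + G')"
  by (simp add: Q_def P_add)

lemma Q_diff: "Q F G \<Longrightarrow> Q F' G' \<Longrightarrow> Q (F - F') (G - G')"
  by (simp add: Q_def P_diff)

lemma Q_uminus: "Q F G \<Longrightarrow> Q (- F) (- G)"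
  using Q_diff[OF Q_0] by simp

lemma Q_mult:
  assumes "Q F G" "Q F' G'"
  shows "Q (F * F') (G * G')"
  unfolding Q_def
proof
  fix m
  define N where "N = Min {fls_subdegree F, fls_subdegree G, fls_subdegree F', fls_subdegree G'}"
  have N: "N \<le> fls_subdegree F" "N \<le> fls_subdegree G" "N \<le> fls_subdegree F'" "N \<le> fls_subdegree G'"
    unfolding N_def by (rule Min_le; simp)+
  show "P (fls_nth (F * F') m) (fls_nth (G * G') m)"
    unfolding fls_times_nth_wide[OF N(1) N(3)] fls_times_nth_wide[OF N(2) N(4)]
    using assms by (intro P_sum P_mult) (auto simp: Q_def)
qed

text \<open>A relation respecting ring operations says nothing about inverses in general. The
  coefficients of 1/(w - c), however, are 0 or powers of c, and no other inverse that depends on w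
  occurs in R.\<close>

lemma Q_inverse_linear: "P c c' \<Longrightarrow> Q (inverse (fls_X_inv - fls_const c)) (inverse (fls_X_inv - fls_const c'))"
  unfolding Q_def fls_inverse_linear_nth by (auto simp: P_0 P_power)

lemma Q_sum2: "(\<And>b. Q (F b) (G b)) \<Longrightarrow> Q (\<Sum>b\<in>{I1, I2}. F b) (\<Sum>b\<in>{I1, I2}. G b)"
  by (simp add: Q_add)

lemma Q_Rmat:
  assumes lam: "Q lam lam'" "Q (inverse lam) (inverse lam')" and y: "Q y y'"
    and x: "Q x x'" "Q (inverse (x - y)) (inverse (x' - y'))"
  shows "Q (Rmat lam x y p q) (Rmat lam' x' y' p q)"
proof -
  obtain a b c d where pq: "p = (a, b)" "q = (c, d)" by (cases p; cases q)
  show ?thesis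
    unfolding pq
    by (cases a; cases b; cases c; cases d)
      (simp_all only: Rmat.simps divide_inverse inverse_mult_distrib Q_0 Q_1,
        (intro Q_uminus Q_mult Q_add Q_diff lam y x)+)
qed

end

section \<open>Products of R-matrices along the auxiliary line\<close>

definition Lfold :: "nat \<Rightarrow> 'f::field \<Rightarrow> 'f \<Rightarrow> (nat \<Rightarrow> 'f) \<Rightarrow> nat list \<Rightarrow>
    (ind \<Rightarrow> nat set \<Rightarrow> 'f fls) \<Rightarrow> ind \<Rightarrow> nat set \<Rightarrow> 'f fls" where
  "Lfold n lam y z = foldr (\<lambda>j. Rop n (fls_const lam) (fls_const y) j (fls_X_inv - fls_const (z j)))"

definition Lc :: "nat \<Rightarrow> 'f::field \<Rightarrow> 'f \<Rightarrow> (nat \<Rightarrow> 'f) \<Rightarrow> ind \<Rightarrow> ind \<Rightarrow> nat \<Rightarrow> (nat set \<Rightarrow> 'f) \<Rightarrow> nat set \<Rightarrow> 'f" where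
  "Lc n lam y z i j s u I =
     fls_nth (Lfold n lam y z [1..<Suc n] (\<lambda>e K. if e = j then fls_const (u K) else 0) i I) (int s)"

lemma fls_const_shift: "fls_const (lam - of_int m * y) = fls_const lam - of_int m * fls_const y"
  by (simp add: fls_of_int fls_minus_const)

lemma L_coeff_Lc: "L_coeff n lam i j s u = Lc n lam (rvar Y) zz i j s u"
proof -
  have c: "fls_const (lam - rvar Y * of_int m) = fls_const lam - of_int m * fls_const (rvar Y)" for m
    unfolding fls_const_shift[symmetric] by (simp only: mult.commute)
  have "R_op n lam j = Rop n (fls_const lam) (fls_const (rvar Y)) j (fls_X_inv - fls_const (zz j))" for j
    by (intro ext) (simp only: R_op_def Rop_def Rm_def tailh_def c)
  then have "R_op n lam = (\<lambda>j. Rop n (fls_const lam) (fls_const (rvar Y)) j (fls_X_inv - fls_const (zz j)))"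
    by (rule ext)
  then show ?thesis
    unfolding L_coeff_def L_op_def Lc_def Lfold_def by simp
qed

context ring_relation
begin

lemma Q_Rop:
  assumes lam: "P lam lam'" "\<And>m::int. P (inverse (lam - of_int m * y)) (inverse (lam' - of_int m * y'))"
    and y: "P y y'" and z: "P z z'" and \<psi>: "\<And>e K. Q (\<psi> e K) (\<psi>' e K)"
  shows "Q (Rop n (fls_const lam) (fls_const y) j (fls_X_inv - fls_const z) \<psi> e I)
    (Rop n (fls_const lam') (fls_const y') j (fls_X_inv - fls_const z') \<psi>' e I)"
proof -
  have x: "fls_X_inv - fls_const c - fls_const d = fls_X_inv - fls_const (c + d)" for c d :: 'f
    by (simp add: fls_plus_const[symmetric])
  have "Q (inverse (fls_const (lam - of_int m * y))) (inverse (fls_const (lam' - of_int m * y')))" for m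
    unfolding fls_inverse_const by (rule Q_const[OF lam(2)])
  then show ?thesis
    unfolding Rop_def Rm_def fls_const_shift[symmetric]
    by (intro Q_sum2 Q_mult \<psi> Q_Rmat Q_diff Q_X_inv Q_const P_diff P_mult P_of_int lam y z)
      (simp_all add: x Q_inverse_linear P_add y z)
qed

lemma P_Lc:
  assumes lam: "P lam lam'" "\<And>m::int. P (inverse (lam - of_int m * y)) (inverse (lam' - of_int m * y'))"
    and y: "P y y'" and z: "\<And>j. j \<in> {1..n} \<Longrightarrow> P (z j) (z' j)" and u: "\<And>K. P (u K) (u' K)"
  shows "P (Lc n lam y z i j s u I) (Lc n lam' y' z' i j s u' I)"
proof -
  let ?\<psi> = "\<lambda>u e K. if e = j then fls_const (u K) else 0"
  have "Q (Lfold n lam y z js (?\<psi> u) e K) (Lfold n lam' y' z' js (?\<psi> u') e K)" if "set js \<subseteq> {1..n}" for js e K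
    using that
  proof (induction js arbitrary: e K)
    case Nil
    then show ?case by (simp add: Lfold_def Q_const Q_0 u)
  next
    case (Cons m js)
    then have "P (z m) (z' m)" using z by simp
    moreover have "Q (Lfold n lam y z js (?\<psi> u) e K) (Lfold n lam' y' z' js (?\<psi> u') e K)" for e K
      using Cons by simp
    ultimately show ?case
      using Q_Rop[OF lam y, of "z m" "z' m"] by (simp add: Lfold_def)
  qed
  moreover have "set [1..<Suc n] \<subseteq> {1..n}" by auto
  ultimately show ?thesis unfolding Lc_def by (intro Q_nth)
qed

end

lemma Lfold_append: "Lfold n lam y z (js @ js') \<psi> = Lfold n lam y z js (Lfold n lam y z js' \<psi>)"
  by (simp add: Lfold_def)

lemma Lfold_cong:
  assumes "\<And>j. j \<in> set js \<Longrightarrow> z j = z' j"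
  shows "Lfold n lam y z js = Lfold n lam y z' js"
proof
  fix \<psi> show "Lfold n lam y z js \<psi> = Lfold n lam y z' js \<psi>"
    using assms by (induction js) (simp_all add: Lfold_def)
qed

lemma Chk_Lfold_left:
  assumes "\<And>j. j \<in> set js \<Longrightarrow> j < a" "Suc a \<le> n"
  shows "Chk n (fls_const lam) (fls_const y) a x 0 (Lfold n lam y z js \<psi>) =
    Lfold n lam y z js (Chk n (fls_const lam) (fls_const y) a x 0 \<psi>)"
  using assms by (induction js) (simp_all add: Lfold_def Chk_Rop_left)

lemma Chk_Lfold_right:
  assumes "\<And>j. j \<in> set js \<Longrightarrow> Suc a < j \<and> j \<le> n"
  shows "Chk n (fls_const lam) (fls_const y) a x 1 (Lfold n lam y z js \<psi>) =
    Lfold n lam y z js (Chk n (fls_const lam) (fls_const y) a x 1 \<psi>)"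
  using assms by (induction js) (simp_all add: Lfold_def Chk_Rop_right)

text \<open>The R-check-matrix passes unchanged through the factors with j < a, crosses the pair a,
  a+1 by the Yang-Baxter equation, which restores the order of the parameters and turns \<delta>
  into 1, and passes through the factors with j > a+1 in that form.\<close>

lemma Chk_Lfold:
  fixes lam y :: "'f::field"
  assumes a: "1 \<le> a" "Suc a \<le> n" and lam: "\<And>m::int. lam - of_int m * y \<noteq> 0"
    and d: "z a - z (Suc a) - y \<noteq> 0"
  shows "Chk n (fls_const lam) (fls_const y) a (fls_const (z a - z (Suc a))) 0
      (Lfold n lam y (z \<circ> transpose a (Suc a)) [1..<Suc n] \<psi>) =
    Lfold n lam y z [1..<Suc n]
      (Chk n (fls_const lam) (fls_const y) a (fls_const (z a - z (Suc a))) 1 \<psi>)"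
proof -
  let ?s = "transpose a (Suc a)"
  let ?C = "Chk n (fls_const lam) (fls_const y) a (fls_const (z a - z (Suc a)))"
  let ?L = "Lfold n lam y z" and ?L' = "Lfold n lam y (z \<circ> ?s)"
  have js: "[1..<Suc n] = [1..<a] @ [a, Suc a] @ [Suc (Suc a)..<Suc n]"
  proof -
    have "[1..<Suc n] = [1..<a] @ [a..<Suc n]" using a upt_add_eq_append[of 1 a "Suc n - a"] by simp
    moreover have "[a..<Suc n] = a # Suc a # [Suc (Suc a)..<Suc n]" using a by (simp add: upt_conv_Cons)
    ultimately show ?thesis by simp
  qed
  have eq: "?L' [1..<a] = ?L [1..<a]" "?L' [Suc (Suc a)..<Suc n] = ?L [Suc (Suc a)..<Suc n]"
    by (intro Lfold_cong; auto simp: transpose_def)+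
  have lamc: "fls_const lam - of_int m * fls_const y \<noteq> 0" for m
    using lam[of m] by (simp add: fls_const_shift[symmetric])
  have xc: "fls_X_inv - fls_const (z j) - fls_const y \<noteq> 0" for j
    using fls_const_geometric(2)[of "z j + y"] by (simp add: fls_plus_const[symmetric] diff_diff_eq)
  have dc: "fls_const (z a - z (Suc a)) - fls_const y \<noteq> 0"
    using d by (simp add: fls_minus_const)
  \<comment> \<open>The spectral parameter w cancels in the difference, so the argument of the
    R-check-matrix is constant in w.\<close>
  have x: "fls_const (z a - z (Suc a)) = (fls_X_inv - fls_const (z (Suc a))) - (fls_X_inv - fls_const (z a))"
    by (simp add: fls_minus_const[symmetric])
  have mid: "?C 0 (?L' [a, Suc a] \<phi>) = ?L [a, Suc a] (?C 1 \<phi>)" for \<phi>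
    using Chk_Rop_Rop[OF a x lamc xc xc dc, of \<phi>] by (simp add: Lfold_def)
  have "?C 0 (?L' [1..<Suc n] \<psi>) = ?C 0 (?L [1..<a] (?L' [a, Suc a] (?L [Suc (Suc a)..<Suc n] \<psi>)))"
    unfolding js Lfold_append eq ..
  also have "\<dots> = ?L [1..<a] (?C 0 (?L' [a, Suc a] (?L [Suc (Suc a)..<Suc n] \<psi>)))"
    by (rule Chk_Lfold_left) (use a in auto)
  also have "\<dots> = ?L [1..<a] (?L [a, Suc a] (?C 1 (?L [Suc (Suc a)..<Suc n] \<psi>)))"
    unfolding mid ..
  also have "?C 1 (?L [Suc (Suc a)..<Suc n] \<psi>) = ?L [Suc (Suc a)..<Suc n] (?C 1 \<psi>)"
    by (rule Chk_Lfold_right) auto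
  finally show ?thesis unfolding js Lfold_append .
qed

definition Ck :: "nat \<Rightarrow> 'f::field \<Rightarrow> 'f \<Rightarrow> nat \<Rightarrow> 'f \<Rightarrow> (nat set \<Rightarrow> 'f) \<Rightarrow> nat set \<Rightarrow> 'f" where
  "Ck n lam y a x u I = (\<Sum>c\<in>{I1, I2}. \<Sum>d\<in>{I1, I2}.
     Rm lam y (tailh n (Suc a) I) x (factor a I, factor (Suc a) I) (c, d) *
     u (set_factor a d (set_factor (Suc a) c I)))"

lemma Rm_fls_const:
  "Rm (fls_const lam) (fls_const y) k (fls_const x) p q = fls_const (Rm lam y k x p q)"
proof -
  obtain a b c d where pq: "p = (a, b)" "q = (c, d)" by (cases p; cases q)
  show ?thesis
    unfolding Rm_def pq fls_const_shift[symmetric]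
    by (cases a; cases b; cases c; cases d)
      (simp_all add: fls_minus_const fls_plus_const fls_const_divide_const)
qed

text \<open>On input with auxiliary label j, the case \<delta> = 1 amounts to replacing \<lambda> by
  \<lambda> - \<epsilon>_j y. This matches the shift of the inverse stable envelope in
  \<open>coh_act\<close>.\<close>

lemma Lc_Ck:
  fixes lam y :: "'f::field"
  assumes a: "1 \<le> a" "Suc a \<le> n" and lam: "\<And>m::int. lam - of_int m * y \<noteq> 0"
    and d: "z a - z (Suc a) - y \<noteq> 0"
  shows "Ck n lam y a (z a - z (Suc a)) (Lc n lam y (z \<circ> transpose a (Suc a)) i j s u) =
    Lc n lam y z i j s (Ck n (lam - of_int (eps j) * y) y a (z a - z (Suc a)) u)"
proof
  fix I
  let ?x = "z a - z (Suc a)" and ?\<psi> = "\<lambda>u e K. if e = j then fls_const (u K) else 0"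
  have "Rm (lam - of_int (eps j) * y) y k x p q = Rm lam y (k + eps j) x p q" for k x p q
    by (simp add: Rm_def algebra_simps)
  then have 1: "Chk n (fls_const lam) (fls_const y) a (fls_const ?x) 1 (?\<psi> u) =
      ?\<psi> (Ck n (lam - of_int (eps j) * y) y a ?x u)"
    by (intro ext) (simp add: Chk_def Ck_def Rm_fls_const fls_plus_const)
  have 0: "fls_nth (Chk n (fls_const lam) (fls_const y) a (fls_const ?x) 0 \<phi> i I) m =
      Ck n lam y a ?x (\<lambda>I. fls_nth (\<phi> i I) m) I" for \<phi> m
    by (simp add: Chk_def Ck_def Rm_fls_const)
  show "Ck n lam y a ?x (Lc n lam y (z \<circ> transpose a (Suc a)) i j s u) I =
      Lc n lam y z i j s (Ck n (lam - of_int (eps j) * y) y a ?x u) I"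
    unfolding Lc_def 0[symmetric] 1[symmetric] Chk_Lfold[OF a lam d] ..
qed


section \<open>The L-operators preserve equivariant integral families\<close>

lemma L_coeff_mem:
  assumes S: "field_subring S" and "\<And>j. j \<in> {1..n} \<Longrightarrow> zz j \<in> S" "rvar Y \<in> S"
    and lam: "\<And>l. lamv l \<in> S" "\<And>l. inverse (lamv l) \<in> S" and u: "\<And>K. u K \<in> S"
  shows "L_coeff n (lamv l) i j s u I \<in> S"
proof -
  interpret field_subring S by fact
  interpret ring_relation "\<lambda>a b. a = b \<and> a \<in> S"
    by unfold_locales auto
  show ?thesis
    using P_Lc[where lam = "lamv l" and lam' = "lamv l" and y = "rvar Y" and y' = "rvar Y" and z = zz
      and z' = zz and u = u and u' = u and n = n and i = i and j = j and s = s and I = I] assms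
    by (simp add: L_coeff_Lc lamv_shift)
qed

lemma rs_lamv [simp]: "rs \<tau> (lamv l) = lamv l"
  by (simp add: lamv_def)

lemma rs_L_coeff:
  assumes "bij \<tau>"
  shows "rs \<tau> (L_coeff n (lamv l) i j s u I) =
    Lc n (lamv l) (rvar Y) (zz \<circ> \<tau>) i j s (\<lambda>K. rs \<tau> (u K)) I"
proof -
  interpret ring_relation "\<lambda>a b. b = rs \<tau> a"
    by unfold_locales (use assms in \<open>simp_all del: fun_upd_apply\<close>)
  show ?thesis
    using P_Lc[where lam = "lamv l" and lam' = "lamv l" and y = "rvar Y" and y' = "rvar Y" and z = zz
      and z' = "zz \<circ> \<tau>" and u = u and u' = "\<lambda>K. rs \<tau> (u K)" and n = n and i = i and j = j and s = s and I = I] assms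
    by (simp add: L_coeff_Lc lamv_shift)
qed

lemma rs_Mt:
  assumes \<tau>: "bij \<tau>" and I: "I \<subseteq> {1..n}" and J: "J \<subseteq> {1..n}"
  shows "rs \<tau> (Mt n l I J) = (if card I = card J then MM n I (lamv l) (zz \<circ> \<tau>) (rvar Y) (zz ` \<tau> ` J) else 0)"
proof -
  have inj: "inj_on \<tau> A" for A using \<tau> by (meson bij_is_inj inj_on_subset subset_UNIV)
  have fin: "finite I" "finite J" using I J by (auto intro: finite_subset)
  have im: "rs \<tau> ` zz ` J = zz ` \<tau> ` J" by (simp add: image_image)
  have "inj_on (rs \<tau>) (zz ` J)"
    using inj by (auto simp: inj_on_def)
  then have "rs \<tau> (MM n I (lamv l) zz (rvar Y) (zz ` J)) =
      MM n I (rs \<tau> (lamv l)) (\<lambda>a. rs \<tau> (zz a)) (rs \<tau> (rvar Y)) (rs \<tau> ` zz ` J)"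
    using \<tau> fin wden_nonzero[of I "\<tau> ` J" n l]
    by (intro rsub_MM[THEN conjunct2]) (simp_all add: image_image)
  then show ?thesis using im by (simp add: Mt_def o_def)
qed

lemma set_factor_subset: "I \<subseteq> {1..n} \<Longrightarrow> j \<in> {1..n} \<Longrightarrow> set_factor j c I \<subseteq> {1..n}"
  by (auto simp: set_factor_def)

text \<open>R conserves weight: its nonzero entries leave the number of labels \<open>I1\<close>
  unchanged.\<close>

lemma card_set_factor:
  assumes "finite I" "Rmat lam x y (c, e) (factor b I, factor a I) \<noteq> 0" "a \<noteq> b"
  shows "card (set_factor a c (set_factor b e I)) = card I"
proof -
  have b: "card (set_factor b e I) + (if factor b I = I1 then 1 else 0) = card I + (if e = I1 then 1 else 0)"
    using assms(1) by (cases "b \<in> I"; cases e) (auto simp: set_factor_def factor_def insert_absorb dest: card_Suc_Diff1)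
  have a: "card (set_factor a c K) + (if factor a K = I1 then 1 else 0) = card K + (if c = I1 then 1 else 0)"
    if "finite K" for K
    using that by (cases "a \<in> K"; cases c) (auto simp: set_factor_def factor_def insert_absorb dest: card_Suc_Diff1)
  have "finite (set_factor b e I)" using assms(1) by (auto simp: set_factor_def)
  from a[OF this] have a': "card (set_factor a c (set_factor b e I)) + (if factor a I = I1 then 1 else 0) =
      card (set_factor b e I) + (if c = I1 then 1 else 0)"
    using assms(3) by simp
  show ?thesis
    using assms(2) a' b by (cases c; cases e; cases "factor a I"; cases "factor b I") auto
qed

text \<open>The exchange relation acts on the index I of the matrix entries; in the sum against u it
  is transferred to an R-check-matrix acting on the coordinates.\<close>

lemma Mapply_exchange:
  assumes a: "1 \<le> a" "Suc a \<le> n" and J: "J \<subseteq> {1..n}"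
  shows "rs (transpose a (Suc a)) (Mapply n l u J) =
    Mapply n l (Ck n (lamv l) (rvar Y) a (zz a - zz (Suc a)) (\<lambda>I. rs (transpose a (Suc a)) (u I)))
      (transpose a (Suc a) ` J)"
proof -
  let ?s = "transpose a (Suc a)" and ?U = "{I1, I2}"
  let ?sf = "\<lambda>c e I. set_factor a c (set_factor (Suc a) e I)"
  let ?R = "\<lambda>I. Rm (lamv l) (rvar Y) (tailh n (Suc a) I) (zz a - zz (Suc a))"
  define K where "K = ?s ` J"
  define v where "v I = rs ?s (u I)" for I
  have s: "bij ?s" by simp
  have cK: "card K = card J" unfolding K_def by (rule card_image, rule inj_on_subset[OF _ subset_UNIV], simp add: bij_is_inj)
  have sf: "?sf c e I \<subseteq> {1..n}" if "I \<subseteq> {1..n}" for c e I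
    using that a by (intro set_factor_subset) auto
  have d: "zz a - zz (Suc a) - rvar Y \<noteq> 0"
  proof
    assume "zz a - zz (Suc a) - rvar Y = 0"
    then have "zz (Suc a) - zz a + rvar Y = 0" by (simp add: algebra_simps)
    then show False using zzy_nonzero by blast
  qed
  have Mt: "rs ?s (Mt n l I J) = (\<Sum>c\<in>?U. \<Sum>e\<in>?U. ?R I (c, e) (factor (Suc a) I, factor a I) * Mt n l (?sf c e I) K)"
    if I: "I \<subseteq> {1..n}" for I
  proof -
    have fin: "finite I" using I by (auto intro: finite_subset)
    have eq: "?R I (c, e) (factor (Suc a) I, factor a I) *
        (if card I = card K then MM n (?sf c e I) (lamv l) zz (rvar Y) (zz ` K) else 0) =
      ?R I (c, e) (factor (Suc a) I, factor a I) * Mt n l (?sf c e I) K" for c e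
    proof (cases "?R I (c, e) (factor (Suc a) I, factor a I) = 0")
      case False
      then have "card (?sf c e I) = card I"
        using fin by (intro card_set_factor) (auto simp: Rm_def)
      then show ?thesis by (simp add: Mt_def)
    qed simp
    have ex: "MM n I (lamv l) (zz \<circ> ?s) (rvar Y) (zz ` K) = (\<Sum>c\<in>?U. \<Sum>e\<in>?U.
        ?R I (c, e) (factor (Suc a) I, factor a I) * MM n (?sf c e I) (lamv l) zz (rvar Y) (zz ` K))"
      unfolding Rm_def
      by (rule exchange[OF a I]) (erule ratf_double_zero, rule lamv_diff_nonzero, rule d)
    have "rs ?s (Mt n l I J) = (if card I = card K then MM n I (lamv l) (zz \<circ> ?s) (rvar Y) (zz ` K) else 0)"
      unfolding rs_Mt[OF s I J] using cK by (simp only: K_def)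
    also have "\<dots> = (\<Sum>c\<in>?U. \<Sum>e\<in>?U. ?R I (c, e) (factor (Suc a) I, factor a I) *
        (if card I = card K then MM n (?sf c e I) (lamv l) zz (rvar Y) (zz ` K) else 0))"
      by (cases "card I = card K") (simp_all only: ex if_True if_False mult_zero_right sum.neutral_const HOL.simp_thms)
    finally show ?thesis unfolding eq .
  qed
  let ?A = "Pow {1..n} \<times> (?U \<times> ?U)"
  have "rs ?s (Mapply n l u J) = (\<Sum>I\<in>Pow {1..n}. rs ?s (Mt n l I J) * v I)"
    unfolding Mapply_def v_def using s by (simp add: rsub_sum)
  also have "\<dots> = (\<Sum>I\<in>Pow {1..n}. \<Sum>c\<in>?U. \<Sum>e\<in>?U.
      ?R I (c, e) (factor (Suc a) I, factor a I) * Mt n l (?sf c e I) K * v I)"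
    by (intro sum.cong HOL.refl) (simp add: Mt sum_distrib_right ring_distribs)
  also have "\<dots> = (\<Sum>(I, c, e)\<in>?A. ?R I (c, e) (factor (Suc a) I, factor a I) * Mt n l (?sf c e I) K * v I)"
    by (simp only: sum.cartesian_product)
  also have "\<dots> = (\<Sum>(I, c, d)\<in>?A. Mt n l I K * (?R I (factor a I, factor (Suc a) I) (c, d) * v (?sf d c I)))"
  \<comment> \<open>The summation variables become the set with the new labels at the two sites
    together with the old labels. The argument of R is unaffected because
    \<open>tailh n (Suc a)\<close> sees neither site.\<close>
  proof (rule sum.reindex_bij_witness[where
      j = "\<lambda>(I, c, e). (?sf c e I, factor (Suc a) I, factor a I)" and
      i = "\<lambda>(I, c, d). (?sf d c I, factor a I, factor (Suc a) I)"])
    note [simp] = set_factor_commute[of a "Suc a"]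
    have U: "c \<in> ?U" for c by (cases c) auto
    fix x assume x: "x \<in> ?A"
    obtain I c e where [simp]: "x = (I, c, e)" by (cases x)
    have I: "I \<subseteq> {1..n}" using x by simp
    show "(case case x of (I, c, e) \<Rightarrow> (?sf c e I, factor (Suc a) I, factor a I) of
        (I, c, d) \<Rightarrow> (?sf d c I, factor a I, factor (Suc a) I)) = x"
      by simp
    show "(case case x of (I, c, d) \<Rightarrow> (?sf d c I, factor a I, factor (Suc a) I) of
        (I, c, e) \<Rightarrow> (?sf c e I, factor (Suc a) I, factor a I)) = x"
      by simp
    show "(case x of (I, c, e) \<Rightarrow> (?sf c e I, factor (Suc a) I, factor a I)) \<in> ?A"
      "(case x of (I, c, d) \<Rightarrow> (?sf d c I, factor a I, factor (Suc a) I)) \<in> ?A"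
      using sf[OF I] U by (cases "factor a I"; cases "factor (Suc a) I"; simp)+
    show "(case case x of (I, c, e) \<Rightarrow> (?sf c e I, factor (Suc a) I, factor a I) of
        (I, c, d) \<Rightarrow> Mt n l I K * (?R I (factor a I, factor (Suc a) I) (c, d) * v (?sf d c I))) =
      (case x of (I, c, e) \<Rightarrow> ?R I (c, e) (factor (Suc a) I, factor a I) * Mt n l (?sf c e I) K * v I)"
      by simp
  qed
  also have "\<dots> = (\<Sum>I\<in>Pow {1..n}. \<Sum>c\<in>?U. \<Sum>d\<in>?U.
      Mt n l I K * (?R I (factor a I, factor (Suc a) I) (c, d) * v (?sf d c I)))"
    by (simp only: sum.cartesian_product)
  also have "\<dots> = Mapply n l (Ck n (lamv l) (rvar Y) a (zz a - zz (Suc a)) v) K"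
    unfolding Mapply_def Ck_def by (intro sum.cong HOL.refl) (simp add: ring_distribs)
  finally show ?thesis unfolding K_def v_def .
qed

section \<open>Equivariance and its consequences for poles\<close>

definition eqv :: "nat \<Rightarrow> (nat set \<Rightarrow> ratf) \<Rightarrow> bool" where
  "eqv n g \<longleftrightarrow> (\<forall>\<tau> J. \<tau> permutes {1..n} \<longrightarrow> J \<subseteq> {1..n} \<longrightarrow> g (\<tau> ` J) = rs \<tau> (g J))"

lemma permutes_subset: "\<tau> permutes A \<Longrightarrow> J \<subseteq> A \<Longrightarrow> \<tau> ` J \<subseteq> A"
  by (metis image_mono permutes_image)

text \<open>The permutations for which g is equivariant are closed under composition, and adjacent
  transpositions generate the symmetric group.\<close>

lemma eqv_if_adjacent:
  assumes adj: "\<And>a J. 1 \<le> a \<Longrightarrow> Suc a \<le> n \<Longrightarrow> J \<subseteq> {1..n} \<Longrightarrow>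
    g (transpose a (Suc a) ` J) = rs (transpose a (Suc a)) (g J)"
  shows "eqv n g"
proof -
  define H where "H = {\<tau>. \<tau> permutes {1..n} \<and> (\<forall>J. J \<subseteq> {1..n} \<longrightarrow> g (\<tau> ` J) = rs \<tau> (g J))}"
  have comp: "\<sigma> \<circ> \<tau> \<in> H" if "\<sigma> \<in> H" "\<tau> \<in> H" for \<sigma> \<tau>
  proof -
    have p: "\<sigma> permutes {1..n}" "\<tau> permutes {1..n}" using that by (auto simp: H_def)
    have "g ((\<sigma> \<circ> \<tau>) ` J) = rs (\<sigma> \<circ> \<tau>) (g J)" if J: "J \<subseteq> {1..n}" for J
    proof -
      have "g ((\<sigma> \<circ> \<tau>) ` J) = rs \<sigma> (g (\<tau> ` J))"
        using \<open>\<sigma> \<in> H\<close> permutes_subset[OF p(2) J] unfolding image_comp[symmetric] by (simp add: H_def)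
      also have "\<dots> = rs (\<sigma> \<circ> \<tau>) (g J)"
        using \<open>\<tau> \<in> H\<close> J by (simp add: H_def rs_rs[OF permutes_bij[OF p(2)] permutes_bij[OF p(1)]])
      finally show ?thesis .
    qed
    then show ?thesis using permutes_compose[OF p(2,1)] by (simp add: H_def)
  qed
  have adjH: "transpose a (Suc a) \<in> H" if "1 \<le> a" "Suc a \<le> n" for a
    using that adj by (auto simp: H_def intro: permutes_swap_id)
  have trH: "transpose a (Suc a + k) \<in> H" if "1 \<le> a" "Suc a + k \<le> n" for a k
    using that
  proof (induction k)
    case (Suc k)
    \<comment> \<open>A longer transposition is a shorter one conjugated by an adjacent one.\<close>
    have e: "transpose a (Suc a + Suc k) = transpose (Suc a + k) (Suc (Suc a + k)) \<circ> transpose a (Suc a + k) \<circ>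
        transpose (Suc a + k) (Suc (Suc a + k))"
      by (auto simp: transpose_def fun_eq_iff)
    show ?case
      unfolding e using Suc by (intro comp adjH) auto
  qed (use adjH in simp)
  have trH': "transpose a b \<in> H" if "a \<in> {1..n}" "b \<in> {1..n}" "a \<noteq> b" for a b
  proof (cases "a < b")
    case True
    then show ?thesis using trH[of a "b - Suc a"] that by simp
  next
    case False
    then show ?thesis using trH[of b "a - Suc b"] that by (simp add: transpose_commute)
  qed
  have "\<tau> \<in> H" if "\<tau> permutes {1..n}" for \<tau>
    using that finite_atLeastAtMost
  proof (induction \<tau> rule: permutes_induct)
    case id
    have "id \<in> H" unfolding H_def using permutes_id by (simp only: mem_Collect_eq image_id id_apply rs_id) simp
    then show ?case by (simp add: id_def)
  next
    case (swap a b p)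
    then show ?case using comp[OF trH'[of a b], of p] by (cases "a = b") (simp_all add: comp_def)
  qed
  then show ?thesis by (auto simp: eqv_def H_def)
qed

text \<open>The denominators of \<open>Pol\<close> involve only \<lambda> and y, so substitutions
  for z_a fix them.\<close>

lemma Pol_regular:
  assumes x: "x \<in> Pol n" and ab: "a \<in> {1..n}" "q = Var (Z b) \<or> q = Var (Z b) - Var Y" "b \<in> {1..n}"
  shows "regular (Var(Z a := q)) x"
proof -
  have "\<exists>V' D'. (\<forall>v\<in>Vlzy n. (Var(Z a := q)) v \<in> polys V') \<and>
    (\<forall>d\<in>insert (Var Y) lam_forms. psubst (Var(Z a := q)) d \<in> D') \<and> 0 \<notin> D'"
  proof (intro exI conjI)
    show "\<forall>v\<in>Vlzy n. (Var(Z a := q)) v \<in> polys UNIV" by (simp add: polys_def)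
    show "\<forall>d\<in>insert (Var Y) lam_forms. psubst (Var(Z a := q)) d \<in> insert (Var Y) lam_forms"
      by (auto simp: lam_forms_def)
  qed (rule forms_nonzero)
  then show ?thesis using rsub_loc(1) x unfolding Pol_def by (metis (no_types, lifting))
qed

text \<open>On z_a = z_b the transposition of these parameters acts trivially. This turns
  equivariance into the congruences modulo z_a - z_b.\<close>

lemma rsub_sC_rs:
  assumes ab: "a \<noteq> b" and x: "regular (sC a b) x"
  shows "rsub (sC a b) (rs (transpose a b) x) = rsub (sC a b) x"
proof -
  obtain p q where pq: "x = Fract p q" "q \<noteq> 0" "psubst (sC a b) q \<noteq> 0"
    "rsub (sC a b) x = Fract (psubst (sC a b) p) (psubst (sC a b) q)"
    using regular_cases[OF x] by blast
  have e: "psubst (sC a b) (zsub (transpose a b) r) = psubst (sC a b) r" for r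
  proof -
    have "psubst (sC a b) (permute_vars id id (transpose a b) v) = (sC a b) v" for v
      using ab by (cases v) (auto simp: transpose_def)
    then show ?thesis by (simp add: psubst_psubst del: fun_upd_apply)
  qed
  have "zsub (transpose a b) q \<noteq> 0" using pq(2) by (intro zsub_nonzero) simp
  then have "rs (transpose a b) x = Fract (zsub (transpose a b) p) (zsub (transpose a b) q)"
    unfolding pq(1) by (rule rsub_Fract)
  then show ?thesis using pq(3,4) by (simp add: rsub_Fract e)
qed

lemma regular_sC_swap:
  assumes "regular (sC a b) x" "a \<noteq> b"
  shows "regular (sC b a) x"
proof -
  obtain p q where pq: "x = Fract p q" "psubst (sC a b) q \<noteq> 0"
    using assms(1) by (auto simp: regular_def)
  have "psubst (permute_vars id id (transpose a b)) ((sC a b) v) = (sC b a) v" for v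
    using assms(2) by (cases v) (auto simp: transpose_def)
  then have "psubst (sC b a) q = zsub (transpose a b) (psubst (sC a b) q)"
    by (simp add: psubst_psubst del: fun_upd_apply)
  then have "psubst (sC b a) q \<noteq> 0" using zsub_nonzero[OF _ pq(2)] by simp
  then show ?thesis unfolding pq(1) by (rule regular_Fract)
qed

text \<open>Equivariance of M u makes u a fixed point of the twisted R-check-matrices at \<lambda> -
  \<epsilon>_j y, and L carries such vectors to fixed points at \<lambda>. Integrality is tested in
  the local ring of each hyperplane: L and M do not leave it, so it suffices that the coordinates u
  lie in it.\<close>

lemma L_coeff_integral:
  fixes u :: vec
  assumes u0: "\<And>K. \<not> K \<subseteq> {1..n} \<Longrightarrow> u K = 0"
    and pol: "\<And>J. J \<subseteq> {1..n} \<Longrightarrow> Mapply n (l - eps j) u J \<in> Pol n"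
    and eqv: "eqv n (Mapply n (l - eps j) u)"
  shows "eqv n (Mapply n l (L_coeff n (lamv l) i j s u))" (is "eqv n ?G")
    and "J \<subseteq> {1..n} \<Longrightarrow> Mapply n l (L_coeff n (lamv l) i j s u) J \<in> Pol n"
proof -
  let ?l = "l - eps j" and ?v = "L_coeff n (lamv l) i j s u"
  have adj: "?G (transpose a (Suc a) ` J) = rs (transpose a (Suc a)) (?G J)"
    if a: "1 \<le> a" "Suc a \<le> n" and J: "J \<subseteq> {1..n}" for a J
  proof -
    let ?s = "transpose a (Suc a)"
    let ?C = "\<lambda>l. Ck n (lamv l) (rvar Y) a (zz a - zz (Suc a))"
    have s: "?s permutes {1..n}" using a by (intro permutes_swap_id) auto
    have ss: "?s ` ?s ` A = A" for A by (simp add: image_image)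
    have d: "zz a - zz (Suc a) - rvar Y \<noteq> 0"
    proof
      assume "zz a - zz (Suc a) - rvar Y = 0"
      then have "zz (Suc a) - zz a + rvar Y = 0" by (simp add: algebra_simps)
      then show False using zzy_nonzero by blast
    qed
    have uC: "?C ?l (\<lambda>I. rs ?s (u I)) K = u K" for K
    proof (cases "K \<subseteq> {1..n}")
      case True
      have "Mapply n ?l u J = Mapply n ?l (?C ?l (\<lambda>I. rs ?s (u I))) J" if J: "J \<subseteq> {1..n}" for J
      proof -
        have J': "?s ` J \<subseteq> {1..n}" by (rule permutes_subset[OF s J])
        have "Mapply n ?l u J = rs ?s (Mapply n ?l u (?s ` J))"
          using eqv[unfolded eqv_def, rule_format, OF s J'] unfolding ss .
        then show ?thesis unfolding Mapply_exchange[OF a J'] ss .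
      qed
      then show ?thesis using Mapply_inj[OF _ True] by metis
    next
      case False
      have "\<not> set_factor a d (set_factor (Suc a) c K) \<subseteq> {1..n}" for c d
        using False a by (auto simp: set_factor_def split: if_splits)
      then show ?thesis using False by (simp add: Ck_def u0)
    qed
    have "rs ?s (?G J) = Mapply n l (?C l (\<lambda>I. rs ?s (?v I))) (?s ` J)"
      by (rule Mapply_exchange[OF a J])
    also have "(\<lambda>I. rs ?s (?v I)) = Lc n (lamv l) (rvar Y) (zz \<circ> ?s) i j s (\<lambda>K. rs ?s (u K))"
      by (intro ext rs_L_coeff) simp
    also have "?C l \<dots> = Lc n (lamv l) (rvar Y) zz i j s (?C ?l (\<lambda>K. rs ?s (u K)))"
      using Lc_Ck[of a n "lamv l" "rvar Y" zz i j s, OF a lamv_diff_nonzero d] by (simp add: lamv_shift)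
    also have "?C ?l (\<lambda>K. rs ?s (u K)) = u" by (rule ext) (rule uC)
    also have "Lc n (lamv l) (rvar Y) zz i j s u = ?v" by (rule L_coeff_Lc[symmetric])
    finally show ?thesis ..
  qed
  show G: "eqv n ?G" by (rule eqv_if_adjacent) (rule adj)
  \<comment> \<open>One argument for all rings S: it is used for \<open>Sfull\<close> and for the
    local rings of both kinds of hyperplanes.\<close>
  have mem: "?G J \<in> S"
    if S: "field_subring S" and "\<And>j. j \<in> {1..n} \<Longrightarrow> zz j \<in> S" "rvar Y \<in> S"
      "\<And>l. lamv l \<in> S" "\<And>l. inverse (lamv l) \<in> S"
      and M: "\<And>I J. I \<subseteq> {1..n} \<Longrightarrow> J \<subseteq> {1..n} \<Longrightarrow> Mt n l I J \<in> S"
      and uS: "\<And>K. K \<subseteq> {1..n} \<Longrightarrow> u K \<in> S" and J: "J \<subseteq> {1..n}" for S J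
  proof -
    interpret field_subring S by fact
    have "u K \<in> S" for K using uS[of K] u0[of K] by (cases "K \<subseteq> {1..n}") auto
    then have "?v I \<in> S" for I using S that(2-5) by (intro L_coeff_mem)
    then show ?thesis unfolding Mapply_def using M J by (intro sum_mem mult_mem) auto
  qed
  have reg: "regular \<sigma> (zz a)" "regular \<sigma> (rvar Y)" for \<sigma> a by simp_all
  have sB: "regular (sB a b) (?G J)" if ab: "a \<in> {1..n}" "b \<in> {1..n}" "a < b" and J: "J \<subseteq> {1..n}" for a b J
  proof -
    let ?S = "{x. regular (sB a b) x}"
    have "?G J \<in> ?S"
    proof (rule mem[OF field_subring_regular])
      fix K :: "nat set" assume K: "K \<subseteq> {1..n}"
      show "u K \<in> ?S"
        by (rule Mapply_solve_mem[OF field_subring_regular _ _ _ K, where l = ?l])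
          (use sB_Mt[OF _ _ ab(3)] sB_inverse_Mt[OF _ ab(3)] Pol_regular[OF pol ab(1) _ ab(2)] in \<open>simp_all del: fun_upd_apply\<close>)
    qed (use sB_Mt[OF _ _ ab(3)] sB_lamv regular_lamv J in \<open>simp_all del: fun_upd_apply\<close>)
    then show ?thesis by simp
  qed
  \<comment> \<open>For b < a the transposition of a and b moves the hyperplane into the half
    treated before, and the result is equivariant already.\<close>
  have sB': "regular (sB a b) (?G J)" if ab: "a \<in> {1..n}" "b \<in> {1..n}" "a \<noteq> b" and J: "J \<subseteq> {1..n}" for a b J
  proof (cases "a < b")
    case True
    then show ?thesis using sB ab J by simp
  next
    case False
    let ?t = "transpose b a"
    have t: "?t permutes {1..n}" using ab by (intro permutes_swap_id)
    have J': "?t ` J \<subseteq> {1..n}" by (rule permutes_subset[OF t J])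
    have "?G (?t ` ?t ` J) = rs ?t (?G (?t ` J))"
      using G t J' unfolding eqv_def by blast
    moreover have "?t ` ?t ` J = J" by (simp add: image_image)
    ultimately have "?G J = rs ?t (?G (?t ` J))" by simp
    moreover have "regular (sB b a) (?G (?t ` J))" using sB False ab J' by simp
    ultimately show ?thesis using regular_transpose[of b a "?G (?t ` J)"] ab(3) by simp
  qed
  have sC: "regular (sC a b) (?G J)" if ab: "a \<in> {1..n}" "b \<in> {1..n}" "a < b" and J: "J \<subseteq> {1..n}" for a b J
  proof -
    let ?S = "{x. regular (sC a b) x}"
    have ne: "a \<noteq> b" using ab by simp
    have g: "regular (sC a b) (Mapply n ?l u K)" if "K \<subseteq> {1..n}" for K
      using Pol_regular[OF pol ab(1) _ ab(2)] that by simp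
    \<comment> \<open>For a in K and b outside, flipping is the transposition of a and b, and this
      acts trivially on z_a = z_b.\<close>
    have gkm: "rsub (sC a b) (Mapply n ?l u K) = rsub (sC a b) (Mapply n ?l u (flip a b K))"
      if K: "K \<subseteq> {1..n}" "a \<in> K" "b \<notin> K" for K
    proof -
      have f: "flip a b K = transpose a b ` K" using K(2,3) by (auto simp: flip_def transpose_def image_iff)
      have "transpose a b permutes {1..n}" using ab by (intro permutes_swap_id)
      then have "Mapply n ?l u (flip a b K) = rs (transpose a b) (Mapply n ?l u K)"
        using eqv K unfolding eqv_def f by blast
      then show ?thesis using rsub_sC_rs[OF ne g[OF K(1)]] by simp
    qed
    have "?G J \<in> ?S"
    proof (rule mem[OF field_subring_regular])
      fix K :: "nat set" assume K: "K \<subseteq> {1..n}"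
      show "u K \<in> ?S"
        using Mapply_solve_sC[OF ab(3,2) g gkm K] by simp
    qed (use sC_Mt[OF _ _ ne] sC_inverse_lamv regular_lamv J in \<open>simp_all del: fun_upd_apply\<close>)
    then show ?thesis by simp
  qed
  have sC': "regular (sC a b) (?G J)" if ab: "a \<in> {1..n}" "b \<in> {1..n}" "a \<noteq> b" and J: "J \<subseteq> {1..n}" for a b J
    using sC[of a b J] sC[of b a J] regular_sC_swap[of b a] that by (cases "a < b") auto
  have full: "?G J \<in> Sfull n" if J: "J \<subseteq> {1..n}" for J
  proof (rule mem[OF Sfull_subring])
    fix K :: "nat set" assume K: "K \<subseteq> {1..n}"
    show "u K \<in> Sfull n"
      by (rule Mapply_solve_mem[OF Sfull_subring _ _ _ K, where l = ?l])
        (use Mt_Sfull inverse_Mt_Sfull subsetD[OF Pol_le_Sfull pol] in auto)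
  qed (use Mt_Sfull Sfull_zz Sfull_y Sfull_lamv Sfull_inverse_lamv J in auto)
  show "?G J \<in> Pol n" if J: "J \<subseteq> {1..n}"
    by (rule Pol_if_regular[OF full[OF J]]) (use sC' sB' J in auto)
qed


section \<open>The stable envelope map in terms of restrictions\<close>

lemma W_plus_Mt:
  assumes I: "I \<subseteq> {1..n}" and J: "J \<in> ksubsets n (card I)"
  shows "W_plus n I (lamv l) (\<lambda>r. zz (nth_elt J r)) zz (rvar Y) = Mt n l I J"
proof -
  have fin: "finite I" "finite J" and c: "card J = card I"
    using I J by (auto simp: ksubsets_def intro: finite_subset)
  have b: "bij_betw (nth_elt J) {1..card I} J" using bij_betw_nth_elt[OF fin(2)] c by simp
  have inj: "inj_on (\<lambda>r. zz (nth_elt J r)) {1..card I}"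
    by (rule inj_onI, rule inj_onD[OF bij_betw_imp_inj_on[OF b]]) simp_all
  have "(\<lambda>r. zz (nth_elt J r)) ` {1..card I} = zz ` J"
    using bij_betw_imp_surj_on[OF b] image_image[of zz "nth_elt J" "{1..card I}"] by simp
  then show ?thesis unfolding W_plus_MM[OF fin(1) inj] Mt_def using c by (simp only: if_True HOL.simp_thms)
qed

lemma Mt_L: "J \<subseteq> {1..n} \<Longrightarrow> Mt n l I J \<in> L_lam_zy n"
  using Mt_Sfull Sfull_le_L by blast

text \<open>The description in \<open>kappa\<close> is proper because restriction is surjective and
  injective; the prescribed values are scalars since the entries of M lie in
  \<open>Sfull\<close>.\<close>

lemma kappa:
  assumes n: "n \<ge> 1" and I: "I \<subseteq> {1..n}"
  shows "kappa n (lamv l) I \<in> carrier (H_T_L n (card I))"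
    and "J \<in> ksubsets n (card I) \<Longrightarrow> res n J (kappa n (lamv l) I) = Mt n l I J"
proof -
  let ?P = "\<lambda>X. X \<in> carrier (H_T_L n (card I)) \<and> (\<forall>J\<in>ksubsets n (card I).
     res n J X = W_plus n I (lamv l) (\<lambda>r. zz (nth_elt J r)) zz (rvar Y))"
  have k: "card I \<le> n" using card_mono[OF _ I] by simp
  have "\<exists>X\<in>carrier (H_T_L n (card I)). \<forall>J\<in>ksubsets n (card I). res n J X = Mt n l I J"
    by (rule res_surj) (simp add: Mt_L ksubsets_def)
  then have ex: "\<exists>X. ?P X" using W_plus_Mt[OF I] by auto
  have "\<exists>!X. ?P X"
    by (rule ex_ex1I[OF ex]) (rule res_inj[OF n k], auto)
  from theI'[OF this] have "?P (kappa n (lamv l) I)" unfolding kappa_def .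
  then show "kappa n (lamv l) I \<in> carrier (H_T_L n (card I))"
    and "J \<in> ksubsets n (card I) \<Longrightarrow> res n J (kappa n (lamv l) I) = Mt n l I J"
    using W_plus_Mt[OF I] by auto
qed

lemma carrier_H_T_sum: "carrier (H_T_sum n) = (\<Pi>\<^sub>E k\<in>{0..n}. carrier (H_T_L n k))"
  by (simp add: H_T_sum_def direct_sum_def)

lemma Stab:
  assumes n: "n \<ge> 1" and u: "\<And>I. I \<subseteq> {1..n} \<Longrightarrow> u I \<in> L_lam_zy n"
  shows "Stab n (lamv l) u \<in> carrier (H_T_sum n)"
    and "J \<subseteq> {1..n} \<Longrightarrow> res n J (Stab n (lamv l) u (card J)) = Mapply n l u J"
proof -
  have F: "u I \<odot>\<^bsub>H_T_L n k\<^esub> kappa n (lamv l) I \<in> carrier (H_T_L n k)"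
    "J \<in> ksubsets n k \<Longrightarrow> res n J (u I \<odot>\<^bsub>H_T_L n k\<^esub> kappa n (lamv l) I) = u I * Mt n l I J"
    if "I \<in> ksubsets n k" for I k J
  proof -
    have I: "I \<subseteq> {1..n}" "card I = k" using that by (auto simp: ksubsets_def)
    note k = kappa[OF n I(1), unfolded I(2)]
    show "u I \<odot>\<^bsub>H_T_L n k\<^esub> kappa n (lamv l) I \<in> carrier (H_T_L n k)"
      by (rule smult_H(1)[OF k(1) u[OF I(1)]])
    show "res n J (u I \<odot>\<^bsub>H_T_L n k\<^esub> kappa n (lamv l) I) = u I * Mt n l I J" if "J \<in> ksubsets n k"
      using smult_H(2)[OF k(1) u[OF I(1)] that] k(2)[OF that] by simp
  qed
  show "Stab n (lamv l) u \<in> carrier (H_T_sum n)"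
    unfolding carrier_H_T_sum Stab_def
    by (intro restrict_PiE_iff[THEN iffD2] ballI res_finsum(1) finite_ksubsets F(1))
  assume J: "J \<subseteq> {1..n}"
  let ?k = "card J"
  have k: "?k \<le> n" using card_mono[OF _ J] by simp
  have Jk: "J \<in> ksubsets n ?k" using J by (simp add: ksubsets_def)
  have "res n J (Stab n (lamv l) u ?k) = (\<Sum>I\<in>ksubsets n ?k. res n J (u I \<odot>\<^bsub>H_T_L n ?k\<^esub> kappa n (lamv l) I))"
    using k res_finsum(2)[OF finite_ksubsets F(1) Jk] by (simp add: Stab_def)
  also have "\<dots> = (\<Sum>I\<in>ksubsets n ?k. Mt n l I J * u I)"
    by (intro sum.cong HOL.refl) (simp add: F(2)[OF _ Jk] mult.commute)
  also have "\<dots> = Mapply n l u J"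
    unfolding Mapply_def by (rule sum.mono_neutral_left) (auto simp: ksubsets_def Mt_def)
  finally show "res n J (Stab n (lamv l) u ?k) = Mapply n l u J" .
qed

lemma H_T_sum_eqI:
  assumes n: "n \<ge> 1" and X: "X \<in> carrier (H_T_sum n)" "X' \<in> carrier (H_T_sum n)"
    and eq: "\<And>J. J \<subseteq> {1..n} \<Longrightarrow> res n J (X (card J)) = res n J (X' (card J))"
  shows "X = X'"
proof (rule PiE_ext[OF X[unfolded carrier_H_T_sum]])
  fix k assume k: "k \<in> {0..n}"
  show "X k = X' k"
  proof (rule res_inj[OF n])
    fix J assume "J \<in> ksubsets n k"
    then show "res n J (X k) = res n J (X' k)" using eq[of J] by (auto simp: ksubsets_def)
  qed (use k X in \<open>auto simp: carrier_H_T_sum\<close>)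
qed

text \<open>The value of \<open>inv_into\<close> is meaningful on the image of \<open>Stab\<close>
  only. The triangular system has entries and inverse pivots in the scalars, hence a solution over
  them, so X lies in this image.\<close>

lemma Stab_inv:
  assumes n: "n \<ge> 1" and X: "X \<in> carrier (H_T_sum n)"
  shows "Stab_inv n (lamv l) X \<in> V_carrier n"
    and "J \<subseteq> {1..n} \<Longrightarrow> Mapply n l (Stab_inv n (lamv l) X) J = res n J (X (card J))"
proof -
  let ?g = "\<lambda>J. res n J (X (card J))"
  obtain u where u: "\<And>J. J \<subseteq> {1..n} \<Longrightarrow> Mapply n l u J = ?g J"
    using Mapply_surj[of n l ?g] by blast
  have g: "?g J \<in> L_lam_zy n" if J: "J \<subseteq> {1..n}" for J
  proof (rule res_in_L)
    show "X (card J) \<in> carrier (H_T_L n (card J))"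
      using X card_mono[OF _ J] by (auto simp: carrier_H_T_sum)
    show "J \<in> ksubsets n (card J)" using J by (simp add: ksubsets_def)
  qed
  have uL: "u J \<in> L_lam_zy n" if J: "J \<subseteq> {1..n}" for J
    by (rule Mapply_solve_mem[OF L_lam_zy_subring _ _ _ J, where l = l])
      (use Mt_L subsetD[OF Sfull_le_L inverse_Mt_Sfull] g u in auto)
  \<comment> \<open>\<open>V_carrier\<close> requires the value 0 at index sets not contained in
    [n], where the system leaves u undetermined.\<close>
  define v where "v = (\<lambda>I. if I \<subseteq> {1..n} then u I else 0)"
  have vV: "v \<in> V_carrier n" using uL L_0 by (auto simp: V_carrier_def v_def)
  have vL: "v I \<in> L_lam_zy n" for I using vV by (simp add: V_carrier_def)
  have "Mapply n l v J = Mapply n l u J" for J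
    unfolding Mapply_def v_def by (intro sum.cong) auto
  then have "Stab n (lamv l) v = X"
    using Stab[OF n vL] X u by (intro H_T_sum_eqI[OF n]) simp_all
  then have X': "X \<in> Stab n (lamv l) ` V_carrier n" using vV by blast
  show S: "Stab_inv n (lamv l) X \<in> V_carrier n"
    unfolding Stab_inv_def by (rule inv_into_into[OF X'])
  have "Stab n (lamv l) (Stab_inv n (lamv l) X) = X"
    unfolding Stab_inv_def by (rule f_inv_into_f[OF X'])
  moreover have "Stab_inv n (lamv l) X I \<in> L_lam_zy n" for I using S by (simp add: V_carrier_def)
  ultimately show "Mapply n l (Stab_inv n (lamv l) X) J = ?g J" if "J \<subseteq> {1..n}"
    using Stab(2)[where l = l and u = "Stab_inv n (lamv l) X" and J = J, OF n] that by simp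
qed

section \<open>The submodule\<close>

lemma H_GL_sum_GL_part: "H_GL_sum n = (\<Pi>\<^sub>E k\<in>{0..n}. GL_part n k)"
  by (simp add: H_GL_sum_def GL_part_def)

lemma H_GL_sum_carrier: "H_GL_sum n \<subseteq> carrier (H_T_sum n)"
  unfolding H_GL_sum_GL_part carrier_H_T_sum by (rule PiE_mono) (use GL_part_D in blast)

lemma H_GL_sumD:
  assumes X: "X \<in> H_GL_sum n"
  shows "J \<subseteq> {1..n} \<Longrightarrow> res n J (X (card J)) \<in> Pol n" and "eqv n (\<lambda>J. res n J (X (card J)))"
proof -
  have G: "X (card J) \<in> GL_part n (card J)" "J \<in> ksubsets n (card J)" if J: "J \<subseteq> {1..n}" for J
    using X card_mono[OF _ J] J by (auto simp: H_GL_sum_GL_part ksubsets_def)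
  show "J \<subseteq> {1..n} \<Longrightarrow> res n J (X (card J)) \<in> Pol n"
    using GL_part_D[OF G(1)] G(2) by blast
  show "eqv n (\<lambda>J. res n J (X (card J)))"
    unfolding eqv_def
  proof (intro allI impI)
    fix \<tau> J assume \<tau>: "\<tau> permutes {1..n}" and J: "J \<subseteq> {1..n}"
    have "card (\<tau> ` J) = card J"
      by (rule card_image, rule inj_on_subset[OF permutes_inj[OF \<tau>] subset_UNIV])
    then show "res n (\<tau> ` J) (X (card (\<tau> ` J))) = rs \<tau> (res n J (X (card J)))"
      using GL_part_D[OF G(1)[OF J]] G(2)[OF J] \<tau> by (simp add: equivariant_def)
  qed
qed

lemma H_GL_sumI:
  assumes n: "n \<ge> 1" and X: "X \<in> carrier (H_T_sum n)"
    and pol: "\<And>J. J \<subseteq> {1..n} \<Longrightarrow> res n J (X (card J)) \<in> Pol n"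
    and eqv: "eqv n (\<lambda>J. res n J (X (card J)))"
  shows "X \<in> H_GL_sum n"
  unfolding H_GL_sum_GL_part
proof (rule PiE_I)
  fix k assume k: "k \<in> {0..n}"
  show "X k \<in> GL_part n k"
  proof (rule GL_part_I[OF n])
    show "res n J (X k) \<in> Pol n" if "J \<in> ksubsets n k" for J
      using pol[of J] that by (auto simp: ksubsets_def)
    show "equivariant n k (\<lambda>J. res n J (X k))"
      unfolding equivariant_def
    proof (intro allI impI)
      fix \<tau> J assume \<tau>: "\<tau> permutes {1..n}" and J: "J \<in> ksubsets n k"
      have "card (\<tau> ` J) = k" "card J = k" "J \<subseteq> {1..n}"
        using image_ksubsets[OF \<tau> J] J by (auto simp: ksubsets_def)
      then show "res n (\<tau> ` J) (X k) = rs \<tau> (res n J (X k))"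
        using eqv \<tau> unfolding eqv_def by metis
    qed
  qed (use k X in \<open>auto simp: carrier_H_T_sum\<close>)
next
  fix k assume "k \<notin> {0..n}"
  then show "X k = undefined" using X by (auto simp: carrier_H_T_sum)
qed

text \<open>Serves both the complex scalars and the functions f(\<lambda>, yh, y): on component k
  each acts by one factor fixed by S_n, which preserves integrality and equivariance.\<close>

lemma H_GL_sum_scale:
  assumes n: "n \<ge> 1" and X: "X \<in> H_GL_sum n" and X': "X' \<in> carrier (H_T_sum n)"
    and c: "\<And>k. c k \<in> Pol n" "\<And>k \<tau>. rs \<tau> (c k) = c k"
    and res: "\<And>J. J \<subseteq> {1..n} \<Longrightarrow> res n J (X' (card J)) = c (card J) * res n J (X (card J))"
  shows "X' \<in> H_GL_sum n"
proof (rule H_GL_sumI[OF n X'])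
  show "res n J (X' (card J)) \<in> Pol n" if "J \<subseteq> {1..n}" for J
    unfolding res[OF that] by (intro Pol_mult c(1) H_GL_sumD(1)[OF X that])
  show "eqv n (\<lambda>J. res n J (X' (card J)))"
    unfolding eqv_def
  proof (intro allI impI)
    fix \<tau> J assume \<tau>: "\<tau> permutes {1..n}" and J: "J \<subseteq> {1..n}"
    have "card (\<tau> ` J) = card J"
      by (rule card_image, rule inj_on_subset[OF permutes_inj[OF \<tau>] subset_UNIV])
    moreover have "res n (\<tau> ` J) (X (card (\<tau> ` J))) = rs \<tau> (res n J (X (card J)))"
      using H_GL_sumD(2)[OF X] \<tau> J unfolding eqv_def by blast
    ultimately show "res n (\<tau> ` J) (X' (card (\<tau> ` J))) = rs \<tau> (res n J (X' (card J)))"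
      unfolding res[OF J] res[OF permutes_subset[OF \<tau> J]] using permutes_bij[OF \<tau>] by (simp only: c(2) rsub_mult rs_regular)
  qed
qed

text \<open>At yh = m y the form \<lambda> + p yh + l y becomes \<lambda> + (p m + l) y, which is
  nonzero. Hence the value does not depend on the chosen fraction, and its denominator is again of
  the permitted kind.\<close>

lemma yh_subst:
  assumes "F \<in> L_lam_yh_y"
  shows "yh_subst (of_int m * Var Y) F \<in> L_lam_y"
proof -
  let ?\<sigma> = "Var(YH := of_int m * Var Y)"
  have den: "psubst ?\<sigma> (\<Prod>(p, l)\<leftarrow>pls. Var Lam + of_int p * Var YH + of_int l * Var Y) =
      (\<Prod>l\<leftarrow>map (\<lambda>(p, l). p * m + l) pls. Var Lam + of_int l * Var Y)" for pls :: "(int \<times> int) list"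
    by (induction pls) (auto simp: algebra_simps)
  have nz: "psubst ?\<sigma> g \<noteq> 0" if g0: "g \<in> yh_denoms" for g
  proof -
    obtain pls where g: "g = (\<Prod>(p, l)\<leftarrow>pls. Var Lam + of_int p * Var YH + of_int l * Var Y)"
      using g0 unfolding yh_denoms_def by blast
    show ?thesis unfolding g den using lam_form_nonzero by (auto simp: prod_list_zero_iff simp del: of_int_add of_int_mult)
  qed
  obtain f g where F: "f \<in> polys {Lam, YH, Y}" "g \<in> yh_denoms" "F = Fract f g"
    using assms by (auto simp: L_lam_yh_y_def)
  have "yh_subst (of_int m * Var Y) F = Fract (psubst ?\<sigma> f) (psubst ?\<sigma> g)"
    unfolding yh_subst_def
  proof (rule the_equality)
    show "\<exists>f' g'. f' \<in> polys {Lam, YH, Y} \<and> g' \<in> yh_denoms \<and> F = Fract f' g' \<and>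
        Fract (psubst ?\<sigma> f) (psubst ?\<sigma> g) = Fract (psubst ?\<sigma> f') (psubst ?\<sigma> g')"
      using F by blast
  next
    fix v assume "\<exists>f' g'. f' \<in> polys {Lam, YH, Y} \<and> g' \<in> yh_denoms \<and> F = Fract f' g' \<and>
        v = Fract (psubst ?\<sigma> f') (psubst ?\<sigma> g')"
    then show "v = Fract (psubst ?\<sigma> f) (psubst ?\<sigma> g)"
      using rsub_Fract[OF nz] F(2,3) by metis
  qed
  moreover have f: "psubst ?\<sigma> f \<in> polys {Lam, Y}"
    by (rule polys_psubst[OF F(1)]) (auto intro!: polys_mult polys_of_int polys_Var)
  moreover obtain pls where "g = (\<Prod>(p, l)\<leftarrow>pls. Var Lam + of_int p * Var YH + of_int l * Var Y)"
    using F(2) unfolding yh_denoms_def by blast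
  ultimately have "yh_subst (of_int m * Var Y) F =
      Fract (psubst ?\<sigma> f) (\<Prod>l\<leftarrow>map (\<lambda>(p, l). p * m + l) pls. Var Lam + of_int l * Var Y)"
    by (simp only: den)
  then show ?thesis unfolding L_lam_y_def mem_Collect_eq using f by (intro exI conjI)
qed

section \<open>Stability of the subspace under the generators\<close>

lemma coh_act_Fn:
  assumes n: "n \<ge> 1" and X: "X \<in> H_GL_sum n" and F: "F \<in> L_lam_yh_y"
  shows "coh_act n (Fn F) X \<in> H_GL_sum n"
proof -
  have XT: "X \<in> carrier (H_T_sum n)" using X H_GL_sum_carrier by blast
  define c where "c k = yh_subst (of_int (2 * int k - int n) * Var Y) F" for k
  have c: "c k \<in> L_lam_y" for k unfolding c_def by (rule yh_subst[OF F])
  have lam: "rvar Lam = lamv 0" by (simp add: lamv_def)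
  define u where "u = Stab_inv n (lamv 0) X"
  have u: "u I \<in> L_lam_zy n" for I using Stab_inv(1)[OF n XT] by (simp add: V_carrier_def u_def)
  have act: "f_act_V n F u = (\<lambda>I. c (card I) * u I)" by (simp add: f_act_V_def c_def)
  have cu: "c (card I) * u I \<in> L_lam_zy n" for I
    using c u L_lam_y_le_Pol Pol_le_L by (intro L_mult) blast+
  note S = Stab[where l = 0, OF n cu]
  have "res n J (Stab n (lamv 0) (\<lambda>I. c (card I) * u I) (card J)) = c (card J) * res n J (X (card J))"
    if J: "J \<subseteq> {1..n}" for J
  proof -
    \<comment> \<open>\<open>Mt\<close> vanishes between subsets of different size, so a factor
      depending only on the size can be pulled out: h commutes with the stable envelope.\<close>
    have "Mapply n 0 (\<lambda>I. c (card I) * u I) J = c (card J) * Mapply n 0 u J"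
      unfolding Mapply_def sum_distrib_left by (intro sum.cong) (auto simp: Mt_def)
    then show ?thesis using S(2)[OF J] Stab_inv(2)[OF n XT J] by (simp add: u_def)
  qed
  then have "Stab n (lamv 0) (\<lambda>I. c (card I) * u I) \<in> H_GL_sum n"
    using c L_lam_y_le_Pol rs_L_lam_y by (intro H_GL_sum_scale[OF n X S(1), of c]) blast+
  then show ?thesis by (simp only: coh_act.simps lam u_def[symmetric] act)
qed

lemma coh_act_Lgen:
  assumes n: "n \<ge> 1" and X: "X \<in> H_GL_sum n"
  shows "coh_act n (Lgen i j s l) X \<in> H_GL_sum n"
proof -
  have XT: "X \<in> carrier (H_T_sum n)" using X H_GL_sum_carrier by blast
  define u where "u = Stab_inv n (lamv (l - eps j)) X"
  have u: "u I \<in> L_lam_zy n" "\<not> I \<subseteq> {1..n} \<Longrightarrow> u I = 0" for I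
    using Stab_inv(1)[OF n XT] by (auto simp: V_carrier_def u_def)
  have g: "Mapply n (l - eps j) u J = res n J (X (card J))" if "J \<subseteq> {1..n}" for J
    unfolding u_def by (rule Stab_inv(2)[OF n XT that])
  have pol: "Mapply n (l - eps j) u J \<in> Pol n" if "J \<subseteq> {1..n}" for J
    unfolding g[OF that] by (rule H_GL_sumD(1)[OF X that])
  have eqv: "eqv n (Mapply n (l - eps j) u)"
    unfolding eqv_def
  proof (intro allI impI)
    fix \<tau> J assume \<tau>: "\<tau> permutes {1..n}" and J: "J \<subseteq> {1..n}"
    show "Mapply n (l - eps j) u (\<tau> ` J) = rs \<tau> (Mapply n (l - eps j) u J)"
      unfolding g[OF J] g[OF permutes_subset[OF \<tau> J]] using H_GL_sumD(2)[OF X] \<tau> J unfolding eqv_def by blast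
  qed
  let ?v = "L_coeff n (lamv l) i j s u"
  have v: "?v I \<in> L_lam_zy n" for I
    by (rule L_coeff_mem[OF L_lam_zy_subring])
      (use u(1) Sfull_le_L Sfull_zz Sfull_y Sfull_lamv Sfull_inverse_lamv in blast)+
  note S = Stab[where l = l, OF n v]
  note G = L_coeff_integral[OF u(2) pol eqv]
  have "Stab n (lamv l) ?v \<in> H_GL_sum n"
  proof (rule H_GL_sumI[OF n S(1)])
    show "res n J (Stab n (lamv l) ?v (card J)) \<in> Pol n" if "J \<subseteq> {1..n}" for J
      unfolding S(2)[OF that] by (rule G(2)[OF _ _ that])
    show "eqv n (\<lambda>J. res n J (Stab n (lamv l) ?v (card J)))"
      unfolding eqv_def
    proof (intro allI impI)
      fix \<tau> J assume \<tau>: "\<tau> permutes {1..n}" and J: "J \<subseteq> {1..n}"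
      have "eqv n (Mapply n l ?v)" by (rule G(1))
      then show "res n (\<tau> ` J) (Stab n (lamv l) ?v (card (\<tau> ` J))) = rs \<tau> (res n J (Stab n (lamv l) ?v (card J)))"
        unfolding S(2)[OF J] S(2)[OF permutes_subset[OF \<tau> J]] using \<tau> J unfolding eqv_def by blast
    qed
  qed
  then show ?thesis
    by (simp only: coh_act.simps Let_def lamv_def[symmetric] lamv_shift u_def[symmetric])
qed

lemma coh_act_Scal:
  assumes n: "n \<ge> 1" and X: "X \<in> H_GL_sum n"
  shows "coh_act n (Scal c) X \<in> H_GL_sum n"
proof -
  have XT: "X k \<in> carrier (H_T_L n k)" if "k \<in> {0..n}" for k
    using subsetD[OF H_GL_sum_carrier X] that by (auto simp: carrier_H_T_sum)
  have cP: "to_fract (Cst c) \<in> Pol n" unfolding Pol_def by (rule to_fract_in_loc) simp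
  then have cL: "to_fract (Cst c) \<in> L_lam_zy n" using Pol_le_L by blast
  have act: "coh_act n (Scal c) X = (\<lambda>k\<in>{0..n}. to_fract (Cst c) \<odot>\<^bsub>H_T_L n k\<^esub> X k)"
    by (simp add: H_T_sum_def direct_sum_def)
  show ?thesis
  proof (rule H_GL_sum_scale[OF n X, where c = "\<lambda>k. to_fract (Cst c)"])
    show "coh_act n (Scal c) X \<in> carrier (H_T_sum n)"
      unfolding act carrier_H_T_sum using smult_H(1)[OF XT cL] by auto
    fix J assume J: "J \<subseteq> {1..n}"
    then have "card J \<in> {0..n}" "J \<in> ksubsets n (card J)"
      using card_mono[OF _ J] by (auto simp: ksubsets_def)
    then show "res n J (coh_act n (Scal c) X (card J)) = to_fract (Cst c) * res n J (X (card J))"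
      unfolding act using smult_H(2)[OF XT cL] by simp
  qed (use cP in simp_all)
qed

lemma H_GL_sum_zero: "\<zero>\<^bsub>H_T_sum n\<^esub> \<in> H_GL_sum n"
  unfolding H_GL_sum_GL_part GL_part_def
  using generate.one[of "add_monoid (H_T_L n k)" for k]
  by (auto simp: H_T_sum_def direct_sum_def)

lemma H_GL_sum_add:
  assumes "X \<in> H_GL_sum n" "X' \<in> H_GL_sum n"
  shows "X \<oplus>\<^bsub>H_T_sum n\<^esub> X' \<in> H_GL_sum n"
proof -
  have "X k \<oplus>\<^bsub>H_T_L n k\<^esub> X' k \<in> GL_part n k" if "k \<in> {0..n}" for k
  proof -
    have "X k \<in> GL_part n k" "X' k \<in> GL_part n k"
      using assms that by (auto simp: H_GL_sum_GL_part)
    from generate.eng[OF this[unfolded GL_part_def]] show ?thesis by (simp add: GL_part_def)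
  qed
  then show ?thesis
    by (auto simp: H_GL_sum_GL_part H_T_sum_def direct_sum_def)
qed

lemma coh_act_H_GL_sum:
  assumes n: "n \<ge> 1" and e: "e \<in> Ey_terms"
  shows "X \<in> H_GL_sum n \<Longrightarrow> coh_act n e X \<in> H_GL_sum n"
  using e
proof (induction e arbitrary: X rule: Ey_terms.induct)
  case (1 c)
  then show ?case by (intro coh_act_Scal n)
next
  case (2 f)
  then show ?case by (intro coh_act_Fn n)
next
  case (3 i j s l)
  then show ?case by (intro coh_act_Lgen n)
next
  case (4 e e')
  then show ?case by (simp add: H_GL_sum_add)
next
  case (5 e e')
  then show ?case by simp
qed

theorem lemma10p6:
  fixes n :: nat
  assumes "n \<ge> 1"
  shows "Ey_gl2_submodule (H_T_sum n) (coh_act n) (H_GL_sum n)"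
proof -
  have "e \<in> Ey_terms" if "E \<in> Ey_gl2" "e \<in> E" for E e
    using that by (auto simp: Ey_gl2_def elim!: quotientE)
  then show ?thesis
    unfolding Ey_gl2_submodule_def
    using H_GL_sum_carrier H_GL_sum_zero H_GL_sum_add coh_act_H_GL_sum[OF assms] by blast
qed

end
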